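(* Let $L$ be a Laakso space and let $(\mathcal{E}_M,\mathcal{F}_M)$ be the minimal generalized upper gradient (MGUG) Dirichlet form on $L^2(L,\mu)$. Then $(\mathcal{E}_M,\mathcal{F}_M)\in\mathfrak{C}$, where $\mathfrak{C}$ is the family of all non-zero, local, regular, conservative, $L$-invariant Dirichlet forms on $L^2(L,\mu)$.
   Context: Laakso space. Let $I=[0,1]$, $K=\{0,1\}^{\mathbb{N}}$ (Cantor set, also regarded as a symmetric Cantor subset of $\mathbb{R}$, e.g. via $w\mapsto\sum_i 2w_i3^{-i}$), $k\ge1$, $j\ge 2$ integers and $j_i\in\{j,j+1\}$ a sequence. Put $d_N=\prod_{i=1}^N j_i$, $d_0=1$, $L_N=\{i/d_N:1\le i\le d_N-1\}$, $L_0=\emptyset$. Let $\sim$ be the equivalence relation on $I\times K^k$ generated by $(x,w)\sim(x,w')$ whenever, for some $n\ge1$, $x\in L_n\setminus L_{n-1}$ and $w'$ is obtained from $w$ by flipping the $n$-th digit of one of the $k$ coordinates. Then $L=(I\times K^k)/\sim$, with quotient map $\iota$. $L$ carries the geodesic metric $|x-y|$ (infimum of one-dimensional Hausdorff measures of sets $p\subset I\times K^k$ such that $\iota(p)$ is a path joining $x$ and $y$) and the measure $\mu$ which is the push-forward under $\iota$ of Lebesgue measure times the uniform Bernoulli (product) measure. Cells. For words $a=(a^1,\dots,a^k)$, each $a^l\in\{0,1\}^n$, let $K_a\subset K^k$ be the set of $w$ whose $l$-th coordinate starts with $a^l$. A depth-$n$ cell is $S=\iota([x_i,x_{i+1}]\times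 K_a)$ with $x_i,x_{i+1}$ adjacent points of $L_n\cup\{0,1\}$; $\mathcal{S}_n$ is the set of depth-$n$ cells, $m_L^n:=\#\mathcal{S}_n$. Folding. Let $\overline\varphi_0:\mathbb{R}\to[0,1]$ be the 2-periodic function with $\overline\varphi_0(x)=|x|$ on $[-1,1]$. For $S=\iota([x_i,x_{i+1}]\times K_a)\in\mathcal{S}_n$ let $\varphi_S(x)=x_i+d_n^{-1}\overline\varphi_0(d_n(x-x_i))$, let $K_S:K^k\to K_a$ replace, in each coordinate $l$, the first $n$ digits by $a^l$, and let $\phi_S:L\to S$, $\phi_S=\iota\circ(\varphi_S,K_S)\circ\iota^{-1}$ (well defined). For $f$ on $L$ set $R_Sf=f|_S$; for $g$ on $S$ set $U_Sg=g\circ\phi_S$. Dirichlet forms. Regular, local ($\mathcal{E}(u,v)=0$ for $u,v\in\mathcal F$ with disjoint compact supports) and conservative (the semigroup satisfies $T_t1=1$ a.e. for all $t>0$) are standard. For a local regular Dirichlet form $(\mathcal{E},\mathcal{F})$ on $L^2(L,\mu)$ and $S\in\mathcal{S}_n$ put $\mathcal{E}^S(g,g)=\frac1{m_L^n}\mathcal{E}(U_Sg,U_Sg)$ with domain $\mathcal{F}^S=\{g:S\to\mathbb{R}: U_Sg\in\mathcal{F}\}$. $\mathcal{E}$ is $L$-invariant if: (1) for all $n\ge 0$, $S\in\mathcal{S}_n$, $f\in\mathcal{F}$: $U_SR_Sf\in\mathcal{F}$; (2) for all $n\ge0$, $S_1,S_2\in\mathcal{S}_n$ (possibly equal) and every isometry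 $\Phi$ of $\mathbb{R}^{1+k}$ such that $\tilde\Phi=\iota\circ\Phi\circ\iota^{-1}$ maps $S_1$ onto $S_2$: if $f\in\mathcal{F}^{S_2}$ then $f\circ\tilde\Phi\in\mathcal{F}^{S_1}$ and $\mathcal{E}^{S_1}(f\circ\tilde\Phi,f\circ\tilde\Phi)=\mathcal{E}^{S_2}(f,f)$; (3) for all $n\ge 0$, $f\in\mathcal{F}$: $\mathcal{E}(f,f)=\sum_{S\in\mathcal{S}_n}\mathcal{E}^S(R_Sf,R_Sf)$. MGUG form. A generalized upper gradient of $f\in C(L)$ is a function $p$ with values in $[0,\infty]$ such that $|f(x)-f(y)|\le\int_\gamma p\,dm$ for all $x,y\in L$ and all rectifiable paths $\gamma$ from $x$ to $y$ ($dm$ = arc length). A minimal generalized upper gradient $p_f$ is one that is $\mu$-a.e. less than or equal to every other. Let $\mathcal{D}_n$ be the set of continuous $f$ on $L$ such that $f$ is piecewise differentiable on each line segment $\iota(I\times\{w\})$, $w\in K^k$, and for each $x\in I$ the function $w\mapsto f(\iota(x,w))$ is constant on each depth-$n$ cell $K_a$ of $K^k$; for such $f$, $p_f=|\partial f/\partial x|$ ($x$ the $I$-coordinate). $(\mathcal{E}_M,\mathcal{F}_M)$ is the (known) local regular Dirichlet form on $L^2(L,\mu)$ with $\mathcal{E}_M(f,f)=\int_L p_f^2\,d\mu$ for $f\in\mathcal{F}_M$, whose domain $\mathcal{F}_M$ is the closure of $\bigcup_n\mathcal{D}_n$ in the norm $(\|f\|_{L^2}^2+\int_L p_f^2\,d\mu)^{1/2}$.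 *)

theory Defs
  imports "HOL-Probability.Probability"
begin

section \<open>Hausdorff measure and lengths of paths\<close>

definition hausdorff1_pre :: "real \<Rightarrow> 'a::metric_space set \<Rightarrow> ennreal" where
  "hausdorff1_pre \<delta> A =
     (INF U \<in> {U :: nat \<Rightarrow> 'a set. A \<subseteq> (\<Union>i. U i) \<and> (\<forall>i. bounded (U i) \<and> diameter (U i) \<le> \<delta>)}.
        \<Sum>i. ennreal (diameter (U i)))"

definition hausdorff1 :: "'a::metric_space set \<Rightarrow> ennreal" where
  "hausdorff1 A = (SUP \<delta> \<in> {0<..}. hausdorff1_pre \<delta> A)"

definition path_length :: "('a \<Rightarrow> 'a \<Rightarrow> real) \<Rightarrow> (real \<Rightarrow> 'a) \<Rightarrow> real \<Rightarrow> real \<Rightarrow> ennreal" where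
  "path_length d \<gamma> a b =
     (SUP (N, t) \<in> {(N :: nat, t :: nat \<Rightarrow> real). mono_on {..N} t \<and> t ` {..N} \<subseteq> {a..b}}.
        \<Sum>i<N. ennreal (d (\<gamma> (t i)) (\<gamma> (t (Suc i)))))"

text \<open>Arc-length parametrization of a rectifiable \<^term>\<open>\<gamma>\<close> on the unit interval. The choice of the
  parameter is immaterial: a path is constant on any interval on which its length function is
  constant.\<close>

definition arc_param :: "('a \<Rightarrow> 'a \<Rightarrow> real) \<Rightarrow> (real \<Rightarrow> 'a) \<Rightarrow> real \<Rightarrow> 'a" where
  "arc_param d \<gamma> s = \<gamma> (SOME t. t \<in> {0..1} \<and> path_length d \<gamma> 0 t = ennreal s)"

definition line_integral :: "('a \<Rightarrow> 'a \<Rightarrow> real) \<Rightarrow> (real \<Rightarrow> 'a) \<Rightarrow> ('a \<Rightarrow> ennreal) \<Rightarrow> ennreal" where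
  "line_integral d \<gamma> p =
     (\<integral>\<^sup>+ s \<in> {0..enn2real (path_length d \<gamma> 0 1)}. p (arc_param d \<gamma> s) \<partial>lborel)"


section \<open>Dirichlet forms\<close>

text \<open>Elements of \<open>L\<^sup>2(M)\<close> are represented by functions; a form is a pair of a bilinear functional
  \<open>E\<close> and a domain \<open>F\<close>, where \<open>F\<close> is required to be saturated and \<open>E\<close> to be invariant under
  equality almost everywhere. Values of \<open>E\<close> off the domain play no role.\<close>

type_synonym 'a form = "('a \<Rightarrow> real) \<Rightarrow> ('a \<Rightarrow> real) \<Rightarrow> real"

definition l2 :: "'a measure \<Rightarrow> ('a \<Rightarrow> real) set" where
  "l2 M = {f \<in> borel_measurable M. integrable M (\<lambda>x. (f x)\<^sup>2)}"

definition l2_inner :: "'a measure \<Rightarrow> ('a \<Rightarrow> real) \<Rightarrow> ('a \<Rightarrow> real) \<Rightarrow> real" where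
  "l2_inner M f g = (\<integral>x. f x * g x \<partial>M)"

definition l2_sq :: "'a measure \<Rightarrow> ('a \<Rightarrow> real) \<Rightarrow> real" where
  "l2_sq M f = l2_inner M f f"

definition form1_sq :: "'a measure \<Rightarrow> 'a form \<Rightarrow> ('a \<Rightarrow> real) \<Rightarrow> real" where
  "form1_sq M E f = E f f + l2_sq M f"

definition dirichlet_form :: "'a measure \<Rightarrow> 'a form \<Rightarrow> ('a \<Rightarrow> real) set \<Rightarrow> bool" where
  "dirichlet_form M E F \<longleftrightarrow>
     \<comment> \<open>densely defined, on equivalence classes\<close>
     F \<subseteq> l2 M \<and> (\<lambda>x. 0) \<in> F \<and>
     (\<forall>f\<in>F. \<forall>g\<in>F. (\<lambda>x. f x + g x) \<in> F) \<and>
     (\<forall>c. \<forall>f\<in>F. (\<lambda>x. c * f x) \<in> F) \<and>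
     (\<forall>f\<in>F. \<forall>g\<in>borel_measurable M. (AE x in M. f x = g x) \<longrightarrow>
        g \<in> F \<and> (\<forall>h\<in>F. E f h = E g h)) \<and>
     (\<forall>f\<in>l2 M. \<forall>\<epsilon>>0. \<exists>g\<in>F. l2_sq M (\<lambda>x. f x - g x) < \<epsilon>) \<and>
     \<comment> \<open>symmetric, bilinear, non-negative\<close>
     (\<forall>f\<in>F. \<forall>g\<in>F. E f g = E g f) \<and>
     (\<forall>f\<in>F. \<forall>g\<in>F. \<forall>h\<in>F. E (\<lambda>x. f x + g x) h = E f h + E g h) \<and>
     (\<forall>c. \<forall>f\<in>F. \<forall>h\<in>F. E (\<lambda>x. c * f x) h = c * E f h) \<and>
     (\<forall>f\<in>F. 0 \<le> E f f) \<and>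
     \<comment> \<open>closed\<close>
     (\<forall>u :: nat \<Rightarrow> 'a \<Rightarrow> real. (\<forall>m. u m \<in> F) \<and>
        (\<forall>\<epsilon>>0. \<exists>N. \<forall>m\<ge>N. \<forall>l\<ge>N. form1_sq M E (\<lambda>x. u m x - u l x) < \<epsilon>) \<longrightarrow>
        (\<exists>f\<in>F. (\<lambda>m. form1_sq M E (\<lambda>x. u m x - f x)) \<longlonglongrightarrow> 0)) \<and>
     \<comment> \<open>Markovian\<close>
     (\<forall>f\<in>F. (\<lambda>x. min (max (f x) 0) 1) \<in> F \<and>
        E (\<lambda>x. min (max (f x) 0) 1) (\<lambda>x. min (max (f x) 0) 1) \<le> E f f)"

definition cont_compact_support :: "'a topology \<Rightarrow> ('a \<Rightarrow> real) set" where
  "cont_compact_support X =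
     {f. continuous_map X euclideanreal f \<and> compactin X (X closure_of {x \<in> topspace X. f x \<noteq> 0})}"

definition regular_form ::
    "'a topology \<Rightarrow> 'a measure \<Rightarrow> 'a form \<Rightarrow> ('a \<Rightarrow> real) set \<Rightarrow> bool" where
  "regular_form X M E F \<longleftrightarrow>
     (\<forall>f\<in>F. \<forall>\<epsilon>>0. \<exists>g \<in> F \<inter> cont_compact_support X. form1_sq M E (\<lambda>x. f x - g x) < \<epsilon>) \<and>
     (\<forall>f\<in>cont_compact_support X. \<forall>\<epsilon>>0. \<exists>g \<in> F \<inter> cont_compact_support X.
        \<forall>x\<in>topspace X. \<bar>f x - g x\<bar> < \<epsilon>)"

text \<open>The support of the signed measure with density \<open>u\<close>; unlike the closure of the set where
  \<open>u\<close> does not vanish, it depends only on the equivalence class of \<open>u\<close>.\<close>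

definition ess_support :: "'a topology \<Rightarrow> 'a measure \<Rightarrow> ('a \<Rightarrow> real) \<Rightarrow> 'a set" where
  "ess_support X M u = topspace X - \<Union>{U. openin X U \<and> (AE x in M. x \<in> U \<longrightarrow> u x = 0)}"

definition local_form ::
    "'a topology \<Rightarrow> 'a measure \<Rightarrow> 'a form \<Rightarrow> ('a \<Rightarrow> real) set \<Rightarrow> bool" where
  "local_form X M E F \<longleftrightarrow>
     (\<forall>u\<in>F. \<forall>v\<in>F. compactin X (ess_support X M u) \<and> compactin X (ess_support X M v) \<and>
        ess_support X M u \<inter> ess_support X M v = {} \<longrightarrow> E u v = 0)"

text \<open>\<open>T\<close> is the strongly continuous symmetric contraction semigroup on \<open>L\<^sup>2(M)\<close> corresponding to
  the closed form: \<open>F\<close> consists of those \<open>u\<close> for which \<open>t\<^sup>-\<^sup>1 (u - T\<^sub>t u, u)\<close> has a finite limit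
  as \<open>t \<rightarrow> 0\<close>, and \<open>E(u, v) = lim t\<^sup>-\<^sup>1 (u - T\<^sub>t u, v)\<close>.\<close>

definition semigroup_of_form ::
    "'a measure \<Rightarrow> 'a form \<Rightarrow> ('a \<Rightarrow> real) set \<Rightarrow> (real \<Rightarrow> ('a \<Rightarrow> real) \<Rightarrow> ('a \<Rightarrow> real)) \<Rightarrow> bool" where
  "semigroup_of_form M E F T \<longleftrightarrow>
     (\<forall>t>0. \<forall>f\<in>l2 M. T t f \<in> l2 M) \<and>
     (\<forall>t>0. \<forall>f\<in>l2 M. \<forall>g\<in>l2 M. AE x in M. T t (\<lambda>x. f x + g x) x = T t f x + T t g x) \<and>
     (\<forall>t>0. \<forall>c. \<forall>f\<in>l2 M. AE x in M. T t (\<lambda>x. c * f x) x = c * T t f x) \<and>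
     (\<forall>t>0. \<forall>f\<in>l2 M. \<forall>g\<in>l2 M. l2_inner M (T t f) g = l2_inner M f (T t g)) \<and>
     (\<forall>t>0. \<forall>f\<in>l2 M. l2_sq M (T t f) \<le> l2_sq M f) \<and>
     (\<forall>s>0. \<forall>t>0. \<forall>f\<in>l2 M. AE x in M. T (s + t) f x = T s (T t f) x) \<and>
     (\<forall>f\<in>l2 M. ((\<lambda>t. l2_sq M (\<lambda>x. T t f x - f x)) \<longlongrightarrow> 0) (at_right 0)) \<and>
     F = {u \<in> l2 M. \<exists>c. ((\<lambda>t. l2_inner M (\<lambda>x. u x - T t u x) u / t) \<longlongrightarrow> c) (at_right 0)} \<and>
     (\<forall>u\<in>F. \<forall>v\<in>F. ((\<lambda>t. l2_inner M (\<lambda>x. u x - T t u x) v / t) \<longlongrightarrow> E u v) (at_right 0))"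

text \<open>For finite measures, so that \<open>1\<close> lies in \<open>L\<^sup>2(M)\<close>. For a Dirichlet form the semigroup
  exists and is unique up to equality almost everywhere.\<close>

definition conservative_form :: "'a measure \<Rightarrow> 'a form \<Rightarrow> ('a \<Rightarrow> real) set \<Rightarrow> bool" where
  "conservative_form M E F \<longleftrightarrow>
     (\<forall>T. semigroup_of_form M E F T \<longrightarrow> (\<forall>t>0. AE x in M. T t (\<lambda>x. 1) x = 1))"


section \<open>Laakso spaces\<close>

text \<open>The number \<open>k\<close> of Cantor factors is the cardinality of the finite index type \<^typ>\<open>'k\<close>.
  A point of the Cantor set is its sequence of digits; the digit with number \<open>n \<ge> 1\<close> is stored at
  position \<open>n - 1\<close>. The value \<open>js 0\<close> is never used.\<close>

type_synonym 'k prelaakso = "real \<times> ('k \<Rightarrow> nat \<Rightarrow> bool)"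
type_synonym 'k laakso_point = "'k prelaakso set"

definition laakso_d :: "(nat \<Rightarrow> nat) \<Rightarrow> nat \<Rightarrow> nat" where
  "laakso_d js N = (\<Prod>i=1..N. js i)"

definition laakso_L :: "(nat \<Rightarrow> nat) \<Rightarrow> nat \<Rightarrow> real set" where
  "laakso_L js N = {real i / real (laakso_d js N) | i. 1 \<le> i \<and> i \<le> laakso_d js N - 1}"

definition laakso_base :: "'k prelaakso set" where
  "laakso_base = {0..1} \<times> UNIV"

definition laakso_glue :: "(nat \<Rightarrow> nat) \<Rightarrow> 'k prelaakso \<Rightarrow> 'k prelaakso \<Rightarrow> bool" where
  "laakso_glue js = (\<lambda>(x, w) (x', w'). x' = x \<and>
     (\<exists>n\<ge>1. x \<in> laakso_L js n - laakso_L js (n - 1) \<and>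
        (\<exists>l. w' = w(l := (w l)(n - 1 := \<not> w l (n - 1))))))"

definition laakso_proj :: "(nat \<Rightarrow> nat) \<Rightarrow> 'k prelaakso \<Rightarrow> 'k laakso_point" where
  "laakso_proj js p = {q. equivclp (laakso_glue js) p q}"

definition laakso_space :: "(nat \<Rightarrow> nat) \<Rightarrow> 'k laakso_point set" where
  "laakso_space js = laakso_proj js ` laakso_base"

definition laakso_topology :: "(nat \<Rightarrow> nat) \<Rightarrow> 'k laakso_point topology" where
  "laakso_topology js = topology (\<lambda>U. U \<subseteq> laakso_space js \<and>
     openin (top_of_set laakso_base) {p \<in> laakso_base. laakso_proj js p \<in> U})"

lemma openin_laakso_topology:
  fixes U :: "'k laakso_point set"
  shows "openin (laakso_topology js) U \<longleftrightarrow> U \<subseteq> laakso_space js \<and>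
     openin (top_of_set laakso_base) {p \<in> laakso_base. laakso_proj js p \<in> U}"
proof -
  let ?P = "\<lambda>U :: 'k laakso_point set. U \<subseteq> laakso_space js \<and>
     openin (top_of_set laakso_base) {p \<in> laakso_base. laakso_proj js p \<in> U}"
  have "?P (S \<inter> T)" if "?P S" "?P T" for S T
  proof -
    have "{p \<in> laakso_base. laakso_proj js p \<in> S \<inter> T} =
          {p \<in> laakso_base. laakso_proj js p \<in> S} \<inter> {p \<in> laakso_base. laakso_proj js p \<in> T}"
      by auto
    then show ?thesis
      using that by auto
  qed
  moreover have "?P (\<Union>\<K>)" if "\<forall>S\<in>\<K>. ?P S" for \<K>
  proof -
    have "{p \<in> laakso_base. laakso_proj js p \<in> \<Union>\<K>} =
          (\<Union>S\<in>\<K>. {p \<in> laakso_base. laakso_proj js p \<in> S})"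
      by auto
    then show ?thesis
      using that by auto
  qed
  ultimately have "istopology ?P"
    unfolding istopology_def by blast
  from topology_inverse'[OF this] show ?thesis
    unfolding laakso_topology_def by simp
qed

lemma topspace_laakso_topology:
  "topspace (laakso_topology js) = (laakso_space js :: 'k laakso_point set)"
proof -
  have "{p \<in> laakso_base. laakso_proj js p \<in> laakso_space js} = (laakso_base :: 'k prelaakso set)"
    by (auto simp: laakso_space_def)
  then have "openin (laakso_topology js) (laakso_space js :: 'k laakso_point set)"
    unfolding openin_laakso_topology by simp
  then show ?thesis
    by (auto simp: topspace_def openin_laakso_topology)
qed

lemma quotient_map_laakso_proj:
  "quotient_map (top_of_set laakso_base) (laakso_topology js) (laakso_proj js)"
  by (auto simp: quotient_map_def topspace_laakso_topology openin_laakso_topology laakso_space_def)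

text \<open>Realization of the digit sequences in the middle-thirds Cantor set.\<close>

definition laakso_emb :: "'k::finite prelaakso \<Rightarrow> real \<times> (real ^ 'k)" where
  "laakso_emb = (\<lambda>(x, w). (x, \<chi> l. \<Sum>i. 2 * of_bool (w l i) / 3 ^ (i + 1)))"

definition laakso_dist ::
    "(nat \<Rightarrow> nat) \<Rightarrow> 'k::finite laakso_point \<Rightarrow> 'k laakso_point \<Rightarrow> real" where
  "laakso_dist js x y = enn2real
     (INF p \<in> {p. p \<subseteq> laakso_base \<and>
                 (\<exists>\<gamma>. pathin (laakso_topology js) \<gamma> \<and> \<gamma> 0 = x \<and> \<gamma> 1 = y \<and>
                      \<gamma> ` {0..1} = laakso_proj js ` p)}.
        hausdorff1 (laakso_emb ` p))"

definition laakso_measure :: "(nat \<Rightarrow> nat) \<Rightarrow> 'k::finite laakso_point measure" where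
  "laakso_measure js =
     distr (restrict_space lborel {0..1} \<Otimes>\<^sub>M
              (\<Pi>\<^sub>M l\<in>UNIV. \<Pi>\<^sub>M i\<in>UNIV. measure_pmf (bernoulli_pmf (1 / 2))))
           (sigma (laakso_space js) {U. openin (laakso_topology js) U})
           (laakso_proj js)"


section \<open>Cells, folding, invariance\<close>

text \<open>A cell of depth \<open>n\<close> is given by its index \<open>(i, a)\<close>, which stands for the interval
  from \<open>i / d\<^sub>n\<close> to \<open>(i + 1) / d\<^sub>n\<close> and the words \<open>a l\<close>. Different indices of the same depth give
  different cells.\<close>

type_synonym 'k cell_index = "nat \<times> ('k \<Rightarrow> bool list)"

definition cell_indices :: "(nat \<Rightarrow> nat) \<Rightarrow> nat \<Rightarrow> 'k cell_index set" where
  "cell_indices js n = {(i, a). i < laakso_d js n \<and> (\<forall>l. length (a l) = n)}"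

definition cell_box :: "(nat \<Rightarrow> nat) \<Rightarrow> nat \<Rightarrow> 'k cell_index \<Rightarrow> 'k prelaakso set" where
  "cell_box js n = (\<lambda>(i, a).
     {real i / real (laakso_d js n) .. real (i + 1) / real (laakso_d js n)} \<times>
     {w. \<forall>l. map (w l) [0..<n] = a l})"

definition cell :: "(nat \<Rightarrow> nat) \<Rightarrow> nat \<Rightarrow> 'k cell_index \<Rightarrow> 'k laakso_point set" where
  "cell js n c = laakso_proj js ` cell_box js n c"

definition cell_count :: "(nat \<Rightarrow> nat) \<Rightarrow> 'k itself \<Rightarrow> nat \<Rightarrow> nat" where
  "cell_count js _ n = card (cell js n ` (cell_indices js n :: 'k cell_index set))"

definition fold0 :: "real \<Rightarrow> real" where
  "fold0 x = \<bar>x - 2 * of_int \<lfloor>(x + 1) / 2\<rfloor>\<bar>"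

lemma fold0_periodic: "fold0 (x + 2) = fold0 x"
proof -
  have "\<lfloor>(x + 2 + 1) / 2\<rfloor> = \<lfloor>(x + 1) / 2\<rfloor> + 1"
    using floor_add_int[of "(x + 1) / 2" 1] by (simp add: add_divide_distrib add.commute add.left_commute)
  then show ?thesis
    by (simp add: fold0_def)
qed

lemma fold0_eq_abs:
  assumes "x \<in> {-1..1}" shows "fold0 x = \<bar>x\<bar>"
proof (cases "x = 1")
  case False
  then have "\<lfloor>(x + 1) / 2\<rfloor> = 0"
    using assms by (intro floor_unique) auto
  then show ?thesis
    by (simp add: fold0_def)
qed (simp add: fold0_def)

text \<open>A point of the Laakso space is the set of its preimages, so \<open>\<iota> \<circ> (\<phi>, K) \<circ> \<iota>\<^sup>-\<^sup>1\<close> is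
  computed by taking the image of that set.\<close>

definition cell_fold ::
    "(nat \<Rightarrow> nat) \<Rightarrow> nat \<Rightarrow> 'k cell_index \<Rightarrow> 'k laakso_point \<Rightarrow> 'k laakso_point" where
  "cell_fold js n = (\<lambda>(i, a) s.
     let d = real (laakso_d js n); x\<^sub>i = real i / d in
     the_elem ((\<lambda>(x, w). laakso_proj js
       (x\<^sub>i + fold0 (d * (x - x\<^sub>i)) / d, \<lambda>l m. if m < n then a l ! m else w l m)) ` s))"

definition restr_op ::
    "(nat \<Rightarrow> nat) \<Rightarrow> nat \<Rightarrow> 'k cell_index \<Rightarrow> ('k laakso_point \<Rightarrow> real) \<Rightarrow> 'k laakso_point \<Rightarrow> real" where
  "restr_op js n c f = restrict f (cell js n c)"

definition unfold_op ::
    "(nat \<Rightarrow> nat) \<Rightarrow> nat \<Rightarrow> 'k cell_index \<Rightarrow> ('k laakso_point \<Rightarrow> real) \<Rightarrow> 'k laakso_point \<Rightarrow> real" where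
  "unfold_op js n c g = g \<circ> cell_fold js n c"

definition cell_dom ::
    "(nat \<Rightarrow> nat) \<Rightarrow> ('k laakso_point \<Rightarrow> real) set \<Rightarrow> nat \<Rightarrow> 'k cell_index \<Rightarrow>
       ('k laakso_point \<Rightarrow> real) set" where
  "cell_dom js F n c = {g. unfold_op js n c g \<in> F}"

definition cell_energy ::
    "(nat \<Rightarrow> nat) \<Rightarrow> 'k laakso_point form \<Rightarrow> nat \<Rightarrow> 'k cell_index \<Rightarrow> ('k laakso_point \<Rightarrow> real) \<Rightarrow> real" where
  "cell_energy js E n c g =
     E (unfold_op js n c g) (unfold_op js n c g) / real (cell_count js TYPE('k) n)"

text \<open>On the cell \<open>c\<^sub>1\<close> the map \<open>\<Psi>\<close> is \<open>\<iota> \<circ> \<Phi> \<circ> \<iota>\<^sup>-\<^sup>1\<close>, where preimages are taken in the box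
  of the cell (points on the ends of the cell also have preimages outside the box, which an
  isometry of the ambient Euclidean space need not map into \<open>I \<times> K\<^sup>k\<close>), and \<open>\<Psi>\<close> maps \<open>c\<^sub>1\<close>
  onto \<open>c\<^sub>2\<close>. The condition includes that \<open>\<iota> \<circ> \<Phi> \<circ> \<iota>\<^sup>-\<^sup>1\<close> is well defined.\<close>

definition induced_cell_map ::
    "(nat \<Rightarrow> nat) \<Rightarrow> nat \<Rightarrow> 'k::finite cell_index \<Rightarrow> 'k cell_index \<Rightarrow>
       (real \<times> (real ^ 'k) \<Rightarrow> real \<times> (real ^ 'k)) \<Rightarrow> ('k laakso_point \<Rightarrow> 'k laakso_point) \<Rightarrow> bool" where
  "induced_cell_map js n c\<^sub>1 c\<^sub>2 \<Phi> \<Psi> \<longleftrightarrow>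
     (\<forall>p\<in>cell_box js n c\<^sub>1. \<exists>q\<in>laakso_base.
        laakso_emb q = \<Phi> (laakso_emb p) \<and> \<Psi> (laakso_proj js p) = laakso_proj js q) \<and>
     \<Psi> ` cell js n c\<^sub>1 = cell js n c\<^sub>2"

definition L_invariant ::
    "(nat \<Rightarrow> nat) \<Rightarrow> 'k::finite laakso_point form \<Rightarrow> ('k laakso_point \<Rightarrow> real) set \<Rightarrow> bool" where
  "L_invariant js E F \<longleftrightarrow>
     (\<forall>n. \<forall>c\<in>cell_indices js n. \<forall>f\<in>F. unfold_op js n c (restr_op js n c f) \<in> F) \<and>
     (\<forall>n. \<forall>c\<^sub>1\<in>cell_indices js n. \<forall>c\<^sub>2\<in>cell_indices js n. \<forall>\<Phi> \<Psi>.
        (\<forall>p q. dist (\<Phi> p) (\<Phi> q) = dist p q) \<and> induced_cell_map js n c\<^sub>1 c\<^sub>2 \<Phi> \<Psi> \<longrightarrow>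
        (\<forall>f\<in>cell_dom js F n c\<^sub>2. f \<circ> \<Psi> \<in> cell_dom js F n c\<^sub>1 \<and>
           cell_energy js E n c\<^sub>1 (f \<circ> \<Psi>) = cell_energy js E n c\<^sub>2 f)) \<and>
     (\<forall>n. \<forall>f\<in>F. E f f = (\<Sum>c\<in>cell_indices js n. cell_energy js E n c (restr_op js n c f)))"

definition laakso_forms ::
    "(nat \<Rightarrow> nat) \<Rightarrow> ('k::finite laakso_point form \<times> ('k laakso_point \<Rightarrow> real) set) set" where
  "laakso_forms js = {(E, F).
     dirichlet_form (laakso_measure js) E F \<and>
     (\<exists>f\<in>F. E f f \<noteq> 0) \<and>
     local_form (laakso_topology js) (laakso_measure js) E F \<and>
     regular_form (laakso_topology js) (laakso_measure js) E F \<and>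
     conservative_form (laakso_measure js) E F \<and>
     L_invariant js E F}"


section \<open>The minimal generalized upper gradient form\<close>

definition gen_upper_gradient ::
    "(nat \<Rightarrow> nat) \<Rightarrow> ('k::finite laakso_point \<Rightarrow> real) \<Rightarrow> ('k laakso_point \<Rightarrow> ennreal) \<Rightarrow> bool" where
  "gen_upper_gradient js f p \<longleftrightarrow> p \<in> borel_measurable (laakso_measure js) \<and>
     (\<forall>\<gamma>. pathin (laakso_topology js) \<gamma> \<and> path_length (laakso_dist js) \<gamma> 0 1 < \<infinity> \<longrightarrow>
        ennreal \<bar>f (\<gamma> 0) - f (\<gamma> 1)\<bar> \<le> line_integral (laakso_dist js) \<gamma> p)"

text \<open>Minimality is among square-integrable upper gradients, as usual. It cannot be asked for among all:
  on the unit interval, a function that vanishes on a fat Cantor set \<open>C\<close>, is at least \<open>1\<close> off \<open>C\<close>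
  and has infinite integral over every interval that meets both \<open>C\<close> and its complement
  is an upper gradient of the identity.\<close>

definition min_upper_gradient ::
    "(nat \<Rightarrow> nat) \<Rightarrow> ('k::finite laakso_point \<Rightarrow> real) \<Rightarrow> ('k laakso_point \<Rightarrow> ennreal) \<Rightarrow> bool" where
  "min_upper_gradient js f p \<longleftrightarrow>
     gen_upper_gradient js f p \<and> (\<integral>\<^sup>+x. (p x)\<^sup>2 \<partial>laakso_measure js) < \<infinity> \<and>
     (\<forall>q. gen_upper_gradient js f q \<and> (\<integral>\<^sup>+x. (q x)\<^sup>2 \<partial>laakso_measure js) < \<infinity> \<longrightarrow>
        (AE x in laakso_measure js. p x \<le> q x))"

definition grad_energy :: "(nat \<Rightarrow> nat) \<Rightarrow> ('k::finite laakso_point \<Rightarrow> real) \<Rightarrow> real" where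
  "grad_energy js f =
     enn2real (\<integral>\<^sup>+x. ((SOME p. min_upper_gradient js f p) x)\<^sup>2 \<partial>laakso_measure js)"

definition mgug_D :: "(nat \<Rightarrow> nat) \<Rightarrow> nat \<Rightarrow> ('k laakso_point \<Rightarrow> real) set" where
  "mgug_D js n = {f. continuous_map (laakso_topology js) euclideanreal f \<and>
     (\<forall>w. (\<lambda>x. f (laakso_proj js (x, w))) piecewise_differentiable_on {0..1}) \<and>
     (\<forall>x\<in>{0..1}. \<forall>w w'. (\<forall>l. \<forall>m<n. w l m = w' l m) \<longrightarrow>
        f (laakso_proj js (x, w)) = f (laakso_proj js (x, w')))}"

text \<open>Piecewise differentiable functions may have infinite energy; those have no place in the
  closure.\<close>

definition mgug_core :: "(nat \<Rightarrow> nat) \<Rightarrow> ('k::finite laakso_point \<Rightarrow> real) set" where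
  "mgug_core js = {f \<in> (\<Union>n. mgug_D js n). \<exists>p. min_upper_gradient js f p}"

definition mgug_approx ::
    "(nat \<Rightarrow> nat) \<Rightarrow> ('k::finite laakso_point \<Rightarrow> real) \<Rightarrow> (nat \<Rightarrow> 'k laakso_point \<Rightarrow> real) \<Rightarrow> bool" where
  "mgug_approx js f u \<longleftrightarrow> (\<forall>m. u m \<in> mgug_core js) \<and>
     (\<lambda>m. l2_sq (laakso_measure js) (\<lambda>x. u m x - f x)) \<longlonglongrightarrow> 0 \<and>
     (\<forall>\<epsilon>>0. \<exists>N. \<forall>m\<ge>N. \<forall>l\<ge>N. grad_energy js (\<lambda>x. u m x - u l x) < \<epsilon>)"

text \<open>The closure of the core in the norm \<open>(\<parallel>f\<parallel>\<^sup>2 + \<integral> p\<^sub>f\<^sup>2)\<^sup>1\<^sup>/\<^sup>2\<close>. The domain contains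
  discontinuous functions in general; the integral of \<open>p\<^sub>f\<^sup>2\<close> is extended to them
  from the core by continuity.\<close>

definition mgug_dom :: "(nat \<Rightarrow> nat) \<Rightarrow> ('k::finite laakso_point \<Rightarrow> real) set" where
  "mgug_dom js = {f \<in> l2 (laakso_measure js). \<exists>u. mgug_approx js f u}"

definition mgug_energy :: "(nat \<Rightarrow> nat) \<Rightarrow> ('k::finite laakso_point \<Rightarrow> real) \<Rightarrow> real" where
  "mgug_energy js f =
     (THE e. \<forall>u. mgug_approx js f u \<longrightarrow> (\<lambda>m. grad_energy js (u m)) \<longlonglongrightarrow> e)"

definition mgug_form :: "(nat \<Rightarrow> nat) \<Rightarrow> 'k::finite laakso_point form" where
  "mgug_form js f g =
     (mgug_energy js (\<lambda>x. f x + g x) - mgug_energy js (\<lambda>x. f x - g x)) / 4"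

end

theory Submission
 imports Defs
begin

text \<open>A core function is recovered from its derivative along the lines \<open>I \<times> {w}\<close>, and every upper gradient
 bounds that derivative almost everywhere, so the minimal upper gradient of a core function is the modulus of its
 derivative. The derivative is closable: integration by parts moves it to core functions that vanish at both ends,
 and these are dense in \<open>L\<^sup>2\<close>. Hence the form is the squared norm of a closed operator that obeys a chain rule,
 which yields the Markov property and locality. Conservativeness follows since constants have energy \<open>0\<close> and
 \<open>t \<mapsto> (T\<^sub>t 1, 1)\<close> is convex. For the invariance, an isometry between cells acts as \<open>x \<mapsto> \<plusminus> x + b\<close> on the
 interval and permutes the cylinders of each level; so folding followed by the isometry is locally isometric in \<open>x\<close>
 and maps the measure to a multiple of its restriction to the cell.\<close>

section \<open>Digit sequences\<close>

text \<open>Upper gradients refer to all rectifiable paths for a distance that is itself an infimum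
  of Hausdorff measures. Two facts about this distance suffice: the \<open>x\<close>-coordinate is
  1-Lipschitz, and on a line the distance is \<open>\<bar>x - y\<bar>\<close>. The lines bound upper
  gradients from below; the Lipschitz property shows that the derivative is an upper gradient.

  Functions are studied through their pull-backs to the product. Identifications occur over
  countably many \<open>x\<close> only, and off \<open>L n\<close> they leave the first
  \<open>n\<close> digits alone, so a function of \<open>n\<close> digits has only finitely many
  exceptional \<open>x\<close>. Wormholes give no boundary terms in the integration by parts, since
  every line passes straight through them.

  Truncation and locality involve functions that are not continuously differentiable. The chain rule
  is therefore proved for smooth functions on the core and then extended to pointwise limits of
  bounded derivatives.

  A folding of level \<open>n\<close> is generically \<open>d n * 2^(n k)\<close> to one. This is
  the number of cells, so it cancels the normalisation of the cell energies.\<close>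

definition agree :: "nat \<Rightarrow> ('k \<Rightarrow> nat \<Rightarrow> bool) \<Rightarrow> ('k \<Rightarrow> nat \<Rightarrow> bool) \<Rightarrow> bool" where
 "agree n w w' \<longleftrightarrow> (\<forall>l. \<forall>m<n. w l m = w' l m)"

text \<open>The canonical representative of the depth-\<open>n\<close> cylinder of \<open>w\<close>:
  sums over cylinders become sums over the finite set \<open>range (trunc n)\<close>.\<close>

definition trunc :: "nat \<Rightarrow> ('k \<Rightarrow> nat \<Rightarrow> bool) \<Rightarrow> ('k \<Rightarrow> nat \<Rightarrow> bool)" where
 "trunc n w = (\<lambda>l m. m < n \<and> w l m)"

definition cyl :: "nat \<Rightarrow> ('k \<Rightarrow> nat \<Rightarrow> bool) \<Rightarrow> ('k \<Rightarrow> nat \<Rightarrow> bool) set" where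
 "cyl n v = {w. agree n v w}"

lemma agree_refl [simp]: "agree n w w" by (simp add: agree_def)

lemma agree_sym: "agree n w w' \<Longrightarrow> agree n w' w" by (simp add: agree_def)

lemma agree_trans: "agree n u v \<Longrightarrow> agree n v w \<Longrightarrow> agree n u w"
 by (simp add: agree_def)

lemma agree_mono: "agree n w w' \<Longrightarrow> m \<le> n \<Longrightarrow> agree m w w'"
 by (simp add: agree_def)

lemma agree_trunc [simp]: "agree n w (trunc n w)" "agree n (trunc n w) w" by (simp_all add: agree_def trunc_def)

lemma trunc_eq_iff: "trunc n w = trunc n w' \<longleftrightarrow> agree n w w'"
 by (auto simp: trunc_def agree_def fun_eq_iff)

lemma trunc_idem [simp]: "trunc n (trunc n w) = trunc n w" by (simp add: trunc_eq_iff)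

lemma mem_cyl: "w \<in> cyl n v \<longleftrightarrow> agree n v w" by (simp add: cyl_def)

lemma cyl_eq_if_agree: "agree n v v' \<Longrightarrow> cyl n v = cyl n v'"
 unfolding cyl_def using agree_sym agree_trans by blast

text \<open>Two cylinders that meet are nested, the deeper one inside. Together with the empty set
  they therefore form an intersection-stable family.\<close>

lemma cyl_Int:
 assumes "m \<le> n" "u \<in> cyl m v \<inter> cyl n v'"
 shows "cyl m v \<inter> cyl n v' = cyl n v'"
 using assms unfolding cyl_def by (auto simp: agree_def)

lemma finite_range_trunc: "finite (range (trunc n :: ('k::finite \<Rightarrow> nat \<Rightarrow> bool) \<Rightarrow> _))"
proof -
 let ?f = "\<lambda>(S :: ('k \<times> nat) set) l m. (l, m) \<in> S"
 have "range (trunc n :: ('k \<Rightarrow> nat \<Rightarrow> bool) \<Rightarrow> _) \<subseteq> ?f ` Pow (UNIV \<times> {..<n})"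
 proof clarify
  fix w :: "'k \<Rightarrow> nat \<Rightarrow> bool"
  have "trunc n w = ?f {(l, m). m < n \<and> w l m}" by (simp add: trunc_def)
  then show "trunc n w \<in> ?f ` Pow (UNIV \<times> {..<n})" by (rule image_eqI) auto
 qed
 then show ?thesis by (rule finite_subset) auto
qed

lemma open_digit: "open {w :: 'k \<Rightarrow> nat \<Rightarrow> bool. w l m = b}"
proof -
 have "continuous_on UNIV (\<lambda>w :: 'k \<Rightarrow> nat \<Rightarrow> bool. w l)"
  by (rule continuous_on_product_coordinates)
 moreover have "continuous_on UNIV (\<lambda>w :: nat \<Rightarrow> bool. w m)"
  by (rule continuous_on_product_coordinates)
 ultimately have "continuous_on UNIV (\<lambda>w :: 'k \<Rightarrow> nat \<Rightarrow> bool. w l m)"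
  using continuous_on_compose2[of UNIV "\<lambda>w. w m" UNIV "\<lambda>w. w l"] by simp
 then have "open ((\<lambda>w :: 'k \<Rightarrow> nat \<Rightarrow> bool. w l m) -` {b})"
  by (simp add: open_vimage discrete_topology_class.open_discrete)
 then show ?thesis by (simp add: vimage_def)
qed

lemma open_cyl: "open (cyl n (v :: 'k::finite \<Rightarrow> nat \<Rightarrow> bool))"
proof -
 have "cyl n v = (\<Inter>l. \<Inter>m\<in>{..<n}. {w. w l m = v l m})" by (auto simp: cyl_def agree_def)
 moreover have "open (\<Inter>l. \<Inter>m\<in>{..<n}. {w :: 'k \<Rightarrow> nat \<Rightarrow> bool. w l m = v l m})"
  by (intro open_INT ballI open_digit) auto
 ultimately show ?thesis by simp
qed

text \<open>A basic open set of a product restricts finitely many factors. The topology is a product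
  of products, so this is used twice; finiteness of \<open>'k\<close> then allows one depth for all
  coordinates.\<close>

lemma open_contains_cyl:
 fixes U :: "('k::finite \<Rightarrow> nat \<Rightarrow> bool) set"
 assumes "open U" "w \<in> U"
 obtains n where "cyl n w \<subseteq> U"
proof -
 have "\<exists>X. w \<in> Pi\<^sub>E UNIV X \<and> (\<forall>i. openin euclidean (X i)) \<and>
      finite {i. X i \<noteq> topspace (euclidean :: (nat \<Rightarrow> bool) topology)} \<and> Pi\<^sub>E UNIV X \<subseteq> U"
  using assms by (intro product_topology_open_contains_basis)
   (simp_all flip: open_openin add: euclidean_product_topology)
 then obtain X where X: "\<And>l. w l \<in> X l" "\<And>l. open (X l)" "Pi\<^sub>E UNIV X \<subseteq> U"
  by (auto simp: PiE_iff)
 have "\<exists>n. \<forall>u. (\<forall>m<n. u m = w l m) \<longrightarrow> u \<in> X l" for l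
 proof -
  have "\<exists>Y. w l \<in> Pi\<^sub>E UNIV Y \<and> (\<forall>i. openin euclidean (Y i)) \<and>
       finite {i. Y i \<noteq> topspace (euclidean :: bool topology)} \<and> Pi\<^sub>E UNIV Y \<subseteq> X l"
   using X by (intro product_topology_open_contains_basis)
    (simp_all flip: open_openin add: euclidean_product_topology)
  then obtain Y where Y: "w l \<in> Pi\<^sub>E UNIV Y" and fin: "finite {i. Y i \<noteq> topspace (euclidean :: bool topology)}"
    and YX: "Pi\<^sub>E UNIV Y \<subseteq> X l" by (elim exE conjE)
  obtain n where n: "\<And>i. Y i \<noteq> topspace (euclidean :: bool topology) \<Longrightarrow> i < n"
   using fin unfolding finite_nat_set_iff_bounded by blast
  have "u \<in> X l" if u: "\<forall>m<n. u m = w l m" for u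
  proof -
   have "u i \<in> Y i" for i
   proof (cases "Y i = topspace (euclidean :: bool topology)")
    case False
    have "u i = w l i"
     using u n[OF False] by blast
    then show ?thesis
     using PiE_mem[OF Y UNIV_I, of i] by simp
   next
    case True
    then show ?thesis by simp
   qed
   then have "u \<in> Pi\<^sub>E UNIV Y" by (simp add: PiE_UNIV_domain)
   then show ?thesis
    using YX by blast
  qed
  then show ?thesis by blast
 qed
 then obtain N where N: "\<And>l u. (\<forall>m<N l. u m = w l m) \<Longrightarrow> u \<in> X l" by metis
 have "cyl (Max (range N)) w \<subseteq> U"
 proof
  fix u assume u: "u \<in> cyl (Max (range N)) w"
  have "u l \<in> X l" for l
  proof (rule N, intro allI impI)
   fix m assume "m < N l"
   also have "N l \<le> Max (range N)" by simp
   finally show "u l m = w l m"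
    using u by (simp add: cyl_def agree_def)
  qed
  then show "u \<in> U"
   using X(3) by (auto simp: PiE_iff)
 qed
 then show ?thesis
  using that by blast
qed

text \<open>Tychonoff twice, for the digits of one coordinate and for the coordinates.\<close>

lemma compact_digits: "compact (UNIV :: ('k \<Rightarrow> nat \<Rightarrow> bool) set)"
proof -
 have "compact_space (euclidean :: bool topology)" by (simp add: compact_space_def finite_imp_compact)
 then have "compact_space (product_topology (\<lambda>i :: nat. euclidean :: bool topology) UNIV)"
  by (simp add: compact_space_product_topology)
 then have "compact_space (euclidean :: (nat \<Rightarrow> bool) topology)"
  by (simp add: euclidean_product_topology)
 then have "compact_space (product_topology (\<lambda>i :: 'k. euclidean :: (nat \<Rightarrow> bool) topology) UNIV)"
  by (simp add: compact_space_product_topology)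
 then show ?thesis by (simp add: euclidean_product_topology compact_space_def)
qed

lemma compact_base: "compact (laakso_base :: 'k prelaakso set)"
 unfolding laakso_base_def by (intro compact_Times compact_digits) simp

lemma open_contains_box:
 fixes U :: "'k::finite prelaakso set"
 assumes "open U" "(x, w) \<in> U"
 obtains n r where "r > 0" "ball x r \<times> cyl n w \<subseteq> U"
proof -
 obtain A B where AB: "open A" "open B" "(x, w) \<in> A \<times> B" "A \<times> B \<subseteq> U"
  using open_prod_elim[OF assms] by blast
 obtain r where "r > 0" "ball x r \<subseteq> A"
  using AB openE by (metis mem_Sigma_iff)
 moreover obtain n where "cyl n w \<subseteq> B"
  using AB open_contains_cyl by (metis mem_Sigma_iff)
 ultimately show ?thesis
  using AB(4) that by blast
qed

lemma openin_base_contains_box: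
 fixes U :: "'k::finite prelaakso set"
 assumes "openin (top_of_set laakso_base) U" "(x, w) \<in> U"
 obtains n r where "r > 0" "(ball x r \<inter> {0..1}) \<times> cyl n w \<subseteq> U"
proof -
 obtain T where T: "open T" "U = laakso_base \<inter> T"
  using assms(1) by (auto simp: openin_open)
 obtain n r where "r > 0" "ball x r \<times> cyl n w \<subseteq> T"
  using open_contains_box T assms(2) by (metis IntD2)
 then show ?thesis
  using T(2) that[of r n] by (auto simp: laakso_base_def)
qed

text \<open>Second countability in the explicit form needed for Borel measurability and for the
 Lindelof property.\<close>

definition boxes :: "'k prelaakso set set" where
 "boxes = (\<Union>n. \<Union>v\<in>range (trunc n). (\<lambda>(a, b). ({a<..<b} \<inter> {0..1}) \<times> cyl n v) ` (\<rat> \<times> \<rat>))"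

lemma countable_boxes: "countable (boxes :: 'k::finite prelaakso set set)"
 unfolding boxes_def
 by (rule countable_UN[OF countableI_type], rule countable_UN[OF countable_finite[OF finite_range_trunc]])
  (intro countable_image countable_SIGMA countable_rat)

lemma openin_base_eq_boxes:
 fixes U :: "'k::finite prelaakso set"
 assumes "openin (top_of_set laakso_base) U"
 shows "U = \<Union>{R \<in> boxes. R \<subseteq> U}"
proof (intro equalityI subsetI)
 fix p assume "p \<in> U"
 obtain x w where p: "p = (x, w)" by fastforce
 obtain n r where nr: "r > 0" "(ball x r \<inter> {0..1}) \<times> cyl n w \<subseteq> U"
  using openin_base_contains_box[OF assms] \<open>p \<in> U\<close> p by metis
 obtain a where a: "a \<in> \<rat>" "x - r < a" "a < x"
  using Rats_dense_in_real[of "x - r" x] nr by auto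
 obtain b where b: "b \<in> \<rat>" "x < b" "b < x + r"
  using Rats_dense_in_real[of x "x + r"] nr by auto
 let ?R = "({a<..<b} \<inter> {0..1}) \<times> cyl n (trunc n w)"
 have "?R \<in> boxes"
  unfolding boxes_def using a(1) b(1) by force
 moreover have "?R \<subseteq> U"
 proof -
  have "{a<..<b} \<subseteq> ball x r"
   using a b by (auto simp: dist_real_def)
  moreover have "cyl n (trunc n w) = cyl n w" by (rule cyl_eq_if_agree) simp
  ultimately show ?thesis
   using nr(2) by auto
 qed
 moreover have "p \<in> ?R"
  using \<open>p \<in> U\<close> openin_subset[OF assms] a b by (auto simp: p laakso_base_def mem_cyl)
 ultimately show "p \<in> \<Union>{R \<in> boxes. R \<subseteq> U}" by blast
qed auto

section \<open>Continuity on the base in terms of intervals and cylinders\<close>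

lemma continuous_on_baseI:
 fixes F :: "'k::finite prelaakso \<Rightarrow> 'b::metric_space"
 assumes "\<And>x w \<epsilon>. x \<in> {0..1} \<Longrightarrow> \<epsilon> > 0 \<Longrightarrow>
  \<exists>r>0. \<exists>n. \<forall>y\<in>ball x r \<inter> {0..1}. \<forall>w'\<in>cyl n w. dist (F (y, w')) (F (x, w)) < \<epsilon>"
 shows "continuous_on laakso_base F"
 unfolding continuous_on_def
proof (intro ballI tendstoI, clarify)
 fix x :: real and w :: "'k \<Rightarrow> nat \<Rightarrow> bool" and \<epsilon> :: real
 assume xw: "(x, w) \<in> laakso_base" and "\<epsilon> > 0"
 then obtain r n where r: "r > 0"
   "\<forall>y\<in>ball x r \<inter> {0..1}. \<forall>w'\<in>cyl n w. dist (F (y, w')) (F (x, w)) < \<epsilon>"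
  using assms[of x \<epsilon> w] unfolding laakso_base_def by blast
 have "open (ball x r \<times> cyl n w)" by (intro open_Times open_cyl open_ball)
 moreover have "(x, w) \<in> ball x r \<times> cyl n w"
  using r(1) by (simp add: mem_cyl)
 moreover have "\<forall>p\<in>ball x r \<times> cyl n w. p \<noteq> (x, w) \<longrightarrow> p \<in> laakso_base \<longrightarrow> dist (F p) (F (x, w)) < \<epsilon>"
  using r(2) by (auto simp: laakso_base_def)
 ultimately show "\<forall>\<^sub>F p in at (x, w) within laakso_base. dist (F p) (F (x, w)) < \<epsilon>"
  unfolding eventually_at_topological by blast
qed

lemma continuous_on_baseD:
 fixes F :: "'k::finite prelaakso \<Rightarrow> 'b::metric_space"
 assumes "continuous_on laakso_base F" "x \<in> {0..1}" "\<epsilon> > 0"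
 obtains r n where "r > 0" "\<And>y w'. \<lbrakk>\<bar>y - x\<bar> < r; y \<in> {0..1}; agree n w w'\<rbrakk> \<Longrightarrow> dist (F (y, w')) (F (x, w)) < \<epsilon>"
proof -
 have xw: "(x, w) \<in> laakso_base"
  using assms by (simp add: laakso_base_def)
 then have "(F \<longlongrightarrow> F (x, w)) (at (x, w) within laakso_base)"
  using assms by (simp add: continuous_on_def)
 then have "\<forall>\<^sub>F p in at (x, w) within laakso_base. dist (F p) (F (x, w)) < \<epsilon>"
  using assms(3) by (rule tendstoD)
 then obtain S where S: "open S" "(x, w) \<in> S"
   "\<forall>p\<in>S. p \<noteq> (x, w) \<longrightarrow> p \<in> laakso_base \<longrightarrow> dist (F p) (F (x, w)) < \<epsilon>"
  unfolding eventually_at_topological by blast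
 obtain n r where "r > 0" "ball x r \<times> cyl n w \<subseteq> S"
  using open_contains_box S by metis
 have "dist (F (y, w')) (F (x, w)) < \<epsilon>" if "\<bar>y - x\<bar> < r" "y \<in> {0..1}" "agree n w w'" for y w'
 proof (cases "(y, w') = (x, w)")
  case False
  have "(y, w') \<in> S"
   using \<open>ball x r \<times> cyl n w \<subseteq> S\<close> that by (auto simp: mem_cyl dist_real_def)
  with False show ?thesis
   using S(3) that(2) unfolding laakso_base_def by blast
 qed (use assms(3) in simp)
 then show ?thesis
  using \<open>r > 0\<close> that by blast
qed

text \<open>Heine-Cantor, with the modulus split into a distance in \<open>x\<close> and a number of
  common digits; \<open>core_uniformly_dense\<close> takes its mesh and its depth from these
  two.\<close>

lemma uniformly_continuous_base:
 fixes F :: "'k::finite prelaakso \<Rightarrow> real"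
 assumes F: "continuous_on laakso_base F" and "\<epsilon> > 0"
 obtains \<delta> n where "\<delta> > 0" "\<And>x y w w'. \<lbrakk>\<bar>y - x\<bar> < \<delta>; x \<in> {0..1}; y \<in> {0..1}; agree n w w'\<rbrakk> \<Longrightarrow>
  \<bar>F (y, w') - F (x, w)\<bar> < \<epsilon>"
proof -
 \<comment> \<open>The oscillation is controlled on twice the radius of the covering ball: a point
   within the Lebesgue number \<open>\<delta>\<close> of a point of the ball still falls into the
   doubled ball.\<close>
 let ?P = "\<lambda>p z. fst z > 0 \<and> (\<forall>y w'. \<bar>y - fst p\<bar> < 2 * fst z \<longrightarrow> y \<in> {0..1} \<longrightarrow>
   agree (snd z) (snd p) w' \<longrightarrow> dist (F (y, w')) (F p) < \<epsilon> / 2)"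
 have "\<exists>z. ?P p z" if "p \<in> laakso_base" for p
 proof -
  obtain x w where p: "p = (x, w)" by fastforce
  obtain r n where r: "r > 0" "\<And>y w'. \<lbrakk>\<bar>y - x\<bar> < r; y \<in> {0..1}; agree n w w'\<rbrakk> \<Longrightarrow> dist (F (y, w')) (F (x, w)) < \<epsilon> / 2"
   by (rule continuous_on_baseD[OF F, of x "\<epsilon> / 2" w])
    (use \<open>\<epsilon> > 0\<close> \<open>p \<in> laakso_base\<close> in \<open>auto simp: p laakso_base_def\<close>)
  then show ?thesis by (intro exI[of _ "(r / 2, n)"]) (simp add: p)
 qed
 then have "\<forall>p\<in>laakso_base. \<exists>z. ?P p z" by blast
 from bchoice[OF this] obtain z where z: "\<forall>p\<in>laakso_base. ?P p (z p)" by blast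
 define r n where "r = fst \<circ> z" "n = snd \<circ> z"
 have rn: "\<And>p. p \<in> laakso_base \<Longrightarrow> r p > 0"
   "\<And>p y w'. \<lbrakk>p \<in> laakso_base; \<bar>y - fst p\<bar> < 2 * r p; y \<in> {0..1}; agree (n p) (snd p) w'\<rbrakk> \<Longrightarrow>
   dist (F (y, w')) (F p) < \<epsilon> / 2"
  using z by (simp_all add: r_n_def)
 let ?U = "\<lambda>p. ball (fst p) (r p) \<times> cyl (n p) (snd p)"
 have "\<exists>T\<subseteq>laakso_base. finite T \<and> laakso_base \<subseteq> (\<Union>p\<in>T. ?U p)"
  using compact_base
 proof (rule compactE_image[of _ laakso_base ?U])
  show "open (?U p)" if "p \<in> laakso_base" for p by (intro open_Times open_cyl open_ball)
  show "laakso_base \<subseteq> (\<Union>p\<in>laakso_base. ?U p)"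
  proof
   fix p :: "'k prelaakso" assume "p \<in> laakso_base"
   then have "p \<in> ?U p"
    using rn(1)[of p] by (cases p) (simp add: mem_cyl)
   then show "p \<in> (\<Union>p\<in>laakso_base. ?U p)"
    using \<open>p \<in> laakso_base\<close> by blast
  qed
 qed blast
 then obtain T where T: "T \<subseteq> laakso_base" "finite T" "laakso_base \<subseteq> (\<Union>p\<in>T. ?U p)"
  by blast
 define \<delta> where "\<delta> = Min (insert 1 (r ` T))"
 define N where "N = Max (insert 0 (n ` T))"
 have "\<delta> > 0"
  using T rn(1) by (auto simp: \<delta>_def)
 moreover have "\<bar>F (y, w') - F (x, w)\<bar> < \<epsilon>" if *: "\<bar>y - x\<bar> < \<delta>" "x \<in> {0..1}" "y \<in> {0..1}" "agree N w w'" for x y w w'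
 proof -
  have "(x, w) \<in> laakso_base"
   using *(2) by (simp add: laakso_base_def)
  then obtain p where p: "p \<in> T" "(x, w) \<in> ?U p"
   using T(3) by blast
  have "\<delta> \<le> r p" "n p \<le> N"
   using p T(2) by (auto simp: \<delta>_def N_def)
  have pb: "p \<in> laakso_base" "r p > 0"
   using p(1) T(1) by (auto intro: rn(1))
  have "\<bar>x - fst p\<bar> < r p" "agree (n p) (snd p) w"
   using p(2) by (simp_all add: dist_real_def mem_cyl abs_minus_commute)
  moreover have "agree (n p) (snd p) w'"
   using agree_trans[OF calculation(2) agree_mono[OF *(4) \<open>n p \<le> N\<close>]] .
  moreover have "\<bar>y - fst p\<bar> < 2 * r p"
   using calculation(1) *(1) \<open>\<delta> \<le> r p\<close> by linarith
  ultimately have d1: "dist (F (y, w')) (F p) < \<epsilon> / 2"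
   using rn(2)[OF pb(1) _ *(3)] by blast
  have "\<bar>x - fst p\<bar> < 2 * r p"
   using \<open>\<bar>x - fst p\<bar> < r p\<close> pb(2) by linarith
  then have "dist (F (x, w)) (F p) < \<epsilon> / 2"
   using rn(2)[OF pb(1) _ *(2)] \<open>agree (n p) (snd p) w\<close> by blast
  with d1 show ?thesis
   unfolding dist_real_def by linarith
 qed
 ultimately show ?thesis
  using that by blast
qed

section \<open>Wormholes and the quotient map\<close>

lemma openin_quotient_preimage:
 "openin (laakso_topology js) U \<Longrightarrow> openin (top_of_set laakso_base) {p \<in> laakso_base. laakso_proj js p \<in> U}"
 by (simp add: openin_laakso_topology)

lemma continuous_map_laakso_proj:
 "continuous_map (top_of_set laakso_base) (laakso_topology js) (laakso_proj js)"
 by (rule quotient_imp_continuous_map[OF quotient_map_laakso_proj])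

lemma continuous_map_laakso_iff:
 "continuous_map (laakso_topology js) Y f \<longleftrightarrow>
   continuous_map (top_of_set laakso_base) Y (f \<circ> laakso_proj js)"
 by (metis continuous_compose_quotient_map_eq quotient_map_laakso_proj)

lemma continuous_laakso_iff:
 "continuous_map (laakso_topology js) euclidean f \<longleftrightarrow> continuous_on laakso_base (\<lambda>p. f (laakso_proj js p))"
 by (simp add: continuous_map_laakso_iff o_def)

lemma compact_space_laakso: "compact_space (laakso_topology js)"
proof -
 have "compact_space (top_of_set (laakso_base :: 'a prelaakso set))"
  by (rule compact_space_subtopology) (simp add: compact_base)
 then show ?thesis
  unfolding compact_space_def
  using image_compactin[OF _ continuous_map_laakso_proj]
   quotient_imp_surjective_map[OF quotient_map_laakso_proj] by metis
qed

lemma laakso_proj_in_space: "p \<in> laakso_base \<Longrightarrow> laakso_proj js p \<in> laakso_space js"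
 by (auto simp: laakso_space_def)

lemma in_laakso_base_iff [simp]: "(x, w) \<in> laakso_base \<longleftrightarrow> x \<in> {0..1}"
 by (auto simp: laakso_base_def)

text \<open>The class of a point is the set of its preimages, so functions on the quotient arise from
 invariant functions on the base by evaluation at an arbitrary representative.\<close>

definition lift :: "('k prelaakso \<Rightarrow> 'b) \<Rightarrow> 'k laakso_point \<Rightarrow> 'b" where
 "lift F s = F (SOME p. p \<in> s)"

lemma mem_laakso_proj: "q \<in> laakso_proj js p \<longleftrightarrow> equivclp (laakso_glue js) p q"
 by (simp add: laakso_proj_def)

lemma laakso_proj_eq_iff: "laakso_proj js p = laakso_proj js q \<longleftrightarrow> equivclp (laakso_glue js) p q"
proof
 assume "laakso_proj js p = laakso_proj js q"
 moreover have "q \<in> laakso_proj js q" by (simp add: mem_laakso_proj)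
 ultimately have "q \<in> laakso_proj js p" by simp
 then show "equivclp (laakso_glue js) p q" by (simp add: mem_laakso_proj)
next
 assume *: "equivclp (laakso_glue js) p q"
 then show "laakso_proj js p = laakso_proj js q"
  unfolding laakso_proj_def
  using equivclp_trans[OF *] equivclp_trans[OF equivclp_sym[OF *]] by blast
qed

lemma equivclp_invariant:
 assumes "\<And>p q. R p q \<Longrightarrow> F p = F q" "equivclp R p q"
 shows "F p = F q"
 using assms(2) by (induction rule: equivclp_induct) (use assms(1) in auto)

lemma lift_proj:
 assumes "\<And>p q. laakso_glue js p q \<Longrightarrow> F p = F q"
 shows "lift F (laakso_proj js p) = F p"
proof -
 have "p \<in> laakso_proj js p" by (simp add: mem_laakso_proj)
 then have "(SOME q. q \<in> laakso_proj js p) \<in> laakso_proj js p"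
  by (rule someI[of "\<lambda>q. q \<in> laakso_proj js p"])
 then show ?thesis
  using equivclp_invariant[of "laakso_glue js" F, OF assms]
  unfolding lift_def mem_laakso_proj by metis
qed

text \<open>Every generating identification keeps \<open>x\<close>, so the coordinate descends to
  the quotient.\<close>

definition xcoord :: "'k laakso_point \<Rightarrow> real" where
 "xcoord = lift fst"

lemma xcoord_proj [simp]: "xcoord (laakso_proj js (x, w)) = x"
 unfolding xcoord_def by (subst lift_proj) (auto simp: laakso_glue_def)

lemma continuous_xcoord: "continuous_map (laakso_topology js) euclidean xcoord"
proof -
 have "continuous_on laakso_base (\<lambda>p :: 'a prelaakso. xcoord (laakso_proj js p))
  \<longleftrightarrow> continuous_on (laakso_base :: 'a prelaakso set) fst" by (rule continuous_on_cong) auto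
 then show ?thesis by (simp add: continuous_laakso_iff continuous_on_fst)
qed

locale laakso =
 fixes js :: "nat \<Rightarrow> nat"
 assumes js_ge2: "\<And>i. i \<ge> 1 \<Longrightarrow> js i \<ge> 2"
begin

abbreviation d :: "nat \<Rightarrow> nat" where "d \<equiv> laakso_d js"
abbreviation L :: "nat \<Rightarrow> real set" where "L \<equiv> laakso_L js"
abbreviation io :: "'k prelaakso \<Rightarrow> 'k laakso_point" where "io \<equiv> laakso_proj js"
abbreviation \<mu> :: "'k::finite laakso_point measure" where "\<mu> \<equiv> laakso_measure js"

section \<open>Arithmetic of the levels \<open>L n\<close>\<close>

lemma d_0 [simp]: "d 0 = 1" by (simp add: laakso_d_def)

lemma d_Suc: "d (Suc n) = d n * js (Suc n)" by (simp add: laakso_d_def)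

lemma d_ge: "2 ^ n \<le> d n"
proof (induction n)
 case (Suc n)
 then show ?case
  using mult_le_mono[OF Suc js_ge2[of "Suc n"]] by (simp add: d_Suc mult.commute)
qed simp

lemma d_pos [simp]: "d n > 0"
 using d_ge[of n] by (metis less_le_trans pos2 zero_less_power)

lemma d_nz [simp]: "d n \<noteq> 0"
 using d_pos[of n] by simp

lemma d_dvd: "m \<le> n \<Longrightarrow> d m dvd d n" by (induction rule: dec_induct) (auto simp: d_Suc)

text \<open>Levels become integrality of \<open>x * d n\<close>, which is stable under the
  translations and reflections by multiples of \<open>1 / d n\<close> that make up the folding
  maps.\<close>

lemma mem_L: "x \<in> L n \<longleftrightarrow> 0 < x \<and> x < 1 \<and> x * d n \<in> \<int>"
proof
 assume "x \<in> L n"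
 then obtain i where "x = real i / real (d n)" "1 \<le> i" "i \<le> d n - 1" by (auto simp: laakso_L_def)
 moreover from this have "i < d n"
  using d_pos[of n] by linarith
 ultimately show "0 < x \<and> x < 1 \<and> x * d n \<in> \<int>" by simp
next
 assume *: "0 < x \<and> x < 1 \<and> x * d n \<in> \<int>"
 then obtain k where k: "x * d n = of_int k" by (auto elim: Ints_cases)
 have "0 < x * d n"
  using * by simp
 then have "0 < k" by (simp add: k)
 have "x * d n < d n"
  using * mult_strict_right_mono[of x 1 "real (d n)"] by simp
 then have "k < int (d n)" by (simp add: k)
 have "x = real (nat k) / real (d n)"
  using k \<open>0 < k\<close> by (simp add: field_simps)
 moreover have "1 \<le> nat k" "nat k \<le> d n - 1"
  using \<open>0 < k\<close> \<open>k < int (d n)\<close> by auto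
 ultimately show "x \<in> L n"
  unfolding laakso_L_def by blast
qed

lemma L_mono: "m \<le> n \<Longrightarrow> L m \<subseteq> L n"
proof
 fix x assume "m \<le> n" "x \<in> L m"
 then obtain c where "d n = d m * c"
  using d_dvd by (auto simp: dvd_def)
 then have "x * d n = (x * d m) * of_nat c" by simp
 then show "x \<in> L n"
  using \<open>x \<in> L m\<close> Ints_mult[OF _ Ints_of_nat[of c], of "x * d m"] by (auto simp: mem_L mult.assoc)
qed

lemma finite_L: "finite (L n)"
 by (rule finite_subset[of _ "(\<lambda>i. real i / real (d n)) ` {..d n}"]) (auto simp: laakso_L_def)

lemma L_subset_Rats: "L n \<subseteq> \<rat>" by (auto simp: laakso_L_def)

text \<open>\<open>n\<close> is the level at which \<open>x\<close> first becomes a grid point; it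
  decides which digit is identified over \<open>x\<close>. The digit with number \<open>n\<close>
  sits at position \<open>n - 1\<close>.\<close>

definition hole :: "real \<Rightarrow> nat \<Rightarrow> bool" where
 "hole x n \<longleftrightarrow> n \<ge> 1 \<and> x \<in> L n - L (n - 1)"

lemma hole_unique: "hole x n \<Longrightarrow> hole x m \<Longrightarrow> n = m"
proof (rule ccontr)
 assume h: "hole x n" "hole x m" "n \<noteq> m"
 have False if "hole x a" "hole x b" "a < b" for a b
 proof -
  have "a \<le> b - 1"
   using that(3) by linarith
  then show False
   using that(1,2) L_mono[of a "b - 1"] unfolding hole_def by blast
 qed
 then show False
  using h by (cases n m rule: linorder_cases) blast+
qed

lemma hole_in_L: "hole x m \<Longrightarrow> m \<le> n \<Longrightarrow> x \<in> L n"
 using L_mono[of m n] unfolding hole_def by auto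

lemma glue_iff: "laakso_glue js (x, w) (x', w') \<longleftrightarrow>
  x' = x \<and> (\<exists>n l. hole x n \<and> w' = w(l := (w l)(n - 1 := \<not> w l (n - 1))))"
 by (auto simp: laakso_glue_def hole_def)

text \<open>Closed form of the generated equivalence. A point \<open>x\<close> has at most one
  level, so over \<open>x\<close> only one digit position is free, in all coordinates at
  once.\<close>

definition glued :: "real \<Rightarrow> ('k \<Rightarrow> nat \<Rightarrow> bool) \<Rightarrow> ('k \<Rightarrow> nat \<Rightarrow> bool) \<Rightarrow> bool" where
 "glued x w w' \<longleftrightarrow> w = w' \<or> (\<exists>n. hole x n \<and> (\<forall>l m. m \<noteq> n - 1 \<longrightarrow> w l m = w' l m))"

text \<open>A generating step flips the digit of a single coordinate, so the proof is an induction
  on the finite set of coordinates that still differ.\<close>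

lemma equivclp_flip:
 fixes w w' :: "'k::finite \<Rightarrow> nat \<Rightarrow> bool"
 assumes n: "hole x n" and eq: "\<And>l m. m \<noteq> n - 1 \<Longrightarrow> w l m = w' l m"
 shows "equivclp (laakso_glue js) (x, w) (x, w')"
proof -
 have "finite {l. w l (n - 1) \<noteq> w' l (n - 1)}" by (rule finite)
 then show ?thesis
  using eq
 proof (induction "{l. w l (n - 1) \<noteq> w' l (n - 1)}" arbitrary: w rule: finite_induct)
  case empty
  then have "w l (n - 1) = w' l (n - 1)" for l by blast
  with empty.prems have "w l m = w' l m" for l m by (cases "m = n - 1") auto
  then have "w = w'" by (intro ext)
  then show ?case by simp
 next
  case (insert l D)
  define u where "u = w(l := (w l)(n - 1 := \<not> w l (n - 1)))"
  have "l' \<in> D \<longleftrightarrow> u l' (n - 1) \<noteq> w' l' (n - 1)" for l'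
   using insert.hyps(2,4) by (cases "l' = l") (auto simp: u_def)
  then have D: "D = {l. u l (n - 1) \<noteq> w' l (n - 1)}" by blast
  have "equivclp (laakso_glue js) (x, u) (x, w')"
   by (rule insert.hyps(3)[of u, OF D]) (use insert.prems in \<open>auto simp: u_def\<close>)
  moreover have "laakso_glue js (x, w) (x, u)"
   unfolding glue_iff u_def using n by blast
  ultimately show ?case by (meson equivclp_trans r_into_equivclp)
 qed
qed

lemma io_eq_iff:
 fixes w w' :: "'k::finite \<Rightarrow> nat \<Rightarrow> bool"
 shows "io (x, w) = io (x', w') \<longleftrightarrow> x = x' \<and> glued x w w'"
proof
 assume "io (x, w) = io (x', w')"
 then have "equivclp (laakso_glue js) (x, w) (x', w')" by (simp add: laakso_proj_eq_iff)
 then have "fst (x', w') = x \<and> glued x w (snd (x', w'))"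
 proof (induction rule: equivclp_induct)
  case base
  then show ?case by (simp add: glued_def)
 next
  case (step q r)
  obtain y u z v where qr: "q = (y, u)" "r = (z, v)" by fastforce
  have "z = y" and "\<exists>n l. hole y n \<and> (v = u(l := (u l)(n - 1 := \<not> u l (n - 1))) \<or> u = v(l := (v l)(n - 1 := \<not> v l (n - 1))))"
   using step(2) by (auto simp: qr glue_iff)
  then obtain n where n: "hole x n" "\<forall>l m. m \<noteq> n - 1 \<longrightarrow> u l m = v l m"
   using step(3) by (auto simp: qr)
  have "glued x w u"
   using step(3) by (simp add: qr)
  \<comment> \<open>Chaining steps cannot free a second position, as \<open>x\<close> has only one
    level.\<close>
  then have "\<forall>l m. m \<noteq> n - 1 \<longrightarrow> w l m = u l m"
   unfolding glued_def using hole_unique[OF n(1)] by auto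
  then have "glued x w v"
   unfolding glued_def using n by auto
  then show ?case
   using step(3) \<open>z = y\<close> by (simp add: qr)
 qed
 then show "x = x' \<and> glued x w w'" by simp
next
 assume "x = x' \<and> glued x w w'"
 then show "io (x, w) = io (x', w')"
  unfolding glued_def laakso_proj_eq_iff using equivclp_flip by auto
qed

text \<open>Off \<open>L n\<close> a point has no level or one above \<open>n\<close>, and then the
  free digit has position at least \<open>n\<close>.\<close>

lemma io_eq_imp_agree:
 fixes w w' :: "'k::finite \<Rightarrow> nat \<Rightarrow> bool"
 assumes "io (x, w) = io (x, w')" "x \<notin> L n"
 shows "agree n w w'"
proof -
 have "glued x w w'"
  using assms(1) by (simp add: io_eq_iff)
 then consider "w = w'" | m where "hole x m" "\<forall>l i. i \<noteq> m - 1 \<longrightarrow> w l i = w' l i"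
  by (auto simp: glued_def)
 then show ?thesis
 proof cases
  case 2
  then have "n < m"
   using assms(2) hole_in_L[of x m n] by (meson not_le)
  then show ?thesis
   using 2(2) by (auto simp: agree_def)
 qed simp
qed

text \<open>Grid points are rational. Over an irrational \<open>x\<close> points of the quotient can
  thus be compared digit by digit, which \<open>isometry_folding\<close> and
  \<open>cell_count_eq\<close> exploit.\<close>

lemma io_inject:
 fixes w w' :: "'k::finite \<Rightarrow> nat \<Rightarrow> bool"
 assumes "io (x, w) = io (x, w')" "x \<notin> \<rat>"
 shows "w = w'"
proof -
 have "agree (Suc m) w w'" for m
  using io_eq_imp_agree[OF assms(1)] L_subset_Rats assms(2) by blast
 then show ?thesis
  unfolding agree_def by blast
qed

text \<open>Truncation either deletes the free digit or keeps it free, so it is compatible with the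
  identifications.\<close>

lemma io_trunc:
 fixes w w' :: "'k::finite \<Rightarrow> nat \<Rightarrow> bool"
 assumes "io (x, w) = io (x, w')"
 shows "io (x, trunc n w) = io (x, trunc n w')"
 using assms unfolding io_eq_iff glued_def trunc_def by auto

lemma lift_io:
 assumes "\<And>x w w'. glued x w w' \<Longrightarrow> F (x, w) = F (x, w')"
 shows "lift F (io (p :: 'k::finite prelaakso)) = F p"
proof (rule lift_proj)
 fix p q :: "'k prelaakso" assume "laakso_glue js p q"
 then have "equivclp (laakso_glue js) p q" by blast
 then have "io p = io q" by (simp add: laakso_proj_eq_iff)
 then show "F p = F q"
  using assms by (cases p; cases q) (simp add: io_eq_iff)
qed

end

section \<open>The base measure\<close>

definition MK :: "('k::finite \<Rightarrow> nat \<Rightarrow> bool) measure" where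
 "MK = (\<Pi>\<^sub>M l\<in>UNIV. \<Pi>\<^sub>M i\<in>UNIV. measure_pmf (bernoulli_pmf (1 / 2)))"

abbreviation MI :: "real measure" where
 "MI \<equiv> restrict_space lborel {0..1}"

definition MB :: "'k::finite prelaakso measure" where
 "MB = MI \<Otimes>\<^sub>M MK"

lemma space_MK [simp]: "space MK = UNIV" by (simp add: MK_def space_PiM)

lemma space_MI [simp]: "space MI = {0..1}" by (simp add: space_restrict_space)

lemma space_MB [simp]: "space MB = laakso_base" by (simp add: MB_def space_pair_measure laakso_base_def)

lemma prob_space_MI: "prob_space MI" by (rule prob_spaceI) (simp add: emeasure_restrict_space)

lemma prob_space_MK: "prob_space MK"
proof -
 interpret A: product_prob_space "\<lambda>_. measure_pmf (bernoulli_pmf (1 / 2))" "UNIV :: nat set"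
  by unfold_locales
 interpret B: product_prob_space "\<lambda>_ :: 'a. \<Pi>\<^sub>M i\<in>(UNIV :: nat set). measure_pmf (bernoulli_pmf (1 / 2))" UNIV
  using A.P.prob_space_axioms by unfold_locales
 show ?thesis
  unfolding MK_def by (rule B.P.prob_space_axioms)
qed

interpretation MI: prob_space MI by (rule prob_space_MI)
interpretation MK: prob_space MK by (rule prob_space_MK)
interpretation MB: pair_prob_space MI MK ..

lemma prob_space_MB: "prob_space MB"
 unfolding MB_def by (rule MB.P.prob_space_axioms)

lemma measurable_MK_digit [measurable]: "(\<lambda>w. w l i) \<in> MK \<rightarrow>\<^sub>M count_space UNIV"
proof -
 have "(\<lambda>w. w l) \<in> MK \<rightarrow>\<^sub>M (\<Pi>\<^sub>M i\<in>UNIV. measure_pmf (bernoulli_pmf (1 / 2)))"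
  unfolding MK_def by (rule measurable_component_singleton) simp
 moreover have "(\<lambda>u. u i) \<in> (\<Pi>\<^sub>M i\<in>UNIV. measure_pmf (bernoulli_pmf (1 / 2))) \<rightarrow>\<^sub>M measure_pmf (bernoulli_pmf (1 / 2))"
  by (rule measurable_component_singleton) simp
 ultimately have "(\<lambda>w. w l i) \<in> MK \<rightarrow>\<^sub>M measure_pmf (bernoulli_pmf (1 / 2))"
  by (rule measurable_compose)
 then show ?thesis by (simp cong: measurable_cong_sets)
qed

lemma measurable_MK:
 assumes "\<And>l i. (\<lambda>x. f x l i) \<in> N \<rightarrow>\<^sub>M count_space UNIV"
 shows "f \<in> N \<rightarrow>\<^sub>M MK"
 unfolding MK_def
proof (rule measurable_PiM_single')
 show "(\<lambda>x. f x l) \<in> N \<rightarrow>\<^sub>M (\<Pi>\<^sub>M i\<in>UNIV. measure_pmf (bernoulli_pmf (1 / 2)))" for l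
  by (rule measurable_PiM_single') (use assms in \<open>auto cong: measurable_cong_sets\<close>)
qed (auto simp: space_PiM)

text \<open>The depth is raised to at least \<open>n\<close> so that the union stays within
  \<open>cyls n\<close>.\<close>

lemma digit_set_eq:
 "{w :: 'k::finite \<Rightarrow> nat \<Rightarrow> bool. w l i = b} =
   (\<Union>v\<in>{v \<in> range (trunc (max (Suc i) n)). v l i = b}. cyl (max (Suc i) n) v)"
 (is "?L = (\<Union>v\<in>?V. cyl ?N v)")
proof (intro equalityI subsetI)
 fix w assume "w \<in> ?L"
 then have "trunc ?N w \<in> ?V" by (simp add: trunc_def less_max_iff_disj)
 moreover have "w \<in> cyl ?N (trunc ?N w)" by (simp add: mem_cyl)
 ultimately show "w \<in> (\<Union>v\<in>?V. cyl ?N v)" by blast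
next
 fix w assume "w \<in> (\<Union>v\<in>?V. cyl ?N v)"
 then obtain v where "v l i = b" "agree ?N v w" by (auto simp: mem_cyl)
 then show "w \<in> ?L" by (simp add: agree_def less_max_iff_disj)
qed

lemma sets_cyl [measurable]: "cyl n v \<in> sets (MK :: ('k::finite \<Rightarrow> nat \<Rightarrow> bool) measure)"
proof -
 have "cyl n v = {w \<in> space MK. \<forall>l. \<forall>m\<in>{..<n}. w l m = v l m}"
  by (auto simp: cyl_def agree_def)
 also have "\<dots> \<in> sets MK" by measurable
 finally show ?thesis .
qed

text \<open>Cylinders of depth at least \<open>n\<close> already generate the sigma-algebra, and for
  these the preimage under a folding map of level \<open>n\<close> is explicit.\<close>

definition cyls :: "nat \<Rightarrow> ('k \<Rightarrow> nat \<Rightarrow> bool) set set" where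
 "cyls n = insert {} {cyl m v | m v. n \<le> m}"

lemma Int_stable_cyls: "Int_stable (cyls n)"
proof (rule Int_stableI)
 fix A B :: "('a \<Rightarrow> nat \<Rightarrow> bool) set" assume AB: "A \<in> cyls n" "B \<in> cyls n"
 show "A \<inter> B \<in> cyls n"
 proof (cases "A \<inter> B = {}")
  case False
  then obtain p q u v where *: "A = cyl p u" "n \<le> p" "B = cyl q v" "n \<le> q"
   using AB by (auto simp: cyls_def)
  have "A \<inter> B = B \<or> A \<inter> B = A"
   using False cyl_Int[of p q _ u v] cyl_Int[of q p _ v u] unfolding * by (cases "p \<le> q") auto
  then show ?thesis
   using AB by auto
 qed (simp add: cyls_def)
qed

lemma sets_MK: "sets (MK :: ('k::finite \<Rightarrow> nat \<Rightarrow> bool) measure) = sigma_sets UNIV (cyls n)"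
proof
 have "cyls n \<subseteq> sets (MK :: ('k \<Rightarrow> nat \<Rightarrow> bool) measure)"
  by (auto simp: cyls_def)
 then show "sigma_sets UNIV (cyls n) \<subseteq> sets (MK :: ('k \<Rightarrow> nat \<Rightarrow> bool) measure)"
  using sets.sigma_sets_subset[of "cyls n" MK] by simp
next
 let ?S = "sigma UNIV (cyls n) :: ('k \<Rightarrow> nat \<Rightarrow> bool) measure"
 have "(\<lambda>w. w) \<in> ?S \<rightarrow>\<^sub>M MK"
 proof (rule measurable_MK)
  fix l :: 'k and i :: nat
  have "{w :: 'k \<Rightarrow> nat \<Rightarrow> bool. w l i = b} \<in> sets ?S" for b
   unfolding digit_set_eq[of l i b n]
  proof (intro sets.finite_UN)
   show "finite {v \<in> range (trunc (max (Suc i) n)). v l i = b}"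
    by (rule finite_subset[OF _ finite_range_trunc]) blast
   have "n \<le> max (Suc i) n" by simp
   then have "cyl (max (Suc i) n) v \<in> cyls n" for v :: "'k \<Rightarrow> nat \<Rightarrow> bool"
    unfolding cyls_def by blast
   then show "cyl (max (Suc i) n) v \<in> sets ?S" for v by auto
  qed
  then show "(\<lambda>w. w l i) \<in> ?S \<rightarrow>\<^sub>M count_space UNIV"
   by (simp add: measurable_count_space_eq2_countable vimage_def)
 qed
 then show "sets (MK :: ('k \<Rightarrow> nat \<Rightarrow> bool) measure) \<subseteq> sigma_sets UNIV (cyls n)"
  by (auto dest!: measurable_sets)
qed

lemma measure_eqI_cyls:
 fixes M N :: "('k::finite \<Rightarrow> nat \<Rightarrow> bool) measure"
 assumes "sets M = sets MK" "sets N = sets MK" "finite_measure M"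
  and eq: "\<And>m v. n \<le> m \<Longrightarrow> emeasure M (cyl m v) = emeasure N (cyl m v)"
 shows "M = N"
proof (rule measure_eqI_generator_eq_countable[of "cyls n" UNIV _ _ "range (\<lambda>v. cyl n (trunc n v))"])
 show "Int_stable (cyls n :: ('k \<Rightarrow> nat \<Rightarrow> bool) set set)" by (rule Int_stable_cyls)
 show "sets M = sigma_sets UNIV (cyls n)" "sets N = sigma_sets UNIV (cyls n)"
  using assms sets_MK by simp_all
 show "emeasure M X = emeasure N X" if "X \<in> cyls n" for X
  using that eq by (auto simp: cyls_def)
 have "w \<in> cyl n (trunc n w)" for w :: "'k \<Rightarrow> nat \<Rightarrow> bool" by (simp add: mem_cyl)
 then show "\<Union> (range (\<lambda>v. cyl n (trunc n v))) = (UNIV :: ('k \<Rightarrow> nat \<Rightarrow> bool) set)"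
  by blast
 have "range (\<lambda>v :: 'k \<Rightarrow> nat \<Rightarrow> bool. cyl n (trunc n v)) = cyl n ` range (trunc n)"
  by auto
 then show "countable (range (\<lambda>v :: 'k \<Rightarrow> nat \<Rightarrow> bool. cyl n (trunc n v)))"
  by (simp add: countable_finite finite_range_trunc)
 show "emeasure M a \<noteq> \<infinity>" for a
  using assms(3) by (simp add: finite_measure.emeasure_finite)
qed (auto simp: cyls_def)

lemma prod_emb_UNIV_eq:
 assumes "\<And>i. space (M i) = UNIV"
 shows "prod_emb UNIV M J (Pi\<^sub>E J X) = {u. \<forall>i\<in>J. u i \<in> X i}"
 by (auto simp: prod_emb_def space_PiM PiE_iff assms)

text \<open>Stated for an arbitrary finite set of positions, because preimages of cylinders under a
  folding of level \<open>n\<close> prescribe the digits at positions \<open>n\<close> to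
  \<open>m - 1\<close>.\<close>

lemma emeasure_MK_digits:
 fixes v :: "'k::finite \<Rightarrow> nat \<Rightarrow> bool"
 assumes "finite J"
 shows "emeasure MK {w. \<forall>l. \<forall>i\<in>J. w l i = v l i} = ennreal ((1 / 2) ^ (card J * CARD('k)))"
proof -
 let ?P = "\<Pi>\<^sub>M i\<in>(UNIV :: nat set). measure_pmf (bernoulli_pmf (1 / 2))"
 let ?S = "\<lambda>l. {u :: nat \<Rightarrow> bool. \<forall>i\<in>J. u i = v l i}"
 interpret A: product_prob_space "\<lambda>_. measure_pmf (bernoulli_pmf (1 / 2))" "UNIV :: nat set"
  by unfold_locales
 interpret B: product_prob_space "\<lambda>_ :: 'k. ?P" UNIV
  using A.P.prob_space_axioms by unfold_locales
 have emb: "?S l = prod_emb UNIV (\<lambda>_. measure_pmf (bernoulli_pmf (1 / 2))) J (Pi\<^sub>E J (\<lambda>i. {v l i}))" for l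
  by (subst prod_emb_UNIV_eq) simp_all
 have "emeasure ?P (?S l) = (\<Prod>i\<in>J. emeasure (measure_pmf (bernoulli_pmf (1 / 2))) {v l i})" for l
  unfolding emb by (rule A.emeasure_PiM_emb) (use assms in auto)
 also have "\<dots> l = (\<Prod>i\<in>J. ennreal (1 / 2))" for l
 proof (rule prod.cong)
  show "emeasure (measure_pmf (bernoulli_pmf (1 / 2))) {v l i} = ennreal (1 / 2)" for i
   by (cases "v l i") (simp_all add: emeasure_pmf_single)
 qed simp
 also have "(\<Prod>i\<in>J. ennreal (1 / 2)) = ennreal ((1 / 2) ^ card J)"
  by (subst prod_constant, subst ennreal_power) simp_all
 finally have S: "emeasure ?P (?S l) = ennreal ((1 / 2) ^ card J)" for l .
 have sets: "?S l \<in> sets ?P" for l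
  unfolding emb by (rule sets_PiM_I) (use assms in auto)
 have "{w. \<forall>l. \<forall>i\<in>J. w l i = v l i} = Pi\<^sub>E UNIV ?S"
  by (simp add: PiE_UNIV_domain Pi_def)
 then have "emeasure MK {w. \<forall>l. \<forall>i\<in>J. w l i = v l i} = emeasure MK (Pi\<^sub>E UNIV ?S)"
  by simp
 also have "\<dots> = (\<Prod>l\<in>(UNIV :: 'k set). emeasure ?P (?S l))"
  unfolding MK_def by (rule B.emeasure_PiM) (use sets in auto)
 also have "\<dots> = ennreal ((1 / 2) ^ (card J * CARD('k)))"
  unfolding S by (subst prod_constant, subst ennreal_power) (simp_all add: power_mult)
 finally show ?thesis .
qed

lemma emeasure_cyl:
 "emeasure MK (cyl n (v :: 'k::finite \<Rightarrow> nat \<Rightarrow> bool)) = ennreal ((1 / 2) ^ (n * CARD('k)))"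
proof -
 have "cyl n v = {w. \<forall>l. \<forall>i\<in>{..<n}. w l i = v l i}" by (auto simp: cyl_def agree_def)
 then show ?thesis
  using emeasure_MK_digits[of "{..<n}" v] by simp
qed

text \<open>Countably many \<open>boxes\<close> suffice, which is what places open sets in the
  product sigma-algebra.\<close>

lemma sets_MB_open:
 fixes U :: "'k::finite prelaakso set"
 assumes "openin (top_of_set laakso_base) U"
 shows "U \<in> sets MB"
proof -
 have box: "R \<in> sets MB" if "R \<in> boxes" for R :: "'k prelaakso set"
 proof -
  have "({a<..<b} \<inter> {0..1}) \<times> cyl n v \<in> sets MB" for a b n and v :: "'k \<Rightarrow> nat \<Rightarrow> bool"
   unfolding MB_def by (intro pair_measureI sets_cyl) (auto simp: sets_restrict_space)
  then show ?thesis
   using that unfolding boxes_def by auto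
 qed
 have "\<Union>{R \<in> boxes. R \<subseteq> U} \<in> sets MB"
  using box countable_subset[OF _ countable_boxes, of "{R \<in> boxes. R \<subseteq> U}"]
  by (intro sets.countable_Union) auto
 then show ?thesis
  using openin_base_eq_boxes[OF assms] by simp
qed

section \<open>The measure on the quotient as a push-forward\<close>

lemma laakso_measure_eq:
 "laakso_measure js = distr MB (sigma (laakso_space js) {U. openin (laakso_topology js) U}) (laakso_proj js)"
 by (simp add: laakso_measure_def MB_def MK_def)

lemma open_subset_Pow_laakso: "{U. openin (laakso_topology js) U} \<subseteq> Pow (laakso_space js)"
 using openin_subset topspace_laakso_topology by blast

lemma space_laakso_measure [simp]: "space (laakso_measure js) = laakso_space js"
 by (simp add: laakso_measure_eq space_measure_of[OF open_subset_Pow_laakso])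

lemma sets_laakso_measure: "sets (laakso_measure js) = sigma_sets (laakso_space js) {U. openin (laakso_topology js) U}"
 by (simp add: laakso_measure_eq sets_measure_of[OF open_subset_Pow_laakso])

lemma openin_sets_laakso: "openin (laakso_topology js) U \<Longrightarrow> U \<in> sets (laakso_measure js)"
 by (simp add: sets_laakso_measure sigma_sets.Basic)

lemma measurable_proj [measurable]: "laakso_proj js \<in> MB \<rightarrow>\<^sub>M (laakso_measure js :: 'k::finite laakso_point measure)"
proof -
 have "laakso_proj js \<in> MB \<rightarrow>\<^sub>M sigma (laakso_space js :: 'k laakso_point set) {U. openin (laakso_topology js) U}"
 proof (rule measurable_measure_of[OF open_subset_Pow_laakso])
  show "laakso_proj js \<in> space MB \<rightarrow> laakso_space js" by (auto simp: laakso_proj_in_space)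
  fix U :: "'k laakso_point set" assume "U \<in> {U. openin (laakso_topology js) U}"
  then have "{p \<in> laakso_base. laakso_proj js p \<in> U} \<in> sets MB"
   by (simp add: sets_MB_open openin_quotient_preimage)
  moreover have "laakso_proj js -` U \<inter> space MB = {p \<in> laakso_base. laakso_proj js p \<in> U}"
   by auto
  ultimately show "laakso_proj js -` U \<inter> space MB \<in> sets MB" by simp
 qed
 then show ?thesis by (simp add: laakso_measure_eq cong: measurable_cong_sets)
qed

text \<open>Taking the measure itself as the target of the push-forward lets integrals and null sets
  be transported without mentioning the generated sigma-algebra.\<close>

lemma laakso_measure_distr: "laakso_measure js = distr MB (laakso_measure js) (laakso_proj js)"
 by (subst laakso_measure_eq, rule distr_cong)
  (simp_all add: sets_laakso_measure sets_measure_of[OF open_subset_Pow_laakso])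

lemma prob_space_laakso: "prob_space (laakso_measure js)"
 by (subst laakso_measure_distr, rule prob_space.prob_space_distr[OF prob_space_MB measurable_proj])

lemma integral_laakso:
 "f \<in> borel_measurable (laakso_measure js) \<Longrightarrow>
  (\<integral>s. f s \<partial>laakso_measure js) = (\<integral>p. f (laakso_proj js p) \<partial>MB :: real)"
 by (subst laakso_measure_distr, rule integral_distr) auto

lemma integrable_laakso_iff:
 fixes f :: "_ \<Rightarrow> real"
 shows "f \<in> borel_measurable (laakso_measure js) \<Longrightarrow>
  integrable (laakso_measure js) f \<longleftrightarrow> integrable MB (\<lambda>p. f (laakso_proj js p))"
 by (subst laakso_measure_distr, rule integrable_distr_eq) auto

lemma nn_integral_laakso:
 "f \<in> borel_measurable (laakso_measure js) \<Longrightarrow>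
  (\<integral>\<^sup>+s. f s \<partial>laakso_measure js) = (\<integral>\<^sup>+p. f (laakso_proj js p) \<partial>MB)"
 by (subst laakso_measure_distr, rule nn_integral_distr) auto

lemma AE_laakso_iff:
 "{s \<in> laakso_space js. P s} \<in> sets (laakso_measure js) \<Longrightarrow>
  (AE s in laakso_measure js. P s) \<longleftrightarrow> (AE p in MB. P (laakso_proj js p))"
 by (subst laakso_measure_distr, rule AE_distr_iff) auto

lemma AE_laakso_imp:
 assumes "AE s in laakso_measure js. P s" shows "AE p in MB. P (laakso_proj js p)"
proof -
 have "AE s in distr MB (laakso_measure js) (laakso_proj js). P s"
  using assms laakso_measure_distr by metis
 then show ?thesis by (rule AE_distrD[OF measurable_proj])
qed

lemma borel_measurable_continuous_laakso:
 fixes f :: "'k::finite laakso_point \<Rightarrow> 'b::topological_space"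
 assumes "continuous_map (laakso_topology js) euclidean f"
 shows "f \<in> borel_measurable (laakso_measure js)"
proof (rule borel_measurableI)
 fix S :: "'b set" assume "open S"
 then have "openin (laakso_topology js) {x \<in> topspace (laakso_topology js). f x \<in> S}"
  using assms openin_continuous_map_preimage[OF assms] by simp
 moreover have "{x \<in> topspace (laakso_topology js). f x \<in> S} = f -` S \<inter> space (laakso_measure js)"
  by (auto simp: topspace_laakso_topology)
 ultimately show "f -` S \<inter> space (laakso_measure js) \<in> sets (laakso_measure js)"
  by (simp add: openin_sets_laakso)
qed

text \<open>A function of finitely many digits is a finite sum, over cylinders, of functions of
  \<open>x\<close> alone, so measurability along lines is enough.\<close>

lemma borel_measurable_MB_trunc:
 fixes h :: "'k::finite prelaakso \<Rightarrow> 'b::{second_countable_topology, real_normed_vector}"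
 assumes "\<And>v. (\<lambda>x. h (x, v)) \<in> borel_measurable MI" "\<And>x w. x \<in> {0..1} \<Longrightarrow> h (x, w) = h (x, trunc n w)"
 shows "h \<in> borel_measurable MB"
proof -
 have "(\<lambda>p. \<Sum>v\<in>range (trunc n). indicator (cyl n v) (snd p) *\<^sub>R h (fst p, v)) \<in> borel_measurable MB"
  unfolding MB_def
 proof (intro borel_measurable_sum borel_measurable_scaleR)
  fix v :: "'k \<Rightarrow> nat \<Rightarrow> bool"
  show "(\<lambda>p. indicator (cyl n v) (snd p)) \<in> borel_measurable (MI \<Otimes>\<^sub>M MK)"
   by measurable
  show "(\<lambda>p. h (fst p, v)) \<in> borel_measurable (MI \<Otimes>\<^sub>M MK)"
   using measurable_compose[OF measurable_fst assms(1)] .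
 qed
 also have "?this \<longleftrightarrow> h \<in> borel_measurable MB"
 proof (rule measurable_cong)
  fix p :: "'k prelaakso" assume p: "p \<in> space MB"
  obtain x w where xw: "p = (x, w)" by fastforce
  have "(\<Sum>v\<in>range (trunc n). indicator (cyl n v) (snd p) *\<^sub>R h (fst p, v)) =
    (\<Sum>v\<in>range (trunc n). if v = trunc n w then h (x, trunc n w) else 0)"
  proof (rule sum.cong)
   fix v :: "'k \<Rightarrow> nat \<Rightarrow> bool" assume "v \<in> range (trunc n)"
   then have "w \<in> cyl n v \<longleftrightarrow> v = trunc n w"
    by (auto simp: mem_cyl) (metis trunc_eq_iff trunc_idem)
   then show "indicator (cyl n v) (snd p) *\<^sub>R h (fst p, v) = (if v = trunc n w then h (x, trunc n w) else 0)"
    by (cases "w \<in> cyl n v") (simp_all add: xw)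
  qed simp
  also have "\<dots> = h p"
   using assms(2)[of x w] p by (simp add: sum.delta[OF finite_range_trunc] xw)
  finally show "(\<Sum>v\<in>range (trunc n). indicator (cyl n v) (snd p) *\<^sub>R h (fst p, v)) = h p" .
 qed
 finally show ?thesis .
qed

lemma nn_integral_MB:
 assumes "h \<in> borel_measurable MB"
 shows "(\<integral>\<^sup>+p. h p \<partial>MB) = (\<integral>\<^sup>+w. \<integral>\<^sup>+x. h (x, w) \<partial>MI \<partial>MK)"
 unfolding MB_def by (rule MB.nn_integral_snd[symmetric]) (use assms in \<open>simp add: MB_def\<close>)

section \<open>Hausdorff measure and the distance\<close>

lemma diameter_le_metric:
 assumes "0 \<le> c" "\<And>x y. x \<in> S \<Longrightarrow> y \<in> S \<Longrightarrow> dist x y \<le> c"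
 shows "diameter S \<le> c"
proof (cases "S = {}")
 case False
 then have "(SUP p\<in>S \<times> S. case p of (x, y) \<Rightarrow> dist x y) \<le> c"
  by (intro cSUP_least) (auto simp: assms)
 with False show ?thesis by (simp add: diameter_def case_prod_beta)
qed (simp add: assms)

lemma hausdorff1_pre_le_cover:
 assumes "A \<subseteq> (\<Union>i. U i)" "\<And>i. bounded (U i)" "\<And>i. diameter (U i) \<le> \<delta>"
 shows "hausdorff1_pre \<delta> A \<le> (\<Sum>i. ennreal (diameter (U i)))"
 unfolding hausdorff1_pre_def by (rule INF_lower2[of U]) (use assms in auto)

lemma hausdorff1_pre_mono: "A \<subseteq> B \<Longrightarrow> hausdorff1_pre \<delta> A \<le> hausdorff1_pre \<delta> B"
 unfolding hausdorff1_pre_def by (rule INF_superset_mono) auto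

lemma hausdorff1_mono: "A \<subseteq> B \<Longrightarrow> hausdorff1 A \<le> hausdorff1 B"
 unfolding hausdorff1_def by (intro SUP_mono' hausdorff1_pre_mono)

lemma hausdorff1_pre_empty: "\<delta> > 0 \<Longrightarrow> hausdorff1_pre \<delta> {} = 0"
 using hausdorff1_pre_le_cover[of "{}" "\<lambda>_. {}" \<delta>] by simp

lemma hausdorff1_empty [simp]: "hausdorff1 {} = 0" by (simp add: hausdorff1_def hausdorff1_pre_empty)

lemma hausdorff1_pre_UN_le:
 "hausdorff1_pre \<delta> (\<Union>i. A i) \<le> (\<Sum>i. hausdorff1_pre \<delta> (A i))"
proof (cases "(\<Sum>i. hausdorff1_pre \<delta> (A i)) = \<infinity>")
 case False
 show ?thesis
 proof (rule ennreal_le_epsilon)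
  fix e :: real assume "e > 0"
  have "\<exists>U. A n \<subseteq> (\<Union>i. U i) \<and> (\<forall>i. bounded (U i) \<and> diameter (U i) \<le> \<delta>) \<and>
    (\<Sum>i. ennreal (diameter (U i))) \<le> hausdorff1_pre \<delta> (A n) + ennreal (e * (1/2)^Suc n)" for n
  proof -
   have "hausdorff1_pre \<delta> (A n) \<noteq> \<infinity>"
    using False ennreal_suminf_lessD[of "\<lambda>n. hausdorff1_pre \<delta> (A n)" top n]
    by (auto simp: less_top)
   then have "hausdorff1_pre \<delta> (A n) < hausdorff1_pre \<delta> (A n) + ennreal (e * (1/2)^Suc n)"
    using \<open>e > 0\<close> ennreal_add_left_cancel_less[of "hausdorff1_pre \<delta> (A n)" 0 "ennreal (e * (1/2)^Suc n)"]
    by simp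
   then show ?thesis
    unfolding hausdorff1_pre_def INF_less_iff by (auto intro: less_imp_le)
  qed
  then obtain U where U: "\<And>n. A n \<subseteq> (\<Union>i. U n i)" "\<And>n i. bounded (U n i)" "\<And>n i. diameter (U n i) \<le> \<delta>"
    "\<And>n. (\<Sum>i. ennreal (diameter (U n i))) \<le> hausdorff1_pre \<delta> (A n) + ennreal (e * (1/2)^Suc n)"
   by metis
  let ?V = "\<lambda>k. case prod_decode k of (n, i) \<Rightarrow> U n i"
  have "hausdorff1_pre \<delta> (\<Union>n. A n) \<le> (\<Sum>k. ennreal (diameter (?V k)))"
  proof (rule hausdorff1_pre_le_cover)
   show "(\<Union>n. A n) \<subseteq> (\<Union>k. ?V k)"
   proof clarify
    fix x n assume "x \<in> A n"
    then obtain i where "x \<in> U n i"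
     using U(1) by blast
    then have "x \<in> ?V (prod_encode (n, i))" by simp
    then show "x \<in> (\<Union>k. ?V k)" by (rule UN_I[OF UNIV_I])
   qed
  qed (use U in \<open>auto split: prod.split\<close>)
  also have "\<dots> = (\<Sum>n. \<Sum>i. ennreal (diameter (U n i)))"
  proof -
   have "(\<lambda>k. ennreal (diameter (?V k))) = (\<lambda>k. (\<lambda>(n, i). ennreal (diameter (U n i))) (prod_decode k))"
    by (simp add: fun_eq_iff split: prod.split)
   then show ?thesis
    using suminf_ennreal_2dimen[of "\<lambda>n. \<Sum>i. ennreal (diameter (U n i))" "\<lambda>(n, i). ennreal (diameter (U n i))"]
    by simp
  qed
  also have "\<dots> \<le> (\<Sum>n. hausdorff1_pre \<delta> (A n) + ennreal (e * (1/2)^Suc n))"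
   by (intro suminf_le U(4)) auto
  also have "\<dots> = (\<Sum>n. hausdorff1_pre \<delta> (A n)) + (\<Sum>n. ennreal (e * (1/2)^Suc n))"
   by (intro suminf_add[symmetric]) auto
  also have "(\<Sum>n. ennreal (e * (1/2)^Suc n)) = ennreal e"
   using sums_mult[OF power_half_series, of e] \<open>e > 0\<close> by (intro suminf_ennreal_eq) auto
  finally show "hausdorff1_pre \<delta> (\<Union>n. A n) \<le> (\<Sum>n. hausdorff1_pre \<delta> (A n)) + ennreal e" .
 qed
qed simp

text \<open>Countable, not only finite, subadditivity is needed: the path of
  \<open>connecting_path\<close> runs through infinitely many segments.\<close>

lemma hausdorff1_UN_le: "hausdorff1 (\<Union>i. A i) \<le> (\<Sum>i. hausdorff1 (A i))"
 unfolding hausdorff1_def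
proof (rule SUP_least)
 fix \<delta> :: real assume "\<delta> \<in> {0<..}"
 then have "(\<Sum>i. hausdorff1_pre \<delta> (A i)) \<le> (\<Sum>i. SUP \<delta>\<in>{0<..}. hausdorff1_pre \<delta> (A i))"
  by (intro suminf_le SUP_upper) auto
 with hausdorff1_pre_UN_le show "hausdorff1_pre \<delta> (\<Union>i. A i) \<le> (\<Sum>i. SUP \<delta>\<in>{0<..}. hausdorff1_pre \<delta> (A i))"
  by (rule order_trans)
qed

lemma hausdorff1_Un_le: "hausdorff1 (A \<union> B) \<le> hausdorff1 A + hausdorff1 B"
 using hausdorff1_UN_le[of "binaryset A B"] by (simp add: suminf_binaryset_eq UN_binaryset_eq)

text \<open>Equal pieces of length at most \<open>\<delta>\<close> have images of diameter at most
  that length, and the lengths add up to \<open>b - a\<close>.\<close>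

lemma hausdorff1_pre_lipschitz_image:
 assumes "a \<le> b" "\<And>s t. dist (f s) (f t) \<le> \<bar>s - t :: real\<bar>" "\<delta> > 0"
 shows "hausdorff1_pre \<delta> (f ` {a..b}) \<le> ennreal (b - a)"
proof -
 obtain N :: nat where N: "(b - a) / \<delta> < real N"
  using reals_Archimedean2 by blast
 then have "N > 0"
  using assms by (metis divide_nonneg_pos diff_ge_0_iff_ge gr0I leD of_nat_0)
 define h where "h = (b - a) / N"
 have h: "0 \<le> h" "h \<le> \<delta>"
  using assms N \<open>N > 0\<close> by (auto simp: h_def field_simps)
 let ?U = "\<lambda>i. if i < N then f ` {a + real i * h .. a + real (Suc i) * h} else {}"
 have diam: "diameter (?U i) \<le> h" for i
 proof (rule diameter_le_metric)
  fix x y assume "x \<in> ?U i" "y \<in> ?U i"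
  then obtain s t where st: "x = f s" "y = f t" "s \<in> {a + real i * h .. a + real (Suc i) * h}"
    "t \<in> {a + real i * h .. a + real (Suc i) * h}" by (auto split: if_splits)
  have "\<bar>s - t\<bar> \<le> h"
   using st(3,4) by (auto simp: algebra_simps abs_if)
  with assms(2)[of s t] show "dist x y \<le> h" by (simp add: st)
 qed (rule h)
 have "hausdorff1_pre \<delta> (f ` {a..b}) \<le> (\<Sum>i. ennreal (diameter (?U i)))"
 proof (rule hausdorff1_pre_le_cover)
  show "f ` {a..b} \<subseteq> (\<Union>i. ?U i)"
  proof clarify
   fix t assume t: "t \<in> {a..b}"
   \<comment> \<open>For \<open>t = b\<close> the floor below would give the index \<open>N\<close>,
     one too many; the right end belongs to the last piece.\<close>
   show "f t \<in> (\<Union>i. ?U i)"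
   proof (cases "t = b")
    case True
    have "a + real (Suc (N - 1)) * h = b"
     using \<open>N > 0\<close> by (simp add: h_def)
    moreover from this have "a + real (N - 1) * h \<le> b"
     using h(1) by (simp add: algebra_simps)
    ultimately have "f t \<in> ?U (N - 1)"
     using True \<open>N > 0\<close> by auto
    then show ?thesis by blast
   next
    case False
    then have "t < b" "a < b"
     using t by auto
    then have "h > 0"
     using \<open>N > 0\<close> by (simp add: h_def)
    define i where "i = nat \<lfloor>(t - a) / h\<rfloor>"
    have "(t - a) / h \<ge> 0"
     using t \<open>h > 0\<close> by simp
    then have i: "real i \<le> (t - a) / h" "(t - a) / h < real i + 1"
     unfolding i_def by linarith+
    have "(t - a) / h < real N"
     using \<open>t < b\<close> \<open>a < b\<close> \<open>N > 0\<close> by (simp add: h_def field_simps)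
    then have "i < N"
     using i(1) by simp
    moreover have "t \<in> {a + real i * h .. a + real (Suc i) * h}"
     using i \<open>h > 0\<close> by (simp add: field_simps)
    ultimately have "f t \<in> ?U i" by simp
    then show ?thesis by blast
   qed
  qed
  show "bounded (?U i)" for i
  proof -
   have "bounded (f ` {u..v})" for u v
    unfolding bounded_def
   proof (intro exI ballI)
    fix y assume "y \<in> f ` {u..v}"
    then obtain t where "y = f t" "t \<in> {u..v}" by blast
    then show "dist (f u) y \<le> v - u"
     using assms(2)[of u t] by auto
   qed
   then show ?thesis by simp
  qed
  show "diameter (?U i) \<le> \<delta>" for i
   using diam[of i] h by linarith
 qed
 also have "\<dots> = (\<Sum>i<N. ennreal (diameter (?U i)))" by (intro suminf_finite) auto
 also have "\<dots> \<le> (\<Sum>i<N. ennreal h)" by (intro sum_mono ennreal_leI diam)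
 also have "\<dots> = ennreal (b - a)"
  using \<open>N > 0\<close> h by (simp add: ennreal_of_nat_eq_real_of_nat flip: ennreal_mult) (simp add: h_def)
 finally show ?thesis .
qed

lemma hausdorff1_lipschitz_image:
 assumes "a \<le> b" "\<And>s t. dist (f s) (f t) \<le> \<bar>s - t :: real\<bar>"
 shows "hausdorff1 (f ` {a..b}) \<le> ennreal (b - a)"
 unfolding hausdorff1_def by (rule SUP_least) (use hausdorff1_pre_lipschitz_image[OF assms] in auto)

text \<open>Projection to the first coordinate does not increase diameters, so the interval is
  covered by the hulls of the projected covering sets. A lower bound at the single scale
  \<open>1\<close> is enough, the measure being a supremum over scales.\<close>

lemma hausdorff1_ge_projection:
 fixes A :: "(real \<times> 'a::metric_space) set"
 assumes "{a..b} \<subseteq> fst ` A" "a \<le> b"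
 shows "ennreal (b - a) \<le> hausdorff1 A"
proof -
 have "ennreal (b - a) \<le> hausdorff1_pre 1 A"
  unfolding hausdorff1_pre_def
 proof (rule INF_greatest, clarify)
  fix U :: "nat \<Rightarrow> (real \<times> 'a) set"
  assume U: "A \<subseteq> (\<Union>i. U i)" "\<forall>i. bounded (U i) \<and> diameter (U i) \<le> 1"
  \<comment> \<open>\<open>Inf\<close> and \<open>Sup\<close> of an empty set carry no information,
    hence the separate case.\<close>
  define J where "J i = (if U i = {} then {} else {Inf (fst ` U i) .. Sup (fst ` U i)})" for i
  have J: "fst ` U i \<subseteq> J i" "emeasure lborel (J i) \<le> ennreal (diameter (U i))" for i
  proof -
   have bdd: "bdd_above (fst ` U i)" "bdd_below (fst ` U i)"
    using U(2) by (simp_all add: bounded_fst bounded_imp_bdd_above bounded_imp_bdd_below)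
   show "fst ` U i \<subseteq> J i"
   proof
    fix x assume x: "x \<in> fst ` U i"
    then have "U i \<noteq> {}" by blast
    then show "x \<in> J i"
     using cInf_lower[OF x bdd(2)] cSup_upper[OF x bdd(1)] by (simp add: J_def)
   qed
   show "emeasure lborel (J i) \<le> ennreal (diameter (U i))"
   proof (cases "U i = {}")
    case False
    have "Sup (fst ` U i) - Inf (fst ` U i) \<le> diameter (U i)"
    proof -
     have "Sup (fst ` U i) \<le> diameter (U i) + Inf (fst ` U i)"
     proof (rule cSup_least)
      fix x assume "x \<in> fst ` U i"
      then obtain p where p: "p \<in> U i" "x = fst p" by blast
      have "x - diameter (U i) \<le> Inf (fst ` U i)"
      proof (rule cInf_greatest)
       fix y assume "y \<in> fst ` U i"
       then obtain q where q: "q \<in> U i" "y = fst q" by blast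
       have "dist (fst p) (fst q) \<le> dist p q" by (rule dist_fst_le)
       also have "\<dots> \<le> diameter (U i)"
        using diameter_bounded_bound U(2) p q by blast
       finally show "x - diameter (U i) \<le> y" by (simp add: dist_real_def p q)
      qed (use False in simp)
      then show "x \<le> diameter (U i) + Inf (fst ` U i)" by simp
     qed (use False in simp)
     then show ?thesis by simp
    qed
    moreover have "Inf (fst ` U i) \<le> Sup (fst ` U i)"
     using False bdd by (intro cInf_le_cSup) simp_all
    ultimately show ?thesis
     using False by (simp add: J_def ennreal_leI)
   qed (simp add: J_def)
  qed
  have "ennreal (b - a) = emeasure lborel {a..b}"
   using assms by simp
  also have "\<dots> \<le> emeasure lborel (\<Union>i. J i)"
  proof (rule emeasure_mono)
   have "{a..b} \<subseteq> fst ` (\<Union>i. U i)"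
    using assms(1) image_mono[OF U(1), of fst] by (rule order_trans)
   also have "\<dots> \<subseteq> (\<Union>i. J i)"
    unfolding image_UN by (intro UN_mono J(1) order_refl)
   finally show "{a..b} \<subseteq> (\<Union>i. J i)" .
  qed (auto simp: J_def)
  also have "\<dots> \<le> (\<Sum>i. emeasure lborel (J i))"
   by (rule emeasure_subadditive_countably) (auto simp: J_def)
  also have "\<dots> \<le> (\<Sum>i. ennreal (diameter (U i)))" by (intro suminf_le J) auto
  finally show "ennreal (b - a) \<le> (\<Sum>i. ennreal (diameter (U i)))" .
 qed
 also have "\<dots> \<le> hausdorff1 A"
  unfolding hausdorff1_def by (rule SUP_upper) simp
 finally show ?thesis .
qed

lemma fst_laakso_emb [simp]: "fst (laakso_emb p) = fst p" by (simp add: laakso_emb_def case_prod_beta)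

lemma hausdorff1_segment:
 assumes "a \<le> b"
 shows "hausdorff1 (laakso_emb ` ({a..b} \<times> {w})) \<le> ennreal (b - a)"
proof -
 have "laakso_emb ` ({a..b} \<times> {w}) = (\<lambda>t. (t, snd (laakso_emb (0, w)))) ` {a..b}"
  by (auto simp: laakso_emb_def image_iff)
 then show ?thesis
  using hausdorff1_lipschitz_image[OF assms, of "\<lambda>t. (t, snd (laakso_emb (0, w)))"]
  by (simp add: dist_Pair_Pair dist_real_def)
qed

section \<open>Paths between arbitrary points; the distance along lines\<close>

context laakso
begin

text \<open>The last point of the grid of mesh \<open>1 / d n\<close> before \<open>1\<close>; for
  \<open>n \<ge> 1\<close> its level is exactly \<open>n\<close>. The sequence climbs to
  \<open>1\<close>, so a path from \<open>0\<close> to \<open>1\<close> can use one wormhole of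
  every level in turn.\<close>

definition stair :: "nat \<Rightarrow> real" where
 "stair n = 1 - 1 / d n"

lemma stair_0 [simp]: "stair 0 = 0" by (simp add: stair_def)

lemma stair_less_1: "stair n < 1" by (simp add: stair_def)

lemma d_less_Suc: "d n < d (Suc n)"
proof -
 have "d n * 1 < d n * js (Suc n)"
  using js_ge2[of "Suc n"] by (intro mult_strict_left_mono) auto
 then show ?thesis by (simp add: d_Suc)
qed

lemma strict_mono_stair: "strict_mono stair"
 by (rule strict_monoI_Suc) (use d_less_Suc in \<open>simp add: stair_def frac_less2\<close>)

lemma hole_stair: "hole (stair (Suc n)) (Suc n)"
proof -
 have "d (Suc n) \<ge> 2"
  using d_less_Suc[of n] d_pos[of n] by linarith
 moreover have "stair (Suc n) * d (Suc n) = real (d (Suc n)) - 1" by (simp add: stair_def left_diff_distrib)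
 ultimately have "stair (Suc n) \<in> L (Suc n)" by (simp add: mem_L) (simp add: stair_def)
 moreover have "stair (Suc n) \<notin> L n"
 proof
  assume "stair (Suc n) \<in> L n"
  then have "(1 - 1 / d (Suc n)) * d n \<in> \<int>" by (simp add: mem_L stair_def)
  then have "d n - (1 - 1 / d (Suc n)) * d n \<in> \<int>" by (intro Ints_diff) simp_all
  then have "real (d n) / d (Suc n) \<in> \<int>" by (simp add: algebra_simps)
  then obtain k where k: "real (d n) / d (Suc n) = of_int k" by (auto elim: Ints_cases)
  have "0 < real (d n) / d (Suc n)" "real (d n) / d (Suc n) < 1"
   using d_less_Suc[of n] by simp_all
  then show False
   unfolding k by simp
 qed
 ultimately show ?thesis by (simp add: hole_def)
qed

lemma stair_tendsto: "stair \<longlonglongrightarrow> 1"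
proof -
 have "(\<lambda>n. (1/2)^n :: real) \<longlonglongrightarrow> 0" by (rule LIMSEQ_realpow_zero) auto
 moreover have "norm (1 / real (d n)) \<le> (1/2)^n" for n
 proof -
  have "(2::real) ^ n \<le> real (d n)"
   using d_ge[of n] by (metis of_nat_le_iff of_nat_numeral of_nat_power)
  then show ?thesis by (simp add: power_one_over frac_le)
 qed
 ultimately have "(\<lambda>n. 1 / real (d n)) \<longlonglongrightarrow> 0"
  by (rule Lim_null_comparison[OF always_eventually[OF allI], rotated])
 from tendsto_diff[OF tendsto_const[of 1] this] show ?thesis by (simp add: stair_def[abs_def])
qed

text \<open>The path runs along \<open>w\<close> down to \<open>0\<close>, then up to
  \<open>1\<close>, exchanging the digit of level \<open>n\<close> for that of \<open>w'\<close>
  when it passes \<open>stair n\<close>, and finally along \<open>w'\<close> down to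
  \<open>x'\<close>. Only at \<open>1\<close> have all digits been exchanged, so the middle part is
  a countable union of segments of total length \<open>1\<close>.\<close>

lemma connecting_path:
 fixes w w' :: "'k::finite \<Rightarrow> nat \<Rightarrow> bool"
 assumes "x \<in> {0..1}" "x' \<in> {0..1}"
 obtains p \<gamma> where "p \<subseteq> laakso_base" "pathin (laakso_topology js) \<gamma>" "\<gamma> 0 = io (x, w)" "\<gamma> 1 = io (x', w')"
  "\<gamma> ` {0..1} = io ` p" "hausdorff1 (laakso_emb ` p) < \<infinity>"
proof -
 \<comment> \<open>The polygon \<open>x\<close>, \<open>0\<close>, \<open>1\<close>,
   \<open>x'\<close> at the times \<open>0\<close>, \<open>1/3\<close>, \<open>2/3\<close>,
   \<open>1\<close>, written as one expression to make its continuity immediate.\<close>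
 define \<xi> where "\<xi> t = max (x * (1 - 3 * t)) (min (3 * t - 1) (1 - (3 * t - 2) * (1 - x')))" for t :: real
 define T where "T n = (1 + stair n) / 3" for n
 define \<omega> where "\<omega> t l i = (if t \<le> T (Suc i) then w l i else w' l i)" for t :: real and l i
 \<comment> \<open>At the moment of exchange \<open>\<omega>\<close> still has the old digit and
   \<open>\<omega>R\<close> already the new one. Both project to \<open>\<gamma>\<close>; continuity
   of \<open>\<gamma>\<close> at a given time is read off from \<open>\<omega>\<close> on the left
   and from \<open>\<omega>R\<close> on the right.\<close>
 define \<omega>R where "\<omega>R t l i = (if t < T (Suc i) then w l i else w' l i)" for t :: real and l i
 define \<gamma> where "\<gamma> t = io (\<xi> t, \<omega> t)" for t
 define p where "p = (\<lambda>t. (\<xi> t, \<omega> t)) ` {0..1}"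
 have T: "1 / 3 \<le> T n" "T n < 2 / 3" for n
  using stair_less_1[of n] strict_mono_less_eq[OF strict_mono_stair, of 0 n] by (auto simp: T_def field_simps)
 have T_inj: "T n = T m \<longleftrightarrow> n = m" for n m
  using strict_mono_eq[OF strict_mono_stair, of n m] by (simp add: T_def)
 have \<xi>1: "\<xi> t = x * (1 - 3 * t)" if "t \<in> {0..1/3}" for t
 proof -
  have "3 * t - 1 \<le> 0" "0 \<le> x * (1 - 3 * t)"
   using that assms by auto
  then show ?thesis by (simp add: \<xi>_def)
 qed
 have \<xi>2: "\<xi> t = 3 * t - 1" if "t \<in> {1/3..2/3}" for t
 proof -
  have "3 * t - 1 \<ge> 0" "x * (1 - 3 * t) \<le> 0" "(3 * t - 2) * (1 - x') \<le> 0" "3 * t - 1 \<le> 1"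
   using that assms by (auto simp: mult_nonneg_nonpos mult_nonpos_nonneg)
  then show ?thesis by (simp add: \<xi>_def)
 qed
 have \<xi>3: "\<xi> t = 1 - (3 * t - 2) * (1 - x')" if "t \<in> {2/3..1}" for t
 proof -
  have "(3 * t - 2) * (1 - x') \<le> 1 * 1"
   using that assms by (intro mult_mono) auto
  moreover have "3 * t - 1 \<ge> 1" "x * (1 - 3 * t) \<le> 0" "(3 * t - 2) * (1 - x') \<ge> 0"
   using that assms by (auto simp: mult_nonneg_nonpos)
  ultimately show ?thesis by (simp add: \<xi>_def)
 qed
 have \<xi>01: "\<xi> t \<in> {0..1}" if t: "t \<in> {0..1}" for t
 proof -
  have "t \<in> {0..1/3} \<or> t \<in> {1/3..2/3} \<or> t \<in> {2/3..1}"
   using t by simp linarith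
  then consider "t \<in> {0..1/3}" | "t \<in> {1/3..2/3}" | "t \<in> {2/3..1}" by blast
  then show ?thesis
  proof cases
   case 1
   then have "x * (1 - 3 * t) \<le> 1 * 1" "0 \<le> x * (1 - 3 * t)"
    using assms by (intro mult_mono mult_nonneg_nonneg; simp)+
   then show ?thesis by (simp add: \<xi>1[OF 1])
  next
   case 3
   then have "(3 * t - 2) * (1 - x') \<le> 1 * 1" "0 \<le> (3 * t - 2) * (1 - x')"
    using assms by (intro mult_mono mult_nonneg_nonneg; simp)+
   then show ?thesis by (simp add: \<xi>3[OF 3])
  qed (auto simp: \<xi>2)
 qed
 have \<xi>_cont: "continuous_on UNIV \<xi>"
  unfolding \<xi>_def by (intro continuous_intros)
 have \<xi>_T: "\<xi> (T n) = stair n" for n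
  using T[of n] \<xi>2[of "T n"] by (simp add: T_def add_divide_distrib)
 have R: "io (\<xi> t, \<omega>R t) = \<gamma> t" for t
 proof (cases "\<exists>n. t = T (Suc n)")
  case True
  then obtain n where n: "t = T (Suc n)" by blast
  have "\<omega>R t l m = \<omega> t l m" if "m \<noteq> Suc n - 1" for l m
  proof -
   have "t \<noteq> T (Suc m)"
    using that T_inj by (simp add: n)
   then have "t \<le> T (Suc m) \<longleftrightarrow> t < T (Suc m)" by linarith
   then show ?thesis by (simp add: \<omega>R_def \<omega>_def)
  qed
  then have "glued (stair (Suc n)) (\<omega>R t) (\<omega> t)"
   using hole_stair[of n] unfolding glued_def by blast
  then show ?thesis by (simp add: \<gamma>_def io_eq_iff n \<xi>_T)
 next
  case False
  then have "t \<le> T (Suc m) \<longleftrightarrow> t < T (Suc m)" for m by (metis less_eq_real_def)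
  then have "\<omega>R t = \<omega> t" by (simp add: \<omega>R_def \<omega>_def fun_eq_iff)
  then show ?thesis by (simp add: \<gamma>_def)
 qed
 have path: "pathin (laakso_topology js) \<gamma>"
  unfolding pathin_def continuous_map_def
 proof (intro conjI allI impI)
  show "\<gamma> \<in> topspace (top_of_set {0..1}) \<rightarrow> topspace (laakso_topology js)"
   using \<xi>01 by (auto simp: topspace_laakso_topology \<gamma>_def intro!: laakso_proj_in_space)
  fix U :: "'k laakso_point set" assume "openin (laakso_topology js) U"
  then have V: "openin (top_of_set laakso_base) {q \<in> laakso_base. io q \<in> U}"
   by (rule openin_quotient_preimage)
  let ?S = "{t \<in> topspace (top_of_set {0..1}). \<gamma> t \<in> U}"
  show "openin (top_of_set {0..1}) ?S"
  proof (subst openin_subopen, intro ballI)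
   fix t0 assume t0: "t0 \<in> ?S"
   then have "t0 \<in> {0..1}" "io (\<xi> t0, \<omega> t0) \<in> U" "io (\<xi> t0, \<omega>R t0) \<in> U"
    unfolding R \<gamma>_def by simp_all
   then have in_V: "(\<xi> t0, \<omega> t0) \<in> {q \<in> laakso_base. io q \<in> U}" "(\<xi> t0, \<omega>R t0) \<in> {q \<in> laakso_base. io q \<in> U}"
    using \<xi>01[of t0] by simp_all
   obtain r1 n1 where r1: "r1 > 0" "(ball (\<xi> t0) r1 \<inter> {0..1}) \<times> cyl n1 (\<omega> t0) \<subseteq> {q \<in> laakso_base. io q \<in> U}"
    by (rule openin_base_contains_box[OF V in_V(1)])
   obtain r2 n2 where r2: "r2 > 0" "(ball (\<xi> t0) r2 \<inter> {0..1}) \<times> cyl n2 (\<omega>R t0) \<subseteq> {q \<in> laakso_base. io q \<in> U}"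
    by (rule openin_base_contains_box[OF V in_V(2)])
   note r = r1 r2
   have "(\<xi> \<longlongrightarrow> \<xi> t0) (nhds t0)"
    using \<xi>_cont by (simp add: continuous_on_eq_continuous_at tendsto_at_iff_tendsto_nhds isCont_def)
   then have ev1: "\<forall>\<^sub>F t in nhds t0. dist (\<xi> t) (\<xi> t0) < min r1 r2"
    using r by (intro tendstoD) auto
   have "\<forall>\<^sub>F t in nhds t0. (t0 < T (Suc i) \<longrightarrow> t < T (Suc i)) \<and> (t0 > T (Suc i) \<longrightarrow> t > T (Suc i))" for i
   proof (intro eventually_conj)
    show "\<forall>\<^sub>F t in nhds t0. t0 < T (Suc i) \<longrightarrow> t < T (Suc i)"
     by (cases "t0 < T (Suc i)") (auto intro!: eventually_nhds_in_open[of "{..<T (Suc i)}", simplified])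
    show "\<forall>\<^sub>F t in nhds t0. T (Suc i) < t0 \<longrightarrow> T (Suc i) < t"
     by (cases "T (Suc i) < t0") (auto intro!: eventually_nhds_in_open[of "{T (Suc i)<..}", simplified])
   qed
   then have "\<forall>\<^sub>F t in nhds t0. \<forall>i\<in>{..<max n1 n2}. (t0 < T (Suc i) \<longrightarrow> t < T (Suc i)) \<and> (t0 > T (Suc i) \<longrightarrow> t > T (Suc i))"
    by (intro eventually_ball_finite) auto
   with ev1 have "\<forall>\<^sub>F t in nhds t0. dist (\<xi> t) (\<xi> t0) < min r1 r2 \<and>
     (\<forall>i\<in>{..<max n1 n2}. (t0 < T (Suc i) \<longrightarrow> t < T (Suc i)) \<and> (t0 > T (Suc i) \<longrightarrow> t > T (Suc i)))"
    by (rule eventually_conj)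
   then obtain A where A: "open A" "t0 \<in> A" and
    A1: "\<And>t. t \<in> A \<Longrightarrow> dist (\<xi> t) (\<xi> t0) < min r1 r2" and
    A2: "\<And>t i. t \<in> A \<Longrightarrow> i < max n1 n2 \<Longrightarrow> (t0 < T (Suc i) \<longrightarrow> t < T (Suc i)) \<and> (t0 > T (Suc i) \<longrightarrow> t > T (Suc i))"
    unfolding eventually_nhds by auto
   have "\<gamma> t \<in> U" if t: "t \<in> A" "t \<in> {0..1}" for t
   proof (cases "t \<le> t0")
    case True
    have "agree n1 (\<omega> t0) (\<omega> t)"
     unfolding agree_def
    proof (intro allI impI)
     fix l i assume "i < n1"
     then have "t0 \<le> T (Suc i) \<longleftrightarrow> t \<le> T (Suc i)"
      using A2[OF t(1), of i] True by force
     then show "\<omega> t0 l i = \<omega> t l i" by (simp add: \<omega>_def)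
    qed
    then have "(\<xi> t, \<omega> t) \<in> (ball (\<xi> t0) r1 \<inter> {0..1}) \<times> cyl n1 (\<omega> t0)"
     using A1[OF t(1)] \<xi>01[OF t(2)] by (simp add: mem_cyl dist_commute)
    from subsetD[OF r(2) this] show ?thesis by (simp add: \<gamma>_def)
   next
    case False
    have "agree n2 (\<omega>R t0) (\<omega> t)"
     unfolding agree_def
    proof (intro allI impI)
     fix l i assume "i < n2"
     then have "t0 < T (Suc i) \<longleftrightarrow> t \<le> T (Suc i)"
      using A2[OF t(1), of i] False by force
     then show "\<omega>R t0 l i = \<omega> t l i" by (simp add: \<omega>_def \<omega>R_def)
    qed
    then have "(\<xi> t, \<omega> t) \<in> (ball (\<xi> t0) r2 \<inter> {0..1}) \<times> cyl n2 (\<omega>R t0)"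
     using A1[OF t(1)] \<xi>01[OF t(2)] by (simp add: mem_cyl dist_commute)
    from subsetD[OF r(4) this] show ?thesis by (simp add: \<gamma>_def)
   qed
   then have "{0..1} \<inter> A \<subseteq> ?S" by auto
   moreover have "openin (top_of_set {0..1}) ({0..1} \<inter> A)"
    using A by (simp add: openin_open_Int)
   ultimately show "\<exists>A. openin (top_of_set {0..1}) A \<and> t0 \<in> A \<and> A \<subseteq> ?S"
    using A(2) t0 by (intro exI[of _ "{0..1} \<inter> A"]) auto
  qed
 qed
 have ends: "\<gamma> 0 = io (x, w)" "\<gamma> 1 = io (x', w')"
 proof -
  have "\<omega> 0 l i = w l i" "\<omega> 1 l i = w' l i" for l i
   using T[of "Suc i"] by (simp_all add: \<omega>_def)
  then have "\<omega> 0 = w" "\<omega> 1 = w'" by (intro ext; simp)+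
  then show "\<gamma> 0 = io (x, w)" "\<gamma> 1 = io (x', w')"
   using \<xi>1[of 0] \<xi>3[of 1] by (simp_all add: \<gamma>_def)
 qed
 \<comment> \<open>Between \<open>stair n\<close> and \<open>stair (Suc n)\<close> the levels
   \<open>1\<close> to \<open>n\<close> have been exchanged, which are the positions below
   \<open>n\<close>.\<close>
 define \<omega>n where "\<omega>n n l i = (if i < n then w' l i else w l i)" for n :: nat and l i
 let ?A = "({0..1} \<times> {w}) \<union> ({0..1} \<times> {w'}) \<union> (\<Union>n. {stair n..stair (Suc n)} \<times> {\<omega>n n})"
 have p_sub: "p \<subseteq> ?A"
 proof
  fix q assume "q \<in> p"
  then obtain t where t: "t \<in> {0..1}" "q = (\<xi> t, \<omega> t)" by (auto simp: p_def)
  consider "t \<le> 1/3" | "1/3 < t" "t < 2/3" | "t \<ge> 2/3" by linarith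
  then show "q \<in> ?A"
  proof cases
   case 1
   then have "\<omega> t l i = w l i" for l i
    using T(1)[of "Suc i"] by (simp add: \<omega>_def)
   then have "\<omega> t = w" by (intro ext)
   then show ?thesis
    using \<xi>01[OF t(1)] by (simp add: t(2))
  next
   case 2
   have y: "\<xi> t = 3 * t - 1"
    using 2 by (intro \<xi>2) auto
   have "\<exists>n. \<xi> t \<le> stair (Suc n)"
   proof -
    have "\<xi> t < 1"
     using 2 y by simp
    then have "\<forall>\<^sub>F n in sequentially. \<xi> t < stair n"
     by (rule order_tendstoD(1)[OF stair_tendsto])
    then obtain n where "\<And>m. m \<ge> n \<Longrightarrow> \<xi> t < stair m"
     unfolding eventually_sequentially by blast
    then have "\<xi> t < stair (Suc n)" by simp
    then show ?thesis by (intro exI[of _ n]) simp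
   qed
   define n where "n = (LEAST n. \<xi> t \<le> stair (Suc n))"
   have n1: "\<xi> t \<le> stair (Suc n)"
    unfolding n_def by (rule LeastI_ex) fact
   have n2: "stair n < \<xi> t"
   proof (cases n)
    case (Suc m)
    then have "m < n" by simp
    then have "\<not> \<xi> t \<le> stair (Suc m)"
     unfolding n_def by (rule not_less_Least)
    then show ?thesis
     using Suc by simp
   qed (use 2 y in simp)
   have "\<omega> t l i = \<omega>n n l i" for l i
   proof -
    have "t \<le> T (Suc i) \<longleftrightarrow> \<xi> t \<le> stair (Suc i)"
     by (simp add: T_def y field_simps)
    also have "\<dots> \<longleftrightarrow> \<not> i < n"
    proof
     assume "\<xi> t \<le> stair (Suc i)"
     then have "stair n < stair (Suc i)"
      using n2 by linarith
     then show "\<not> i < n"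
      using strict_mono_less[OF strict_mono_stair, of n "Suc i"] by simp
    next
     assume "\<not> i < n"
     then have "stair (Suc n) \<le> stair (Suc i)"
      using strict_mono_less_eq[OF strict_mono_stair, of "Suc n" "Suc i"] by simp
     then show "\<xi> t \<le> stair (Suc i)"
      using n1 by linarith
    qed
    finally show ?thesis by (simp add: \<omega>_def \<omega>n_def)
   qed
   then have "\<omega> t = \<omega>n n" by (intro ext)
   then have "q \<in> {stair n..stair (Suc n)} \<times> {\<omega>n n}"
    using n1 n2 by (simp add: t(2))
   then show ?thesis by blast
  next
   case 3
   then have "\<omega> t l i = w' l i" for l i
    using T(2)[of "Suc i"] by (simp add: \<omega>_def)
   then have "\<omega> t = w'" by (intro ext)
   then show ?thesis
    using \<xi>01[OF t(1)] by (simp add: t(2))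
  qed
 qed
 have "hausdorff1 (laakso_emb ` p) \<le> hausdorff1 (laakso_emb ` ?A)"
  by (intro hausdorff1_mono image_mono p_sub)
 also have "\<dots> \<le> hausdorff1 (laakso_emb ` ({0..1} \<times> {w})) + hausdorff1 (laakso_emb ` ({0..1} \<times> {w'})) +
   (\<Sum>n. hausdorff1 (laakso_emb ` ({stair n..stair (Suc n)} \<times> {\<omega>n n})))"
  unfolding image_Un image_UN by (intro order_trans[OF hausdorff1_Un_le] add_mono order_refl hausdorff1_UN_le)
 also have "\<dots> \<le> ennreal (1 - 0) + ennreal (1 - 0) + (\<Sum>n. ennreal (stair (Suc n) - stair n))"
 proof (intro add_mono suminf_le hausdorff1_segment zero_le_one)
  show "stair n \<le> stair (Suc n)" for n by (simp add: strict_mono_less_eq[OF strict_mono_stair])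
 qed auto
 also have "(\<Sum>n. ennreal (stair (Suc n) - stair n)) = ennreal (1 - stair 0)"
  using telescope_sums[OF stair_tendsto] strict_mono_less_eq[OF strict_mono_stair]
  by (intro suminf_ennreal_eq) auto
 also have "ennreal (1 - 0) + ennreal (1 - 0) + ennreal (1 - stair 0) < \<infinity>" by simp
 finally have fin: "hausdorff1 (laakso_emb ` p) < \<infinity>" .
 have "p \<subseteq> laakso_base"
  using \<xi>01 by (auto simp: p_def)
 moreover have "\<gamma> ` {0..1} = io ` p" by (simp add: p_def image_image \<gamma>_def)
 ultimately show ?thesis
  using that path ends fin by blast
qed

lemma laakso_space_cases:
 assumes "s \<in> laakso_space js"
 obtains x w where "s = io (x, w)" "x \<in> {0..1}"
 using assms by (auto simp: laakso_space_def laakso_base_def)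

text \<open>The \<open>x\<close>-coordinates of an admissible set \<open>p\<close> are those of the
  path, hence a connected set containing both ends; the Hausdorff measure of \<open>p\<close> is at
  least the length of their span.\<close>

lemma xcoord_le_dist:
 fixes s t :: "'k::finite laakso_point"
 assumes "s \<in> laakso_space js" "t \<in> laakso_space js"
 shows "\<bar>xcoord s - xcoord t\<bar> \<le> laakso_dist js s t"
proof -
 obtain x w where s: "s = io (x, w)" "x \<in> {0..1}"
  using assms(1) by (rule laakso_space_cases)
 obtain y v where t: "t = io (y, v)" "y \<in> {0..1}"
  using assms(2) by (rule laakso_space_cases)
 define P where "P = {p :: 'k prelaakso set. p \<subseteq> laakso_base \<and>
         (\<exists>\<gamma>. pathin (laakso_topology js) \<gamma> \<and> \<gamma> 0 = s \<and> \<gamma> 1 = t \<and> \<gamma> ` {0..1} = io ` p)}"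
 have dist: "laakso_dist js s t = enn2real (INF p\<in>P. hausdorff1 (laakso_emb ` p))"
  by (simp add: laakso_dist_def P_def)
 \<comment> \<open>\<open>enn2real\<close> turns an infinite value into \<open>0\<close>, so the
   lower bound needs an admissible set of finite measure.\<close>
 have "(INF p\<in>P. hausdorff1 (laakso_emb ` p)) < \<infinity>"
 proof -
  obtain p \<gamma> where p: "p \<subseteq> laakso_base" "pathin (laakso_topology js) \<gamma>" "\<gamma> 0 = s" "\<gamma> 1 = t"
    "\<gamma> ` {0..1} = io ` p" and fin: "hausdorff1 (laakso_emb ` p) < \<infinity>"
   unfolding s(1) t(1) by (rule connecting_path[OF s(2) t(2)])
  have "p \<in> P"
   unfolding P_def using p by blast
  then have "(INF p\<in>P. hausdorff1 (laakso_emb ` p)) \<le> hausdorff1 (laakso_emb ` p)" by (rule INF_lower)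
  then show ?thesis
   using fin by (rule le_less_trans)
 qed
 moreover have "ennreal \<bar>x - y\<bar> \<le> (INF p\<in>P. hausdorff1 (laakso_emb ` p))"
 proof (rule INF_greatest)
  fix p assume "p \<in> P"
  then obtain \<gamma> where \<gamma>: "pathin (laakso_topology js) \<gamma>" "\<gamma> 0 = s" "\<gamma> 1 = t" "\<gamma> ` {0..1} = io ` p"
   unfolding P_def by blast
  have "continuous_map (top_of_set {0..1}) euclidean (xcoord \<circ> \<gamma>)"
   using \<gamma>(1) unfolding pathin_def by (rule continuous_map_compose[OF _ continuous_xcoord])
  then have "connected ((xcoord \<circ> \<gamma>) ` {0..1})" by (intro connected_continuous_image) auto
  moreover have "(xcoord \<circ> \<gamma>) ` {0..1} = fst ` p"
  proof -
   have "(xcoord \<circ> \<gamma>) ` {0..1} = xcoord ` io ` p" by (simp only: image_comp[symmetric] \<gamma>(4))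
   also have "\<dots> = fst ` p"
    unfolding image_image by (rule image_cong) auto
   finally show ?thesis .
  qed
  ultimately have conn: "connected (fst ` p)" by simp
  have "(xcoord \<circ> \<gamma>) 0 \<in> (xcoord \<circ> \<gamma>) ` {0..1}" "(xcoord \<circ> \<gamma>) 1 \<in> (xcoord \<circ> \<gamma>) ` {0..1}"
   by auto
  then have "x \<in> fst ` p" "y \<in> fst ` p"
   using \<open>(xcoord \<circ> \<gamma>) ` {0..1} = fst ` p\<close> by (simp_all add: \<gamma> s t)
  then have "{min x y..max x y} \<subseteq> fst ` p"
   using conn by (intro connected_contains_Icc) (auto simp: min_def max_def)
  then have "{min x y..max x y} \<subseteq> fst ` laakso_emb ` p" by (simp add: image_image)
  then have "ennreal (max x y - min x y) \<le> hausdorff1 (laakso_emb ` p)"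
   by (rule hausdorff1_ge_projection) simp
  then show "ennreal \<bar>x - y\<bar> \<le> hausdorff1 (laakso_emb ` p)"
   by (simp add: max_def min_def abs_if split: if_splits)
 qed
 ultimately have "\<bar>x - y\<bar> \<le> laakso_dist js s t"
  unfolding dist
  using enn2real_mono[of "ennreal \<bar>x - y\<bar>"] by (simp add: infinity_ennreal_def)
 then show ?thesis by (simp add: s(1) t(1))
qed

lemma pathin_line:
 assumes "x \<in> {0..1}" "y \<in> {0..1}"
 shows "pathin (laakso_topology js) (\<lambda>t. io (x + t * (y - x), w))"
proof -
 have "x + t * (y - x) \<in> {0..1}" if "t \<in> {0..1}" for t
 proof -
  have "x + t * (y - x) = (1 - t) * x + t * y" by (simp add: algebra_simps)
  moreover have "(1 - t) * x + t * y \<le> 1"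
   using that assms by (intro convex_bound_le) auto
  moreover have "0 \<le> (1 - t) * x + t * y"
   using that assms by simp
  ultimately show ?thesis by simp
 qed
 then have "continuous_map (top_of_set {0..1}) (top_of_set laakso_base) (\<lambda>t. (x + t * (y - x), w))"
  by (auto intro!: continuous_intros)
 then show ?thesis
  unfolding pathin_def using continuous_map_compose[OF _ continuous_map_laakso_proj, of _ "\<lambda>t. (x + t * (y - x), w)" js]
  by (simp add: o_def)
qed

text \<open>The segment itself is admissible and gives the upper bound; the lower bound is the
  Lipschitz property of the \<open>x\<close>-coordinate.\<close>

lemma dist_line:
 fixes w :: "'k::finite \<Rightarrow> nat \<Rightarrow> bool"
 assumes "x \<in> {0..1}" "y \<in> {0..1}"
 shows "laakso_dist js (io (x, w)) (io (y, w)) = \<bar>x - y\<bar>"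
proof (rule antisym)
 have img: "(\<lambda>t. x + t * (y - x)) ` {0..1} = {min x y..max x y}"
 proof -
  have "(\<lambda>t. x + t * (y - x)) ` {0..1} = closed_segment x y"
   unfolding closed_segment_image_interval by (rule image_cong) (simp_all add: algebra_simps)
  then show ?thesis by (simp add: closed_segment_eq_real_ivl min_def max_def)
 qed
 let ?p = "{min x y..max x y} \<times> {w}"
 have "laakso_dist js (io (x, w)) (io (y, w)) \<le> enn2real (hausdorff1 (laakso_emb ` ?p))"
  unfolding laakso_dist_def
 proof (intro enn2real_mono INF_lower CollectI conjI exI)
  show "?p \<subseteq> laakso_base"
   using assms by auto
  show "pathin (laakso_topology js) (\<lambda>t. io (x + t * (y - x), w))"
   using assms by (rule pathin_line)
  show "(\<lambda>t. io (x + t * (y - x), w)) ` {0..1} = io ` ?p"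
   unfolding img[symmetric] by auto
  show "hausdorff1 (laakso_emb ` ?p) < top"
   by (rule le_less_trans[OF hausdorff1_segment[of "min x y" "max x y" w]]) auto
 qed auto
 also have "\<dots> \<le> enn2real (ennreal (max x y - min x y))"
  by (intro enn2real_mono hausdorff1_segment) auto
 also have "\<dots> = \<bar>x - y\<bar>" by (simp add: min_def max_def)
 finally show "laakso_dist js (io (x, w)) (io (y, w)) \<le> \<bar>x - y\<bar>" .
 show "\<bar>x - y\<bar> \<le> laakso_dist js (io (x, w)) (io (y, w))"
  using xcoord_le_dist[of "io (x, w)" "io (y, w)"] assms by (simp add: laakso_proj_in_space)
qed

end

section \<open>Monotone images, Lipschitz images, difference quotients\<close>

lemma components_open_real:
 fixes U :: "real set"
 assumes "open U"
 shows "countable (components U)" "pairwise disjnt (components U)" "\<And>K. K \<in> components U \<Longrightarrow> open K"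
proof -
 show pw: "pairwise disjnt (components U)" by (simp add: pairwise_def disjnt_def components_nonoverlap)
 show op: "open K" if "K \<in> components U" for K
  using open_components[OF assms that] .
 show "countable (components U)"
  using op by (rule countable_disjoint_open_subsets[OF _ pw])
qed

text \<open>Countable subadditivity over an index set that is not a set of numbers, such as the
  components of an open set.\<close>

lemma emeasure_countable_UN_le:
 assumes "countable I" and [measurable]: "\<And>i. i \<in> I \<Longrightarrow> X i \<in> sets M"
 shows "emeasure M (\<Union>i\<in>I. X i) \<le> (\<integral>\<^sup>+i. emeasure M (X i) \<partial>count_space I)"
proof -
 have [measurable]: "(\<Union>i\<in>I. X i) \<in> sets M"
  using assms by (intro sets.countable_UN'') auto
 have "emeasure M (\<Union>i\<in>I. X i) = (\<integral>\<^sup>+x. indicator (\<Union>i\<in>I. X i) x \<partial>M)"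
  by simp
 also have "\<dots> \<le> (\<integral>\<^sup>+x. \<integral>\<^sup>+i. indicator (X i) x \<partial>count_space I \<partial>M)"
 proof (rule nn_integral_mono)
  fix x
  show "indicator (\<Union>i\<in>I. X i) x \<le> (\<integral>\<^sup>+i. indicator (X i) x \<partial>count_space I)"
  proof (cases "x \<in> (\<Union>i\<in>I. X i)")
   case True
   then obtain i where i: "i \<in> I" "x \<in> X i" by blast
   have "(1 :: ennreal) = indicator (X i) x"
    using i by simp
   also have "\<dots> \<le> (\<integral>\<^sup>+i. indicator (X i) x \<partial>count_space I)"
    by (rule nn_integral_ge_point[OF i(1)])
   finally show ?thesis
    using True by simp
  qed simp
 qed
 also have "\<dots> = (\<integral>\<^sup>+i. \<integral>\<^sup>+x. indicator (X i) x \<partial>M \<partial>count_space I)"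
  by (intro nn_integral_count_space_nn_integral assms(1) borel_measurable_indicator assms(2))
 also have "\<dots> = (\<integral>\<^sup>+i. emeasure M (X i) \<partial>count_space I)"
  by (intro nn_integral_cong) simp
 finally show ?thesis .
qed

lemma nn_integral_le_measure:
 assumes "sets M = sets N" "\<And>A. A \<in> sets M \<Longrightarrow> emeasure M A \<le> emeasure N A"
 shows "(\<integral>\<^sup>+x. f x \<partial>M) \<le> (\<integral>\<^sup>+x. f x \<partial>N)"
 unfolding nn_integral_def
proof (rule SUP_mono, clarify)
 fix g :: "'a \<Rightarrow> ennreal" assume g: "simple_function M g" "g \<le> f"
 have sp: "space M = space N"
  using assms(1) by (rule sets_eq_imp_space_eq)
 have "simple_function N g"
  using g(1) by (simp add: simple_function_def assms(1) sp)
 moreover have "integral\<^sup>S M g \<le> integral\<^sup>S N g"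
  unfolding simple_integral_def sp
 proof (intro sum_mono mult_left_mono)
  fix x assume "x \<in> g ` space N"
  have "g -` {x} \<inter> space N \<in> sets M"
   using simple_functionD(2)[OF g(1)] sp by metis
  then show "emeasure M (g -` {x} \<inter> space N) \<le> emeasure N (g -` {x} \<inter> space N)"
   by (rule assms(2))
 qed simp
 ultimately show "\<exists>h\<in>{g. simple_function N g \<and> g \<le> f}. integral\<^sup>S M g \<le> integral\<^sup>S N h"
  using g(2) by blast
qed

text \<open>Arc length is only known to be monotone, so its image may have gaps. Within the hull
  \<open>J\<close> every point of a gap can be joined to a rational without meeting the image. For
  each rational \<open>q\<close> such points form an interval, so the gaps are a countable union of
  intervals.\<close>

lemma borel_mono_image:
 fixes f :: "real \<Rightarrow> real"
 assumes I: "is_interval I" and f: "mono_on I f"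
 shows "f ` I \<in> sets borel"
proof -
 let ?S = "f ` I"
 define J where "J = {y. \<exists>a\<in>?S. \<exists>b\<in>?S. a \<le> y \<and> y \<le> b}"
 define G where "G q = {z \<in> J. \<forall>s\<in>?S. s \<notin> {min z q..max z q}}" for q
 have "is_interval J"
  unfolding is_interval_1 J_def by (auto intro: order_trans)
 have "is_interval (G q)" for q
  unfolding is_interval_1
 proof (intro allI impI ballI)
  fix a b x assume ab: "a \<in> G q" "b \<in> G q" and x: "a \<le> x \<and> x \<le> b"
  have "x \<in> J"
   using ab x \<open>is_interval J\<close> by (auto simp: G_def is_interval_1)
  moreover have "s \<notin> {min x q..max x q}" if "s \<in> ?S" for s
   using ab that x by (fastforce simp: G_def min_def max_def split: if_splits)
  ultimately show "x \<in> G q" by (simp add: G_def)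
 qed
 then have "(\<Union>q\<in>\<rat>. G q) \<in> sets borel"
  by (intro sets.countable_UN'' countable_rat real_interval_borel_measurable)
 moreover have "J - ?S = (\<Union>q\<in>\<rat>. G q)"
 proof (intro equalityI subsetI)
  fix z assume z: "z \<in> J - ?S"
  then obtain a b where ab: "a \<in> I" "b \<in> I" "f a \<le> z" "z \<le> f b" by (auto simp: J_def)
  moreover have "f a \<noteq> z" "f b \<noteq> z"
   using z ab by auto
  ultimately have lt: "f a < z" "z < f b" by auto
  define A where "A = {t \<in> I. f t < z}"
  have "a \<in> A"
   using ab lt by (simp add: A_def)
  have bound: "t \<le> b" if "t \<in> A" for t
  proof (rule ccontr)
   assume "\<not> t \<le> b"
   then have "f b \<le> f t"
    using that ab by (intro mono_onD[OF f]) (auto simp: A_def)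
   then show False
    using that lt by (simp add: A_def)
  qed
  then have bdd: "bdd_above A" by (auto simp: bdd_above_def)
  \<comment> \<open>The value \<open>z\<close> is jumped over at \<open>t0\<close>; whether
    \<open>f t0\<close> lies below or above \<open>z\<close> tells on which side of \<open>z\<close>
    the rational is to be placed.\<close>
  define t0 where "t0 = Sup A"
  have "a \<le> t0" "t0 \<le> b"
   unfolding t0_def using \<open>a \<in> A\<close> bdd bound by (auto intro: cSup_upper cSup_least)
  then have "t0 \<in> I" by (rule mem_is_interval_1_I[OF I ab(1,2)])
  then have "f t0 \<noteq> z"
   using z by auto
  then consider "f t0 < z" | "z < f t0" by linarith
  then show "z \<in> (\<Union>q\<in>\<rat>. G q)"
  proof cases
   case 1
   then obtain q where q: "q \<in> \<rat>" "f t0 < q" "q < z"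
    using Rats_dense_in_real by blast
   have "s \<notin> {min z q..max z q}" if s: "s \<in> ?S" for s
   proof
    assume "s \<in> {min z q..max z q}"
    then have "q \<le> s" "s \<le> z"
     using q by auto
    obtain t where t: "t \<in> I" "s = f t"
     using s by blast
    then have "f t < z"
     using \<open>s \<le> z\<close> z s by (metis DiffD2 less_eq_real_def)
    then have "t \<le> t0"
     unfolding t0_def using t bdd by (intro cSup_upper) (auto simp: A_def)
    then have "f t \<le> f t0"
     using t \<open>t0 \<in> I\<close> by (intro mono_onD[OF f])
    then show False
     using \<open>q \<le> s\<close> q t by linarith
   qed
   then have "z \<in> G q"
    using z by (simp add: G_def)
   with q show ?thesis by blast
  next
   case 2
   then obtain q where q: "q \<in> \<rat>" "z < q" "q < f t0"
    using Rats_dense_in_real by blast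
   have "s \<notin> {min z q..max z q}" if s: "s \<in> ?S" for s
   proof
    assume "s \<in> {min z q..max z q}"
    then have "s \<le> q" "z \<le> s"
     using q by auto
    obtain t where t: "t \<in> I" "s = f t"
     using s by blast
    have "t < t0"
    proof (rule ccontr)
     assume "\<not> t < t0"
     then have "f t0 \<le> f t"
      using t \<open>t0 \<in> I\<close> by (intro mono_onD[OF f]) auto
     then show False
      using \<open>s \<le> q\<close> q t by linarith
    qed
    then obtain t' where t': "t' \<in> A" "t < t'"
     unfolding t0_def using less_cSup_iff[OF _ bdd, of t] \<open>a \<in> A\<close> by blast
    then have "f t \<le> f t'"
     using t by (intro mono_onD[OF f]) (auto simp: A_def)
    then show False
     using \<open>z \<le> s\<close> t t' by (simp add: A_def)
   qed
   then have "z \<in> G q"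
    using z by (simp add: G_def)
   with q show ?thesis by blast
  qed
 qed (auto simp: G_def)
 ultimately have "J - (J - ?S) \<in> sets borel"
  using \<open>is_interval J\<close> by (metis real_interval_borel_measurable sets.Diff)
 moreover have "J - (J - ?S) = ?S" by (auto simp: J_def)
 ultimately show ?thesis by simp
qed

lemma connected_real_diameter_measure:
 fixes S :: "real set"
 assumes "\<And>x y. x \<in> S \<Longrightarrow> y \<in> S \<Longrightarrow> ennreal \<bar>x - y\<bar> \<le> c"
 obtains J where "S \<subseteq> J" "J \<in> sets borel" "emeasure lborel J \<le> c"
proof (cases "S = {} \<or> c = \<infinity>")
 case True
 then show ?thesis
  using that[of "{}"] that[of UNIV] by auto
next
 case False
 then obtain r where r: "c = ennreal r" "r \<ge> 0" by (cases c) auto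
 have xy: "\<bar>x - y\<bar> \<le> r" if "x \<in> S" "y \<in> S" for x y
  using assms[OF that] r by simp
 obtain x0 where x0: "x0 \<in> S"
  using False by blast
 have bdd: "bdd_above S" "bdd_below S"
  using xy[OF _ x0] by (auto intro!: bdd_aboveI[of _ "x0 + r"] bdd_belowI[of _ "x0 - r"] simp: abs_le_iff) fastforce+
 have "Sup S \<le> r + Inf S"
 proof (rule cSup_least)
  fix x assume "x \<in> S"
  have "x - r \<le> Inf S"
   using x0 xy[OF \<open>x \<in> S\<close>] by (intro cInf_greatest) (auto simp: abs_le_iff, fastforce)
  then show "x \<le> r + Inf S" by simp
 qed (use x0 in blast)
 moreover have "Inf S \<le> Sup S"
  using x0 bdd by (meson cInf_lower cSup_upper order_trans)
 ultimately have "emeasure lborel {Inf S..Sup S} \<le> c"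
  using r by (simp add: ennreal_leI)
 then show ?thesis
  using bdd by (intro that[of "{Inf S..Sup S}"]) (auto intro: cInf_lower cSup_upper)
qed

text \<open>As \<open>h\<close> is controlled on \<open>C\<close> only, the image is estimated over
  the components of an open set slightly larger than \<open>C\<close>: the part of \<open>C\<close>
  in a component has an image whose diameter is at most the length of the component.\<close>

lemma emeasure_lipschitz_image_le:
 fixes h :: "real \<Rightarrow> real"
 assumes C: "C \<in> sets borel" and h: "\<And>s t. s \<in> C \<Longrightarrow> t \<in> C \<Longrightarrow> \<bar>h s - h t\<bar> \<le> \<bar>s - t\<bar>"
  and Y: "Y \<subseteq> h ` C"
 shows "emeasure lborel Y \<le> emeasure lborel C"
proof (rule ennreal_le_epsilon)
 fix e :: real assume "e > 0"
 obtain U where U: "open U" "C \<subseteq> U" "emeasure lborel (U - C) < ennreal e"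
  using outer_regular_lborel[OF C \<open>e > 0\<close>] .
 have "\<exists>J. h ` (C \<inter> K) \<subseteq> J \<and> J \<in> sets borel \<and> emeasure lborel J \<le> emeasure lborel K" if K: "K \<in> components U" for K
 proof -
  have "ennreal \<bar>x - y\<bar> \<le> emeasure lborel K" if xy: "x \<in> h ` (C \<inter> K)" "y \<in> h ` (C \<inter> K)" for x y
  proof -
   obtain s t where st: "x = h s" "y = h t" "s \<in> C \<inter> K" "t \<in> C \<inter> K"
    using xy by blast
   have "connected K"
    using K by (rule in_components_connected)
   then have "{min s t..max s t} \<subseteq> K"
    using st by (intro connected_contains_Icc) (auto simp: min_def max_def)
   have "ennreal \<bar>x - y\<bar> \<le> ennreal (max s t - min s t)"
    using h[of s t] st by (intro ennreal_leI) (auto simp: min_def max_def)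
   also have "\<dots> = emeasure lborel {min s t..max s t}" by simp
   also have "\<dots> \<le> emeasure lborel K"
    using \<open>{min s t..max s t} \<subseteq> K\<close> components_open_real(3)[OF U(1) K] by (intro emeasure_mono) auto
   finally show ?thesis .
  qed
  then show ?thesis
   using connected_real_diameter_measure by metis
 qed
 then have "\<forall>K\<in>components U. \<exists>J. h ` (C \<inter> K) \<subseteq> J \<and> J \<in> sets borel \<and> emeasure lborel J \<le> emeasure lborel K"
  by blast
 from bchoice[OF this] obtain J where J: "\<And>K. K \<in> components U \<Longrightarrow> h ` (C \<inter> K) \<subseteq> J K"
   "\<And>K. K \<in> components U \<Longrightarrow> J K \<in> sets borel"
   "\<And>K. K \<in> components U \<Longrightarrow> emeasure lborel (J K) \<le> emeasure lborel K" by blast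
 have ct: "countable (components U)" by (rule components_open_real(1)[OF U(1)])
 have "Y \<subseteq> (\<Union>K\<in>components U. J K)"
 proof
  fix y assume "y \<in> Y"
  then obtain s where s: "s \<in> C" "y = h s"
   using Y by blast
  then have "s \<in> \<Union>(components U)"
   using U(2) by (auto simp: Union_components)
  then obtain K where "K \<in> components U" "s \<in> K" by blast
  then show "y \<in> (\<Union>K\<in>components U. J K)"
   using J(1) s by blast
 qed
 then have "emeasure lborel Y \<le> emeasure lborel (\<Union>K\<in>components U. J K)"
  using J(2) ct by (intro emeasure_mono sets.countable_UN'') auto
 also have "\<dots> \<le> (\<integral>\<^sup>+K. emeasure lborel (J K) \<partial>count_space (components U))"
  using J(2) by (intro emeasure_countable_UN_le ct) auto
 also have "\<dots> \<le> (\<integral>\<^sup>+K. emeasure lborel K \<partial>count_space (components U))"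
  using J(3) by (intro nn_integral_mono) auto
 also have "\<dots> = emeasure lborel (\<Union>K\<in>components U. K)"
  using components_open_real(2,3)[OF U(1)] ct
  by (intro emeasure_UN_countable[symmetric]) (auto simp: pairwise_def disjoint_family_on_def disjnt_def)
 also have "(\<Union>K\<in>components U. K) = U"
  using Union_components[of U] by simp
 also have "emeasure lborel U \<le> emeasure lborel C + emeasure lborel (U - C)"
  using C U(1) emeasure_subadditive[of C lborel "U - C"] U(2) by (simp add: Un_absorb1)
 also have "\<dots> \<le> emeasure lborel C + ennreal e"
  using U(3) by (intro add_mono) auto
 finally show "emeasure lborel Y \<le> emeasure lborel C + ennreal e" .
qed

text \<open>The area estimate says that Lebesgue measure on \<open>Y\<close> is dominated by the
  image under \<open>h\<close> of Lebesgue measure on \<open>C\<close>; domination of measures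
  passes to integrals of non-negative functions.\<close>

lemma nn_integral_lipschitz_image_le:
 fixes h :: "real \<Rightarrow> real" and \<psi> :: "real \<Rightarrow> ennreal"
 assumes C: "C \<in> sets borel" and h: "\<And>s t. s \<in> C \<Longrightarrow> t \<in> C \<Longrightarrow> \<bar>h s - h t\<bar> \<le> \<bar>s - t\<bar>"
  and Y: "Y \<in> sets borel" "Y \<subseteq> h ` C" and \<psi>: "\<psi> \<in> borel_measurable borel"
 shows "(\<integral>\<^sup>+x\<in>Y. \<psi> x \<partial>lborel) \<le> (\<integral>\<^sup>+s\<in>C. \<psi> (h s) \<partial>lborel)"
  and "(\<lambda>s. \<psi> (h s) * indicator C s) \<in> borel_measurable lborel"
proof -
 have "continuous_on C h"
  unfolding continuous_on_iff
 proof (intro ballI allI impI)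
  fix x e :: real assume "x \<in> C" "0 < e"
  then show "\<exists>d>0. \<forall>x'\<in>C. dist x' x < d \<longrightarrow> dist (h x') (h x) < e"
   using h by (intro exI[of _ e]) (auto simp: dist_real_def intro: le_less_trans)
 qed
 then have "h \<in> restrict_space borel C \<rightarrow>\<^sub>M borel"
  by (rule borel_measurable_continuous_on_restrict)
 then have h_meas [measurable]: "h \<in> restrict_space lborel C \<rightarrow>\<^sub>M borel"
  by (simp add: measurable_cong_sets[OF sets_restrict_space_cong[OF sets_lborel] refl])
 have "(\<lambda>s. \<psi> (h s)) \<in> borel_measurable (restrict_space lborel C)"
  using measurable_compose[OF h_meas \<psi>] .
 then show "(\<lambda>s. \<psi> (h s) * indicator C s) \<in> borel_measurable lborel"
  using C by (subst (asm) borel_measurable_restrict_space_iff_ennreal) auto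
 let ?N = "distr (restrict_space lborel C) borel h"
 have "(\<integral>\<^sup>+x\<in>Y. \<psi> x \<partial>lborel) = (\<integral>\<^sup>+x. \<psi> x \<partial>density lborel (indicator Y))"
  using Y \<psi> by (subst nn_integral_density) (auto simp: mult.commute)
 also have "\<dots> \<le> (\<integral>\<^sup>+x. \<psi> x \<partial>?N)"
 proof (rule nn_integral_le_measure)
  show "sets (density lborel (indicator Y)) = sets ?N" by simp
  fix A assume "A \<in> sets (density lborel (indicator Y))"
  then have A: "A \<in> sets borel" by simp
  have "h -` A \<inter> space (restrict_space lborel C) \<in> sets (restrict_space lborel C)"
   using measurable_sets[OF h_meas A] .
  then have B: "h -` A \<inter> C \<in> sets borel"
   using C by (simp add: space_restrict_space sets_restrict_space_iff)
  have "emeasure (density lborel (indicator Y)) A = emeasure lborel (A \<inter> Y)"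
   using A Y by (subst emeasure_density) (auto simp: indicator_inter_arith[symmetric] Int_commute)
  also have "\<dots> \<le> emeasure lborel (h -` A \<inter> C)"
   using B h Y(2) by (intro emeasure_lipschitz_image_le[where h = h]) auto
  also have "\<dots> = emeasure ?N A"
   using A C by (subst emeasure_distr) (auto simp: space_restrict_space emeasure_restrict_space)
  finally show "emeasure (density lborel (indicator Y)) A \<le> emeasure ?N A" .
 qed
 also have "\<dots> = (\<integral>\<^sup>+s. \<psi> (h s) \<partial>restrict_space lborel C)"
  using \<psi> by (intro nn_integral_distr) auto
 also have "\<dots> = (\<integral>\<^sup>+s\<in>C. \<psi> (h s) \<partial>lborel)"
  using C by (subst nn_integral_restrict_space) auto
 finally show "(\<integral>\<^sup>+x\<in>Y. \<psi> x \<partial>lborel) \<le> (\<integral>\<^sup>+s\<in>C. \<psi> (h s) \<partial>lborel)" .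
qed

section \<open>Upper gradients along rectifiable paths\<close>

text \<open>Half of the additivity of length: any partition of \<open>{0..t}\<close> can be
  continued by the points \<open>t\<close> and \<open>t'\<close>.\<close>

lemma path_length_step:
 assumes "0 \<le> t" "t \<le> t'"
 shows "path_length \<delta> \<gamma> 0 t + ennreal (\<delta> (\<gamma> t) (\<gamma> t')) \<le> path_length \<delta> \<gamma> 0 t'"
proof -
 let ?P = "\<lambda>t. {(N :: nat, \<tau> :: nat \<Rightarrow> real). mono_on {..N} \<tau> \<and> \<tau> ` {..N} \<subseteq> {0..t}}"
 let ?s = "\<lambda>(N, \<tau>). \<Sum>i<N. ennreal (\<delta> (\<gamma> (\<tau> i)) (\<gamma> (\<tau> (Suc i))))"
 have "(0, \<lambda>_. 0) \<in> ?P t"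
  using assms by (auto simp: mono_on_def)
 then have ne: "?P t \<noteq> {}" by blast
 have "path_length \<delta> \<gamma> 0 t + ennreal (\<delta> (\<gamma> t) (\<gamma> t')) = (SUP z\<in>?P t. ?s z + ennreal (\<delta> (\<gamma> t) (\<gamma> t')))"
  unfolding path_length_def by (subst ennreal_SUP_add_left[OF ne]) simp_all
 also have "\<dots> \<le> path_length \<delta> \<gamma> 0 t'"
 proof (rule SUP_least)
  fix z assume "z \<in> ?P t"
  then obtain N \<tau> where z: "z = (N, \<tau>)" "mono_on {..N} \<tau>" "\<tau> ` {..N} \<subseteq> {0..t}"
   by auto
  \<comment> \<open>Both \<open>t\<close> and \<open>t'\<close> are appended, since the last
    partition point may lie before \<open>t\<close>; the extra term between it and \<open>t\<close>
    is non-negative and is dropped.\<close>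
  define \<sigma> where "\<sigma> i = (if i \<le> N then \<tau> i else if i = Suc N then t else t')" for i
  have \<tau>: "\<tau> i \<in> {0..t}" if "i \<le> N" for i
   using z(3) that by auto
  have "mono_on {..Suc (Suc N)} \<sigma>"
  proof (rule mono_onI)
   fix r s assume rs: "r \<in> {..Suc (Suc N)}" "s \<in> {..Suc (Suc N)}" "r \<le> s"
   show "\<sigma> r \<le> \<sigma> s"
    using rs \<tau>[of r] mono_onD[OF z(2), of r s] assms by (auto simp: \<sigma>_def)
  qed
  moreover have "\<sigma> ` {..Suc (Suc N)} \<subseteq> {0..t'}"
   using \<tau> assms by (force simp: \<sigma>_def)
  ultimately have mem: "(Suc (Suc N), \<sigma>) \<in> ?P t'" by simp
  have "?s z + ennreal (\<delta> (\<gamma> t) (\<gamma> t')) =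
    (\<Sum>i<N. ennreal (\<delta> (\<gamma> (\<sigma> i)) (\<gamma> (\<sigma> (Suc i))))) + ennreal (\<delta> (\<gamma> (\<sigma> (Suc N))) (\<gamma> (\<sigma> (Suc (Suc N)))))"
   unfolding z by (auto simp: \<sigma>_def intro!: arg_cong2[where f = plus] sum.cong)
  also have "\<dots> \<le> ?s (Suc (Suc N), \<sigma>)" by (simp add: add.commute add.left_commute add_left_mono)
  also have "\<dots> \<le> path_length \<delta> \<gamma> 0 t'"
   unfolding path_length_def by (rule SUP_upper[OF mem])
  finally show "?s z + ennreal (\<delta> (\<gamma> t) (\<gamma> t')) \<le> path_length \<delta> \<gamma> 0 t'" .
 qed
 finally show ?thesis .
qed

context laakso
begin

text \<open>Over \<open>L n\<close> the first \<open>n\<close> digits are not defined on the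
  quotient, but away from it they are, and they are locally constant there. Hence along a path they
  stay constant as long as it avoids the fibres over \<open>Z\<close>.\<close>

lemma openin_word:
 fixes v :: "'k::finite \<Rightarrow> nat \<Rightarrow> bool"
 assumes "finite Z" "L n \<subseteq> Z"
 shows "openin (laakso_topology js) (io ` ({(x, w). x \<in> {0..1} \<and> x \<notin> Z \<and> agree n v w}))"
  (is "openin _ (io ` ?A)")
proof -
 have "io ` ?A \<subseteq> laakso_space js" by (auto intro: laakso_proj_in_space)
 moreover have "{p \<in> laakso_base. io p \<in> io ` ?A} = ?A"
 proof (intro equalityI subsetI)
  fix p assume "p \<in> {p \<in> laakso_base. io p \<in> io ` ?A}"
  then obtain x w x' w' where p: "p = (x, w)" "io (x, w) = io (x', w')" "(x', w') \<in> ?A" by (cases p) auto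
  have "x = x'"
   using p(2) by (simp add: io_eq_iff)
  moreover from this have "agree n w' w"
   using p assms(2) by (intro io_eq_imp_agree[of x]) auto
  ultimately show "p \<in> ?A"
   using p agree_trans by auto
 qed auto
 moreover have "openin (top_of_set laakso_base) ?A"
 proof -
  have "?A = laakso_base \<inter> ((- Z) \<times> cyl n v)" by (auto simp: mem_cyl)
  moreover have "open ((- Z) \<times> cyl n v)"
   using assms(1) by (intro open_Times open_cyl open_Compl finite_imp_closed)
  ultimately show ?thesis by (simp add: openin_open_Int)
 qed
 ultimately show ?thesis
  unfolding openin_laakso_topology by simp
qed

text \<open>The arc length \<open>\<l>\<close> below need not be continuous for the proof. Away from the fibres over \<open>Z\<close>
 the function is locally a function of the \<open>x\<close>-coordinate, which is \<open>1\<close>-Lipschitz in arc length,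
 and over \<open>Z\<close> it takes only finitely many values; so the image of \<open>f \<circ> \<gamma>\<close> can be measured.\<close>

lemma gen_upper_gradientI:
 fixes f :: "'k::finite laakso_point \<Rightarrow> real"
 assumes Z: "finite Z" "L n \<subseteq> Z"
  and f: "continuous_map (laakso_topology js) euclidean f"
  and p: "p \<in> borel_measurable (\<mu>)"
  and f_trunc: "\<And>x w. x \<in> {0..1} \<Longrightarrow> f (io (x, w)) = f (io (x, trunc n w))"
  and p_trunc: "\<And>x w. x \<in> {0..1} \<Longrightarrow> x \<notin> Z \<Longrightarrow> p (io (x, w)) = p (io (x, trunc n w))"
  and ac: "\<And>a b w. a \<le> b \<Longrightarrow> {a..b} \<subseteq> {0..1} - Z \<Longrightarrow>
   ennreal \<bar>f (io (b, w)) - f (io (a, w))\<bar> \<le> (\<integral>\<^sup>+x\<in>{a..b}. p (io (x, w)) \<partial>lborel)"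
 shows "gen_upper_gradient js f p"
 unfolding gen_upper_gradient_def
proof (intro conjI p allI impI, elim conjE)
 fix \<gamma> :: "real \<Rightarrow> 'k laakso_point"
 let ?\<delta> = "laakso_dist js :: 'k laakso_point \<Rightarrow> _"
 assume \<gamma>: "pathin (laakso_topology js) \<gamma>" and fin: "path_length ?\<delta> \<gamma> 0 1 < \<infinity>"
 define len where "len t = path_length ?\<delta> \<gamma> 0 t" for t
 define \<l> where "\<l> t = enn2real (len t)" for t
 define h where "h t = xcoord (\<gamma> t)" for t
 define F where "F t = f (\<gamma> t)" for t
 have \<gamma>_in: "\<gamma> t \<in> laakso_space js" if "t \<in> {0..1}" for t
  using \<gamma> that unfolding pathin_def continuous_map_def by (auto simp: topspace_laakso_topology)
 have h_cont: "continuous_on {0..1} h"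
  using continuous_map_compose[OF \<gamma>[unfolded pathin_def] continuous_xcoord] by (simp add: h_def o_def)
 have F_cont: "continuous_on {0..1} F"
  using continuous_map_compose[OF \<gamma>[unfolded pathin_def] f] by (simp add: F_def o_def)
 have step: "len t + ennreal (?\<delta> (\<gamma> t) (\<gamma> t')) \<le> len t'" if "0 \<le> t" "t \<le> t'" for t t'
  unfolding len_def using that by (rule path_length_step)
 have len_fin: "len t < \<infinity>" if "t \<in> {0..1}" for t
 proof -
  have "len t \<le> len t + ennreal (?\<delta> (\<gamma> t) (\<gamma> 1))" by simp
  also have "\<dots> \<le> len 1"
   using that by (intro step) auto
  finally show ?thesis
   using fin by (simp add: len_def)
 qed
 have len: "len t = ennreal (\<l> t)" if "t \<in> {0..1}" for t
  using len_fin[OF that] by (simp add: \<l>_def)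
 have \<l>_nn: "0 \<le> \<l> t" for t by (simp add: \<l>_def)
 have h_step: "\<bar>h t - h t'\<bar> \<le> \<l> t' - \<l> t" if t: "t \<in> {0..1}" "t' \<in> {0..1}" "t \<le> t'" for t t'
 proof -
  have "\<bar>h t - h t'\<bar> \<le> ?\<delta> (\<gamma> t) (\<gamma> t')"
   unfolding h_def using t by (intro xcoord_le_dist \<gamma>_in)
  moreover have "ennreal (\<l> t + ?\<delta> (\<gamma> t) (\<gamma> t')) \<le> ennreal (\<l> t')"
   using step[of t t'] t \<l>_nn by (simp add: len laakso_dist_def ennreal_plus)
  then have "\<l> t + ?\<delta> (\<gamma> t) (\<gamma> t') \<le> \<l> t'"
   using \<l>_nn by simp
  ultimately show ?thesis by linarith
 qed
 have \<l>_mono: "mono_on {0..1} \<l>"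
 proof (rule mono_onI)
  fix r s :: real assume "r \<in> {0..1}" "s \<in> {0..1}" "r \<le> s"
  from h_step[OF this] show "\<l> r \<le> \<l> s" by linarith
 qed
 have h_lip: "\<bar>h t - h t'\<bar> \<le> \<bar>\<l> t - \<l> t'\<bar>" if "t \<in> {0..1}" "t' \<in> {0..1}" for t t'
  using h_step[of t t'] h_step[of t' t] that by linarith
 \<comment> \<open>The choice hidden in \<open>arc_param\<close>. Nothing is known of the chosen
   time except its arc length; the fact \<open>same\<close> below shows that this is enough.\<close>
 define sel where "sel s = (SOME t. t \<in> {0..1} \<and> len t = ennreal s)" for s
 have arc: "arc_param ?\<delta> \<gamma> s = \<gamma> (sel s)" for s
  by (simp add: arc_param_def sel_def len_def)
 have sel: "sel (\<l> t) \<in> {0..1}" "\<l> (sel (\<l> t)) = \<l> t" if "t \<in> {0..1}" for t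
 proof -
  have "sel (\<l> t) \<in> {0..1} \<and> len (sel (\<l> t)) = ennreal (\<l> t)"
   unfolding sel_def by (rule someI[of _ t]) (use that len in auto)
  then show "sel (\<l> t) \<in> {0..1}" "\<l> (sel (\<l> t)) = \<l> t" by (auto simp: \<l>_def)
 qed
 \<comment> \<open>The path is extended constantly to the real line, so that the times spent off
   \<open>Z\<close> form an open set with countably many components.\<close>
 define clamp where "clamp t = max 0 (min 1 t)" for t :: real
 have clamp: "clamp t \<in> {0..1}" "t \<in> {0..1} \<Longrightarrow> clamp t = t" for t
  by (auto simp: clamp_def)
 have hc_cont: "continuous_on UNIV (\<lambda>t. h (clamp t))"
  using clamp(1) by (intro continuous_on_compose2[OF h_cont]) (auto simp: clamp_def intro!: continuous_intros)
 define O' where "O' = {t. h (clamp t) \<notin> Z}"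
 have "open O'"
 proof -
  have "open ((\<lambda>t. h (clamp t)) -` (- Z))"
   using Z(1) hc_cont by (intro open_vimage open_Compl finite_imp_closed)
  then show ?thesis by (simp add: O'_def vimage_def)
 qed
 let ?C = "components O'"
 let ?K = "\<lambda>K. K \<inter> {0..1}"
 have K_int: "is_interval (?K K)" if "K \<in> ?C" for K
  using that in_components_connected by (intro is_interval_Int) (auto simp: is_interval_connected_1)
 have K_Z: "h t \<notin> Z" if "K \<in> ?C" "t \<in> ?K K" for K t
  using that in_components_subset[OF that(1)] clamp(2)[of t] by (auto simp: O'_def)
 \<comment> \<open>Between two times of equal arc length the \<open>x\<close>-coordinate does not
   move, so the path does not reach \<open>Z\<close> in between: equal arc length means same
   component and same \<open>x\<close>.\<close>
 have same: "t' \<in> K \<and> h t' = h t" if K: "K \<in> ?C" "t \<in> ?K K" "t' \<in> {0..1}" "\<l> t' = \<l> t" for K t t'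
 proof -
  let ?J = "{min t t'..max t t'}"
  have J: "?J \<subseteq> {0..1}" "t \<in> ?J" "t' \<in> ?J"
   using K by auto
  have const: "h s = h t" if s: "s \<in> ?J" for s
  proof -
   have "s \<in> {0..1}" "min t t' \<in> {0..1}" "max t t' \<in> {0..1}"
    using J s by auto
   then have "\<l> (min t t') \<le> \<l> s" "\<l> s \<le> \<l> (max t t')"
    using s by (auto intro!: mono_onD[OF \<l>_mono])
   then have "\<l> s = \<l> t"
    using K(4) by (simp add: min_def max_def split: if_splits)
   then show ?thesis
    using h_lip[OF \<open>s \<in> {0..1}\<close>, of t] K(2) by simp
  qed
  have "?J \<subseteq> O'"
  proof
   fix s assume s: "s \<in> ?J"
   then have "clamp s = s"
    using J(1) by (intro clamp(2)) blast
   then show "s \<in> O'"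
    unfolding O'_def mem_Collect_eq using const[OF s] K_Z[OF K(1,2)] by metis
  qed
  moreover have "K \<inter> ?J \<noteq> {}"
   using J(2) K(2) by blast
  ultimately have "?J \<subseteq> K" by (intro components_maximal[OF K(1)]) auto
  then show ?thesis
   using J(3) const[OF J(3)] by blast
 qed
 define G where "G K s = p (arc_param ?\<delta> \<gamma> s) * indicator (\<l> ` ?K K) s" for K s
 have main: "\<exists>J. F ` ?K K \<subseteq> J \<and> J \<in> sets borel \<and> emeasure lborel J \<le> (\<integral>\<^sup>+s. G K s \<partial>lborel) \<and>
   G K \<in> borel_measurable lborel" if K: "K \<in> ?C" for K
 proof -
  \<comment> \<open>The first \<open>n\<close> digits of an arbitrary preimage. Off \<open>Z\<close>
    they do not depend on the preimage, and by connectedness they do not change within a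
    component.\<close>
  define pref where "pref t = trunc n (snd (SOME q. q \<in> \<gamma> t))" for t
  have rep: "\<gamma> t = io (h t, w) \<Longrightarrow> pref t = trunc n w" if "t \<in> ?K K" for t w
  proof -
   assume w: "\<gamma> t = io (h t, w)"
   have "(h t, w) \<in> \<gamma> t"
    unfolding w by (simp add: mem_laakso_proj)
   then have "(SOME q. q \<in> \<gamma> t) \<in> \<gamma> t"
    by (rule someI[of "\<lambda>q. q \<in> \<gamma> t"])
   then obtain y v where q: "(SOME q. q \<in> \<gamma> t) = (y, v)" "(y, v) \<in> io (h t, w)"
    unfolding w by (metis surj_pair)
   then have "io (h t, w) = io (y, v)" by (simp add: mem_laakso_proj laakso_proj_eq_iff)
   then have "y = h t" "io (h t, w) = io (h t, v)" by (auto simp: io_eq_iff)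
   then have "agree n w v"
    using K_Z[OF K that] Z(2) by (intro io_eq_imp_agree) auto
   then show "pref t = trunc n w"
    unfolding pref_def q(1) by (metis snd_conv trunc_eq_iff)
  qed
  have ex_rep: "\<exists>w. \<gamma> t = io (h t, w)" if "t \<in> {0..1}" for t
   using \<gamma>_in[OF that] by (metis h_def laakso_space_cases xcoord_proj)
  have pref_const: "pref t = pref t'" if "t \<in> ?K K" "t' \<in> ?K K" for t t'
  proof (rule connected_local_const[OF _ that])
   show "connected (?K K)"
    using K_int[OF K] by (simp add: is_interval_connected_1)
   show "\<forall>a\<in>?K K. \<forall>\<^sub>F b in at a within ?K K. pref a = pref b"
   proof
    fix a assume a: "a \<in> ?K K"
    obtain w where w: "\<gamma> a = io (h a, w)"
     using ex_rep a by blast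
    let ?P = "io ` {(x, u). x \<in> {0..1} \<and> x \<notin> Z \<and> agree n w u}"
    have "openin (top_of_set {0..1}) {t \<in> {0..1}. \<gamma> t \<in> ?P}"
     using openin_continuous_map_preimage[OF \<gamma>[unfolded pathin_def] openin_word[OF Z, of w]] by simp
    then obtain T where T: "open T" "{t \<in> {0..1}. \<gamma> t \<in> ?P} = {0..1} \<inter> T"
     by (auto simp: openin_open)
    have "h a \<in> {0..1}"
     using \<gamma>_in[of a] a by (metis IntD2 h_def laakso_space_cases xcoord_proj)
    then have "\<gamma> a \<in> ?P"
     using w K_Z[OF K a] by auto
    then have "a \<in> T"
     using T(2) a by blast
    moreover have "pref a = pref b" if b: "b \<in> T" "b \<in> ?K K" for b
    proof -
     have "\<gamma> b \<in> ?P"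
      using T(2) b by blast
     then obtain u where u: "\<gamma> b = io (h b, u)" "agree n w u" by (auto simp: h_def)
     then show ?thesis
      using rep[OF a w] rep[OF b(2) u(1)] by (simp add: trunc_eq_iff)
    qed
    ultimately show "\<forall>\<^sub>F b in at a within ?K K. pref a = pref b"
     unfolding eventually_at_topological using T(1) by blast
   qed
  qed
  show ?thesis
  proof (cases "?K K = {}")
   case True
   then have "G K = (\<lambda>_. 0)" by (simp add: G_def fun_eq_iff)
   with True show ?thesis by (intro exI[of _ "{}"]) simp
  next
   case False
   then obtain t0 where t0: "t0 \<in> ?K K" by blast
   define v where "v = pref t0"
   have val: "h t \<in> {0..1}" "F t = f (io (h t, v))" "p (\<gamma> t) = p (io (h t, v))" if t: "t \<in> ?K K" for t
   proof -
    obtain w where w: "\<gamma> t = io (h t, w)"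
     using ex_rep t by blast
    show h01: "h t \<in> {0..1}"
     using \<gamma>_in[of t] t by (metis IntD2 h_def laakso_space_cases xcoord_proj)
    have "v = trunc n w"
     using rep[OF t w] pref_const[OF t t0] by (simp add: v_def)
    then show "F t = f (io (h t, v))" "p (\<gamma> t) = p (io (h t, v))"
     using f_trunc[OF h01, of w] p_trunc[OF h01 K_Z[OF K t], of w] by (simp_all add: F_def w)
   qed
   define \<psi> where "\<psi> x = (if x \<in> {0..1} then p (io (x, v)) else 0)" for x
   have "(\<lambda>x. p (io (x, v))) \<in> borel_measurable MI"
   proof -
    have "(\<lambda>x. (x, v)) \<in> MI \<rightarrow>\<^sub>M MB"
     unfolding MB_def by measurable
    from measurable_compose[OF measurable_compose[OF this measurable_proj] p] show ?thesis .
   qed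
   then have "(\<lambda>x. p (io (x, v)) * indicator {0..1} x) \<in> borel_measurable lborel"
    by (subst (asm) borel_measurable_restrict_space_iff_ennreal) auto
   moreover have "(\<lambda>x. p (io (x, v)) * indicator {0..1} x) = \<psi>" by (auto simp: \<psi>_def)
   ultimately have \<psi>: "\<psi> \<in> borel_measurable borel" by simp
   let ?Y = "h ` ?K K" and ?S = "\<l> ` ?K K"
   define hh where "hh s = h (sel s)" for s
   have sel_K: "sel s \<in> ?K K" "\<l> (sel s) = s" if s: "s \<in> ?S" for s
   proof -
    obtain t where t: "t \<in> ?K K" "s = \<l> t"
     using s by blast
    then show "sel s \<in> ?K K" "\<l> (sel s) = s"
     using same[OF K t(1) sel(1)[of t] sel(2)[of t]] sel[of t] by auto
   qed
   have Y_int: "is_interval ?Y"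
    unfolding is_interval_connected_1
    using K_int[OF K] h_cont
    by (intro connected_continuous_image continuous_on_subset[OF h_cont]) (auto simp: is_interval_connected_1)
   have Y_sub: "?Y \<subseteq> hh ` ?S"
   proof
    fix x assume "x \<in> ?Y"
    then obtain t where t: "t \<in> ?K K" "x = h t" by blast
    have "hh (\<l> t) = x"
     unfolding hh_def using same[OF K t(1) sel(1)[of t] sel(2)[of t]] t by auto
    then show "x \<in> hh ` ?S"
     using t(1) by blast
   qed
   have lip: "\<bar>hh s - hh s'\<bar> \<le> \<bar>s - s'\<bar>" if "s \<in> ?S" "s' \<in> ?S" for s s'
    unfolding hh_def using h_lip[of "sel s" "sel s'"] sel_K[OF that(1)] sel_K[OF that(2)] by auto
   have S_borel: "?S \<in> sets borel"
    using K_int[OF K] by (rule borel_mono_image) (rule mono_on_subset[OF \<l>_mono], simp)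
   have Y_borel: "?Y \<in> sets borel"
    using Y_int by (rule real_interval_borel_measurable)
   have G_eq: "G K s = \<psi> (hh s) * indicator ?S s" for s
    using val(1,3)[OF sel_K(1)[of s]] by (cases "s \<in> ?S") (simp_all add: G_def \<psi>_def hh_def arc)
   have area: "(\<integral>\<^sup>+x\<in>?Y. \<psi> x \<partial>lborel) \<le> (\<integral>\<^sup>+s. G K s \<partial>lborel)"
    unfolding G_eq using nn_integral_lipschitz_image_le(1)[OF S_borel lip Y_borel Y_sub \<psi>] .
   have G_meas: "G K \<in> borel_measurable lborel"
    using nn_integral_lipschitz_image_le(2)[OF S_borel lip Y_borel Y_sub \<psi>] G_eq[abs_def] by simp
   have diam: "ennreal \<bar>y - y'\<bar> \<le> (\<integral>\<^sup>+s. G K s \<partial>lborel)" if y: "y \<in> F ` ?K K" "y' \<in> F ` ?K K" for y y'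
   proof -
    have *: "ennreal \<bar>f (io (b, v)) - f (io (a, v))\<bar> \<le> (\<integral>\<^sup>+x\<in>?Y. \<psi> x \<partial>lborel)"
     if ab: "a \<in> ?Y" "b \<in> ?Y" "a \<le> b" for a b
    proof -
     have sub: "{a..b} \<subseteq> ?Y"
      using ab Y_int mem_is_interval_1_I[OF Y_int ab(1,2)] by auto
     moreover have "?Y \<subseteq> {0..1} - Z"
      using val(1) K_Z[OF K] by blast
     ultimately have "{a..b} \<subseteq> {0..1} - Z" by blast
     then have "ennreal \<bar>f (io (b, v)) - f (io (a, v))\<bar> \<le> (\<integral>\<^sup>+x\<in>{a..b}. p (io (x, v)) \<partial>lborel)"
      by (rule ac[OF ab(3)])
     also have "\<dots> \<le> (\<integral>\<^sup>+x\<in>?Y. \<psi> x \<partial>lborel)"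
      using sub \<open>{a..b} \<subseteq> {0..1} - Z\<close>
      by (intro nn_integral_mono) (auto simp: \<psi>_def indicator_def)
     finally show ?thesis .
    qed
    obtain t t' where t: "t \<in> ?K K" "t' \<in> ?K K" "y = F t" "y' = F t'"
     using y by blast
    have "ennreal \<bar>y - y'\<bar> \<le> (\<integral>\<^sup>+x\<in>?Y. \<psi> x \<partial>lborel)"
     using *[of "h t" "h t'"] *[of "h t'" "h t"] t val(2) by (cases "h t \<le> h t'") (auto simp: abs_minus_commute)
    then show ?thesis
     using area by (rule order_trans)
   qed
   obtain J where "F ` ?K K \<subseteq> J" "J \<in> sets borel" "emeasure lborel J \<le> (\<integral>\<^sup>+s. G K s \<partial>lborel)"
    using connected_real_diameter_measure[OF diam] by blast
   then show ?thesis
    using G_meas by blast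
  qed
 qed
 then have "\<forall>K\<in>?C. \<exists>J. F ` ?K K \<subseteq> J \<and> J \<in> sets borel \<and> emeasure lborel J \<le> (\<integral>\<^sup>+s. G K s \<partial>lborel) \<and>
   G K \<in> borel_measurable lborel" by blast
 from bchoice[OF this] obtain J where
  J: "\<And>K. K \<in> ?C \<Longrightarrow> F ` ?K K \<subseteq> J K" "\<And>K. K \<in> ?C \<Longrightarrow> J K \<in> sets borel"
   "\<And>K. K \<in> ?C \<Longrightarrow> emeasure lborel (J K) \<le> (\<integral>\<^sup>+s. G K s \<partial>lborel)" and
  G: "\<And>K. K \<in> ?C \<Longrightarrow> G K \<in> borel_measurable lborel" by blast
 have ct: "countable ?C" by (rule components_open_real(1)[OF \<open>open O'\<close>])
 \<comment> \<open>Values of \<open>f\<close> over \<open>Z\<close>: finitely many, as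
   \<open>f\<close> depends on \<open>n\<close> digits. The path may return to \<open>Z\<close>
   infinitely often, but these values form a null set.\<close>
 define V where "V = (\<lambda>(z, u). f (io (z, u))) ` (Z \<times> range (trunc n))"
 have "finite V"
  unfolding V_def by (rule finite_imageI[OF finite_cartesian_product[OF Z(1) finite_range_trunc]])
 have cover: "F ` {0..1} \<subseteq> V \<union> (\<Union>K\<in>?C. J K)"
 proof clarify
  fix t assume t: "t \<in> {0..1}" "F t \<notin> (\<Union>K\<in>?C. J K)"
  obtain x w where x: "\<gamma> t = io (x, w)" "x \<in> {0..1}"
   using \<gamma>_in[OF t(1)] by (rule laakso_space_cases)
  have "t \<notin> O'"
  proof
   assume "t \<in> O'"
   then obtain K where "K \<in> ?C" "t \<in> K"
    using Union_components[of O'] by blast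
   then show False
    using J(1)[of K] t by blast
  qed
  then have "x \<in> Z"
   using clamp(2)[OF t(1)] by (simp add: O'_def h_def x)
  then have "(x, trunc n w) \<in> Z \<times> range (trunc n)" by blast
  moreover have "F t = f (io (x, trunc n w))"
   using f_trunc[OF x(2)] by (simp add: F_def x)
  ultimately show "F t \<in> V"
   unfolding V_def by (metis (mono_tags, lifting) case_prod_conv image_eqI)
 qed
 \<comment> \<open>The increment is measured as the length of an interval that the continuous
   function \<open>F\<close> must cover, which replaces a summation along the path by subadditivity
   of measure.\<close>
 let ?I = "{min (F 0) (F 1)..max (F 0) (F 1)}"
 have "?I \<subseteq> F ` {0..1}"
 proof -
  have "connected (F ` {0..1})"
   using F_cont by (rule connected_continuous_image) simp
  then show ?thesis by (rule connected_contains_Icc) (auto simp: min_def max_def)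
 qed
 then have I_sub: "?I \<subseteq> V \<union> (\<Union>K\<in>?C. J K)"
  using cover by (rule order_trans)
 have V_sets: "V \<in> sets lborel"
  using \<open>finite V\<close> by (simp add: finite_imp_closed)
 have J_sets: "(\<Union>K\<in>?C. J K) \<in> sets lborel"
  using J(2) ct by (intro sets.countable_UN'') auto
 have "ennreal \<bar>f (\<gamma> 0) - f (\<gamma> 1)\<bar> = emeasure lborel ?I"
  by (simp add: F_def min_def max_def abs_if)
 also have "\<dots> \<le> emeasure lborel (V \<union> (\<Union>K\<in>?C. J K))"
  using I_sub V_sets J_sets by (intro emeasure_mono) auto
 also have "\<dots> \<le> emeasure lborel V + emeasure lborel (\<Union>K\<in>?C. J K)"
  using V_sets J_sets by (rule emeasure_subadditive)
 also have "emeasure lborel V = 0"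
  using \<open>finite V\<close> by (simp add: emeasure_lborel_countable countable_finite)
 also have "emeasure lborel (\<Union>K\<in>?C. J K) \<le> (\<integral>\<^sup>+K. emeasure lborel (J K) \<partial>count_space ?C)"
  using J(2) by (intro emeasure_countable_UN_le ct) auto
 also have "\<dots> \<le> (\<integral>\<^sup>+K. \<integral>\<^sup>+s. G K s \<partial>lborel \<partial>count_space ?C)"
  using J(3) by (intro nn_integral_mono) auto
 also have "\<dots> = (\<integral>\<^sup>+s. \<integral>\<^sup>+K. G K s \<partial>count_space ?C \<partial>lborel)"
  using G by (intro nn_integral_count_space_nn_integral[symmetric] ct)
 also have "\<dots> \<le> (\<integral>\<^sup>+s\<in>{0..\<l> 1}. p (arc_param ?\<delta> \<gamma> s) \<partial>lborel)"
 proof (rule nn_integral_mono)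
  fix s
  show "(\<integral>\<^sup>+K. G K s \<partial>count_space ?C) \<le> p (arc_param ?\<delta> \<gamma> s) * indicator {0..\<l> 1} s"
  proof (cases "\<exists>K\<in>?C. s \<in> \<l> ` ?K K")
   case True
   then obtain K0 t where K0: "K0 \<in> ?C" "t \<in> ?K K0" "s = \<l> t" by blast
   \<comment> \<open>Different components have disjoint images under arc length, so the terms
     \<open>G K\<close> never overlap.\<close>
   have uniq: "K = K0" if K: "K \<in> ?C" "s \<in> \<l> ` ?K K" for K
   proof -
    obtain t' where t': "t' \<in> ?K K" "s = \<l> t'"
     using K by blast
    then have "t' \<in> K0"
     using same[OF K0(1,2), of t'] K0 by auto
    then show ?thesis
     using t' K K0(1) components_nonoverlap[of K O' K0] by blast
   qed
   have "G K s = G K0 s * indicator {K0} K" if "K \<in> ?C" for K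
    using uniq[OF that] by (cases "s \<in> \<l> ` ?K K") (auto simp: G_def indicator_def)
   then have "(\<integral>\<^sup>+K. G K s \<partial>count_space ?C) = (\<integral>\<^sup>+K. G K0 s * indicator {K0} K \<partial>count_space ?C)"
    by (intro nn_integral_cong) auto
   also have "\<dots> = G K0 s"
    using K0(1) by (subst nn_integral_cmult_indicator) auto
   also have "\<dots> \<le> p (arc_param ?\<delta> \<gamma> s) * indicator {0..\<l> 1} s"
   proof -
    have "s \<in> {0..\<l> 1}"
     using K0 \<l>_nn mono_onD[OF \<l>_mono, of t 1] by auto
    then show ?thesis by (auto simp: G_def indicator_def)
   qed
   finally show ?thesis .
  next
   case False
   then have "(\<integral>\<^sup>+K. G K s \<partial>count_space ?C) = (\<integral>\<^sup>+K. 0 \<partial>count_space ?C)"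
    by (intro nn_integral_cong) (auto simp: G_def)
   then show ?thesis by simp
  qed
 qed
 also have "\<dots> = line_integral ?\<delta> \<gamma> p" by (simp add: line_integral_def \<l>_def len_def)
 finally show "ennreal \<bar>f (\<gamma> 0) - f (\<gamma> 1)\<bar> \<le> line_integral ?\<delta> \<gamma> p"
  by simp
qed

end

section \<open>Minimal upper gradients of the core functions\<close>

text \<open>Tested on the set where the inequality fails; finiteness of the integral of
  \<open>g\<close> permits the subtraction.\<close>

lemma AE_le_if_nn_integral_le:
 fixes f g :: "'a \<Rightarrow> ennreal"
 assumes [measurable]: "f \<in> borel_measurable M" "g \<in> borel_measurable M" and fin: "(\<integral>\<^sup>+x. g x \<partial>M) < \<infinity>"
  and le: "\<And>B. B \<in> sets M \<Longrightarrow> (\<integral>\<^sup>+x\<in>B. f x \<partial>M) \<le> (\<integral>\<^sup>+x\<in>B. g x \<partial>M)"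
 shows "AE x in M. f x \<le> g x"
proof -
 let ?B = "{x \<in> space M. g x < f x}"
 have "(\<integral>\<^sup>+x\<in>?B. g x \<partial>M) \<le> (\<integral>\<^sup>+x. g x \<partial>M)"
  by (intro nn_integral_mono) (auto simp: indicator_def)
 then have finB: "(\<integral>\<^sup>+x\<in>?B. g x \<partial>M) \<noteq> \<infinity>"
  using fin by (auto simp: top_unique)
 have "(\<integral>\<^sup>+x. f x * indicator ?B x - g x * indicator ?B x \<partial>M) = (\<integral>\<^sup>+x\<in>?B. f x \<partial>M) - (\<integral>\<^sup>+x\<in>?B. g x \<partial>M)"
  using finB by (intro nn_integral_diff) (auto simp: indicator_def)
 also have "\<dots> = 0"
  using le[of ?B] finB by (intro diff_eq_0_ennreal) (auto simp: less_top intro: le_less_trans)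
 finally have "AE x in M. f x * indicator ?B x - g x * indicator ?B x = 0"
  by (subst (asm) nn_integral_0_iff_AE) auto
 then show ?thesis
 proof (rule AE_mp, intro AE_I2 impI)
  fix x assume x: "x \<in> space M" "f x * indicator ?B x - g x * indicator ?B x = 0"
  show "f x \<le> g x"
  proof (rule ccontr)
   assume "\<not> f x \<le> g x"
   then have "g x < f x" by simp
   moreover from this have "f x - g x = 0"
    using x by simp
   ultimately show False by (metis diff_gt_0_iff_gt_ennreal less_irrefl)
  qed
 qed
qed

text \<open>Tonelli for \<open>x \<le> y \<le> x + h\<close> bounds the difference quotients on an open set by the gradient, and
 Fatou passes to the limit.\<close>

lemma difference_quotient_bound:
 fixes g g' :: "real \<Rightarrow> real" and G :: "real \<Rightarrow> ennreal"
 assumes g: "continuous_on UNIV g" and [measurable]: "G \<in> borel_measurable borel"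
  and "finite Z" and U: "open U"
  and g': "\<And>x. x \<in> U - Z \<Longrightarrow> (g has_real_derivative g' x) (at x)" "g' \<in> borel_measurable borel"
  and le: "\<And>a b. a \<le> b \<Longrightarrow> {a..b} \<subseteq> U \<Longrightarrow> ennreal \<bar>g b - g a\<bar> \<le> (\<integral>\<^sup>+x\<in>{a..b}. G x \<partial>lborel)"
 shows "(\<integral>\<^sup>+x\<in>U. ennreal \<bar>g' x\<bar> \<partial>lborel) \<le> (\<integral>\<^sup>+x\<in>U. G x \<partial>lborel)"
proof -
 define h where "h m = inverse (real (Suc m))" for m
 have h: "h m > 0" for m by (simp add: h_def)
 have h_lim: "h \<longlonglongrightarrow> 0"
  unfolding h_def by (rule LIMSEQ_inverse_real_of_nat)
 define W where "W m = {x. {x..x + h m} \<subseteq> U}" for m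
 have W: "W m \<in> sets borel" for m
 proof -
  \<comment> \<open>The points that leave \<open>U\<close> within a step \<open>h m\<close> form the
    sum of a closed and a compact set, hence a closed set.\<close>
  have "- W m = (\<Union>x\<in>- U. \<Union>y\<in>{- h m..0}. {x + y})"
  proof (intro equalityI subsetI)
   fix x assume "x \<in> - W m"
   then obtain y where "y \<in> {x..x + h m}" "y \<notin> U"
    unfolding W_def by blast
   then show "x \<in> (\<Union>x\<in>- U. \<Union>y\<in>{- h m..0}. {x + y})"
    by (intro UN_I[of y] UN_I[of "x - y"]) auto
  next
   fix x assume "x \<in> (\<Union>x\<in>- U. \<Union>y\<in>{- h m..0}. {x + y})"
   then obtain a b where "a \<notin> U" "b \<in> {- h m..0}" "x = a + b" by blast
   then have "a \<in> {x..x + h m}" "a \<notin> U" by auto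
   then show "x \<in> - W m"
    unfolding W_def by blast
  qed
  moreover have "closed (\<Union>x\<in>- U. \<Union>y\<in>{- h m..0}. {x + y})"
   using U by (intro closed_compact_sums) auto
  ultimately have "open (W m)" by (simp add: open_closed)
  then show ?thesis by simp
 qed
 note [measurable] = W borel_open[OF U] g'(2) borel_measurable_continuous_onI[OF g]
 define D where "D m x = ennreal (\<bar>g (x + h m) - g x\<bar> / h m) * indicator (W m) x" for m x
 have [measurable]: "D m \<in> borel_measurable borel" for m
  unfolding D_def[abs_def] by measurable
 have D_le: "(\<integral>\<^sup>+x. D m x \<partial>lborel) \<le> (\<integral>\<^sup>+x\<in>U. G x \<partial>lborel)" for m
 proof -
  have "(\<integral>\<^sup>+x. D m x \<partial>lborel) \<le> (\<integral>\<^sup>+x. \<integral>\<^sup>+y. ennreal (1 / h m) * (G y * indicator U y * indicator {y - h m..y} x) \<partial>lborel \<partial>lborel)"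
  proof (rule nn_integral_mono)
   fix x
   show "D m x \<le> (\<integral>\<^sup>+y. ennreal (1 / h m) * (G y * indicator U y * indicator {y - h m..y} x) \<partial>lborel)"
   proof (cases "x \<in> W m")
    case True
    then have "D m x = ennreal (1 / h m) * ennreal \<bar>g (x + h m) - g x\<bar>"
     using h[of m] by (simp add: D_def ennreal_mult'[symmetric])
    also have "\<dots> \<le> ennreal (1 / h m) * (\<integral>\<^sup>+y\<in>{x..x + h m}. G y \<partial>lborel)"
     using True h[of m] by (intro mult_left_mono le) (auto simp: W_def)
    also have "\<dots> = (\<integral>\<^sup>+y. ennreal (1 / h m) * (G y * indicator {x..x + h m} y) \<partial>lborel)"
     by (subst nn_integral_cmult) auto
    also have "\<dots> \<le> (\<integral>\<^sup>+y. ennreal (1 / h m) * (G y * indicator U y * indicator {y - h m..y} x) \<partial>lborel)"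
     using True by (intro nn_integral_mono mult_left_mono) (auto simp: indicator_def W_def subset_iff)
    finally show ?thesis .
   qed (simp add: D_def)
  qed
  also have "\<dots> = (\<integral>\<^sup>+y. \<integral>\<^sup>+x. ennreal (1 / h m) * (G y * indicator U y * indicator {y - h m..y} x) \<partial>lborel \<partial>lborel)"
  proof (rule lborel_pair.Fubini'[symmetric])
   have "(\<lambda>(x, y). indicator {y - h m..y} x :: ennreal) = (\<lambda>(x, y). if y - h m \<le> x \<and> x \<le> y then 1 else 0)"
    by (auto simp: indicator_def fun_eq_iff)
   then have [measurable]: "(\<lambda>(x, y). indicator {y - h m..y} x :: ennreal) \<in> borel_measurable (lborel \<Otimes>\<^sub>M lborel)"
    by simp
   show "(\<lambda>(x, y). ennreal (1 / h m) * (G y * indicator U y * indicator {y - h m..y} x)) \<in> borel_measurable (lborel \<Otimes>\<^sub>M lborel)"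
    unfolding case_prod_beta by measurable
  qed
  also have "\<dots> = (\<integral>\<^sup>+y. G y * indicator U y \<partial>lborel)"
  proof (rule nn_integral_cong)
   fix y :: real
   have "(\<integral>\<^sup>+x. ennreal (1 / h m) * (G y * indicator U y * indicator {y - h m..y} x) \<partial>lborel) =
     ennreal (1 / h m) * (G y * indicator U y) * emeasure lborel {y - h m..y}"
    by (subst nn_integral_cmult_indicator[symmetric]) (auto simp: mult.assoc)
   also have "\<dots> = (G y * indicator U y) * (ennreal (1 / h m) * ennreal (h m))"
    using h[of m] by (simp add: ac_simps)
   also have "ennreal (1 / h m) * ennreal (h m) = 1"
    using h[of m] by (simp flip: ennreal_mult)
   finally show "(\<integral>\<^sup>+x. ennreal (1 / h m) * (G y * indicator U y * indicator {y - h m..y} x) \<partial>lborel) = G y * indicator U y"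
    by simp
  qed
  finally show ?thesis .
 qed
 have "(\<integral>\<^sup>+x\<in>U. ennreal \<bar>g' x\<bar> \<partial>lborel) \<le> (\<integral>\<^sup>+x. liminf (\<lambda>m. D m x) \<partial>lborel)"
 proof (rule nn_integral_mono_AE)
  have "AE x in lborel. x \<notin> Z"
   using \<open>finite Z\<close> by (intro AE_not_in finite_imp_null_set_lborel)
  then show "AE x in lborel. ennreal \<bar>g' x\<bar> * indicator U x \<le> liminf (\<lambda>m. D m x)"
  proof (rule AE_mp, intro AE_I2 impI)
   fix x assume "x \<notin> Z"
   show "ennreal \<bar>g' x\<bar> * indicator U x \<le> liminf (\<lambda>m. D m x)"
   proof (cases "x \<in> U")
    case True
    then have "(g has_real_derivative g' x) (at x)"
     using g' \<open>x \<notin> Z\<close> by blast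
    then have "((\<lambda>t. (g (x + t) - g x) / t) \<longlongrightarrow> g' x) (at 0)" by (simp add: DERIV_def)
    moreover have "filterlim h (at 0) sequentially"
     unfolding filterlim_at using h_lim h by (auto intro!: always_eventually) (metis less_irrefl h)
    ultimately have "(\<lambda>m. (g (x + h m) - g x) / h m) \<longlonglongrightarrow> g' x"
     by (rule filterlim_compose)
    then have "(\<lambda>m. ennreal \<bar>(g (x + h m) - g x) / h m\<bar>) \<longlonglongrightarrow> ennreal \<bar>g' x\<bar>"
     by (intro tendsto_ennrealI tendsto_rabs)
    moreover have "\<forall>\<^sub>F m in sequentially. ennreal \<bar>(g (x + h m) - g x) / h m\<bar> = D m x"
    proof -
     obtain r where r: "r > 0" "ball x r \<subseteq> U"
      using U True openE by blast
     have "\<forall>\<^sub>F m in sequentially. h m < r"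
      using h_lim r(1) by (rule order_tendstoD(2))
     then show ?thesis
     proof (rule eventually_mono)
      fix m assume "h m < r"
      then have "{x..x + h m} \<subseteq> ball x r" by (auto simp: dist_real_def)
      then have "x \<in> W m"
       using r(2) by (auto simp: W_def)
      then show "ennreal \<bar>(g (x + h m) - g x) / h m\<bar> = D m x"
       using h[of m] by (simp add: D_def abs_divide)
     qed
    qed
    ultimately have "(\<lambda>m. D m x) \<longlonglongrightarrow> ennreal \<bar>g' x\<bar>"
     by (rule Lim_transform_eventually)
    then show ?thesis
     using True by (simp add: lim_imp_Liminf)
   qed simp
  qed
 qed
 also have "\<dots> \<le> liminf (\<lambda>m. \<integral>\<^sup>+x. D m x \<partial>lborel)"
  by (rule nn_integral_liminf) simp
 also have "\<dots> \<le> (\<integral>\<^sup>+x\<in>U. G x \<partial>lborel)"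
  by (intro Liminf_le always_eventually allI D_le) simp
 finally show ?thesis .
qed

text \<open>The estimate on open sets extends to Borel sets by outer regularity of the measure with
  density \<open>G\<close> on the unit interval, which is finite by \<open>fin\<close>; an
  inequality of integrals over all Borel sets is an inequality almost everywhere.\<close>

lemma AE_gradient_le:
 fixes g g' :: "real \<Rightarrow> real" and G :: "real \<Rightarrow> ennreal"
 assumes g: "continuous_on UNIV g" and [measurable]: "G \<in> borel_measurable borel"
  and "finite Z" and g': "\<And>x. x \<in> {0<..<1} - Z \<Longrightarrow> (g has_real_derivative g' x) (at x)" "g' \<in> borel_measurable borel"
  and le: "\<And>a b. a \<le> b \<Longrightarrow> {a..b} \<subseteq> {0..1} \<Longrightarrow> ennreal \<bar>g b - g a\<bar> \<le> (\<integral>\<^sup>+x\<in>{a..b}. G x \<partial>lborel)"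
  and fin: "(\<integral>\<^sup>+x\<in>{0..1}. G x \<partial>lborel) < \<infinity>"
 shows "AE x in MI. ennreal \<bar>g' x\<bar> \<le> G x"
proof -
 note [measurable] = g'(2)
 let ?M = "density lborel (\<lambda>x. G x * indicator {0..1} x)"
 have "AE x in lborel. ennreal \<bar>g' x\<bar> * indicator {0<..<1} x \<le> G x * indicator {0..1} x"
 proof (rule AE_le_if_nn_integral_le)
  fix B :: "real set" assume "B \<in> sets lborel"
  then have B [measurable]: "B \<in> sets borel" by simp
  have "(\<integral>\<^sup>+x\<in>B. ennreal \<bar>g' x\<bar> * indicator {0<..<1} x \<partial>lborel) \<le> emeasure ?M B"
  proof (subst Regularity.outer_regular)
   show "emeasure ?M (space ?M) \<noteq> \<infinity>"
    using fin by (simp add: emeasure_density)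
   show "(\<integral>\<^sup>+x\<in>B. ennreal \<bar>g' x\<bar> * indicator {0<..<1} x \<partial>lborel) \<le> (INF U\<in>{U. B \<subseteq> U \<and> open U}. emeasure ?M U)"
   proof (rule INF_greatest, clarify)
    fix U assume U: "B \<subseteq> U" "open U"
    have [measurable]: "U \<in> sets borel"
     using U by simp
    have "(\<integral>\<^sup>+x\<in>B. ennreal \<bar>g' x\<bar> * indicator {0<..<1} x \<partial>lborel) \<le> (\<integral>\<^sup>+x\<in>U \<inter> {0<..<1}. ennreal \<bar>g' x\<bar> \<partial>lborel)"
     using U by (intro nn_integral_mono) (auto simp: indicator_def)
    also have "\<dots> \<le> (\<integral>\<^sup>+x\<in>U \<inter> {0<..<1}. G x \<partial>lborel)"
    proof (rule difference_quotient_bound[OF g _ \<open>finite Z\<close> _ _ g'(2)])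
     show "(g has_real_derivative g' x) (at x)" if "x \<in> U \<inter> {0<..<1} - Z" for x
      using g'(1)[of x] that by blast
     show "ennreal \<bar>g b - g a\<bar> \<le> (\<integral>\<^sup>+x\<in>{a..b}. G x \<partial>lborel)" if "a \<le> b" "{a..b} \<subseteq> U \<inter> {0<..<1}" for a b
     proof -
      have "{a..b} \<subseteq> {0..1}"
       using that(2) greaterThanLessThan_subseteq_atLeastAtMost_iff[of 0 1 0 1] by (metis inf.boundedE order_refl order_trans)
      then show ?thesis by (rule le[OF that(1)])
     qed
    qed (use U in auto)
    also have "\<dots> \<le> (\<integral>\<^sup>+x. (G x * indicator {0..1} x) * indicator U x \<partial>lborel)"
     by (intro nn_integral_mono) (auto simp: indicator_def)
    also have "\<dots> = emeasure ?M U" by (simp add: emeasure_density)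
    finally show "(\<integral>\<^sup>+x\<in>B. ennreal \<bar>g' x\<bar> * indicator {0<..<1} x \<partial>lborel) \<le> emeasure ?M U" .
   qed
  qed (use B in simp_all)
  then show "(\<integral>\<^sup>+x\<in>B. ennreal \<bar>g' x\<bar> * indicator {0<..<1} x \<partial>lborel) \<le> (\<integral>\<^sup>+x\<in>B. G x * indicator {0..1} x \<partial>lborel)"
   by (simp add: emeasure_density)
 qed (use fin in auto)
 moreover have "AE x in lborel. x \<notin> {0, 1 :: real}" by (intro AE_not_in finite_imp_null_set_lborel) simp
 ultimately have "AE x in lborel. x \<in> {0..1} \<longrightarrow> ennreal \<bar>g' x\<bar> \<le> G x"
  by eventually_elim (auto simp: indicator_def split: if_splits)
 then show ?thesis by (simp add: AE_restrict_space_iff)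
qed

lemma AE_MB_fst_notin:
 assumes "finite Z" shows "AE p in (MB :: 'a::finite prelaakso measure). fst p \<notin> Z"
proof -
 have "AE x in lborel. x \<notin> Z"
  using assms by (intro AE_not_in finite_imp_null_set_lborel)
 then have "AE x in lborel. x \<in> {0..1} \<longrightarrow> x \<notin> Z" by eventually_elim simp
 then have "AE x in MI. x \<notin> Z" by (simp add: AE_restrict_space_iff)
 then have "AE x in MI. AE w in (MK :: ('a \<Rightarrow> nat \<Rightarrow> bool) measure). fst (x, w) \<notin> Z"
  by eventually_elim simp
 moreover have "fst \<in> borel_measurable (MI \<Otimes>\<^sub>M (MK :: ('a \<Rightarrow> nat \<Rightarrow> bool) measure))"
  by (rule measurable_compose[OF measurable_fst measurable_restrict_space1]) simp
 then have "fst -` (- Z) \<inter> space (MI \<Otimes>\<^sub>M (MK :: ('a \<Rightarrow> nat \<Rightarrow> bool) measure)) \<in> sets (MI \<Otimes>\<^sub>M MK)"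
  by (rule measurable_sets) (use finite_imp_closed[OF assms] in auto)
 then have "{p \<in> space (MI \<Otimes>\<^sub>M (MK :: ('a \<Rightarrow> nat \<Rightarrow> bool) measure)). fst p \<notin> Z} \<in> sets (MI \<Otimes>\<^sub>M MK)"
  by (simp add: vimage_def Int_def conj_commute)
 ultimately show ?thesis
  unfolding MB_def by (intro MB.AE_pair_measure)
qed

text \<open>Lives on the base, because the derivatives along different lines through a wormhole need
  not agree. At the ends of \<open>I\<close> a two-sided derivative would involve parameters outside
  \<open>I\<close>, so the value there is set to \<open>0\<close>.\<close>

definition dx :: "(nat \<Rightarrow> nat) \<Rightarrow> ('k laakso_point \<Rightarrow> real) \<Rightarrow> 'k prelaakso \<Rightarrow> real" where
 "dx js f = (\<lambda>(x, w). if 0 < x \<and> x < 1 then deriv (\<lambda>y. f (laakso_proj js (y, w))) x else 0)"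

lemma dx_eqI:
 assumes "((\<lambda>y. f (laakso_proj js (y, w))) has_real_derivative c) (at x)" "0 < x" "x < 1"
 shows "dx js f (x, w) = c"
 using assms DERIV_imp_deriv by (simp add: dx_def)

context laakso
begin

section \<open>Functions of finitely many digits and their derivatives along lines\<close>

lemma mgug_D_continuous: "f \<in> mgug_D js n \<Longrightarrow> continuous_map (laakso_topology js) euclidean f"
 by (simp add: mgug_D_def)

lemma mgug_D_agree: "f \<in> mgug_D js n \<Longrightarrow> x \<in> {0..1} \<Longrightarrow> agree n w w' \<Longrightarrow> f (io (x, w)) = f (io (x, w'))"
 unfolding mgug_D_def agree_def by blast

lemma mgug_D_trunc: "f \<in> mgug_D js n \<Longrightarrow> x \<in> {0..1} \<Longrightarrow> f (io (x, w)) = f (io (x, trunc n w))"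
 by (rule mgug_D_agree[OF _ _ agree_trunc(1)])

lemma mgug_D_line_continuous:
 assumes "f \<in> mgug_D js n" shows "continuous_on {0..1} (\<lambda>x. f (io (x, w)))"
proof -
 have "continuous_on laakso_base (\<lambda>p. f (io p))"
  using mgug_D_continuous[OF assms] by (simp add: continuous_laakso_iff)
 then show ?thesis by (rule continuous_on_compose2) (auto intro!: continuous_intros)
qed

text \<open>One finite exceptional set serves all lines, because a function of \<open>n\<close>
  digits has only finitely many different restrictions to lines. The ends and \<open>L n\<close> are
  included for later use.\<close>

lemma mgug_D_differentiable:
 fixes f :: "'k::finite laakso_point \<Rightarrow> real"
 assumes f: "f \<in> mgug_D js n"
 obtains Z where "finite Z" "{0, 1} \<subseteq> Z" "L n \<subseteq> Z"
  "\<And>x w. x \<in> {0..1} - Z \<Longrightarrow> ((\<lambda>y. f (io (y, w))) has_real_derivative dx js f (x, w)) (at x)"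
proof -
 have "\<exists>S. finite S \<and> (\<forall>x\<in>{0..1} - S. (\<lambda>y. f (io (y, v))) differentiable (at x within {0..1}))" for v
  using f by (simp add: mgug_D_def piecewise_differentiable_on_def)
 then obtain S where S: "\<And>v. finite (S v)"
   "\<And>v x. x \<in> {0..1} - S v \<Longrightarrow> (\<lambda>y. f (io (y, v))) differentiable (at x within {0..1})"
  by metis
 let ?Z = "{0, 1} \<union> L n \<union> (\<Union>v\<in>range (trunc n). S v)"
 have "((\<lambda>y. f (io (y, w))) has_real_derivative dx js f (x, w)) (at x)" if x: "x \<in> {0..1} - ?Z" for x w
 proof -
  have x01: "0 < x" "x < 1"
   using x by auto
  have "x \<in> {0..1} - S (trunc n w)"
   using x by blast
  then have "(\<lambda>y. f (io (y, trunc n w))) differentiable (at x within {0..1})" by (rule S(2))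
  then obtain c where "((\<lambda>y. f (io (y, trunc n w))) has_real_derivative c) (at x within {0..1})"
   by (metis real_differentiable_def)
  then have "((\<lambda>y. f (io (y, trunc n w))) has_real_derivative c) (at x)"
   using x01 at_within_interior[of x "{0..1}"] by simp
  then have "((\<lambda>y. f (io (y, w))) has_real_derivative c) (at x)"
   by (rule has_field_derivative_transform_within_open[of _ _ _ "{0<..<1}"])
    (use x01 mgug_D_trunc[OF f, of _ w] in auto)
  then show ?thesis
   using dx_eqI[OF _ x01] by metis
 qed
 moreover have "finite ?Z"
  using S(1) finite_L finite_range_trunc by blast
 ultimately show ?thesis
  using that[of ?Z] by blast
qed

lemma dx_agree:
 assumes "f \<in> mgug_D js n" "agree n w w'"
 shows "dx js f (x, w) = dx js f (x, w')"
proof (cases "0 < x \<and> x < 1")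
 case True
 have "\<forall>\<^sub>F y in nhds x. y \<in> {0<..<1}"
  using True by (intro eventually_nhds_in_open) auto
 then have "\<forall>\<^sub>F y in nhds x. f (io (y, w)) = f (io (y, w'))"
  by eventually_elim (rule mgug_D_agree[OF assms(1) _ assms(2)], auto)
 then show ?thesis
  using True by (simp add: dx_def deriv_cong_ev)
qed (auto simp: dx_def)

lemma dx_trunc: "f \<in> mgug_D js n \<Longrightarrow> dx js f (x, w) = dx js f (x, trunc n w)"
 by (rule dx_agree[OF _ agree_trunc(1)])

text \<open>Off the finite set \<open>Z\<close> the derivative is the limit of difference quotients
  with steps \<open>1 / (m + 1)\<close>; the function is first extended constantly beyond the
  ends.\<close>

lemma dx_line_measurable:
 assumes f: "f \<in> mgug_D js n"
 shows "(\<lambda>x. dx js f (x, w :: 'k::finite \<Rightarrow> nat \<Rightarrow> bool)) \<in> borel_measurable borel"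
proof -
 obtain Z where Z: "finite Z" "{0, 1} \<subseteq> Z"
   "\<And>x w. x \<in> {0..1} - Z \<Longrightarrow> ((\<lambda>y. f (io (y, w))) has_real_derivative dx js f (x, w)) (at x)"
  using mgug_D_differentiable[OF f] by metis
 define g where "g x = f (io (max 0 (min 1 x), w))" for x
 have "continuous_on UNIV g"
  unfolding g_def by (rule continuous_on_compose2[OF mgug_D_line_continuous[OF f]]) (auto intro!: continuous_intros)
 then have [measurable]: "g \<in> borel_measurable borel" by (rule borel_measurable_continuous_onI)
 define h where "h m = inverse (real (Suc m))" for m
 have h_lim: "filterlim h (at 0) sequentially"
  unfolding filterlim_at h_def using LIMSEQ_inverse_real_of_nat by auto
 have "(\<lambda>x. if x \<in> {0<..<1} then lim (\<lambda>m. (g (x + h m) - g x) / h m) else 0) \<in> borel_measurable borel"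
  by (intro measurable_If borel_measurable_lim_metric) measurable
 then show ?thesis
 proof (rule measurable_discrete_difference[where X = Z])
  show "countable Z"
   using Z(1) by (rule countable_finite)
  fix x assume "x \<notin> Z"
  show "(if x \<in> {0<..<1} then lim (\<lambda>m. (g (x + h m) - g x) / h m) else 0) = dx js f (x, w)"
  proof (cases "x \<in> {0<..<1}")
   case True
   then have "((\<lambda>y. f (io (y, w))) has_real_derivative dx js f (x, w)) (at x)"
    using Z(3) \<open>x \<notin> Z\<close> by auto
   then have "(g has_real_derivative dx js f (x, w)) (at x)"
    by (rule has_field_derivative_transform_within_open[of _ _ _ "{0<..<1}"]) (use True in \<open>auto simp: g_def\<close>)
   then have "((\<lambda>t. (g (x + t) - g x) / t) \<longlongrightarrow> dx js f (x, w)) (at 0)"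
    by (simp add: DERIV_def)
   from filterlim_compose[OF this h_lim] show ?thesis
    using True by (simp add: limI)
  qed (auto simp: dx_def)
 qed auto
qed

lemma borel_measurable_dx:
 assumes "f \<in> mgug_D js n"
 shows "dx js f \<in> borel_measurable (MB :: 'k::finite prelaakso measure)"
proof (rule borel_measurable_MB_trunc)
 show "(\<lambda>x. dx js f (x, v)) \<in> borel_measurable MI" for v :: "'k \<Rightarrow> nat \<Rightarrow> bool"
  using dx_line_measurable[OF assms, of v] by (intro measurable_restrict_space1) simp
 show "dx js f (x, w) = dx js f (x, trunc n w)" for x and w :: "'k \<Rightarrow> nat \<Rightarrow> bool"
  by (rule dx_trunc[OF assms])
qed

text \<open>Continuity together with a derivative off a finite set yields the fundamental theorem
  for the gauge integral; integrability identifies this integral with the Lebesgue integral.\<close>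

lemma dx_ftc:
 fixes w :: "'k::finite \<Rightarrow> nat \<Rightarrow> bool"
 assumes f: "f \<in> mgug_D js n" and "a \<le> b" and "{a..b} \<subseteq> {0..1}"
  and int: "integrable lborel (\<lambda>x. indicator {a..b} x *\<^sub>R dx js f (x, w))"
 shows "f (io (b, w)) - f (io (a, w)) = (\<integral>x. indicator {a..b} x *\<^sub>R dx js f (x, w) \<partial>lborel)"
proof (rule has_integral_unique)
 let ?G = "\<lambda>x. indicator {a..b} x *\<^sub>R dx js f (x, w)"
 obtain Z where Z: "finite Z"
   "\<And>x w. x \<in> {0..1} - Z \<Longrightarrow> ((\<lambda>y. f (io (y, w))) has_real_derivative dx js f (x, w)) (at x)"
  using mgug_D_differentiable[OF f] by metis
 show "((\<lambda>x. dx js f (x, w)) has_integral f (io (b, w)) - f (io (a, w))) {a..b}"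
 proof (rule fundamental_theorem_of_calculus_interior_strong[OF Z(1) assms(2)])
  show "continuous_on {a..b} (\<lambda>x. f (io (x, w)))"
   by (rule continuous_on_subset[OF mgug_D_line_continuous[OF f] assms(3)])
  fix x assume "x \<in> {a<..<b} - Z"
  then have "x \<in> {0..1} - Z"
   using assms(3) by (auto simp: subset_iff)
  from Z(2)[OF this] show "((\<lambda>x. f (io (x, w))) has_vector_derivative dx js f (x, w)) (at x)"
   by (simp add: has_real_derivative_iff_has_vector_derivative)
 qed
 have "(\<lambda>x. if x \<in> {a..b} then dx js f (x, w) else 0) = ?G" by (auto simp: fun_eq_iff)
 then show "((\<lambda>x. dx js f (x, w)) has_integral (\<integral>x. ?G x \<partial>lborel)) {a..b}"
  using has_integral_integral_lborel[OF int] has_integral_restrict_UNIV[of "{a..b}" "\<lambda>x. dx js f (x, w)"]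
  by simp
qed

lemma dx_ac:
 fixes w :: "'k::finite \<Rightarrow> nat \<Rightarrow> bool"
 assumes f: "f \<in> mgug_D js n" and "a \<le> b" and "{a..b} \<subseteq> {0..1}"
 shows "ennreal \<bar>f (io (b, w)) - f (io (a, w))\<bar> \<le> (\<integral>\<^sup>+x\<in>{a..b}. ennreal \<bar>dx js f (x, w)\<bar> \<partial>lborel)"
proof (cases "(\<integral>\<^sup>+x\<in>{a..b}. ennreal \<bar>dx js f (x, w)\<bar> \<partial>lborel) = \<infinity>")
 case False
 note [measurable] = dx_line_measurable[OF f, of w]
 let ?G = "\<lambda>x. indicator {a..b} x *\<^sub>R dx js f (x, w)"
 have nn: "(\<integral>\<^sup>+x. ennreal (norm (?G x)) \<partial>lborel) = (\<integral>\<^sup>+x\<in>{a..b}. ennreal \<bar>dx js f (x, w)\<bar> \<partial>lborel)"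
  by (intro nn_integral_cong) (simp add: indicator_def)
 have int: "integrable lborel ?G"
  using False by (intro integrableI_bounded) (simp_all only: nn, simp_all add: less_top)
 have "ennreal \<bar>f (io (b, w)) - f (io (a, w))\<bar> = ennreal (norm (\<integral>x. ?G x \<partial>lborel))"
  using dx_ftc[OF assms int] by simp
 also have "\<dots> \<le> (\<integral>\<^sup>+x. ennreal (norm (?G x)) \<partial>lborel)"
  using integral_norm_bound_ennreal[OF int] .
 finally show ?thesis
  unfolding nn .
qed simp

text \<open>An upper gradient has to be a function on the quotient. Over \<open>Z\<close>, which
  contains \<open>L n\<close>, the value \<open>0\<close> is taken; elsewhere identified points
  share their first \<open>n\<close> digits and hence the derivative.\<close>

lemma gen_upper_gradient_dx:
 fixes f :: "'k::finite laakso_point \<Rightarrow> real"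
 assumes f: "f \<in> mgug_D js n"
 obtains p where "gen_upper_gradient js f p" "AE q in MB. p (io q) = ennreal \<bar>dx js f q\<bar>"
proof -
 obtain Z where Z: "finite Z" "{0, 1} \<subseteq> Z" "L n \<subseteq> Z"
   "\<And>x w. x \<in> {0..1} - Z \<Longrightarrow> ((\<lambda>y. f (io (y, w))) has_real_derivative dx js f (x, w)) (at x)"
  using mgug_D_differentiable[OF f] by metis
 let ?h = "\<lambda>(x, w). if x \<in> {0..1} - Z then ennreal \<bar>dx js f (x, w)\<bar> else 0"
 define p where "p = lift ?h"
 have p_io: "p (io q) = ?h q" for q :: "'k prelaakso"
  unfolding p_def
 proof (rule lift_io)
  fix x and w w' :: "'k \<Rightarrow> nat \<Rightarrow> bool" assume "glued x w w'"
  then have "io (x, w) = io (x, w')" by (simp add: io_eq_iff)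
  then have "x \<notin> Z \<Longrightarrow> agree n w w'"
   using Z(3) by (intro io_eq_imp_agree) auto
  then show "?h (x, w) = ?h (x, w')"
   using dx_agree[OF f, of w w' x] by auto
 qed
 have "gen_upper_gradient js f p"
 proof (rule gen_upper_gradientI[OF Z(1,3) mgug_D_continuous[OF f]])
  show "f (io (x, w)) = f (io (x, trunc n w))" if "x \<in> {0..1}" for x w by (rule mgug_D_trunc[OF f that])
  show "p (io (x, w)) = p (io (x, trunc n w))" for x w
   using dx_trunc[OF f, of x w] by (simp add: p_io)
  show "ennreal \<bar>f (io (b, w)) - f (io (a, w))\<bar> \<le> (\<integral>\<^sup>+x\<in>{a..b}. p (io (x, w)) \<partial>lborel)"
   if ab: "a \<le> b" "{a..b} \<subseteq> {0..1} - Z" for a b w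
  proof -
   have "ennreal \<bar>f (io (b, w)) - f (io (a, w))\<bar> \<le> (\<integral>\<^sup>+x\<in>{a..b}. ennreal \<bar>dx js f (x, w)\<bar> \<partial>lborel)"
    using ab by (intro dx_ac[OF f]) auto
   also have "\<dots> = (\<integral>\<^sup>+x\<in>{a..b}. p (io (x, w)) \<partial>lborel)"
    using ab(2) by (intro nn_integral_cong) (auto simp: p_io indicator_def subset_iff)
   finally show ?thesis .
  qed
  show "p \<in> borel_measurable (\<mu>)"
  proof -
   let ?P = "\<lambda>v. io ` {(x, w). x \<in> {0..1} \<and> x \<notin> Z \<and> agree n v w}"
   have [measurable]: "?P v \<in> sets (\<mu>)" for v by (intro openin_sets_laakso openin_word Z)
   have [measurable]: "xcoord \<in> \<mu> \<rightarrow>\<^sub>M borel"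
    by (rule borel_measurable_continuous_laakso[OF continuous_xcoord])
   note [measurable] = dx_line_measurable[OF f]
   \<comment> \<open>On the open set \<open>?P v\<close> the first \<open>n\<close> digits are those
     of \<open>v\<close>, so on the quotient \<open>p\<close> is a finite sum of functions of the
     \<open>x\<close>-coordinate.\<close>
   have "(\<lambda>s. \<Sum>v\<in>range (trunc n). indicator (?P v) s * ennreal \<bar>dx js f (xcoord s, v)\<bar>) \<in> borel_measurable (\<mu>)"
    by measurable
   also have "?this \<longleftrightarrow> p \<in> borel_measurable (\<mu>)"
   proof (rule measurable_cong)
    fix s :: "'k laakso_point" assume "s \<in> space (\<mu>)"
    then obtain x w where s: "s = io (x, w)" "x \<in> {0..1}" by (metis laakso_space_cases space_laakso_measure)
    have P_iff: "s \<in> ?P v \<longleftrightarrow> x \<notin> Z \<and> v = trunc n w" if v: "v \<in> range (trunc n)" for v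
    proof
     assume "s \<in> ?P v"
     then obtain x' w' where *: "io (x, w) = io (x', w')" "x' \<notin> Z" "agree n v w'"
      using s by auto
     have "x = x'"
      using *(1) by (simp add: io_eq_iff)
     then have "agree n w w'"
      using * Z(3) by (intro io_eq_imp_agree[of x]) auto
     then have "trunc n w = trunc n v"
      using *(3) by (simp add: trunc_eq_iff[symmetric])
     moreover have "trunc n v = v"
      using v by auto
     ultimately show "x \<notin> Z \<and> v = trunc n w"
      using * \<open>x = x'\<close> by simp
    next
     assume "x \<notin> Z \<and> v = trunc n w"
     then have "(x, w) \<in> {(x, w). x \<in> {0..1} \<and> x \<notin> Z \<and> agree n v w}"
      using s(2) agree_trunc(2)[of n w] by simp
     then show "s \<in> ?P v"
      unfolding s(1) by (rule imageI)
    qed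
    have "(\<Sum>v\<in>range (trunc n). indicator (?P v) s * ennreal \<bar>dx js f (xcoord s, v)\<bar>) =
      (\<Sum>v\<in>range (trunc n). if v = trunc n w then ?h (x, w) else 0)"
    proof (rule sum.cong[OF refl])
     fix v :: "'k \<Rightarrow> nat \<Rightarrow> bool" assume v: "v \<in> range (trunc n)"
     show "indicator (?P v) s * ennreal \<bar>dx js f (xcoord s, v)\<bar> = (if v = trunc n w then ?h (x, w) else 0)"
     proof (cases "s \<in> ?P v")
      case True
      then have "x \<notin> Z" "v = trunc n w"
       using P_iff[OF v] by auto
      moreover have "indicator (?P v) s = (1 :: ennreal)"
       using True by (rule indicator_simps)
      ultimately show ?thesis
       using s dx_trunc[OF f, of x w] by simp
     next
      case False
      then have "indicator (?P v) s = (0 :: ennreal)" by (rule indicator_simps)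
      then show ?thesis
       using False P_iff[OF v] by auto
     qed
    qed
    also have "\<dots> = p s" by (simp add: sum.delta[OF finite_range_trunc] s(1) p_io)
    finally show "(\<Sum>v\<in>range (trunc n). indicator (?P v) s * ennreal \<bar>dx js f (xcoord s, v)\<bar>) = p s" .
   qed
   finally show ?thesis .
  qed
 qed
 moreover have "AE q in MB. p (io q) = ennreal \<bar>dx js f q\<bar>"
  using AE_MB_fst_notin[OF Z(1)]
 proof (rule AE_mp, intro AE_I2 impI)
  fix q :: "'k prelaakso" assume "q \<in> space MB" "fst q \<notin> Z"
  then show "p (io q) = ennreal \<bar>dx js f q\<bar>" by (cases q) (simp add: p_io)
 qed
 ultimately show ?thesis by (rule that)
qed

section \<open>Upper gradients on lines; the minimal upper gradient\<close>

lemma path_length_line: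
 fixes w :: "'k::finite \<Rightarrow> nat \<Rightarrow> bool"
 assumes "0 \<le> a" "a \<le> b" "b \<le> 1" "t \<in> {0..1}"
 shows "path_length (laakso_dist js) (\<lambda>t. io (a + t * (b - a), w)) 0 t = ennreal (t * (b - a))"
proof (rule antisym)
 have dist: "laakso_dist js (io (a + s * (b - a), w)) (io (a + r * (b - a), w)) = (r - s) * (b - a)"
  if "s \<in> {0..1}" "r \<in> {0..1}" "s \<le> r" for s r
 proof -
  have in01: "a + u * (b - a) \<in> {0..1}" if "u \<in> {0..1}" for u
   using mult_right_mono[of u 1 "b - a"] that assms by auto
  have "laakso_dist js (io (a + s * (b - a), w)) (io (a + r * (b - a), w)) = \<bar>(s - r) * (b - a)\<bar>"
   using dist_line[OF in01[OF that(1)] in01[OF that(2)]] by (simp add: algebra_simps)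
  also have "\<dots> = (r - s) * (b - a)"
   using that(3) assms by (simp add: abs_mult)
  finally show ?thesis .
 qed
 show "path_length (laakso_dist js) (\<lambda>t. io (a + t * (b - a), w)) 0 t \<le> ennreal (t * (b - a))"
  unfolding path_length_def
 proof (rule SUP_least, clarify)
  fix N and \<tau> :: "nat \<Rightarrow> real" assume \<tau>: "mono_on {..N} \<tau>" "\<tau> ` {..N} \<subseteq> {0..t}"
  have in_t: "\<tau> i \<in> {0..t}" if "i \<le> N" for i
   using \<tau>(2) that by auto
  have mono: "\<tau> i \<le> \<tau> (Suc i)" if "i < N" for i
   using that by (intro mono_onD[OF \<tau>(1)]) auto
  have "(\<Sum>i<N. ennreal (laakso_dist js (io (a + \<tau> i * (b - a), w)) (io (a + \<tau> (Suc i) * (b - a), w)))) =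
    (\<Sum>i<N. ennreal ((\<tau> (Suc i) - \<tau> i) * (b - a)))"
  proof (rule sum.cong[OF refl])
   fix i assume "i \<in> {..<N}"
   then show "ennreal (laakso_dist js (io (a + \<tau> i * (b - a), w)) (io (a + \<tau> (Suc i) * (b - a), w))) =
     ennreal ((\<tau> (Suc i) - \<tau> i) * (b - a))"
    using dist[of "\<tau> i" "\<tau> (Suc i)"] in_t[of i] in_t[of "Suc i"] mono[of i] assms(4) by simp
  qed
  also have "\<dots> = ennreal (\<Sum>i<N. (\<tau> (Suc i) - \<tau> i) * (b - a))"
   using mono assms by (intro sum_ennreal) simp
  also have "(\<Sum>i<N. (\<tau> (Suc i) - \<tau> i) * (b - a)) = (\<tau> N - \<tau> 0) * (b - a)"
   by (simp add: sum_distrib_right[symmetric] sum_lessThan_telescope)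
  also have "ennreal \<dots> \<le> ennreal (t * (b - a))"
   using in_t[of 0] in_t[of N] assms by (intro ennreal_leI mult_right_mono) auto
  finally show "(\<Sum>i<N. ennreal (laakso_dist js (io (a + \<tau> i * (b - a), w)) (io (a + \<tau> (Suc i) * (b - a), w))))
    \<le> ennreal (t * (b - a))" .
 qed
 have "path_length (laakso_dist js) (\<lambda>t. io (a + t * (b - a), w)) 0 0 +
   ennreal (laakso_dist js (io (a + 0 * (b - a), w)) (io (a + t * (b - a), w))) \<le>
   path_length (laakso_dist js) (\<lambda>t. io (a + t * (b - a), w)) 0 t"
  using assms by (intro path_length_step) auto
 moreover have "laakso_dist js (io (a + 0 * (b - a), w)) (io (a + t * (b - a), w)) = t * (b - a)"
  using dist[of 0 t] assms(4) by simp
 ultimately show "ennreal (t * (b - a)) \<le> path_length (laakso_dist js) (\<lambda>t. io (a + t * (b - a), w)) 0 t"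
  by (simp only:) (erule order_trans[rotated], simp)
qed

lemma borel_measurable_line:
 fixes q :: "'k::finite laakso_point \<Rightarrow> ennreal"
 assumes "q \<in> borel_measurable (\<mu>)"
 shows "(\<lambda>x. q (io (x, w))) \<in> borel_measurable MI"
  and "(\<lambda>x. q (io (x, w)) * indicator {0..1} x) \<in> borel_measurable borel"
proof -
 have "(\<lambda>x. (x, w)) \<in> MI \<rightarrow>\<^sub>M MB"
  unfolding MB_def by measurable
 from measurable_compose[OF measurable_compose[OF this measurable_proj] assms]
 show *: "(\<lambda>x. q (io (x, w))) \<in> borel_measurable MI" .
 then have "(\<lambda>x. q (io (x, w)) * indicator {0..1} x) \<in> borel_measurable lborel"
  by (subst (asm) borel_measurable_restrict_space_iff_ennreal) auto
 then show "(\<lambda>x. q (io (x, w)) * indicator {0..1} x) \<in> borel_measurable borel" by simp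
qed

text \<open>On a line arc length is \<open>t * (b - a)\<close>, which is injective for
  \<open>a < b\<close>; the choice in \<open>arc_param\<close> is therefore forced, and the line
  integral is an ordinary integral.\<close>

lemma upper_gradient_line:
 fixes f :: "'k::finite laakso_point \<Rightarrow> real"
 assumes q: "gen_upper_gradient js f q" and ab: "0 \<le> a" "a \<le> b" "b \<le> 1"
 shows "ennreal \<bar>f (io (b, w)) - f (io (a, w))\<bar> \<le> (\<integral>\<^sup>+x\<in>{a..b}. q (io (x, w)) \<partial>lborel)"
proof (cases "a = b")
 case False
 let ?\<gamma> = "\<lambda>t. io (a + t * (b - a), w)" and ?\<delta> = "laakso_dist js :: 'k laakso_point \<Rightarrow> _"
 note len = path_length_line[OF ab, of _ w]
 have "pathin (laakso_topology js) ?\<gamma>"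
  using ab by (intro pathin_line) auto
 moreover have "path_length ?\<delta> ?\<gamma> 0 1 < \<infinity>"
  using len[of 1] by simp
 ultimately have "ennreal \<bar>f (?\<gamma> 0) - f (?\<gamma> 1)\<bar> \<le> line_integral ?\<delta> ?\<gamma> q"
  using q unfolding gen_upper_gradient_def by blast
 then have "ennreal \<bar>f (io (b, w)) - f (io (a, w))\<bar> \<le> line_integral ?\<delta> ?\<gamma> q"
  by (simp add: abs_minus_commute)
 also have "\<dots> = (\<integral>\<^sup>+s\<in>{0..b - a}. q (io (a + s, w)) \<partial>lborel)"
  unfolding line_integral_def
 proof (rule nn_integral_cong)
  fix s
  have end1: "enn2real (path_length ?\<delta> ?\<gamma> 0 1) = b - a"
   using len[of 1] ab by simp
  show "q (arc_param ?\<delta> ?\<gamma> s) * indicator {0..enn2real (path_length ?\<delta> ?\<gamma> 0 1)} s =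
    q (io (a + s, w)) * indicator {0..b - a} s"
  proof (cases "s \<in> {0..b - a}")
   case True
   let ?t = "SOME t. t \<in> {0..1} \<and> path_length ?\<delta> ?\<gamma> 0 t = ennreal s"
   have "s / (b - a) \<in> {0..1}"
    using True False ab by (simp add: field_simps)
   then have "s / (b - a) \<in> {0..1} \<and> path_length ?\<delta> ?\<gamma> 0 (s / (b - a)) = ennreal s"
    using False by (simp add: len)
   then have t: "?t \<in> {0..1} \<and> path_length ?\<delta> ?\<gamma> 0 ?t = ennreal s" by (rule someI)
   then have "ennreal (?t * (b - a)) = ennreal s"
    using len[of ?t] by simp
   then have "?t * (b - a) = s"
    using t True ab by (subst (asm) ennreal_inj) auto
   then have "arc_param ?\<delta> ?\<gamma> s = io (a + s, w)" by (simp add: arc_param_def)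
   then show ?thesis by (simp add: end1)
  qed (simp add: end1)
 qed
 also have "\<dots> = (\<integral>\<^sup>+x\<in>{a..b}. q (io (x, w)) \<partial>lborel)"
 proof -
  have q_meas: "q \<in> borel_measurable (\<mu>)"
   using q by (simp add: gen_upper_gradient_def)
  let ?h = "\<lambda>x. q (io (x, w)) * indicator {0..1} x * indicator {a..b} x"
  have "?h \<in> borel_measurable borel"
   using borel_measurable_line(2)[OF q_meas, of w] by measurable
  from nn_integral_real_affine[OF this, of 1 a]
  have "(\<integral>\<^sup>+x. ?h x \<partial>lborel) = (\<integral>\<^sup>+s. ?h (a + s) \<partial>lborel)"
   by simp
  moreover have "?h x = q (io (x, w)) * indicator {a..b} x" for x
   using ab by (auto simp: indicator_def)
  moreover have "?h (a + s) = q (io (a + s, w)) * indicator {0..b - a} s" for s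
   using ab by (auto simp: indicator_def)
  ultimately show ?thesis by (simp only:)
 qed
 finally show ?thesis .
qed simp

text \<open>The two cases of the definition meet: an upper gradient bounds the derivative almost everywhere
 because of the lines, and the derivative itself is an upper gradient.\<close>

lemma upper_gradient_ge_dx:
 fixes f :: "'k::finite laakso_point \<Rightarrow> real"
 assumes f: "f \<in> mgug_D js n" and q: "gen_upper_gradient js f q"
  and q2: "(\<integral>\<^sup>+s. (q s)\<^sup>2 \<partial>\<mu>) < \<infinity>"
 shows "AE p in MB. ennreal \<bar>dx js f p\<bar> \<le> q (io p)"
proof -
 have q_meas: "q \<in> borel_measurable (\<mu>)"
  using q by (simp add: gen_upper_gradient_def)
 have q_io [measurable]: "(\<lambda>p. q (io p)) \<in> borel_measurable MB"
  using measurable_compose[OF measurable_proj q_meas] .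
 note [measurable] = borel_measurable_dx[OF f]
 obtain Z where Z: "finite Z"
   "\<And>x w. x \<in> {0..1} - Z \<Longrightarrow> ((\<lambda>y. f (io (y, w))) has_real_derivative dx js f (x, w)) (at x)"
  using mgug_D_differentiable[OF f] by metis
 have "(\<integral>\<^sup>+p. (q (io p))\<^sup>2 \<partial>MB) < \<infinity>"
  using q2 q_meas by (subst (asm) nn_integral_laakso) auto
 then have fin: "(\<integral>\<^sup>+w. \<integral>\<^sup>+x. (q (io (x, w)))\<^sup>2 \<partial>MI \<partial>MK) \<noteq> \<infinity>"
  by (subst (asm) nn_integral_MB) auto
 \<comment> \<open>By Tonelli the upper gradient is square-integrable along almost every line; only
   these lines are considered.\<close>
 have "(\<lambda>w. \<integral>\<^sup>+x. (q (io (x, w)))\<^sup>2 \<partial>MI) \<in> borel_measurable MK"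
 proof (rule MI.borel_measurable_nn_integral)
  have "(\<lambda>z. (snd z, fst z)) \<in> MK \<Otimes>\<^sub>M MI \<rightarrow>\<^sub>M MB"
   unfolding MB_def by (rule measurable_Pair[OF measurable_snd measurable_fst])
  from measurable_compose[OF this q_io]
  show "(\<lambda>(w, x). (q (io (x, w)))\<^sup>2) \<in> borel_measurable (MK \<Otimes>\<^sub>M MI)"
   unfolding case_prod_beta by simp
 qed
 then have AEw: "AE w in MK. (\<integral>\<^sup>+x. (q (io (x, w)))\<^sup>2 \<partial>MI) \<noteq> \<infinity>"
  using fin by (rule nn_integral_PInf_AE)
 have line: "AE x in MI. ennreal \<bar>dx js f (x, w)\<bar> \<le> q (io (x, w))"
  if w: "(\<integral>\<^sup>+x. (q (io (x, w)))\<^sup>2 \<partial>MI) \<noteq> \<infinity>" for w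
 proof -
  let ?G = "\<lambda>x. q (io (x, w)) * indicator {0..1} x"
  note m = borel_measurable_line[OF q_meas, of w]
  \<comment> \<open>On the unit interval this turns square-integrability into the integrability
    required by \<open>AE_gradient_le\<close>.\<close>
  have sq: "c \<le> 1 + c\<^sup>2" for c :: ennreal
  proof (cases c)
   case (real r)
   have "r \<le> 1 + r\<^sup>2"
    using zero_le_power2[of "r - 1"] real(1) by (simp add: power2_diff)
   then show ?thesis
    using real by (simp add: ennreal_power flip: ennreal_plus ennreal_1)
  qed (simp add: ennreal_top_mult power2_eq_square)
  have "(\<integral>\<^sup>+x\<in>{0..1}. ?G x \<partial>lborel) = (\<integral>\<^sup>+x. q (io (x, w)) \<partial>MI)"
   by (subst nn_integral_restrict_space) (auto intro!: nn_integral_cong simp: indicator_def)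
  also have "\<dots> \<le> (\<integral>\<^sup>+x. 1 + (q (io (x, w)))\<^sup>2 \<partial>MI)"
   by (intro nn_integral_mono sq)
  also have "\<dots> = 1 + (\<integral>\<^sup>+x. (q (io (x, w)))\<^sup>2 \<partial>MI)"
   using m(1) MI.emeasure_space_1 by (subst nn_integral_add) auto
  also have "\<dots> < \<infinity>"
   using w by (simp add: less_top)
  finally have G_fin: "(\<integral>\<^sup>+x\<in>{0..1}. ?G x \<partial>lborel) < \<infinity>" .
  define g where "g x = f (io (max 0 (min 1 x), w))" for x
  have "AE x in MI. ennreal \<bar>dx js f (x, w)\<bar> \<le> ?G x"
  proof (rule AE_gradient_le[OF _ m(2) Z(1) _ dx_line_measurable[OF f] _ G_fin])
   show "continuous_on UNIV g"
    unfolding g_def by (rule continuous_on_compose2[OF mgug_D_line_continuous[OF f]]) (auto intro!: continuous_intros)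
   show "(g has_real_derivative dx js f (x, w)) (at x)" if x: "x \<in> {0<..<1} - Z" for x
   proof -
    have "((\<lambda>y. f (io (y, w))) has_real_derivative dx js f (x, w)) (at x)"
     using Z(2) x by auto
    then show ?thesis
     by (rule has_field_derivative_transform_within_open[of _ _ _ "{0<..<1}"]) (use x in \<open>auto simp: g_def\<close>)
   qed
   show "ennreal \<bar>g b - g a\<bar> \<le> (\<integral>\<^sup>+x\<in>{a..b}. ?G x \<partial>lborel)" if ab: "a \<le> b" "{a..b} \<subseteq> {0..1}" for a b
   proof -
    have "0 \<le> a" "b \<le> 1"
     using ab by auto
    then have "ennreal \<bar>g b - g a\<bar> \<le> (\<integral>\<^sup>+x\<in>{a..b}. q (io (x, w)) \<partial>lborel)"
     using upper_gradient_line[OF q, of a b w] ab(1) by (simp add: g_def)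
    also have "\<dots> = (\<integral>\<^sup>+x\<in>{a..b}. ?G x \<partial>lborel)"
     using \<open>0 \<le> a\<close> \<open>b \<le> 1\<close> by (intro nn_integral_cong) (auto simp: indicator_def)
    finally show ?thesis .
   qed
  qed
  then show ?thesis by (rule AE_mp) (auto intro!: AE_I2)
 qed
 \<comment> \<open>The exceptional set is measurable on the base, so it is null as soon as almost
   all of its sections are.\<close>
 define B where "B = {p \<in> space MB. \<not> ennreal \<bar>dx js f p\<bar> \<le> q (io p)}"
 have B [measurable]: "B \<in> sets MB"
  unfolding B_def by measurable
 have "emeasure MB B = (\<integral>\<^sup>+p. indicator B p \<partial>MB)" by simp
 also have "\<dots> = (\<integral>\<^sup>+w. \<integral>\<^sup>+x. indicator B (x, w) \<partial>MI \<partial>MK)"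
  by (rule nn_integral_MB) measurable
 also have "\<dots> = (\<integral>\<^sup>+w. 0 \<partial>(MK :: ('k \<Rightarrow> nat \<Rightarrow> bool) measure))"
 proof (rule nn_integral_cong_AE, use AEw in eventually_elim)
  fix w assume "(\<integral>\<^sup>+x. (q (io (x, w)))\<^sup>2 \<partial>MI) \<noteq> \<infinity>"
  from line[OF this] have "AE x in MI. indicator B (x, w) = (0 :: ennreal)" by eventually_elim (simp add: B_def)
  then show "(\<integral>\<^sup>+x. indicator B (x, w) \<partial>MI) = 0"
   by (subst nn_integral_cong_AE[where v = "\<lambda>_. 0"]) simp_all
 qed
 finally have "emeasure MB B = 0" by simp
 then show ?thesis
  using B by (intro AE_I[of _ _ B]) (auto simp: B_def[symmetric], auto simp: B_def)
qed

text \<open>Lines bound \<open>p\<close> from below. From above, minimality is tested against a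
  representative of \<open>\<bar>dx js f\<bar>\<close> on the quotient, which is square-integrable
  because it lies below \<open>p\<close>.\<close>

lemma min_upper_gradient_AE:
 fixes f :: "'k::finite laakso_point \<Rightarrow> real"
 assumes f: "f \<in> mgug_D js n" and p: "min_upper_gradient js f p"
 shows "AE q in MB. p (io q) = ennreal \<bar>dx js f q\<bar>"
proof -
 have p1: "gen_upper_gradient js f p" "(\<integral>\<^sup>+s. (p s)\<^sup>2 \<partial>\<mu>) < \<infinity>"
  and min: "\<And>q. gen_upper_gradient js f q \<Longrightarrow> (\<integral>\<^sup>+s. (q s)\<^sup>2 \<partial>\<mu>) < \<infinity> \<Longrightarrow>
   AE s in \<mu>. p s \<le> q s"
  using p by (auto simp: min_upper_gradient_def)
 have ge: "AE q in MB. ennreal \<bar>dx js f q\<bar> \<le> p (io q)" by (rule upper_gradient_ge_dx[OF f p1])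
 obtain p' where p': "gen_upper_gradient js f p'" "AE q in MB. p' (io q) = ennreal \<bar>dx js f q\<bar>"
  by (rule gen_upper_gradient_dx[OF f])
 have meas: "p \<in> borel_measurable (\<mu>)" "p' \<in> borel_measurable (\<mu>)"
  using p1 p' by (auto simp: gen_upper_gradient_def)
 have "(\<integral>\<^sup>+s. (p' s)\<^sup>2 \<partial>\<mu>) = (\<integral>\<^sup>+q. (p' (io q))\<^sup>2 \<partial>MB)"
  using meas by (intro nn_integral_laakso) auto
 also have "\<dots> \<le> (\<integral>\<^sup>+q. (p (io q))\<^sup>2 \<partial>MB)"
 proof (rule nn_integral_mono_AE)
  show "AE q in MB. (p' (io q))\<^sup>2 \<le> (p (io q))\<^sup>2"
   using ge p'(2) by eventually_elim (simp add: power_mono)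
 qed
 also have "\<dots> = (\<integral>\<^sup>+s. (p s)\<^sup>2 \<partial>\<mu>)"
  using meas by (intro nn_integral_laakso[symmetric]) auto
 finally have "AE s in \<mu>. p s \<le> p' s"
  using p1(2) p'(1) by (intro min) (auto intro: le_less_trans)
 from AE_laakso_imp[OF this] ge p'(2) show ?thesis by eventually_elim auto
qed

text \<open>The derivative is the only candidate, so existence comes down to finite energy; the core
  thus consists of the functions of finite energy in some \<open>mgug_D js n\<close>.\<close>

lemma ex_min_upper_gradient_iff:
 fixes f :: "'k::finite laakso_point \<Rightarrow> real"
 assumes f: "f \<in> mgug_D js n"
 shows "(\<exists>p. min_upper_gradient js f p) \<longleftrightarrow> integrable MB (\<lambda>q. (dx js f q)\<^sup>2)"
proof -
 note [measurable] = borel_measurable_dx[OF f]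
 have fin: "integrable MB (\<lambda>q. (dx js f q)\<^sup>2) \<longleftrightarrow> (\<integral>\<^sup>+q. (ennreal \<bar>dx js f q\<bar>)\<^sup>2 \<partial>MB) < \<infinity>"
  by (simp add: integrable_iff_bounded ennreal_power)
 show ?thesis
 proof
  assume "\<exists>p. min_upper_gradient js f p"
  then obtain p where p: "min_upper_gradient js f p" by blast
  then have p_meas: "p \<in> borel_measurable (\<mu>)" and "(\<integral>\<^sup>+s. (p s)\<^sup>2 \<partial>\<mu>) < \<infinity>"
   by (auto simp: min_upper_gradient_def gen_upper_gradient_def)
  then have "(\<integral>\<^sup>+q. (p (io q))\<^sup>2 \<partial>MB) < \<infinity>"
   by (subst (asm) nn_integral_laakso) auto
  also have "(\<integral>\<^sup>+q. (p (io q))\<^sup>2 \<partial>MB) = (\<integral>\<^sup>+q. (ennreal \<bar>dx js f q\<bar>)\<^sup>2 \<partial>MB)"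
   using min_upper_gradient_AE[OF f p] by (intro nn_integral_cong_AE) (auto elim!: eventually_mono)
  finally show "integrable MB (\<lambda>q. (dx js f q)\<^sup>2)"
   using fin by simp
 next
  assume "integrable MB (\<lambda>q. (dx js f q)\<^sup>2)"
  obtain p where p: "gen_upper_gradient js f p" "AE q in MB. p (io q) = ennreal \<bar>dx js f q\<bar>"
   by (rule gen_upper_gradient_dx[OF f])
  have p_meas: "p \<in> borel_measurable (\<mu>)"
   using p by (auto simp: gen_upper_gradient_def)
  have "(\<integral>\<^sup>+s. (p s)\<^sup>2 \<partial>\<mu>) = (\<integral>\<^sup>+q. (p (io q))\<^sup>2 \<partial>MB)"
   using p_meas by (intro nn_integral_laakso) auto
  also have "\<dots> = (\<integral>\<^sup>+q. (ennreal \<bar>dx js f q\<bar>)\<^sup>2 \<partial>MB)"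
   using p(2) by (intro nn_integral_cong_AE) (auto elim!: eventually_mono)
  also have "\<dots> < \<infinity>"
   using fin \<open>integrable MB (\<lambda>q. (dx js f q)\<^sup>2)\<close> by simp
  finally have fin_p: "(\<integral>\<^sup>+s. (p s)\<^sup>2 \<partial>\<mu>) < \<infinity>" .
  have "AE s in \<mu>. p s \<le> q s"
   if q: "gen_upper_gradient js f q" "(\<integral>\<^sup>+s. (q s)\<^sup>2 \<partial>\<mu>) < \<infinity>" for q
  proof -
   have [measurable]: "q \<in> borel_measurable (\<mu>)" "p \<in> borel_measurable (\<mu>)"
    using q p_meas by (auto simp: gen_upper_gradient_def)
   have "{s \<in> space (\<mu>). p s \<le> q s} \<in> sets (\<mu>)" by measurable
   then have "(AE s in \<mu>. p s \<le> q s) \<longleftrightarrow> (AE r in MB. p (io r) \<le> q (io r))"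
    by (intro AE_laakso_iff) simp
   moreover have "AE r in MB. p (io r) \<le> q (io r)"
    using upper_gradient_ge_dx[OF f q] p(2) by eventually_elim simp
   ultimately show ?thesis by simp
  qed
  then show "\<exists>p. min_upper_gradient js f p"
   unfolding min_upper_gradient_def using p(1) fin_p by blast
 qed
qed

lemma mem_mgug_core:
 "f \<in> mgug_core js \<longleftrightarrow> (\<exists>n. f \<in> mgug_D js n) \<and> integrable (MB :: 'k::finite prelaakso measure) (\<lambda>q. (dx js f q)\<^sup>2)"
 using ex_min_upper_gradient_iff unfolding mgug_core_def by blast

text \<open>The chosen gradient is determined almost everywhere, so the choice does not affect the
  integral.\<close>

lemma grad_energy_core:
 fixes f :: "'k::finite laakso_point \<Rightarrow> real"
 assumes "f \<in> mgug_core js"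
 shows "grad_energy js f = (\<integral>q. (dx js f q)\<^sup>2 \<partial>MB)"
proof -
 obtain n where f: "f \<in> mgug_D js n"
  using assms by (auto simp: mgug_core_def)
 define p where "p = (SOME p. min_upper_gradient js f p)"
 have "\<exists>p. min_upper_gradient js f p"
  using assms by (auto simp: mgug_core_def)
 then have p: "min_upper_gradient js f p"
  unfolding p_def by (rule someI_ex)
 have "(\<integral>\<^sup>+s. (p s)\<^sup>2 \<partial>\<mu>) = (\<integral>\<^sup>+q. (p (io q))\<^sup>2 \<partial>MB)"
  using p by (intro nn_integral_laakso) (auto simp: min_upper_gradient_def gen_upper_gradient_def)
 also have "\<dots> = (\<integral>\<^sup>+q. ennreal ((dx js f q)\<^sup>2) \<partial>MB)"
  using min_upper_gradient_AE[OF f p]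
  by (intro nn_integral_cong_AE) (auto elim!: eventually_mono simp: ennreal_power)
 finally show ?thesis
  using borel_measurable_dx[OF f] by (simp add: grad_energy_def p_def[symmetric] integral_eq_nn_integral)
qed

end

section \<open>Square-integrable functions\<close>

lemma l2I: "f \<in> borel_measurable M \<Longrightarrow> integrable M (\<lambda>x. (f x)\<^sup>2) \<Longrightarrow> f \<in> l2 M"
 by (simp add: l2_def)

lemma l2D: assumes "f \<in> l2 M" shows "f \<in> borel_measurable M" "integrable M (\<lambda>x. (f x)\<^sup>2)"
 using assms by (simp_all add: l2_def)

lemma l2_sq_eq: "l2_sq M f = (\<integral>x. (f x)\<^sup>2 \<partial>M)"
 by (simp add: l2_sq_def l2_inner_def power2_eq_square)

lemma l2_sq_nonneg [simp]: "0 \<le> l2_sq M f" by (simp add: l2_sq_eq)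

lemma l2_mult_integrable:
 assumes "f \<in> l2 M" "g \<in> l2 M" shows "integrable M (\<lambda>x. f x * g x)"
proof (rule Bochner_Integration.integrable_bound)
 show "integrable M (\<lambda>x. (f x)\<^sup>2 + (g x)\<^sup>2)"
  using assms by (simp add: l2_def)
 have "\<bar>a * b\<bar> \<le> a\<^sup>2 + b\<^sup>2" for a b :: real
 proof -
  have "2 * \<bar>a * b\<bar> \<le> a\<^sup>2 + b\<^sup>2"
   using sum_squares_bound[of "\<bar>a\<bar>" "\<bar>b\<bar>"] by (simp add: abs_mult mult.assoc)
  then show ?thesis
   using abs_ge_zero[of "a * b"] by linarith
 qed
 then show "AE x in M. norm (f x * g x) \<le> norm ((f x)\<^sup>2 + (g x)\<^sup>2)" by (intro AE_I2) simp
qed (use assms in \<open>auto simp: l2_def\<close>)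

lemma l2_bounded_mult:
 assumes "f \<in> l2 M" "h \<in> borel_measurable M" "\<And>x. x \<in> space M \<Longrightarrow> \<bar>h x\<bar> \<le> c"
 shows "(\<lambda>x. h x * f x) \<in> l2 M"
proof (rule l2I)
 show "integrable M (\<lambda>x. (h x * f x)\<^sup>2)"
 proof (rule Bochner_Integration.integrable_bound)
  show "integrable M (\<lambda>x. c\<^sup>2 * (f x)\<^sup>2)"
   using assms by (simp add: l2_def)
  show "AE x in M. norm ((h x * f x)\<^sup>2) \<le> norm (c\<^sup>2 * (f x)\<^sup>2)"
  proof (rule AE_I2)
   fix x assume "x \<in> space M"
   then have "(h x)\<^sup>2 \<le> c\<^sup>2"
    using power_mono[OF assms(3)[OF \<open>x \<in> space M\<close>], of 2] by simp
   then show "norm ((h x * f x)\<^sup>2) \<le> norm (c\<^sup>2 * (f x)\<^sup>2)"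
    by (simp add: power_mult_distrib mult_right_mono)
  qed
 qed (use assms in \<open>auto simp: l2_def\<close>)
qed (use assms in \<open>auto simp: l2_def\<close>)

lemma l2_add [intro]:
 assumes "f \<in> l2 M" "g \<in> l2 M" shows "(\<lambda>x. f x + g x) \<in> l2 M"
proof (rule l2I)
 have "integrable M (\<lambda>x. (f x)\<^sup>2 + (g x)\<^sup>2 + 2 * (f x * g x))"
  using assms l2_mult_integrable[OF assms] by (simp add: l2_def)
 moreover have "(f x + g x)\<^sup>2 = (f x)\<^sup>2 + (g x)\<^sup>2 + 2 * (f x * g x)" for x
  by (simp add: power2_sum)
 ultimately show "integrable M (\<lambda>x. (f x + g x)\<^sup>2)" by simp
qed (use assms in \<open>auto simp: l2_def\<close>)

lemma l2_scale [intro]: "f \<in> l2 M \<Longrightarrow> (\<lambda>x. c * f x) \<in> l2 M"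
 by (auto simp: l2_def power_mult_distrib)

lemma l2_diff [intro]: "f \<in> l2 M \<Longrightarrow> g \<in> l2 M \<Longrightarrow> (\<lambda>x. f x - g x) \<in> l2 M"
 using l2_add[of f M "\<lambda>x. - 1 * g x"] l2_scale[of g M "- 1"] by simp

lemma l2_sq_cong_AE:
 "f \<in> borel_measurable M \<Longrightarrow> g \<in> borel_measurable M \<Longrightarrow> AE x in M. f x = g x \<Longrightarrow> l2_sq M f = l2_sq M g"
 unfolding l2_sq_eq by (intro integral_cong_AE) auto

lemma l2_sq_add_le:
 assumes "f \<in> l2 M" "g \<in> l2 M"
 shows "l2_sq M (\<lambda>x. f x + g x) \<le> 2 * l2_sq M f + 2 * l2_sq M g"
proof -
 have "l2_sq M (\<lambda>x. f x + g x) \<le> (\<integral>x. 2 * (f x)\<^sup>2 + 2 * (g x)\<^sup>2 \<partial>M)"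
  unfolding l2_sq_eq
 proof (rule integral_mono)
  show "(f x + g x)\<^sup>2 \<le> 2 * (f x)\<^sup>2 + 2 * (g x)\<^sup>2" for x
   using sum_squares_bound[of "f x" "g x"] by (simp add: power2_sum)
 qed (use assms l2_add[OF assms] in \<open>auto simp: l2_def\<close>)
 also have "\<dots> = 2 * l2_sq M f + 2 * l2_sq M g"
  using assms by (simp add: l2_sq_eq l2_def)
 finally show ?thesis .
qed

lemma l2_sq_diff_commute: "l2_sq M (\<lambda>x. f x - g x) = l2_sq M (\<lambda>x. g x - f x)"
 by (simp add: l2_sq_eq power2_commute)

lemma l2_sq_triangle:
 assumes "f \<in> l2 M" "g \<in> l2 M" "h \<in> l2 M"
 shows "l2_sq M (\<lambda>x. f x - h x) \<le> 2 * l2_sq M (\<lambda>x. f x - g x) + 2 * l2_sq M (\<lambda>x. g x - h x)"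
 using l2_sq_add_le[OF l2_diff[OF assms(1,2)] l2_diff[OF assms(2,3)]] by simp

lemma l2_cauchy_schwarz:
 assumes "f \<in> l2 M" "g \<in> l2 M"
 shows "(l2_inner M f g)\<^sup>2 \<le> l2_sq M f * l2_sq M g"
proof -
 let ?A = "l2_sq M f" and ?B = "l2_inner M f g" and ?C = "l2_sq M g"
 have quad: "0 \<le> ?A + 2 * t * ?B + t\<^sup>2 * ?C" for t
 proof -
  have "0 \<le> (\<integral>x. (f x + t * g x)\<^sup>2 \<partial>M)" by simp
  also have "\<dots> = (\<integral>x. (f x)\<^sup>2 + 2 * t * (f x * g x) + t\<^sup>2 * (g x)\<^sup>2 \<partial>M)"
   by (intro Bochner_Integration.integral_cong) (simp_all add: power2_sum power_mult_distrib algebra_simps)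
  also have "\<dots> = ?A + 2 * t * ?B + t\<^sup>2 * ?C"
   using assms l2_mult_integrable[OF assms] by (simp add: l2_sq_eq l2_inner_def l2_def)
  finally show ?thesis .
 qed
 show ?thesis
 proof (cases "?C = 0")
  case True
  have "?B = 0"
  proof (rule ccontr)
   assume B: "?B \<noteq> 0"
   \<comment> \<open>This \<open>t\<close> gives the quadratic, which is linear for
     \<open>?C = 0\<close>, the value \<open>-1\<close>.\<close>
   have "2 * (- (?A + 1) / (2 * ?B)) * ?B = - (?A + 1)"
    using B by (simp add: field_simps)
   with quad[of "- (?A + 1) / (2 * ?B)"] True show False by simp
  qed
  then show ?thesis
   using True by simp
 next
  case False
  then have C: "?C > 0"
   using l2_sq_nonneg[of M g] by linarith
  \<comment> \<open>The quadratic is evaluated at its minimum \<open>t = - ?B / ?C\<close>.\<close>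
  have "0 \<le> (?A + 2 * (- ?B / ?C) * ?B + (- ?B / ?C)\<^sup>2 * ?C) * ?C"
   using quad[of "- ?B / ?C"] C by simp
  also have "\<dots> = ?A * ?C - ?B\<^sup>2"
   using C by (simp add: field_simps power2_eq_square)
  finally show ?thesis by simp
 qed
qed

lemma l2_inner_tendsto:
 assumes "\<And>m. f m \<in> l2 M" "f' \<in> l2 M" "g \<in> l2 M" "(\<lambda>m. l2_sq M (\<lambda>x. f m x - f' x)) \<longlonglongrightarrow> 0"
 shows "(\<lambda>m. l2_inner M (f m) g) \<longlonglongrightarrow> l2_inner M f' g"
proof -
 have "(\<lambda>m. l2_inner M (\<lambda>x. f m x - f' x) g) \<longlonglongrightarrow> 0"
 proof (rule tendsto_0_le[where K = 1])
  show "(\<lambda>m. sqrt (l2_sq M (\<lambda>x. f m x - f' x) * l2_sq M g)) \<longlonglongrightarrow> 0"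
   using tendsto_real_sqrt[OF tendsto_mult_left[OF assms(4), of "l2_sq M g"]] by (simp add: mult.commute)
  show "\<forall>\<^sub>F m in sequentially. norm (l2_inner M (\<lambda>x. f m x - f' x) g) \<le>
    norm (sqrt (l2_sq M (\<lambda>x. f m x - f' x) * l2_sq M g)) * 1"
   using real_sqrt_le_mono[OF l2_cauchy_schwarz[OF l2_diff[OF assms(1,2)] assms(3)]]
   by (intro always_eventually allI) simp
 qed
 moreover have "l2_inner M (\<lambda>x. f m x - f' x) g = l2_inner M (f m) g - l2_inner M f' g" for m
  using l2_mult_integrable[OF assms(1,3)] l2_mult_integrable[OF assms(2,3)]
  by (simp add: l2_inner_def left_diff_distrib)
 ultimately show ?thesis
  using Lim_null[of "\<lambda>m. l2_inner M (f m) g" "l2_inner M f' g" sequentially] by simp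
qed

lemma l2_sq_tendsto:
 assumes "\<And>m. f m \<in> l2 M" "f' \<in> l2 M" "(\<lambda>m. l2_sq M (\<lambda>x. f m x - f' x)) \<longlonglongrightarrow> 0"
 shows "(\<lambda>m. l2_sq M (f m)) \<longlonglongrightarrow> l2_sq M f'"
proof -
 have "l2_sq M (f m) = l2_sq M (\<lambda>x. f m x - f' x) + 2 * l2_inner M (f m) f' - l2_sq M f'" for m
 proof -
  have "l2_sq M (\<lambda>x. f m x - f' x) = (\<integral>x. (f m x)\<^sup>2 - 2 * (f m x * f' x) + (f' x)\<^sup>2 \<partial>M)"
   unfolding l2_sq_eq by (intro Bochner_Integration.integral_cong) (simp_all add: power2_diff algebra_simps)
  also have "\<dots> = l2_sq M (f m) - 2 * l2_inner M (f m) f' + l2_sq M f'"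
   using assms(1)[of m] assms(2) l2_mult_integrable[OF assms(1)[of m] assms(2)] by (simp add: l2_sq_eq l2_inner_def l2_def)
  finally show ?thesis by simp
 qed
 moreover have "(\<lambda>m. l2_sq M (\<lambda>x. f m x - f' x) + 2 * l2_inner M (f m) f' - l2_sq M f') \<longlonglongrightarrow>
   0 + 2 * l2_inner M f' f' - l2_sq M f'"
  using assms by (intro tendsto_intros l2_inner_tendsto)
 ultimately show ?thesis by (simp add: l2_sq_def)
qed

lemma l2_AE_subseq:
 assumes "\<And>m. f m \<in> l2 M" "f' \<in> l2 M" "(\<lambda>m. l2_sq M (\<lambda>x. f m x - f' x)) \<longlonglongrightarrow> 0"
 obtains r :: "nat \<Rightarrow> nat" where "strict_mono r" "AE x in M. (\<lambda>m. f (r m) x) \<longlonglongrightarrow> f' x"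
proof -
 have "\<exists>r::nat\<Rightarrow>nat. strict_mono r \<and> (AE x in M. (\<lambda>n. (f (r n) x - f' x)\<^sup>2) \<longlonglongrightarrow> 0)"
  using assms(3) l2D(2)[OF l2_diff[OF assms(1,2)]] by (intro tendsto_L1_AE_subseq) (auto simp: l2_sq_eq)
 then obtain r :: "nat \<Rightarrow> nat" where r: "strict_mono r" "AE x in M. (\<lambda>n. (f (r n) x - f' x)\<^sup>2) \<longlonglongrightarrow> 0"
  by blast
 have "AE x in M. (\<lambda>m. f (r m) x) \<longlonglongrightarrow> f' x"
  using r(2)
 proof eventually_elim
  fix x assume "(\<lambda>n. (f (r n) x - f' x)\<^sup>2) \<longlonglongrightarrow> 0"
  then have "(\<lambda>n. sqrt ((f (r n) x - f' x)\<^sup>2)) \<longlonglongrightarrow> sqrt 0"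
   by (rule tendsto_real_sqrt)
  then have "(\<lambda>n. f (r n) x - f' x) \<longlonglongrightarrow> 0" by (simp add: tendsto_rabs_zero_iff)
  then show "(\<lambda>m. f (r m) x) \<longlonglongrightarrow> f' x"
   using Lim_null by blast
 qed
 with r(1) show ?thesis by (rule that)
qed

lemma (in finite_measure) l2_const: "(\<lambda>x. c) \<in> l2 M" by (simp add: l2_def)

text \<open>Riesz-Fischer. For a probability measure the sequence is also Cauchy in
  \<open>L1\<close>, which provides an almost everywhere convergent subsequence; Fatou's lemma then
  compares the limit with the whole sequence.\<close>

lemma (in prob_space) l2_complete:
 assumes u: "\<And>m. u m \<in> l2 M" and cauchy: "\<And>\<epsilon>. \<epsilon> > 0 \<Longrightarrow> \<exists>N. \<forall>m\<ge>N. \<forall>l\<ge>N. l2_sq M (\<lambda>x. u m x - u l x) < \<epsilon>"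
 obtains f where "f \<in> l2 M" "(\<lambda>m. l2_sq M (\<lambda>x. u m x - f x)) \<longlonglongrightarrow> 0"
proof -
 note [measurable] = l2D(1)[OF u]
 have L1: "(\<integral>x. \<bar>h x\<bar> \<partial>M) \<le> sqrt (l2_sq M h)" if h: "h \<in> l2 M" for h
 proof -
  have h': "(\<lambda>x. \<bar>h x\<bar>) \<in> l2 M"
   using h by (auto simp: l2_def)
  have "(l2_inner M (\<lambda>x. \<bar>h x\<bar>) (\<lambda>x. 1))\<^sup>2 \<le> l2_sq M (\<lambda>x. \<bar>h x\<bar>) * l2_sq M (\<lambda>x. 1)"
   by (rule l2_cauchy_schwarz[OF h' l2_const])
  then have "(\<integral>x. \<bar>h x\<bar> \<partial>M)\<^sup>2 \<le> l2_sq M h"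
   by (simp add: l2_inner_def l2_sq_eq prob_space)
  then show ?thesis by (rule real_le_rsqrt)
 qed
 have "integrable M (u m)" for m
  using l2_mult_integrable[OF u l2_const[of 1]] by simp
 moreover have "\<exists>N. \<forall>i\<ge>N. \<forall>j\<ge>N. (\<integral>x. norm (u i x - u j x) \<partial>M) < e" if e: "e > 0" for e
 proof -
  obtain N where N: "\<And>i j. i \<ge> N \<Longrightarrow> j \<ge> N \<Longrightarrow> l2_sq M (\<lambda>x. u i x - u j x) < e\<^sup>2"
   using cauchy[of "e\<^sup>2"] e by auto
  have "(\<integral>x. norm (u i x - u j x) \<partial>M) < e" if "i \<ge> N" "j \<ge> N" for i j
  proof -
   have "(\<integral>x. norm (u i x - u j x) \<partial>M) \<le> sqrt (l2_sq M (\<lambda>x. u i x - u j x))"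
    using L1[OF l2_diff[OF u u]] by simp
   also have "\<dots> < sqrt (e\<^sup>2)"
    using N[OF that] by (rule real_sqrt_less_mono)
   finally show ?thesis
    using e by simp
  qed
  then show ?thesis by blast
 qed
 ultimately obtain r where r: "strict_mono r" "AE x in M. Cauchy (\<lambda>i. u (r i) x)"
  by (rule cauchy_L1_AE_cauchy_subseq[of M u]) blast
 define f where "f x = lim (\<lambda>i. u (r i) x)" for x
 have f [measurable]: "f \<in> borel_measurable M"
  unfolding f_def by (rule borel_measurable_lim_metric) simp
 have conv: "AE x in M. (\<lambda>i. u (r i) x) \<longlonglongrightarrow> f x"
  using r(2) by eventually_elim (simp add: f_def convergent_LIMSEQ_iff[symmetric] Cauchy_convergent_iff)
 have fatou: "\<exists>N. \<forall>m\<ge>N. (\<integral>\<^sup>+x. ennreal ((u m x - f x)\<^sup>2) \<partial>M) \<le> ennreal e" if e: "e > 0" for e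
 proof -
  obtain N where N: "\<And>i j. i \<ge> N \<Longrightarrow> j \<ge> N \<Longrightarrow> l2_sq M (\<lambda>x. u i x - u j x) < e"
   using cauchy[OF e] by blast
  have "(\<integral>\<^sup>+x. ennreal ((u m x - f x)\<^sup>2) \<partial>M) \<le> ennreal e" if m: "m \<ge> N" for m
  proof -
   have "(\<integral>\<^sup>+x. ennreal ((u m x - f x)\<^sup>2) \<partial>M) = (\<integral>\<^sup>+x. liminf (\<lambda>i. ennreal ((u m x - u (r i) x)\<^sup>2)) \<partial>M)"
   proof (rule nn_integral_cong_AE, use conv in eventually_elim)
    fix x assume "(\<lambda>i. u (r i) x) \<longlonglongrightarrow> f x"
    then have "(\<lambda>i. ennreal ((u m x - u (r i) x)\<^sup>2)) \<longlonglongrightarrow> ennreal ((u m x - f x)\<^sup>2)"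
     by (intro tendsto_ennrealI tendsto_intros)
    then show "ennreal ((u m x - f x)\<^sup>2) = liminf (\<lambda>i. ennreal ((u m x - u (r i) x)\<^sup>2))"
     by (intro lim_imp_Liminf[symmetric]) simp_all
   qed
   also have "\<dots> \<le> liminf (\<lambda>i. \<integral>\<^sup>+x. ennreal ((u m x - u (r i) x)\<^sup>2) \<partial>M)"
    by (rule nn_integral_liminf) measurable
   also have "\<dots> \<le> ennreal e"
   proof (rule Liminf_le)
    have "(\<integral>\<^sup>+x. ennreal ((u m x - u (r i) x)\<^sup>2) \<partial>M) \<le> ennreal e" if "i \<ge> N" for i
    proof -
     have "r i \<ge> N"
      using that seq_suble[OF r(1), of i] by linarith
     then have "l2_sq M (\<lambda>x. u m x - u (r i) x) < e"
      using N m by blast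
     moreover have "(\<integral>\<^sup>+x. ennreal ((u m x - u (r i) x)\<^sup>2) \<partial>M) = ennreal (l2_sq M (\<lambda>x. u m x - u (r i) x))"
      unfolding l2_sq_eq by (intro nn_integral_eq_integral l2D(2) l2_diff u) simp
     ultimately show ?thesis by (simp add: ennreal_leI)
    qed
    then show "\<forall>\<^sub>F i in sequentially. (\<integral>\<^sup>+x. ennreal ((u m x - u (r i) x)\<^sup>2) \<partial>M) \<le> ennreal e"
     unfolding eventually_sequentially by blast
   qed simp
   finally show ?thesis .
  qed
  then show ?thesis by blast
 qed
 have diff_l2: "(\<lambda>x. u m x - f x) \<in> l2 M" if "(\<integral>\<^sup>+x. ennreal ((u m x - f x)\<^sup>2) \<partial>M) \<le> ennreal e" for m e
  using that by (intro l2I integrableI_bounded) (auto intro: le_less_trans)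
 obtain N where "\<forall>m\<ge>N. (\<integral>\<^sup>+x. ennreal ((u m x - f x)\<^sup>2) \<partial>M) \<le> ennreal 1"
  using fatou[of 1] by auto
 then have "(\<lambda>x. u N x - f x) \<in> l2 M" by (intro diff_l2) blast
 from l2_diff[OF u[of N] this] have "f \<in> l2 M" by simp
 moreover have "(\<lambda>m. l2_sq M (\<lambda>x. u m x - f x)) \<longlonglongrightarrow> 0"
 proof (rule LIMSEQ_I)
  fix e :: real assume "e > 0"
  then obtain N where N: "\<And>m. m \<ge> N \<Longrightarrow> (\<integral>\<^sup>+x. ennreal ((u m x - f x)\<^sup>2) \<partial>M) \<le> ennreal (e / 2)"
   using fatou[of "e / 2"] by auto
  have "l2_sq M (\<lambda>x. u m x - f x) \<le> e / 2" if "m \<ge> N" for m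
  proof -
   have "ennreal (l2_sq M (\<lambda>x. u m x - f x)) = (\<integral>\<^sup>+x. ennreal ((u m x - f x)\<^sup>2) \<partial>M)"
    unfolding l2_sq_eq using diff_l2[OF N[OF that]] by (intro nn_integral_eq_integral[symmetric] l2D(2)) auto
   also have "\<dots> \<le> ennreal (e / 2)" by (rule N[OF that])
   finally show ?thesis
    using \<open>e > 0\<close> by simp
  qed
  have "norm (l2_sq M (\<lambda>x. u m x - f x) - 0) < e" if "m \<ge> N" for m
  proof -
   have "l2_sq M (\<lambda>x. u m x - f x) < e"
    using \<open>\<And>m. m \<ge> N \<Longrightarrow> l2_sq M (\<lambda>x. u m x - f x) \<le> e / 2\<close>[OF that] \<open>e > 0\<close> by linarith
   then show ?thesis by simp
  qed
  then show "\<exists>N. \<forall>m\<ge>N. norm (l2_sq M (\<lambda>x. u m x - f x) - 0) < e" by blast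
 qed
 ultimately show ?thesis by (rule that)
qed

lemma l2_sq_dominated:
 assumes "\<And>m. h m \<in> borel_measurable M" "integrable M b" "\<And>m. AE x in M. (h m x)\<^sup>2 \<le> b x" "AE x in M. (\<lambda>m. h m x) \<longlonglongrightarrow> 0"
 shows "(\<lambda>m. l2_sq M (h m)) \<longlonglongrightarrow> 0"
proof -
 have "(\<lambda>m. \<integral>x. (h m x)\<^sup>2 \<partial>M) \<longlonglongrightarrow> (\<integral>x. 0 \<partial>M)"
 proof (rule integral_dominated_convergence[OF _ _ assms(2)])
  show "AE x in M. (\<lambda>m. (h m x)\<^sup>2) \<longlonglongrightarrow> 0"
   using assms(4) by eventually_elim (use tendsto_power[of _ 0 _ 2] in fastforce)
  show "AE x in M. norm ((h m x)\<^sup>2) \<le> b x" for m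
   using assms(3)[of m] by eventually_elim simp
 qed (use assms(1) in auto)
 then show ?thesis by (simp add: l2_sq_eq)
qed

section \<open>The core and the closure of the derivative\<close>

context laakso
begin

interpretation LM: prob_space "\<mu>" by (rule prob_space_laakso)
interpretation BM: prob_space "MB" by (rule prob_space_MB)

lemma l2_laakso_iff:
 fixes f :: "'k::finite laakso_point \<Rightarrow> real"
 assumes "f \<in> borel_measurable (\<mu>)"
 shows "f \<in> l2 (\<mu>) \<longleftrightarrow> (\<lambda>p. f (io p)) \<in> l2 MB"
 using assms measurable_compose[OF measurable_proj assms] integrable_laakso_iff[of "\<lambda>s. (f s)\<^sup>2" js]
 by (simp add: l2_def)

lemma l2_laakso_imp: "f \<in> l2 (\<mu>) \<Longrightarrow> (\<lambda>p :: 'k::finite prelaakso. f (io p)) \<in> l2 MB"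
 using l2_laakso_iff l2D(1) by blast

lemma l2_sq_laakso:
 fixes f :: "'k::finite laakso_point \<Rightarrow> real"
 shows "f \<in> borel_measurable (\<mu>) \<Longrightarrow> l2_sq (\<mu>) f = l2_sq MB (\<lambda>p. f (io p))"
 by (simp add: l2_sq_eq integral_laakso)

lemma continuous_bounded:
 assumes "continuous_map (laakso_topology js) euclideanreal f"
 obtains C where "\<And>s. s \<in> laakso_space js \<Longrightarrow> \<bar>f s\<bar> \<le> C"
proof -
 have "compactin euclidean (f ` laakso_space js)"
  using image_compactin[OF _ assms] compact_space_laakso by (metis compact_space_def topspace_laakso_topology)
 then have "bounded (f ` laakso_space js)" by (simp add: compact_imp_bounded)
 then show ?thesis
  using that unfolding bounded_iff by auto
qed

lemma continuous_l2:
 fixes f :: "'k::finite laakso_point \<Rightarrow> real"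
 assumes "continuous_map (laakso_topology js) euclideanreal f"
 shows "f \<in> l2 (\<mu>)"
proof -
 obtain C where "\<And>s. s \<in> laakso_space js \<Longrightarrow> \<bar>f s\<bar> \<le> C"
  by (rule continuous_bounded[OF assms]) (rule that; assumption)
 from l2_bounded_mult[OF LM.l2_const[of 1] borel_measurable_continuous_laakso[OF assms], of C] this
 show ?thesis by simp
qed

lemma mgug_D_mono: "f \<in> mgug_D js n \<Longrightarrow> n \<le> m \<Longrightarrow> f \<in> mgug_D js m"
 unfolding mgug_D_def by auto

lemma core_continuous: "f \<in> mgug_core js \<Longrightarrow> continuous_map (laakso_topology js) euclideanreal f"
 by (auto simp: mgug_core_def mgug_D_def)

lemma core_l2: "f \<in> mgug_core js \<Longrightarrow> f \<in> l2 (\<mu>)"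
 by (rule continuous_l2[OF core_continuous])

lemma core_dx_l2: "f \<in> mgug_core js \<Longrightarrow> dx js f \<in> l2 MB"
 using borel_measurable_dx by (auto simp: mem_mgug_core l2_def)

lemma coreI:
 assumes "f \<in> mgug_D js n" "g \<in> l2 MB" "AE p in MB. dx js f p = g p"
 shows "f \<in> mgug_core js"
proof -
 have "integrable MB (\<lambda>q. (dx js f q)\<^sup>2) \<longleftrightarrow> integrable MB (\<lambda>q. (g q)\<^sup>2)"
  using assms borel_measurable_dx[OF assms(1)] by (intro integrable_cong_AE) (auto simp: l2_def)
 then show ?thesis
  using assms by (auto simp: mem_mgug_core l2_def)
qed

lemma AE_dxI:
 fixes g :: "'k::finite prelaakso \<Rightarrow> real"
 assumes "finite Z" "\<And>x w. 0 < x \<Longrightarrow> x < 1 \<Longrightarrow> x \<notin> Z \<Longrightarrow> ((\<lambda>y. f (io (y, w))) has_real_derivative g (x, w)) (at x)"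
 shows "AE p in MB. dx js f p = g p"
proof -
 have "finite (insert 0 (insert 1 Z))"
  using assms(1) by simp
 from AE_MB_fst_notin[OF this] show ?thesis
 proof (rule AE_mp, intro AE_I2 impI)
  fix p :: "'k prelaakso" assume "p \<in> space MB" "fst p \<notin> insert 0 (insert 1 Z)"
  then show "dx js f p = g p" by (cases p) (auto intro!: dx_eqI assms(2))
 qed
qed

lemma piecewise_differentiable_chain:
 assumes "(f :: real \<Rightarrow> real) piecewise_differentiable_on {0..1}" "\<And>x. (\<phi> has_real_derivative \<phi>' x) (at x)"
 shows "(\<lambda>x. \<phi> (f x)) piecewise_differentiable_on {0..1}"
proof -
 have "\<phi> differentiable (at x)" for x
  using assms(2) real_differentiable_def by blast
 then have "\<phi> \<circ> f piecewise_differentiable_on {0..1}"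
  using assms(1) continuous_on_compose[of "{0..1}" f \<phi>]
  unfolding piecewise_differentiable_on_def
  by (metis (no_types, lifting) assms(2) DERIV_continuous_on differentiable_at_withinI differentiable_chain_within has_field_derivative_at_within)
 then show ?thesis by (simp add: o_def)
qed

text \<open>A continuous \<open>\<phi>'\<close> stays bounded along a continuous function on a
  compact space, so composition preserves finite energy.\<close>

lemma core_chain:
 fixes u :: "'k::finite laakso_point \<Rightarrow> real"
 assumes u: "u \<in> mgug_core js" and \<phi>: "\<And>x. (\<phi> has_real_derivative \<phi>' x) (at x)" "continuous_on UNIV \<phi>'"
 shows "(\<lambda>s. \<phi> (u s)) \<in> mgug_core js" "AE p in MB. dx js (\<lambda>s. \<phi> (u s)) p = \<phi>' (u (io p)) * dx js u p"
proof -
 obtain n where n: "u \<in> mgug_D js n"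
  using u by (auto simp: mem_mgug_core)
 have \<phi>_cont: "continuous_on UNIV \<phi>"
  using \<phi>(1) DERIV_continuous_on by blast
 have D: "(\<lambda>s. \<phi> (u s)) \<in> mgug_D js n"
 proof -
  have "\<phi> (u (io (x, w))) = \<phi> (u (io (x, w')))" if "x \<in> {0..1}" "\<forall>l. \<forall>m<n. w l m = w' l m" for x w w'
   using mgug_D_agree[OF n that(1), of w w'] that(2) by (simp add: agree_def)
  moreover have "(\<lambda>x. \<phi> (u (io (x, w)))) piecewise_differentiable_on {0..1}" for w
   using n by (intro piecewise_differentiable_chain[OF _ \<phi>(1)]) (simp add: mgug_D_def)
  moreover have "continuous_map (laakso_topology js) euclideanreal (\<lambda>s. \<phi> (u s))"
   using core_continuous[OF u] \<phi>_cont by (auto simp: continuous_laakso_iff intro: continuous_on_compose2)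
  ultimately show ?thesis
   unfolding mgug_D_def by blast
 qed
 obtain Z where Z: "finite Z"
   "\<And>x w. x \<in> {0..1} - Z \<Longrightarrow> ((\<lambda>y. u (io (y, w))) has_real_derivative dx js u (x, w)) (at x)"
  using mgug_D_differentiable[OF n] by metis
 show AE: "AE p in MB. dx js (\<lambda>s. \<phi> (u s)) p = \<phi>' (u (io p)) * dx js u p"
 proof (rule AE_dxI[OF Z(1)])
  fix x w assume "0 < x" "x < 1" "x \<notin> Z"
  then show "((\<lambda>y. \<phi> (u (io (y, w)))) has_real_derivative \<phi>' (u (io (x, w))) * dx js u (x, w)) (at x)"
   by (intro DERIV_chain2[OF \<phi>(1)] Z(2)) auto
 qed
 have cont: "continuous_map (laakso_topology js) euclideanreal (\<lambda>s. \<phi>' (u s))"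
  using core_continuous[OF u] \<phi>(2) by (auto simp: continuous_laakso_iff intro: continuous_on_compose2)
 obtain C where C: "\<And>s. s \<in> laakso_space js \<Longrightarrow> \<bar>\<phi>' (u s)\<bar> \<le> C"
  by (rule continuous_bounded[OF cont]) (rule that; assumption)
 have "(\<lambda>p. \<phi>' (u (io p))) \<in> borel_measurable MB"
  using measurable_compose[OF measurable_proj borel_measurable_continuous_laakso[OF cont]] .
 then have "(\<lambda>p. \<phi>' (u (io p)) * dx js u p) \<in> l2 MB"
  using C core_dx_l2[OF u] by (intro l2_bounded_mult[where c = C]) (auto simp: laakso_proj_in_space)
 from coreI[OF D this AE] show "(\<lambda>s. \<phi> (u s)) \<in> mgug_core js" .
qed

lemma core_common:
 fixes u v :: "'k::finite laakso_point \<Rightarrow> real"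
 assumes "u \<in> mgug_core js" "v \<in> mgug_core js"
 obtains n Z where "u \<in> mgug_D js n" "v \<in> mgug_D js n" "finite Z"
  "\<And>x w. x \<in> {0..1} - Z \<Longrightarrow> ((\<lambda>y. u (io (y, w))) has_real_derivative dx js u (x, w)) (at x)"
  "\<And>x w. x \<in> {0..1} - Z \<Longrightarrow> ((\<lambda>y. v (io (y, w))) has_real_derivative dx js v (x, w)) (at x)"
proof -
 obtain n m where nm: "u \<in> mgug_D js n" "v \<in> mgug_D js m"
  using assms by (auto simp: mem_mgug_core)
 obtain Z where Z: "finite Z"
   "\<And>x w. x \<in> {0..1} - Z \<Longrightarrow> ((\<lambda>y. u (io (y, w))) has_real_derivative dx js u (x, w)) (at x)"
  using mgug_D_differentiable[OF nm(1)] by metis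
 obtain Z' where Z': "finite Z'"
   "\<And>x w. x \<in> {0..1} - Z' \<Longrightarrow> ((\<lambda>y. v (io (y, w))) has_real_derivative dx js v (x, w)) (at x)"
  using mgug_D_differentiable[OF nm(2)] by metis
 show ?thesis
  using Z Z' mgug_D_mono[OF nm(1), of "max n m"] mgug_D_mono[OF nm(2), of "max n m"]
  by (intro that[of "max n m" "Z \<union> Z'"]) auto
qed

lemma core_add:
 fixes u v :: "'k::finite laakso_point \<Rightarrow> real"
 assumes uv: "u \<in> mgug_core js" "v \<in> mgug_core js"
 shows "(\<lambda>s. u s + v s) \<in> mgug_core js" "AE p in MB. dx js (\<lambda>s. u s + v s) p = dx js u p + dx js v p"
proof -
 obtain n Z where nZ: "u \<in> mgug_D js n" "v \<in> mgug_D js n" "finite Z"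
  "\<And>x w. x \<in> {0..1} - Z \<Longrightarrow> ((\<lambda>y. u (io (y, w))) has_real_derivative dx js u (x, w)) (at x)"
  "\<And>x w. x \<in> {0..1} - Z \<Longrightarrow> ((\<lambda>y. v (io (y, w))) has_real_derivative dx js v (x, w)) (at x)"
  by (rule core_common[OF uv]) (rule that; assumption)
 have D: "(\<lambda>s. u s + v s) \<in> mgug_D js n"
 proof -
  have "u (io (x, w)) + v (io (x, w)) = u (io (x, w')) + v (io (x, w'))"
   if "x \<in> {0..1}" "\<forall>l. \<forall>m<n. w l m = w' l m" for x w w'
   using mgug_D_agree[OF nZ(1) that(1), of w w'] mgug_D_agree[OF nZ(2) that(1), of w w'] that(2)
   by (simp add: agree_def)
  moreover have "(\<lambda>x. u (io (x, w)) + v (io (x, w))) piecewise_differentiable_on {0..1}" for w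
   using nZ(1,2) by (intro piecewise_differentiable_add) (simp_all add: mgug_D_def)
  moreover have "continuous_map (laakso_topology js) euclideanreal (\<lambda>s. u s + v s)"
   using core_continuous uv by (intro continuous_map_add) auto
  ultimately show ?thesis
   unfolding mgug_D_def by blast
 qed
 show AE: "AE p in MB. dx js (\<lambda>s. u s + v s) p = dx js u p + dx js v p"
  by (rule AE_dxI[OF nZ(3)]) (intro DERIV_add nZ(4,5); simp)
 show "(\<lambda>s. u s + v s) \<in> mgug_core js" by (rule coreI[OF D l2_add AE]) (intro core_dx_l2 uv)+
qed

lemma core_scale:
 fixes u :: "'k::finite laakso_point \<Rightarrow> real"
 assumes "u \<in> mgug_core js"
 shows "(\<lambda>s. c * u s) \<in> mgug_core js" "AE p in MB. dx js (\<lambda>s. c * u s) p = c * dx js u p"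
 using core_chain[OF assms, of "\<lambda>x. c * x" "\<lambda>_. c"] by (auto intro!: derivative_eq_intros continuous_intros)

lemma core_diff:
 fixes u v :: "'k::finite laakso_point \<Rightarrow> real"
 assumes uv: "u \<in> mgug_core js" "v \<in> mgug_core js"
 shows "(\<lambda>s. u s - v s) \<in> mgug_core js" "AE p in MB. dx js (\<lambda>s. u s - v s) p = dx js u p - dx js v p"
proof -
 note a = core_add[OF uv(1) core_scale(1)[OF uv(2), of "- 1"]] and s = core_scale(2)[OF uv(2), of "- 1"]
 show "(\<lambda>s. u s - v s) \<in> mgug_core js"
  using a(1) by simp
 have "AE p in MB. dx js (\<lambda>s. u s + - 1 * v s) p = dx js u p - dx js v p"
  using a(2) s by eventually_elim simp
 then show "AE p in MB. dx js (\<lambda>s. u s - v s) p = dx js u p - dx js v p" by simp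
qed

text \<open>Builds core functions from formulas on the base. For a function of \<open>n\<close>
  digits continuity along lines is already continuity on the base, and a bounded derivative ensures
  finite energy.\<close>

lemma core_liftI:
 fixes F F' :: "'k::finite prelaakso \<Rightarrow> real"
 assumes trunc: "\<And>x w. x \<in> {0..1} \<Longrightarrow> F (x, w) = F (x, trunc n w)"
  and glue: "\<And>x w w'. glued x w w' \<Longrightarrow> F (x, w) = F (x, w')"
  and cont: "\<And>v. continuous_on {0..1} (\<lambda>x. F (x, v))"
  and Z: "finite Z" and deriv: "\<And>x v. 0 < x \<Longrightarrow> x < 1 \<Longrightarrow> x \<notin> Z \<Longrightarrow> ((\<lambda>y. F (y, v)) has_real_derivative F' (x, v)) (at x)"
  and bound: "\<And>x v. 0 < x \<Longrightarrow> x < 1 \<Longrightarrow> x \<notin> Z \<Longrightarrow> \<bar>F' (x, v)\<bar> \<le> C"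
 shows "lift F \<in> mgug_core js" "\<And>p. lift F (io p) = F p"
proof -
 show lift: "lift F (io p) = F p" for p by (rule lift_io) (rule glue)
 have "continuous_on laakso_base F"
 proof (rule continuous_on_baseI)
  fix x :: real and w :: "'k \<Rightarrow> nat \<Rightarrow> bool" and \<epsilon> :: real assume x: "x \<in> {0..1}" "\<epsilon> > 0"
  obtain r where r: "r > 0" "\<And>y. y \<in> {0..1} \<Longrightarrow> dist y x < r \<Longrightarrow> dist (F (y, trunc n w)) (F (x, trunc n w)) < \<epsilon>"
   using cont[of "trunc n w"] x unfolding continuous_on_iff by metis
  show "\<exists>r>0. \<exists>n. \<forall>y\<in>ball x r \<inter> {0..1}. \<forall>w'\<in>cyl n w. dist (F (y, w')) (F (x, w)) < \<epsilon>"
  proof (intro exI[of _ r] exI[of _ n] conjI ballI r(1))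
   fix y and w' :: "'k \<Rightarrow> nat \<Rightarrow> bool" assume y: "y \<in> ball x r \<inter> {0..1}" "w' \<in> cyl n w"
   have "trunc n w' = trunc n w"
    using y(2) by (metis mem_cyl trunc_eq_iff)
   then show "dist (F (y, w')) (F (x, w)) < \<epsilon>"
    using trunc[of y w'] trunc[OF x(1), of w] y(1) r(2)[of y] by (simp add: dist_commute)
  qed
 qed
 then have "continuous_map (laakso_topology js) euclidean (lift F)" by (simp add: continuous_laakso_iff lift)
 moreover have "(\<lambda>x. F (x, w)) piecewise_differentiable_on {0..1}" for w
  unfolding piecewise_differentiable_on_def
 proof (intro conjI cont exI[of _ "Z \<union> {0, 1}"] ballI)
  fix x assume "x \<in> {0..1} - (Z \<union> {0, 1})"
  then have "((\<lambda>y. F (y, w)) has_real_derivative F' (x, w)) (at x)" by (intro deriv) auto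
  then show "(\<lambda>x. F (x, w)) differentiable (at x within {0..1})"
   using real_differentiable_def differentiable_at_withinI by blast
 qed (use Z in simp)
 moreover have "F (x, w) = F (x, w')" if "x \<in> {0..1}" "\<forall>l. \<forall>m<n. w l m = w' l m" for x w w'
 proof -
  have "trunc n w = trunc n w'"
   using that(2) by (simp add: trunc_eq_iff agree_def)
  then show ?thesis
   using trunc[OF that(1), of w] trunc[OF that(1), of w'] by simp
 qed
 ultimately have D: "lift F \<in> mgug_D js n" by (simp add: mgug_D_def lift)
 have AE: "AE p in MB. dx js (lift F) p = F' p" by (rule AE_dxI[OF Z]) (simp add: lift deriv)
 have "AE p in MB. \<bar>dx js (lift F) p\<bar> \<le> \<bar>C\<bar>"
 proof -
  have "finite (insert 0 (insert 1 Z))"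
   using Z by simp
  from AE_MB_fst_notin[OF this] AE show ?thesis
  proof (rule AE_mp[OF _ AE_mp], intro AE_I2 impI)
   fix p :: "'k prelaakso" assume "p \<in> space MB" "dx js (lift F) p = F' p" "fst p \<notin> insert 0 (insert 1 Z)"
   then show "\<bar>dx js (lift F) p\<bar> \<le> \<bar>C\<bar>"
    using bound[of "fst p" "snd p"] by (cases p) auto
  qed
 qed
 then have "AE p in MB. norm ((dx js (lift F) p)\<^sup>2) \<le> norm (C\<^sup>2)"
  by eventually_elim (simp add: abs_le_square_iff)
 then have "integrable MB (\<lambda>p. (dx js (lift F) p)\<^sup>2)"
  by (rule Bochner_Integration.integrable_bound[OF BM.integrable_const borel_measurable_power[OF borel_measurable_dx[OF D]]])
 then show "lift F \<in> mgug_core js"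
  using D by (auto simp: mem_mgug_core)
qed

text \<open>Test functions for the integration by parts below.\<close>

definition core0 :: "('k::finite laakso_point \<Rightarrow> real) set" where
 "core0 = {v \<in> mgug_core js. \<forall>w. v (io (0, w)) = 0 \<and> v (io (1, w)) = 0}"

text \<open>The indicator may jump at \<open>a\<close>, may differ on identified points over
  \<open>L n\<close>, and need not vanish at the ends. A factor that vanishes at these finitely many
  \<open>x\<close> and tends to \<open>1\<close> elsewhere removes all three defects.\<close>

lemma rectangle_approx:
 fixes v :: "'k::finite \<Rightarrow> nat \<Rightarrow> bool"
 assumes "\<epsilon> > 0"
 shows "\<exists>u\<in>core0. l2_sq MB (\<lambda>p. u (io p) - indicator (({..a} \<inter> {0..1}) \<times> cyl n v) p) < \<epsilon>"
proof -
 define Z where "Z = L n \<union> {0, 1, a}"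
 have Z: "finite Z" by (simp add: Z_def finite_L)
 \<comment> \<open>A non-negative polynomial with zero set \<open>Z\<close>; then
   \<open>m q / (1 + m q)\<close> is smooth, lies between \<open>0\<close> and \<open>1\<close>,
   vanishes on \<open>Z\<close> and tends to \<open>1\<close> off \<open>Z\<close>.\<close>
 define q where "q = (\<Prod>z\<in>Z. [:- z, 1:]\<^sup>2 :: real poly)"
 have q_nn: "0 \<le> poly q x" for x
  unfolding q_def poly_prod by (intro prod_nonneg) (simp add: poly_power)
 have q_0: "poly q x = 0 \<longleftrightarrow> x \<in> Z" for x
  unfolding q_def poly_prod using Z by (auto simp: poly_power prod_zero_iff)
 define \<psi> where "\<psi> m x = real m * poly q x / (1 + real m * poly q x)" for m x
 have pos: "0 < 1 + real m * poly q x" for m x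
  using q_nn[of x] by (intro add_pos_nonneg) auto
 define \<psi>' where "\<psi>' m x = real m * poly (pderiv q) x / (1 + real m * poly q x)\<^sup>2" for m x
 have \<psi>_deriv: "(\<psi> m has_real_derivative \<psi>' m x) (at x)" for m x
  unfolding \<psi>_def[abs_def] \<psi>'_def using pos[of m x]
  by (auto intro!: derivative_eq_intros poly_DERIV simp: power2_eq_square field_simps)
 have \<psi>_Z: "\<psi> m x = 0" if "x \<in> Z" for m x
  using that q_0 by (simp add: \<psi>_def)
 have \<psi>_01: "0 \<le> \<psi> m x" "\<psi> m x \<le> 1" for m x
  using q_nn[of x] pos[of m x] by (auto simp: \<psi>_def field_simps)
 have \<psi>_lim: "(\<lambda>m. \<psi> m x) \<longlonglongrightarrow> 1" if "x \<notin> Z" for x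
 proof -
  have c: "poly q x > 0"
   using q_nn[of x] q_0[of x] that by linarith
  have "filterlim (\<lambda>m. 1 + poly q x * real m) at_top sequentially"
   using c by (intro filterlim_tendsto_add_at_top[OF tendsto_const]
    filterlim_tendsto_pos_mult_at_top[OF tendsto_const c filterlim_real_sequentially])
  then have "(\<lambda>m. 1 - inverse (1 + poly q x * real m)) \<longlonglongrightarrow> 1 - 0"
   by (intro tendsto_intros tendsto_inverse_0_at_top)
  moreover have "1 - inverse (1 + poly q x * real m) = \<psi> m x" for m
   using pos[of m x] by (simp add: \<psi>_def field_simps)
  ultimately show ?thesis by simp
 qed
 have \<psi>_cont: "continuous_on UNIV (\<psi> m)" for m
  using \<psi>_deriv DERIV_continuous_on by blast
 define F where "F m = (\<lambda>(x, w). if x \<le> a \<and> w \<in> cyl n v then \<psi> m x else 0)" for m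
 define F' where "F' m = (\<lambda>(x, w). if x \<le> a \<and> w \<in> cyl n v then \<psi>' m x else 0)" for m
 have cyl_trunc: "trunc n w \<in> cyl n v \<longleftrightarrow> w \<in> cyl n v" for w
  unfolding mem_cyl by (metis trunc_eq_iff trunc_idem)
 have core: "lift (F m) \<in> core0" and lift: "lift (F m) (io p) = F m p" for m p
 proof -
  have "continuous_on UNIV (\<psi>' m)"
   unfolding \<psi>'_def using pos[of m] by (intro continuous_intros) (auto simp: less_imp_neq[symmetric])
  from continuous_on_subset[OF this, of "{0..1}"] have "bounded (\<psi>' m ` {0..1})"
   by (intro compact_imp_bounded compact_continuous_image) auto
  then obtain C where "\<forall>x\<in>{0..1}. \<bar>\<psi>' m x\<bar> \<le> C"
   unfolding bounded_iff by auto
  then have C: "\<bar>\<psi>' m x\<bar> \<le> C" if "x \<in> {0..1}" for x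
   using that by blast
  have C0: "0 \<le> C"
   using C[of 0] by simp
  have F1: "F m (x, w) = F m (x, trunc n w)" for x w by (simp add: F_def cyl_trunc)
  have F2: "F m (x, w) = F m (x, w')" if g: "glued x w w'" for x w w'
  proof (cases "x \<in> L n")
   case True
   then show ?thesis
    using \<psi>_Z[of x m] by (simp add: F_def Z_def)
  next
   case False
   have "io (x, w) = io (x, w')"
    using g by (simp add: io_eq_iff)
   then have "trunc n w = trunc n w'"
    using io_eq_imp_agree[OF _ False] by (simp add: trunc_eq_iff)
   then show ?thesis
    using F1[of x w] F1[of x w'] by simp
  qed
  have F3: "continuous_on {0..1} (\<lambda>x. F m (x, w))" for w
  proof (cases "w \<in> cyl n v")
   case True
   have "continuous_on ({..a} \<union> {a..}) (\<lambda>x. if x \<le> a then \<psi> m x else 0)"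
    using \<psi>_Z[of a m] by (intro continuous_on_If continuous_on_subset[OF \<psi>_cont] continuous_on_const) (auto simp: Z_def)
   moreover have "{..a} \<union> {a..} = UNIV" by auto
   ultimately have "continuous_on UNIV (\<lambda>x. F m (x, w))"
    using True by (simp add: F_def)
   then show ?thesis by (rule continuous_on_subset) simp
  qed (simp add: F_def)
  have F4: "((\<lambda>y. F m (y, w)) has_real_derivative F' m (x, w)) (at x)" if "x \<notin> Z" for x w
  proof -
   have "x < a \<or> a < x"
    using that by (auto simp: Z_def)
   then show ?thesis
   proof
    assume x: "x < a"
    show ?thesis
    proof (cases "w \<in> cyl n v")
     case True
     have "((\<lambda>y. F m (y, w)) has_real_derivative \<psi>' m x) (at x)"
      by (rule has_field_derivative_transform_within_open[of "\<psi> m" _ _ "{..<a}"]) (use x True \<psi>_deriv in \<open>auto simp: F_def\<close>)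
     then show ?thesis
      using x True by (simp add: F'_def)
    qed (simp add: F_def F'_def)
   next
    assume x: "a < x"
    have "((\<lambda>y. F m (y, w)) has_real_derivative 0) (at x)"
     by (rule has_field_derivative_transform_within_open[of "\<lambda>_. 0" _ _ "{a<..}"]) (use x in \<open>auto simp: F_def\<close>)
    then show ?thesis
     using x by (simp add: F'_def)
   qed
  qed
  have F5: "\<bar>F' m (x, w)\<bar> \<le> C" if "0 < x" "x < 1" for x w
   using C[of x] C0 that by (simp add: F'_def)
  have "lift (F m) \<in> mgug_core js"
   by (rule core_liftI(1)[where F = "F m" and F' = "F' m" and n = n and C = C, OF F1 F2 F3 Z F4 F5])
  moreover show l: "lift (F m) (io p) = F m p" for p by (rule lift_io) (rule F2)
  moreover have "F m (0, w) = 0" "F m (1, w) = 0" for w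
   using \<psi>_Z[of 0 m] \<psi>_Z[of 1 m] by (simp_all add: F_def Z_def)
  ultimately show "lift (F m) \<in> core0"
   unfolding core0_def by simp
 qed
 let ?I = "indicator (({..a} \<inter> {0..1}) \<times> cyl n v) :: 'k prelaakso \<Rightarrow> real"
 have I_sets [measurable]: "({..a} \<inter> {0..1}) \<times> cyl n v \<in> sets MB"
  unfolding MB_def by (intro pair_measureI sets_cyl) (auto simp: sets_restrict_space)
 have F_meas: "F m \<in> borel_measurable MB" for m
 proof -
  have "(\<lambda>p. lift (F m) (io p)) \<in> borel_measurable MB"
   using core[of m] by (intro l2D(1)[OF l2_laakso_imp[OF core_l2]]) (simp add: core0_def)
  then show ?thesis
   unfolding lift .
 qed
 have "(\<lambda>m. l2_sq MB (\<lambda>p. F m p - ?I p)) \<longlonglongrightarrow> 0"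
 proof (rule l2_sq_dominated)
  show "(\<lambda>p. F m p - ?I p) \<in> borel_measurable MB" for m
   using F_meas[of m] by measurable
  show "integrable MB (\<lambda>_ :: 'k prelaakso. 1 :: real)" by simp
  have 1: "F m (x, w) = \<psi> m x * ?I (x, w)" if "x \<in> {0..1}" for x w m
   using that by (auto simp: F_def indicator_def)
  show "AE p in MB. (F m p - ?I p)\<^sup>2 \<le> 1" for m
  proof (rule AE_I2)
   fix p :: "'k prelaakso" assume "p \<in> space MB"
   then have "F m p - ?I p = (\<psi> m (fst p) - 1) * ?I p"
    using 1 by (cases p) (simp add: left_diff_distrib)
   also have "\<bar>\<dots>\<bar> \<le> 1 * 1"
    unfolding abs_mult using \<psi>_01[of m "fst p"] by (intro mult_mono) (auto simp: indicator_def)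
   finally show "(F m p - ?I p)\<^sup>2 \<le> 1" by (simp add: abs_square_le_1)
  qed
  show "AE p in MB. (\<lambda>m. F m p - ?I p) \<longlonglongrightarrow> 0"
   using AE_MB_fst_notin[OF Z]
  proof (rule AE_mp, intro AE_I2 impI)
   fix p :: "'k prelaakso" assume p: "p \<in> space MB" "fst p \<notin> Z"
   have "(\<lambda>m. \<psi> m (fst p) * ?I p - ?I p) \<longlonglongrightarrow> 1 * ?I p - ?I p"
    using \<psi>_lim[OF p(2)] by (intro tendsto_intros)
   then show "(\<lambda>m. F m p - ?I p) \<longlonglongrightarrow> 0"
    using 1 p by (cases p) simp
  qed
 qed
 then have "\<forall>\<^sub>F m in sequentially. l2_sq MB (\<lambda>p. F m p - ?I p) < \<epsilon>"
  using assms by (rule order_tendstoD(2))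
 then obtain m where "l2_sq MB (\<lambda>p. F m p - ?I p) < \<epsilon>"
  unfolding eventually_sequentially by blast
 then show ?thesis
  using core[of m] by (intro bexI[of _ "lift (F m)"]) (simp_all add: lift)
qed

end

lemma l2_sq_zero: "l2_sq M (\<lambda>_. 0) = 0" by (simp add: l2_sq_eq)

lemma l2_sq_scale_diff: "l2_sq M (\<lambda>s. c * a s - c * b s) = c\<^sup>2 * l2_sq M (\<lambda>s. a s - b s)"
 by (simp add: l2_sq_eq power_mult_distrib flip: right_diff_distrib)

lemma l2_sq_sum_lim:
 assumes "\<And>m. a m \<in> l2 M" "\<And>m. b m \<in> l2 M" "a' \<in> l2 M" "b' \<in> l2 M"
  "(\<lambda>m. l2_sq M (\<lambda>s. a m s - a' s)) \<longlonglongrightarrow> 0" "(\<lambda>m. l2_sq M (\<lambda>s. b m s - b' s)) \<longlonglongrightarrow> 0"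
 shows "(\<lambda>m. l2_sq M (\<lambda>s. (a m s + b m s) - (a' s + b' s))) \<longlonglongrightarrow> 0"
proof (rule tendsto_sandwich[OF _ _ tendsto_const])
 have "l2_sq M (\<lambda>s. (a m s - a' s) + (b m s - b' s)) \<le> 2 * l2_sq M (\<lambda>s. a m s - a' s) + 2 * l2_sq M (\<lambda>s. b m s - b' s)" for m
  by (intro l2_sq_add_le l2_diff assms)
 moreover have "(\<lambda>s. (a m s + b m s) - (a' s + b' s)) = (\<lambda>s. (a m s - a' s) + (b m s - b' s))" for m
  by (simp add: fun_eq_iff)
 ultimately show "\<forall>\<^sub>F m in sequentially. l2_sq M (\<lambda>s. (a m s + b m s) - (a' s + b' s)) \<le> 2 * l2_sq M (\<lambda>s. a m s - a' s) + 2 * l2_sq M (\<lambda>s. b m s - b' s)"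
  by (intro always_eventually allI) (simp only:)
 show "(\<lambda>m. 2 * l2_sq M (\<lambda>s. a m s - a' s) + 2 * l2_sq M (\<lambda>s. b m s - b' s)) \<longlonglongrightarrow> 0"
  using tendsto_add[OF tendsto_mult_left[OF assms(5), of 2] tendsto_mult_left[OF assms(6), of 2]] by simp
qed simp

context laakso
begin

interpretation LM: prob_space "\<mu>" by (rule prob_space_laakso)
interpretation BM: prob_space "MB" by (rule prob_space_MB)

section \<open>Density of the test functions in \<open>L2\<close>; integration by parts\<close>

lemma core0_core: "v \<in> core0 \<Longrightarrow> v \<in> mgug_core js" by (simp add: core0_def)

lemma core0_l2: "v \<in> core0 \<Longrightarrow> (\<lambda>p :: 'k::finite prelaakso. v (io p)) \<in> l2 MB"
 by (intro l2_laakso_imp core_l2 core0_core)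

text \<open>Naming the closure allows a density proof by stability: it is a closed linear subspace,
  and once it contains the indicators of measurable sets it is all of \<open>l2 MB\<close>.\<close>

definition core0_closure :: "('k::finite prelaakso \<Rightarrow> real) set" where
 "core0_closure = {h \<in> l2 MB. \<forall>\<epsilon>>0. \<exists>u\<in>core0. l2_sq MB (\<lambda>p. u (io p) - h p) < \<epsilon>}"

lemma core0_closureD:
 "h \<in> core0_closure \<Longrightarrow> \<epsilon> > 0 \<Longrightarrow> \<exists>u\<in>core0. l2_sq MB (\<lambda>p. u (io p) - h p) < \<epsilon>"
 by (simp add: core0_closure_def)

lemma core0_closure_add:
 fixes h k :: "'k::finite prelaakso \<Rightarrow> real"
 assumes "h \<in> core0_closure" "k \<in> core0_closure"
 shows "(\<lambda>p. h p + k p) \<in> core0_closure"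
 unfolding core0_closure_def
proof (intro CollectI conjI allI impI)
 have hk: "h \<in> l2 MB" "k \<in> l2 MB"
  using assms by (auto simp: core0_closure_def)
 then show "(\<lambda>p. h p + k p) \<in> l2 MB" by blast
 fix \<epsilon> :: real assume "\<epsilon> > 0"
 then have "\<epsilon> / 4 > 0" by simp
 then obtain u v where uv: "u \<in> core0" "v \<in> core0" "l2_sq MB (\<lambda>p. u (io p) - h p) < \<epsilon> / 4"
   "l2_sq MB (\<lambda>p. v (io p) - k p) < \<epsilon> / 4"
  using core0_closureD[OF assms(1)] core0_closureD[OF assms(2)] by blast
 have "l2_sq MB (\<lambda>p. (u (io p) - h p) + (v (io p) - k p)) \<le> 2 * l2_sq MB (\<lambda>p. u (io p) - h p) + 2 * l2_sq MB (\<lambda>p. v (io p) - k p)"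
  by (intro l2_sq_add_le l2_diff core0_l2 uv hk)
 then have "l2_sq MB (\<lambda>p. (u (io p) + v (io p)) - (h p + k p)) < \<epsilon>"
  using uv(3,4) by (simp add: algebra_simps)
 moreover have "(\<lambda>s. u s + v s) \<in> core0"
  using uv core_add(1)[OF core0_core core0_core] by (auto simp: core0_def)
 ultimately show "\<exists>u\<in>core0. l2_sq MB (\<lambda>p. u (io p) - (h p + k p)) < \<epsilon>"
  by (intro bexI[of _ "\<lambda>s. u s + v s"])
qed

lemma core0_closure_scale:
 fixes h :: "'k::finite prelaakso \<Rightarrow> real"
 assumes "h \<in> core0_closure"
 shows "(\<lambda>p. c * h p) \<in> core0_closure"
 unfolding core0_closure_def
proof (intro CollectI conjI allI impI)
 show "(\<lambda>p. c * h p) \<in> l2 MB"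
  using assms by (auto simp: core0_closure_def)
 fix \<epsilon> :: real assume \<epsilon>: "\<epsilon> > 0"
 \<comment> \<open>\<open>c\<close> may be \<open>0\<close>, so the tolerance is divided by
   \<open>c\<^sup>2 + 1\<close>.\<close>
 have c: "c\<^sup>2 + 1 > 0" by (simp add: add_nonneg_pos)
 then have "\<epsilon> / (c\<^sup>2 + 1) > 0"
  using \<epsilon> by simp
 then obtain u where u: "u \<in> core0" "l2_sq MB (\<lambda>p. u (io p) - h p) < \<epsilon> / (c\<^sup>2 + 1)"
  using core0_closureD[OF assms] by blast
 have "l2_sq MB (\<lambda>p. c * u (io p) - c * h p) = c\<^sup>2 * l2_sq MB (\<lambda>p. u (io p) - h p)"
  by (simp add: l2_sq_eq power_mult_distrib flip: right_diff_distrib)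
 also have "\<dots> \<le> (c\<^sup>2 + 1) * l2_sq MB (\<lambda>p. u (io p) - h p)"
  by (simp add: mult_right_mono)
 also have "\<dots> < \<epsilon>"
  using u(2) c by (simp add: pos_less_divide_eq mult.commute)
 finally show "\<exists>u\<in>core0. l2_sq MB (\<lambda>p. u (io p) - c * h p) < \<epsilon>"
  using u(1) core_scale(1)[OF core0_core[OF u(1)], of c] by (intro bexI[of _ "\<lambda>s. c * u s"]) (auto simp: core0_def)
qed

lemma core0_closure_lim:
 fixes h :: "'k::finite prelaakso \<Rightarrow> real"
 assumes h: "h \<in> l2 MB" and k: "\<And>m. k m \<in> core0_closure" "(\<lambda>m. l2_sq MB (\<lambda>p. k m p - h p)) \<longlonglongrightarrow> 0"
 shows "h \<in> core0_closure"
 unfolding core0_closure_def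
proof (intro CollectI conjI allI impI h)
 fix \<epsilon> :: real assume \<epsilon>: "\<epsilon> > 0"
 then have "\<forall>\<^sub>F m in sequentially. l2_sq MB (\<lambda>p. k m p - h p) < \<epsilon> / 4"
  using k(2) by (intro order_tendstoD(2)[of _ 0]) auto
 then obtain m where m: "l2_sq MB (\<lambda>p. k m p - h p) < \<epsilon> / 4"
  unfolding eventually_sequentially by blast
 have km: "k m \<in> l2 MB"
  using k(1)[of m] by (simp add: core0_closure_def)
 obtain u where u: "u \<in> core0" "l2_sq MB (\<lambda>p. u (io p) - k m p) < \<epsilon> / 4"
  using core0_closureD[OF k(1)[of m], of "\<epsilon> / 4"] \<epsilon> by auto
 have "l2_sq MB (\<lambda>p. u (io p) - h p) \<le> 2 * l2_sq MB (\<lambda>p. u (io p) - k m p) + 2 * l2_sq MB (\<lambda>p. k m p - h p)"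
  by (intro l2_sq_triangle core0_l2 u km h)
 then have "l2_sq MB (\<lambda>p. u (io p) - h p) < \<epsilon>"
  using u(2) m by linarith
 then show "\<exists>u\<in>core0. l2_sq MB (\<lambda>p. u (io p) - h p) < \<epsilon>"
  using u(1) by blast
qed

text \<open>An intersection-stable generator of the product sigma-algebra whose non-empty members
  are the sets treated by \<open>rectangle_approx\<close>.\<close>

definition rects :: "'k prelaakso set set" where
 "rects = insert {} {({..a} \<inter> {0..1}) \<times> cyl n v | a n v. True}"

lemma rects_Int: "Int_stable rects"
proof (rule Int_stableI)
 fix A B :: "'a prelaakso set" assume AB: "A \<in> rects" "B \<in> rects"
 show "A \<inter> B \<in> rects"
 proof (cases "A \<inter> B = {}")
  case False
  then have "A \<noteq> {}" "B \<noteq> {}" by auto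
  then obtain a n v b m u where *: "A = ({..a} \<inter> {0..1}) \<times> cyl n v" "B = ({..b} \<inter> {0..1}) \<times> cyl m u"
   using AB unfolding rects_def by blast
  have I: "({..a} \<inter> {0..1}) \<inter> ({..b} \<inter> {0..1}) = {..min a b} \<inter> {0..1 :: real}"
   by auto
  then have AB_eq: "A \<inter> B = ({..min a b} \<inter> {0..1}) \<times> (cyl n v \<inter> cyl m u)"
   unfolding * by (simp only: Times_Int_Times I)
  then have "cyl n v \<inter> cyl m u \<noteq> {}"
   using False by auto
  then have "cyl n v \<inter> cyl m u = cyl m u \<or> cyl n v \<inter> cyl m u = cyl n v"
   using cyl_Int[of n m _ v u] cyl_Int[of m n _ u v] by (cases "n \<le> m") (auto simp: Int_commute)
  then show ?thesis
   unfolding AB_eq rects_def by auto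
 qed (simp add: rects_def)
qed

lemma rects_sets:
 assumes "R \<in> rects" shows "R \<in> sets (MB :: 'k::finite prelaakso measure)"
proof -
 have "({..a} \<inter> {0..1}) \<times> cyl n v \<in> sets MB" for a n and v :: "'k \<Rightarrow> nat \<Rightarrow> bool"
  unfolding MB_def by (intro pair_measureI sets_cyl) (auto simp: sets_restrict_space)
 then show ?thesis
  using assms unfolding rects_def by blast
qed

lemma sets_MB: "sets (MB :: 'k::finite prelaakso measure) = sigma_sets laakso_base rects"
proof
 show "sigma_sets laakso_base rects \<subseteq> sets (MB :: 'k prelaakso measure)"
  using sets.sigma_sets_subset[of rects MB] rects_sets by auto
 have sub: "rects \<subseteq> Pow (laakso_base :: 'k prelaakso set)" by (auto simp: rects_def)
 let ?S = "sigma laakso_base rects :: 'k prelaakso measure"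
 have sp: "space ?S = laakso_base"
  using sub by (rule space_measure_of)
 have R: "({..a} \<inter> {0..1}) \<times> cyl n v \<in> sets ?S" for a n and v :: "'k \<Rightarrow> nat \<Rightarrow> bool"
  using sub by (auto simp: sets_measure_of rects_def)
 have "fst \<in> borel_measurable ?S"
 proof (rule borel_measurableI_le)
  fix a :: real
  have "{p \<in> space ?S. fst p \<le> a} = ({..a} \<inter> {0..1}) \<times> cyl 0 (\<lambda>_ _. False)"
   unfolding sp by (auto simp: cyl_def agree_def)
  then show "{p \<in> space ?S. fst p \<le> a} \<in> sets ?S"
   using R by simp
 qed
 then have fst_borel: "fst \<in> ?S \<rightarrow>\<^sub>M lborel" by simp
 have "fst \<in> ?S \<rightarrow>\<^sub>M MI"
 proof (rule measurable_restrict_space2[OF _ fst_borel])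
  show "fst \<in> space ?S \<rightarrow> {0..1}"
   unfolding sp by (auto simp: laakso_base_def)
 qed
 moreover have "snd \<in> ?S \<rightarrow>\<^sub>M MK"
 proof (rule measurable_MK)
  fix l :: 'k and i :: nat
  have "snd -` {w. w l i = b} \<inter> laakso_base \<in> sets ?S" for b
  proof -
   let ?V = "{v \<in> range (trunc (max (Suc i) 0)). v l i = b} :: ('k \<Rightarrow> nat \<Rightarrow> bool) set"
   have "snd -` {w. w l i = b} \<inter> laakso_base = (\<Union>v\<in>?V. ({..1} \<inter> {0..1}) \<times> cyl (max (Suc i) 0) v)"
    unfolding digit_set_eq[of l i b 0] by (auto simp: laakso_base_def)
   also have "\<dots> \<in> sets ?S" by (rule sets.finite_UN[OF finite_subset[OF _ finite_range_trunc] R]) blast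
   finally show ?thesis .
  qed
  then have "(\<lambda>p. snd p l i) -` {b} \<inter> space ?S \<in> sets ?S" for b
   unfolding sp by (simp only: vimage_def mem_Collect_eq singleton_iff)
  then show "(\<lambda>p. snd p l i) \<in> ?S \<rightarrow>\<^sub>M count_space UNIV"
   unfolding measurable_count_space_eq2_countable by blast
 qed
 ultimately have "(\<lambda>p. (fst p, snd p)) \<in> ?S \<rightarrow>\<^sub>M MI \<Otimes>\<^sub>M MK"
  by (rule measurable_Pair)
 then have id: "(\<lambda>p. p) \<in> ?S \<rightarrow>\<^sub>M MB" by (simp add: MB_def)
 show "sets (MB :: 'k prelaakso measure) \<subseteq> sigma_sets laakso_base rects"
 proof
  fix A :: "'k prelaakso set" assume A: "A \<in> sets MB"
  have "(\<lambda>p. p) -` A \<inter> space ?S \<in> sets ?S" by (rule measurable_sets[OF id A])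
  moreover have "(\<lambda>p. p) -` A \<inter> space ?S = A"
   using sets.sets_into_space[OF A] by (auto simp: sp)
  ultimately show "A \<in> sigma_sets laakso_base rects"
   using sub by (simp add: sets_measure_of)
 qed
qed

lemma core0_closure_sum:
 fixes h :: "'i \<Rightarrow> 'k::finite prelaakso \<Rightarrow> real"
 assumes "finite I" "\<And>i. i \<in> I \<Longrightarrow> h i \<in> core0_closure" "(\<lambda>p :: 'k prelaakso. 0) \<in> core0_closure"
 shows "(\<lambda>p. \<Sum>i\<in>I. h i p) \<in> core0_closure"
 using assms(1,2) by (induction I rule: finite_induct) (auto intro: core0_closure_add assms(3))

text \<open>The sets whose indicator lies in the closed subspace are stable under complements and
  disjoint unions; the pi-lambda theorem starts from the rectangles.\<close>

lemma indicator_in_closure: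
 fixes A :: "'k::finite prelaakso set"
 assumes "A \<in> sets MB"
 shows "indicator A \<in> core0_closure"
proof -
 have ind_l2: "(indicator A :: _ \<Rightarrow> real) \<in> l2 MB" if "A \<in> sets MB" for A :: "'k prelaakso set"
 proof (rule l2I)
  have "(\<lambda>p. (indicator A p)\<^sup>2 :: real) = indicator A" by (auto simp: indicator_def)
  then show "integrable MB (\<lambda>p. (indicator A p)\<^sup>2 :: real)"
   using integrable_real_indicator[OF that] BM.emeasure_finite[of A, unfolded infinity_ennreal_def less_top]
   by (simp only: infinity_ennreal_def)
 qed (use that in simp)
 have rect: "indicator (({..a} \<inter> {0..1}) \<times> cyl n v) \<in> core0_closure" for a n and v :: "'k \<Rightarrow> nat \<Rightarrow> bool"
 proof -
  have "({..a} \<inter> {0..1}) \<times> cyl n v \<in> rects"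
   unfolding rects_def by blast
  from ind_l2[OF rects_sets[OF this]] show ?thesis
   unfolding core0_closure_def using rectangle_approx by blast
 qed
 have one: "indicator laakso_base \<in> (core0_closure :: ('k prelaakso \<Rightarrow> real) set)"
 proof -
  have "laakso_base = ({..1} \<inter> {0..1}) \<times> cyl 0 (\<lambda>_ _. False)"
   by (auto simp: laakso_base_def cyl_def agree_def)
  then show ?thesis
   using rect by metis
 qed
 have zero: "(\<lambda>_. 0) \<in> (core0_closure :: ('k prelaakso \<Rightarrow> real) set)"
  using core0_closure_scale[OF one, of 0] by simp
 have empty: "indicator {} \<in> (core0_closure :: ('k prelaakso \<Rightarrow> real) set)"
 proof -
  have "(indicator {} :: 'k prelaakso \<Rightarrow> real) = (\<lambda>_. 0)" by (simp add: fun_eq_iff)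
  then show ?thesis
   using zero by (simp only:)
 qed
 have "rects \<subseteq> Pow (laakso_base :: 'k prelaakso set)" by (auto simp: rects_def)
 moreover have "A \<in> sigma_sets laakso_base rects"
  using assms sets_MB by blast
 ultimately show ?thesis
 proof (induction A rule: sigma_sets_induct_disjoint[OF rects_Int, consumes 2])
  fix A :: "'k prelaakso set" assume "A \<in> rects"
  then show "indicator A \<in> core0_closure"
   using rect empty unfolding rects_def by blast
 next
  show "indicator {} \<in> (core0_closure :: ('k prelaakso \<Rightarrow> real) set)" by (rule empty)
 next
  fix A :: "'k prelaakso set" assume A: "A \<in> sigma_sets laakso_base rects" "indicator A \<in> (core0_closure :: ('k prelaakso \<Rightarrow> real) set)"
  have "A \<subseteq> laakso_base"
   using A(1) sets.sets_into_space[of A MB] unfolding sets_MB[symmetric] by simp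
  then have "indicator (laakso_base - A) = (\<lambda>p. indicator laakso_base p + (- 1) * indicator A p :: real)"
   by (auto simp: indicator_def fun_eq_iff)
  then show "indicator (laakso_base - A) \<in> (core0_closure :: ('k prelaakso \<Rightarrow> real) set)"
   using core0_closure_add[OF one core0_closure_scale[OF A(2), of "- 1"]] by simp
 next
  fix A :: "nat \<Rightarrow> 'k prelaakso set"
  assume A: "disjoint_family A" "range A \<subseteq> sigma_sets laakso_base rects" "\<And>i. indicator (A i) \<in> (core0_closure :: ('k prelaakso \<Rightarrow> real) set)"
  have A_sets [measurable]: "A i \<in> sets MB" for i
   using A(2) unfolding sets_MB by blast
  have U_sets [measurable]: "(\<Union>i. A i) \<in> sets MB" by (rule sets.countable_UN) (use A_sets in blast)
  let ?k = "\<lambda>m p. \<Sum>i<m. indicator (A i) p :: real"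
  have k_eq: "?k m p = indicator (\<Union>i<m. A i) p" for m p
   using A(1) by (subst indicator_UN_disjoint) (auto simp: disjoint_family_on_def)
  show "indicator (\<Union>i. A i) \<in> (core0_closure :: ('k prelaakso \<Rightarrow> real) set)"
  proof (rule core0_closure_lim[OF ind_l2[OF U_sets]])
   show "?k m \<in> core0_closure" for m
    using A(3) by (intro core0_closure_sum zero) auto
   show "(\<lambda>m. l2_sq MB (\<lambda>p. ?k m p - indicator (\<Union>i. A i) p)) \<longlonglongrightarrow> 0"
   proof (rule l2_sq_dominated[where b = "\<lambda>_. 1"])
    show "(\<lambda>p. ?k m p - indicator (\<Union>i. A i) p) \<in> borel_measurable MB" for m by measurable
    show "AE p in MB. (?k m p - indicator (\<Union>i. A i) p)\<^sup>2 \<le> 1" for m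
     unfolding k_eq by (intro AE_I2) (auto simp: indicator_def)
    show "AE p in MB. (\<lambda>m. ?k m p - indicator (\<Union>i. A i) p) \<longlonglongrightarrow> 0"
    proof (rule AE_I2)
     fix p :: "'k prelaakso"
     have "\<forall>\<^sub>F m in sequentially. indicator (\<Union>i<m. A i) p = (indicator (\<Union>i. A i) p :: real)"
     proof (cases "p \<in> (\<Union>i. A i)")
      case True
      then obtain i where "p \<in> A i" by blast
      then have "p \<in> (\<Union>i<m. A i)" if "m \<ge> Suc i" for m
       using that by (intro UN_I[of i]) auto
      then show ?thesis
       unfolding eventually_sequentially using True by (intro exI[of _ "Suc i"]) auto
     qed (auto intro!: always_eventually)
     then have "(\<lambda>m. ?k m p) \<longlonglongrightarrow> indicator (\<Union>i. A i) p"
      unfolding k_eq by (rule tendsto_eventually)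
     then show "(\<lambda>m. ?k m p - indicator (\<Union>i. A i) p) \<longlonglongrightarrow> 0"
      by (rule Lim_null[THEN iffD1])
    qed
   qed simp
  qed
 qed
qed

lemma core0_dense:
 fixes h :: "'k::finite prelaakso \<Rightarrow> real"
 assumes h: "h \<in> l2 MB"
 shows "h \<in> core0_closure"
proof -
 obtain F where F: "\<And>i. simple_function MB (F i)" "\<And>x. x \<in> space MB \<Longrightarrow> (\<lambda>i. F i x) \<longlonglongrightarrow> h x"
   "\<And>i x. x \<in> space MB \<Longrightarrow> dist (F i x) 0 \<le> 2 * dist (h x) 0"
  using borel_measurable_implies_sequence_metric[OF l2D(1)[OF h], of 0] by blast
 let ?k = "\<lambda>i p. \<Sum>y\<in>F i ` space MB. y * indicator (F i -` {y} \<inter> space MB) p"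
 have zero: "(\<lambda>_. 0) \<in> (core0_closure :: ('k prelaakso \<Rightarrow> real) set)"
  using core0_closure_scale[OF indicator_in_closure[of "{}"], of 0] by simp
 have k_eq: "?k i p = F i p" if "p \<in> space MB" for i p
 proof -
  have "F i p = (\<Sum>y\<in>F i ` space MB. indicator (F i -` {y} \<inter> space MB) p *\<^sub>R y)"
   by (rule simple_function_indicator_representation_banach[OF F(1) that])
  also have "\<dots> = ?k i p" by (rule sum.cong[OF refl]) (simp only: real_scaleR_def mult.commute)
  finally show ?thesis by (rule sym)
 qed
 have k_meas: "?k i \<in> borel_measurable MB" for i
  using simple_functionD(2)[OF F(1)[of i]] by (intro borel_measurable_sum borel_measurable_times borel_measurable_indicator) auto
 show ?thesis
 proof (rule core0_closure_lim[OF h, of ?k])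
  show "?k i \<in> core0_closure" for i
   using simple_functionD[OF F(1)[of i]]
   by (intro core0_closure_sum core0_closure_scale indicator_in_closure zero) auto
  show "(\<lambda>i. l2_sq MB (\<lambda>p. ?k i p - h p)) \<longlonglongrightarrow> 0"
  \<comment> \<open>The simple functions satisfy
    \<open>\<bar>F i p\<bar> \<le> 2 * \<bar>h p\<bar>\<close>, so the error is at most
    \<open>3 * \<bar>h p\<bar>\<close>; squaring gives the factor \<open>9\<close>.\<close>
  proof (rule l2_sq_dominated[where b = "\<lambda>p. 9 * (h p)\<^sup>2"])
   show "(\<lambda>p. ?k i p - h p) \<in> borel_measurable MB" for i
    by (intro borel_measurable_diff k_meas l2D(1)[OF h])
   show "integrable MB (\<lambda>p. 9 * (h p)\<^sup>2)"
    using h by (simp add: l2_def)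
   show "AE p in MB. (?k i p - h p)\<^sup>2 \<le> 9 * (h p)\<^sup>2" for i
   proof (rule AE_I2)
    fix p assume p: "p \<in> space (MB :: 'k prelaakso measure)"
    have "\<bar>F i p - h p\<bar> \<le> \<bar>3 * h p\<bar>"
     using F(3)[OF p, of i] by (simp add: dist_real_def)
    then have "(F i p - h p)\<^sup>2 \<le> (3 * h p)\<^sup>2" by (simp only: abs_le_square_iff)
    then show "(?k i p - h p)\<^sup>2 \<le> 9 * (h p)\<^sup>2"
     unfolding k_eq[OF p] by (simp add: power_mult_distrib)
   qed
   show "AE p in MB. (\<lambda>i. ?k i p - h p) \<longlonglongrightarrow> 0"
   proof (rule AE_I2)
    fix p assume p: "p \<in> space (MB :: 'k prelaakso measure)"
    show "(\<lambda>i. ?k i p - h p) \<longlonglongrightarrow> 0"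
     unfolding k_eq[OF p] by (rule Lim_null[THEN iffD1, OF F(2)[OF p]])
   qed
  qed
 qed
qed

lemma core0_approx:
 fixes h :: "'k::finite prelaakso \<Rightarrow> real"
 assumes "h \<in> l2 MB"
 obtains v where "\<And>m. v m \<in> core0" "(\<lambda>m. l2_sq MB (\<lambda>p. v m (io p) - h p)) \<longlonglongrightarrow> 0"
proof -
 have "\<exists>u\<in>core0. l2_sq MB (\<lambda>p. u (io p) - h p) < inverse (real (Suc m))" for m
  using core0_dense[OF assms] unfolding core0_closure_def by simp
 then obtain v where v: "\<And>m. v m \<in> core0" "\<And>m. l2_sq MB (\<lambda>p. v m (io p) - h p) < inverse (real (Suc m))"
  by metis
 have "(\<lambda>m. l2_sq MB (\<lambda>p. v m (io p) - h p)) \<longlonglongrightarrow> 0"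
  using v(2) by (intro tendsto_sandwich[OF _ _ tendsto_const LIMSEQ_inverse_real_of_nat])
   (auto intro!: always_eventually less_imp_le)
 with v(1) show ?thesis by (rule that)
qed

text \<open>The fundamental theorem holds on almost every line from one end to the other. The line
  passes through all wormholes, so only the two ends of \<open>I\<close> contribute.\<close>

lemma dx_integral_0:
 fixes f :: "'k::finite laakso_point \<Rightarrow> real"
 assumes f: "f \<in> mgug_core js" and eq: "\<And>w. f (io (0, w)) = f (io (1, w))"
 shows "(\<integral>p. dx js f p \<partial>MB) = 0"
proof -
 obtain n where n: "f \<in> mgug_D js n"
  using f by (auto simp: mem_mgug_core)
 have "integrable MB (\<lambda>p. dx js f p * 1)" by (rule l2_mult_integrable[OF core_dx_l2[OF f] BM.l2_const])
 then have int: "integrable (MI \<Otimes>\<^sub>M MK) (\<lambda>(x, w). dx js f (x, w))"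
  by (simp add: MB_def case_prod_eta)
 have line: "(\<integral>x. dx js f (x, w) \<partial>MI) = 0" if "integrable MI (\<lambda>x. dx js f (x, w))" for w
 proof -
  have "integrable lborel (\<lambda>x. indicator {0..1} x *\<^sub>R dx js f (x, w))"
   using that by (subst (asm) integrable_restrict_space) auto
  from dx_ftc[OF n _ _ this] show ?thesis
   using eq[of w] by (subst integral_restrict_space) auto
 qed
 have "(\<integral>p. dx js f p \<partial>MB) = (\<integral>w. (\<integral>x. dx js f (x, w) \<partial>MI) \<partial>MK)"
  using MB.integral_snd[OF int] by (simp add: MB_def case_prod_eta)
 also have "\<dots> = (\<integral>w. 0 \<partial>(MK :: ('k \<Rightarrow> nat \<Rightarrow> bool) measure))"
 proof (rule integral_cong_AE)
  show "AE w in MK. (\<integral>x. dx js f (x, w) \<partial>MI) = 0"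
   using MB.AE_integrable_snd[OF int] by eventually_elim (rule line)
  show "(\<lambda>w. \<integral>x. dx js f (x, w) \<partial>MI) \<in> borel_measurable MK"
   using MB.integrable_snd[OF int] by (rule borel_measurable_integrable)
 qed simp
 finally show ?thesis by simp
qed

text \<open>The product rule comes from the chain rule for squares through
  \<open>u v = ((u + v)^2 - (u - v)^2) / 4\<close>. The product has boundary values \<open>0\<close>
  because \<open>v\<close> does.\<close>

lemma core_parts:
 fixes u v :: "'k::finite laakso_point \<Rightarrow> real"
 assumes u: "u \<in> mgug_core js" and v0: "v \<in> core0"
 shows "l2_inner MB (dx js u) (\<lambda>p. v (io p)) = - l2_inner MB (\<lambda>p. u (io p)) (dx js v)"
proof -
 note v = core0_core[OF v0]
 have sq: "((\<lambda>x :: real. x\<^sup>2) has_real_derivative 2 * x) (at x)" for x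
  by (auto intro!: derivative_eq_intros)
 have sqc: "continuous_on UNIV (\<lambda>x :: real. 2 * x)" by (intro continuous_intros)
 note p = core_chain[OF core_add(1)[OF u v] sq sqc] and m = core_chain[OF core_diff(1)[OF u v] sq sqc]
 note d = core_scale[OF core_diff(1)[OF p(1) m(1)], of "1/4"]
 let ?f = "\<lambda>s. 1/4 * ((u s + v s)\<^sup>2 - (u s - v s)\<^sup>2)"
 have "AE q in MB. dx js ?f q = dx js u q * v (io q) + u (io q) * dx js v q"
  using d(2) core_diff(2)[OF p(1) m(1)] p(2) m(2) core_add(2)[OF u v] core_diff(2)[OF u v]
  by eventually_elim (simp add: algebra_simps)
 moreover have "(\<integral>q. dx js ?f q \<partial>MB) = 0"
  by (rule dx_integral_0[OF d(1)]) (use v0 in \<open>simp add: core0_def\<close>)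
 moreover have int: "integrable MB (\<lambda>q. dx js u q * v (io q))" "integrable MB (\<lambda>q. u (io q) * dx js v q)"
  by (intro l2_mult_integrable core_dx_l2 l2_laakso_imp core_l2 u v)+
 ultimately have "(\<integral>q. dx js u q * v (io q) + u (io q) * dx js v q \<partial>MB) = 0"
  using l2D(1)[OF core_dx_l2[OF d(1)]] by (subst (asm) integral_cong_AE) auto
 then show ?thesis
  using int by (simp add: l2_inner_def)
qed

text \<open>The closure of the graph of the derivative.\<close>

definition W :: "('k::finite laakso_point \<Rightarrow> real) \<Rightarrow> ('k prelaakso \<Rightarrow> real) \<Rightarrow> bool" where
 "W f g \<longleftrightarrow> f \<in> l2 (\<mu>) \<and> g \<in> l2 MB \<and> (\<forall>\<epsilon>>0. \<exists>u\<in>mgug_core js.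
   l2_sq (\<mu>) (\<lambda>s. u s - f s) < \<epsilon> \<and> l2_sq MB (\<lambda>p. dx js u p - g p) < \<epsilon>)"

lemma W_l2: "W f g \<Longrightarrow> f \<in> l2 (\<mu>)" "W f g \<Longrightarrow> g \<in> l2 MB"
 by (auto simp: W_def)

lemma W_seq:
 fixes f :: "'k::finite laakso_point \<Rightarrow> real"
 assumes "W f g"
 obtains u where "\<And>m. u m \<in> mgug_core js" "(\<lambda>m. l2_sq (\<mu>) (\<lambda>s. u m s - f s)) \<longlonglongrightarrow> 0"
  "(\<lambda>m. l2_sq MB (\<lambda>p. dx js (u m) p - g p)) \<longlonglongrightarrow> 0"
proof -
 have "\<exists>u\<in>mgug_core js. l2_sq (\<mu>) (\<lambda>s. u s - f s) < inverse (real (Suc m)) \<and>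
   l2_sq MB (\<lambda>p. dx js u p - g p) < inverse (real (Suc m))" for m
  using assms unfolding W_def by simp
 then have "\<forall>m. \<exists>u. u \<in> mgug_core js \<and> l2_sq (\<mu>) (\<lambda>s. u s - f s) < inverse (real (Suc m)) \<and>
   l2_sq MB (\<lambda>p. dx js u p - g p) < inverse (real (Suc m))" by blast
 from choice[OF this] obtain u where "\<forall>m. u m \<in> mgug_core js \<and>
   l2_sq (\<mu>) (\<lambda>s. u m s - f s) < inverse (real (Suc m)) \<and>
   l2_sq MB (\<lambda>p. dx js (u m) p - g p) < inverse (real (Suc m))" by blast
 then have u: "\<And>m. u m \<in> mgug_core js"
   "\<And>m. l2_sq (\<mu>) (\<lambda>s. u m s - f s) < inverse (real (Suc m))"
   "\<And>m. l2_sq MB (\<lambda>p. dx js (u m) p - g p) < inverse (real (Suc m))" by blast+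
 have "(\<lambda>m. l2_sq (\<mu>) (\<lambda>s. u m s - f s)) \<longlonglongrightarrow> 0" "(\<lambda>m. l2_sq MB (\<lambda>p. dx js (u m) p - g p)) \<longlonglongrightarrow> 0"
  using u(2,3) by (intro tendsto_sandwich[OF _ _ tendsto_const LIMSEQ_inverse_real_of_nat];
   auto intro!: always_eventually less_imp_le)+
 with u(1) show ?thesis by (rule that)
qed

lemma W_lim:
 fixes f :: "'k::finite laakso_point \<Rightarrow> real"
 assumes W: "\<And>m. W (f' m) (g' m)" and f: "f \<in> l2 (\<mu>)" "g \<in> l2 MB"
  and lim: "(\<lambda>m. l2_sq (\<mu>) (\<lambda>s. f' m s - f s)) \<longlonglongrightarrow> 0" "(\<lambda>m. l2_sq MB (\<lambda>p. g' m p - g p)) \<longlonglongrightarrow> 0"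
 shows "W f g"
 unfolding W_def
proof (intro conjI f allI impI)
 fix \<epsilon> :: real assume \<epsilon>: "\<epsilon> > 0"
 have "\<forall>\<^sub>F m in sequentially. l2_sq (\<mu>) (\<lambda>s. f' m s - f s) < \<epsilon> / 4 \<and> l2_sq MB (\<lambda>p. g' m p - g p) < \<epsilon> / 4"
  using lim \<epsilon> by (intro eventually_conj order_tendstoD(2)[of _ 0]) auto
 then obtain m where m: "l2_sq (\<mu>) (\<lambda>s. f' m s - f s) < \<epsilon> / 4" "l2_sq MB (\<lambda>p. g' m p - g p) < \<epsilon> / 4"
  unfolding eventually_sequentially by blast
 have "\<epsilon> / 4 > 0"
  using \<epsilon> by simp
 then obtain u where u: "u \<in> mgug_core js" "l2_sq (\<mu>) (\<lambda>s. u s - f' m s) < \<epsilon> / 4"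
   "l2_sq MB (\<lambda>p. dx js u p - g' m p) < \<epsilon> / 4"
  using W[of m] unfolding W_def by blast
 have "l2_sq (\<mu>) (\<lambda>s. u s - f s) < \<epsilon>"
  using l2_sq_triangle[OF core_l2[OF u(1)] W_l2(1)[OF W[of m]] f(1)] m(1) u(2) by linarith
 moreover have "l2_sq MB (\<lambda>p. dx js u p - g p) < \<epsilon>"
  using l2_sq_triangle[OF core_dx_l2[OF u(1)] W_l2(2)[OF W[of m]] f(2)] m(2) u(3) by linarith
 ultimately show "\<exists>u\<in>mgug_core js. l2_sq (\<mu>) (\<lambda>s. u s - f s) < \<epsilon> \<and> l2_sq MB (\<lambda>p. dx js u p - g p) < \<epsilon>"
  using u(1) by blast
qed

lemma W_cong_AE:
 fixes f :: "'k::finite laakso_point \<Rightarrow> real"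
 assumes "W f g" "f' \<in> borel_measurable (\<mu>)" "AE s in \<mu>. f s = f' s"
  "g' \<in> borel_measurable MB" "AE p in MB. g p = g' p"
 shows "W f' g'"
proof -
 note l = W_l2[OF assms(1)]
 have f': "f' \<in> l2 (\<mu>)"
 proof (rule l2I[OF assms(2)])
  have "integrable (\<mu>) (\<lambda>s. (f s)\<^sup>2) \<longleftrightarrow> integrable (\<mu>) (\<lambda>s. (f' s)\<^sup>2)"
   using l2D(1)[OF l(1)] assms(2,3) by (intro integrable_cong_AE) auto
  then show "integrable (\<mu>) (\<lambda>s. (f' s)\<^sup>2)"
   using l2D(2)[OF l(1)] by simp
 qed
 have g': "g' \<in> l2 MB"
 proof (rule l2I[OF assms(4)])
  have "integrable MB (\<lambda>s. (g s)\<^sup>2) \<longleftrightarrow> integrable MB (\<lambda>s. (g' s)\<^sup>2)"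
   using l2D(1)[OF l(2)] assms(4,5) by (intro integrable_cong_AE) auto
  then show "integrable MB (\<lambda>s. (g' s)\<^sup>2)"
   using l2D(2)[OF l(2)] by simp
 qed
 have "l2_sq (\<mu>) (\<lambda>s. f s - f' s) = l2_sq (\<mu>) (\<lambda>_ :: 'k laakso_point. 0)"
 proof (rule l2_sq_cong_AE)
  show "AE s in \<mu>. f s - f' s = 0"
   using assms(3) by eventually_elim simp
 qed (use l2D(1)[OF l(1)] assms(2) in auto)
 moreover have "l2_sq MB (\<lambda>p. g p - g' p) = l2_sq MB (\<lambda>_ :: 'k prelaakso. 0)"
 proof (rule l2_sq_cong_AE)
  show "AE p in MB. g p - g' p = 0"
   using assms(5) by eventually_elim simp
 qed (use l2D(1)[OF l(2)] assms(4) in auto)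
 ultimately show ?thesis by (intro W_lim[OF assms(1) f' g']) (simp_all only: tendsto_const l2_sq_zero)
qed

lemma W_core: "u \<in> mgug_core js \<Longrightarrow> W u (dx js u)"
 unfolding W_def using core_l2 core_dx_l2 by (auto simp: l2_sq_eq intro!: bexI[of _ u])

lemma W_core_AE:
 fixes u :: "'k::finite laakso_point \<Rightarrow> real"
 assumes "u \<in> mgug_core js" "AE p in MB. dx js u p = g p" "g \<in> borel_measurable MB"
 shows "W u g"
 using assms l2D(1)[OF core_l2[OF assms(1)]] by (intro W_cong_AE[OF W_core[OF assms(1)]]) auto

lemma W_add:
 fixes f f' :: "'k::finite laakso_point \<Rightarrow> real"
 assumes "W f g" "W f' g'"
 shows "W (\<lambda>s. f s + f' s) (\<lambda>p. g p + g' p)"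
proof -
 obtain u where u: "\<And>m. u m \<in> mgug_core js" "(\<lambda>m. l2_sq (\<mu>) (\<lambda>s. u m s - f s)) \<longlonglongrightarrow> 0"
  "(\<lambda>m. l2_sq MB (\<lambda>p. dx js (u m) p - g p)) \<longlonglongrightarrow> 0"
  by (rule W_seq[OF assms(1)]) (rule that; assumption)
 obtain v where v: "\<And>m. v m \<in> mgug_core js" "(\<lambda>m. l2_sq (\<mu>) (\<lambda>s. v m s - f' s)) \<longlonglongrightarrow> 0"
  "(\<lambda>m. l2_sq MB (\<lambda>p. dx js (v m) p - g' p)) \<longlonglongrightarrow> 0"
  by (rule W_seq[OF assms(2)]) (rule that; assumption)
 show ?thesis
 proof (rule W_lim)
  show "W (\<lambda>s. u m s + v m s) (\<lambda>p. dx js (u m) p + dx js (v m) p)" for m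
   using core_add[OF u(1)[of m] v(1)[of m]] core_dx_l2[OF u(1)[of m]] core_dx_l2[OF v(1)[of m]]
   by (intro W_core_AE) (auto simp: l2_def)
  show "(\<lambda>m. l2_sq (\<mu>) (\<lambda>s. u m s + v m s - (f s + f' s))) \<longlonglongrightarrow> 0"
   by (intro l2_sq_sum_lim core_l2 u v W_l2(1)[OF assms(1)] W_l2(1)[OF assms(2)])
  show "(\<lambda>m. l2_sq MB (\<lambda>p. dx js (u m) p + dx js (v m) p - (g p + g' p))) \<longlonglongrightarrow> 0"
   by (intro l2_sq_sum_lim core_dx_l2 u v W_l2(2)[OF assms(1)] W_l2(2)[OF assms(2)])
 qed (intro l2_add W_l2(1)[OF assms(1)] W_l2(1)[OF assms(2)] W_l2(2)[OF assms(1)] W_l2(2)[OF assms(2)])+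
qed

lemma W_scale:
 fixes f :: "'k::finite laakso_point \<Rightarrow> real"
 assumes "W f g"
 shows "W (\<lambda>s. c * f s) (\<lambda>p. c * g p)"
proof -
 obtain u where u: "\<And>m. u m \<in> mgug_core js" "(\<lambda>m. l2_sq (\<mu>) (\<lambda>s. u m s - f s)) \<longlonglongrightarrow> 0"
  "(\<lambda>m. l2_sq MB (\<lambda>p. dx js (u m) p - g p)) \<longlonglongrightarrow> 0"
  by (rule W_seq[OF assms(1)]) (rule that; assumption)
 show ?thesis
 proof (rule W_lim)
  show "W (\<lambda>s. c * u m s) (\<lambda>p. c * dx js (u m) p)" for m
   using core_scale[OF u(1)[of m]] core_dx_l2[OF u(1)[of m]] by (intro W_core_AE) (auto simp: l2_def)
  show "(\<lambda>m. l2_sq (\<mu>) (\<lambda>s. c * u m s - c * f s)) \<longlonglongrightarrow> 0"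
   "(\<lambda>m. l2_sq MB (\<lambda>p. c * dx js (u m) p - c * g p)) \<longlonglongrightarrow> 0"
   unfolding l2_sq_scale_diff using tendsto_mult_left[OF u(2), of "c\<^sup>2"] tendsto_mult_left[OF u(3), of "c\<^sup>2"] by simp_all
 qed (intro l2_scale W_l2[OF assms])+
qed

lemma W_diff:
 fixes f f' :: "'k::finite laakso_point \<Rightarrow> real"
 assumes "W f g" "W f' g'"
 shows "W (\<lambda>s. f s - f' s) (\<lambda>p. g p - g' p)"
 using W_add[OF assms(1) W_scale[OF assms(2), of "- 1"]] by simp

text \<open>Closability: if \<open>f\<close> vanishes, integration by parts makes the limit
  \<open>g\<close> of the derivatives orthogonal to all test functions, hence by density to
  itself.\<close>

lemma W_null:
 fixes f :: "'k::finite laakso_point \<Rightarrow> real"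
 assumes W: "W f g" and f0: "AE s in \<mu>. f s = 0"
 shows "AE p in MB. g p = 0"
proof -
 obtain u where u: "\<And>m. u m \<in> mgug_core js" "(\<lambda>m. l2_sq (\<mu>) (\<lambda>s. u m s - f s)) \<longlonglongrightarrow> 0"
  "(\<lambda>m. l2_sq MB (\<lambda>p. dx js (u m) p - g p)) \<longlonglongrightarrow> 0"
  by (rule W_seq[OF W]) (rule that; assumption)
 note g = W_l2(2)[OF W] and f = W_l2(1)[OF W]
 have "l2_sq (\<mu>) (\<lambda>s. u m s - f s) = l2_sq MB (\<lambda>p. u m (io p) - f (io p))" for m
  using l2D(1)[OF l2_diff[OF core_l2[OF u(1)] f]] by (rule l2_sq_laakso)
 then have u_io: "(\<lambda>m. l2_sq MB (\<lambda>p. u m (io p) - f (io p))) \<longlonglongrightarrow> 0"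
  using u(2) by simp
 have f_io: "AE p in MB. f (io p) = 0" by (rule AE_laakso_imp[OF f0])
 have orth: "l2_inner MB g (\<lambda>p. v (io p)) = 0" if v: "v \<in> core0" for v
 proof -
  note dv = core_dx_l2[OF core0_core[OF v]]
  have "(\<lambda>m. l2_inner MB (dx js (u m)) (\<lambda>p. v (io p))) \<longlonglongrightarrow> l2_inner MB g (\<lambda>p. v (io p))"
   by (intro l2_inner_tendsto core_dx_l2 u g core0_l2 v)
  moreover have "(\<lambda>m. - l2_inner MB (\<lambda>p. u m (io p)) (dx js v)) \<longlonglongrightarrow> - l2_inner MB (\<lambda>p. f (io p)) (dx js v)"
   by (intro tendsto_minus l2_inner_tendsto l2_laakso_imp core_l2 u f dv u_io)
  moreover have "l2_inner MB (\<lambda>p. f (io p)) (dx js v) = (\<integral>p. 0 \<partial>(MB :: 'k prelaakso measure))"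
   unfolding l2_inner_def
   using f_io l2D(1)[OF l2_laakso_imp[OF f]] l2D(1)[OF dv] by (intro integral_cong_AE) auto
  ultimately show ?thesis
   unfolding core_parts[OF u(1) v] using LIMSEQ_unique by fastforce
 qed
 obtain v where v: "\<And>m. v m \<in> core0" "(\<lambda>m. l2_sq MB (\<lambda>p. v m (io p) - g p)) \<longlonglongrightarrow> 0"
  by (rule core0_approx[OF g]) (rule that; assumption)
 have "(\<lambda>m. l2_inner MB (\<lambda>p. v m (io p)) g) \<longlonglongrightarrow> l2_inner MB g g"
  by (intro l2_inner_tendsto core0_l2 v g)
 moreover have "l2_inner MB (\<lambda>p. v m (io p)) g = 0" for m
  using orth[OF v(1)[of m]] by (simp add: l2_inner_def mult.commute)
 ultimately have "l2_inner MB g g = 0"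
  using LIMSEQ_unique[OF _ tendsto_const] by fastforce
 then have "(\<integral>p. (g p)\<^sup>2 \<partial>MB) = 0" by (simp add: l2_inner_def power2_eq_square)
 then show ?thesis
  using l2D(2)[OF g] by (simp add: integral_nonneg_eq_0_iff_AE)
qed

lemma W_unique:
 fixes f :: "'k::finite laakso_point \<Rightarrow> real"
 assumes "W f g" "W f' g'" "AE s in \<mu>. f s = f' s"
 shows "AE p in MB. g p = g' p"
proof -
 have "AE s in \<mu>. f s - f' s = 0"
  using assms(3) by eventually_elim simp
 from W_null[OF W_diff[OF assms(1,2)] this] show ?thesis by simp
qed

text \<open>Extends the chain rule to a uniform limit \<open>\<psi>\<close> of continuously
  differentiable functions whose derivatives are uniformly bounded and converge pointwise. The limit
  \<open>\<psi>'\<close> may be discontinuous: it is \<open>sgn\<close> in \<open>W_abs\<close> and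
  the indicator of \<open>{0}\<close> in \<open>W_zero_set\<close>.\<close>

lemma W_chain_lim:
 fixes f :: "'k::finite laakso_point \<Rightarrow> real" and \<phi> \<phi>' :: "nat \<Rightarrow> real \<Rightarrow> real"
 assumes W: "W f g"
  and \<phi>: "\<And>k x. (\<phi> k has_real_derivative \<phi>' k x) (at x)" "\<And>k. continuous_on UNIV (\<phi>' k)" "\<And>k x. \<bar>\<phi>' k x\<bar> \<le> C"
  and \<psi>: "\<And>k x. \<bar>\<phi> k x - \<psi> x\<bar> \<le> \<delta> k" "\<delta> \<longlonglongrightarrow> 0" "\<And>x. (\<lambda>k. \<phi>' k x) \<longlonglongrightarrow> \<psi>' x"
 shows "W (\<lambda>s. \<psi> (f s)) (\<lambda>p. \<psi>' (f (io p)) * g p)"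
proof -
 note f = W_l2(1)[OF W] and g = W_l2(2)[OF W]
 note f_io = l2_laakso_imp[OF f]
 have \<phi>_cont: "continuous_on UNIV (\<phi> k)" for k
  using \<phi>(1) DERIV_continuous_on by blast
 note [measurable] = l2D(1)[OF f] l2D(1)[OF g] l2D(1)[OF f_io] borel_measurable_continuous_onI[OF \<phi>_cont] borel_measurable_continuous_onI[OF \<phi>(2)]
 have C0: "0 \<le> C"
  using \<phi>(3)[of 0 0] by linarith
 have lip: "\<bar>\<phi> k x - \<phi> k y\<bar> \<le> C * \<bar>x - y\<bar>" for k x y
  using field_differentiable_bound[of UNIV "\<phi> k" "\<phi>' k" C x y] \<phi>(1,3) by simp
 have lip_sq: "(\<phi> k x - \<phi> k y)\<^sup>2 \<le> C\<^sup>2 * (x - y)\<^sup>2" for k x y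
 proof -
  have "\<bar>\<phi> k x - \<phi> k y\<bar> \<le> \<bar>C * (x - y)\<bar>"
   using lip[of k x y] C0 by (simp add: abs_mult)
  then show ?thesis by (simp only: abs_le_square_iff power_mult_distrib[symmetric])
 qed
 have \<psi>_lim: "(\<lambda>k. \<phi> k x) \<longlonglongrightarrow> \<psi> x" for x
 proof (rule Lim_null[THEN iffD2], rule tendsto_0_le[OF \<psi>(2), of _ 1])
  show "\<forall>\<^sub>F k in sequentially. norm (\<phi> k x - \<psi> x) \<le> norm (\<delta> k) * 1"
   using \<psi>(1)[of _ x] by (intro always_eventually allI) (simp add: order_trans[OF _ abs_ge_self])
 qed
 have [measurable]: "\<psi> \<in> borel_measurable borel"
  by (rule borel_measurable_LIMSEQ_real[OF \<psi>_lim]) measurable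
 have [measurable]: "\<psi>' \<in> borel_measurable borel"
  by (rule borel_measurable_LIMSEQ_real[OF \<psi>(3)]) measurable
 have \<psi>'_bound: "\<bar>\<psi>' x\<bar> \<le> C" for x
  using tendsto_rabs[OF \<psi>(3)[of x]] \<phi>(3) by (intro LIMSEQ_le_const2) auto
 have \<phi>f: "(\<lambda>s. \<phi> k (f s)) \<in> l2 (\<mu>)" for k
 proof -
  have "(\<lambda>s. \<phi> k (f s) - \<phi> k 0) \<in> l2 (\<mu>)"
  proof (rule l2I)
   show "integrable (\<mu>) (\<lambda>s. (\<phi> k (f s) - \<phi> k 0)\<^sup>2)"
   proof (rule Bochner_Integration.integrable_bound)
    show "integrable (\<mu>) (\<lambda>s. C\<^sup>2 * (f s)\<^sup>2)"
     using l2D(2)[OF f] by simp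
   qed (use lip_sq[of k _ 0] in auto)
  qed measurable
  from l2_add[OF this LM.l2_const[of "\<phi> k 0"]] show ?thesis by simp
 qed
 \<comment> \<open>For fixed \<open>k\<close> the chain rule passes from the core to
   \<open>f\<close> along a subsequence that converges almost everywhere, so that
   \<open>\<phi>' k\<close> converges at the approximants.\<close>
 have step1: "W (\<lambda>s. \<phi> k (f s)) (\<lambda>p. \<phi>' k (f (io p)) * g p)" for k
 proof -
  obtain u where u: "\<And>m. u m \<in> mgug_core js" "(\<lambda>m. l2_sq (\<mu>) (\<lambda>s. u m s - f s)) \<longlonglongrightarrow> 0"
   "(\<lambda>m. l2_sq MB (\<lambda>p. dx js (u m) p - g p)) \<longlonglongrightarrow> 0"
   by (rule W_seq[OF W]) (rule that; assumption)
  note u_io = l2_laakso_imp[OF core_l2[OF u(1)]] and du = core_dx_l2[OF u(1)]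
  note [measurable] = l2D(1)[OF core_l2[OF u(1)]] l2D(1)[OF u_io] l2D(1)[OF du]
  have "(\<lambda>m. l2_sq MB (\<lambda>p. u m (io p) - f (io p))) \<longlonglongrightarrow> 0"
   using u(2) by (subst (asm) l2_sq_laakso) measurable
  from l2_AE_subseq[OF u_io f_io this]
  obtain r :: "nat \<Rightarrow> nat" where r: "strict_mono r" "AE p in MB. (\<lambda>m. u (r m) (io p)) \<longlonglongrightarrow> f (io p)"
   by blast
  define v where "v m = u (r m)" for m
  have v: "v m \<in> mgug_core js" for m by (simp add: v_def u)
  have v_lim: "(\<lambda>m. l2_sq (\<mu>) (\<lambda>s. v m s - f s)) \<longlonglongrightarrow> 0" "(\<lambda>m. l2_sq MB (\<lambda>p. dx js (v m) p - g p)) \<longlonglongrightarrow> 0"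
   using LIMSEQ_subseq_LIMSEQ[OF u(2) r(1)] LIMSEQ_subseq_LIMSEQ[OF u(3) r(1)] by (simp_all add: o_def v_def)
  note v_io = l2_laakso_imp[OF core_l2[OF v]] and dv = core_dx_l2[OF v]
  note [measurable] = l2D(1)[OF core_l2[OF v]] l2D(1)[OF v_io] l2D(1)[OF dv]
  \<comment> \<open>The error splits into a part that is small because the derivatives converge in
    \<open>L2\<close> and \<open>\<phi>' k\<close> is bounded, and a part with the fixed function
    \<open>g\<close>, to which dominated convergence applies.\<close>
  let ?a = "\<lambda>m p. \<phi>' k (v m (io p)) * (dx js (v m) p - g p)"
  let ?b = "\<lambda>m p. (\<phi>' k (v m (io p)) - \<phi>' k (f (io p))) * g p"
  have a_l2: "?a m \<in> l2 MB" for m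
   by (rule l2_bounded_mult[OF l2_diff[OF dv g], of _ C]) (measurable, use \<phi>(3) in auto)
  have bb: "\<bar>\<phi>' k x - \<phi>' k y\<bar> \<le> 2 * C" for x y
   using \<phi>(3)[of k x] \<phi>(3)[of k y] by linarith
  have b_l2: "?b m \<in> l2 MB" for m by (rule l2_bounded_mult[OF g, of _ "2 * C"]) (measurable, use bb in auto)
  have a_lim: "(\<lambda>m. l2_sq MB (?a m)) \<longlonglongrightarrow> 0"
  proof (rule tendsto_sandwich[OF _ _ tendsto_const])
   have "l2_sq MB (?a m) \<le> C\<^sup>2 * l2_sq MB (\<lambda>p. dx js (v m) p - g p)" for m
    unfolding l2_sq_eq integral_mult_right_zero[symmetric]
   proof (rule integral_mono)
    show "(?a m p)\<^sup>2 \<le> C\<^sup>2 * (dx js (v m) p - g p)\<^sup>2" for p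
     using power_mono[OF \<phi>(3)[of k "v m (io p)"], of 2] by (simp add: power_mult_distrib mult_right_mono)
   qed (use l2D(2)[OF a_l2] l2D(2)[OF l2_diff[OF dv g]] in auto)
   then show "\<forall>\<^sub>F m in sequentially. l2_sq MB (?a m) \<le> C\<^sup>2 * l2_sq MB (\<lambda>p. dx js (v m) p - g p)"
    by simp
   show "(\<lambda>m. C\<^sup>2 * l2_sq MB (\<lambda>p. dx js (v m) p - g p)) \<longlonglongrightarrow> 0"
    using tendsto_mult_left[OF v_lim(2), of "C\<^sup>2"] by simp
  qed simp
  have b_lim: "(\<lambda>m. l2_sq MB (?b m)) \<longlonglongrightarrow> 0"
  proof (rule l2_sq_dominated[where b = "\<lambda>p. (2 * C)\<^sup>2 * (g p)\<^sup>2"])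
   show "integrable MB (\<lambda>p. (2 * C)\<^sup>2 * (g p)\<^sup>2)"
    using l2D(2)[OF g] by simp
   show "AE p in MB. (?b m p)\<^sup>2 \<le> (2 * C)\<^sup>2 * (g p)\<^sup>2" for m
   proof (rule AE_I2)
    fix p show "(?b m p)\<^sup>2 \<le> (2 * C)\<^sup>2 * (g p)\<^sup>2"
     using power_mono[OF bb[of "v m (io p)" "f (io p)"], of 2] unfolding power_mult_distrib[of _ "g p"]
     by (intro mult_right_mono) auto
   qed
   show "AE p in MB. (\<lambda>m. ?b m p) \<longlonglongrightarrow> 0"
    using r(2)
   proof eventually_elim
    fix p assume "(\<lambda>m. u (r m) (io p)) \<longlonglongrightarrow> f (io p)"
    then have "(\<lambda>m. \<phi>' k (v m (io p))) \<longlonglongrightarrow> \<phi>' k (f (io p))"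
     using \<phi>(2)[of k] unfolding v_def by (intro continuous_on_tendsto_compose[of UNIV "\<phi>' k"]) auto
    then have "(\<lambda>m. (\<phi>' k (v m (io p)) - \<phi>' k (f (io p))) * g p) \<longlonglongrightarrow> (\<phi>' k (f (io p)) - \<phi>' k (f (io p))) * g p"
     by (intro tendsto_intros)
    then show "(\<lambda>m. ?b m p) \<longlonglongrightarrow> 0" by simp
   qed
  qed measurable
  show ?thesis
  proof (rule W_lim)
   show "W (\<lambda>s. \<phi> k (v m s)) (\<lambda>p. \<phi>' k (v m (io p)) * dx js (v m) p)" for m
    using core_chain[OF v[of m] \<phi>(1,2)[of k]] by (intro W_core_AE) auto
   show "(\<lambda>p. \<phi>' k (f (io p)) * g p) \<in> l2 MB"
    by (rule l2_bounded_mult[OF g, of _ C]) (measurable, use \<phi>(3) in auto)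
   show "(\<lambda>m. l2_sq (\<mu>) (\<lambda>s. \<phi> k (v m s) - \<phi> k (f s))) \<longlonglongrightarrow> 0"
   proof (rule tendsto_sandwich[OF _ _ tendsto_const])
    have "l2_sq (\<mu>) (\<lambda>s. \<phi> k (v m s) - \<phi> k (f s)) \<le> C\<^sup>2 * l2_sq (\<mu>) (\<lambda>s. v m s - f s)" for m
     unfolding l2_sq_eq integral_mult_right_zero[symmetric]
    proof (rule integral_mono)
     show "integrable (\<mu>) (\<lambda>s. (\<phi> k (v m s) - \<phi> k (f s))\<^sup>2)"
      using core_l2[OF core_chain(1)[OF v[of m] \<phi>(1,2)[of k]]] by (intro l2D(2) l2_diff \<phi>f)
     show "(\<phi> k (v m s) - \<phi> k (f s))\<^sup>2 \<le> C\<^sup>2 * (v m s - f s)\<^sup>2" for s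
      by (rule lip_sq)
    qed (use l2D(2)[OF l2_diff[OF core_l2[OF v] f]] in auto)
    then show "\<forall>\<^sub>F m in sequentially. l2_sq (\<mu>) (\<lambda>s. \<phi> k (v m s) - \<phi> k (f s)) \<le> C\<^sup>2 * l2_sq (\<mu>) (\<lambda>s. v m s - f s)"
     by simp
    show "(\<lambda>m. C\<^sup>2 * l2_sq (\<mu>) (\<lambda>s. v m s - f s)) \<longlonglongrightarrow> 0"
     using tendsto_mult_left[OF v_lim(1), of "C\<^sup>2"] by simp
   qed simp
   show "(\<lambda>m. l2_sq MB (\<lambda>p. \<phi>' k (v m (io p)) * dx js (v m) p - \<phi>' k (f (io p)) * g p)) \<longlonglongrightarrow> 0"
   proof (rule tendsto_sandwich[OF _ _ tendsto_const])
    have "(\<lambda>p. \<phi>' k (v m (io p)) * dx js (v m) p - \<phi>' k (f (io p)) * g p) = (\<lambda>p. ?a m p + ?b m p)" for m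
     by (simp add: algebra_simps)
    then show "\<forall>\<^sub>F m in sequentially. l2_sq MB (\<lambda>p. \<phi>' k (v m (io p)) * dx js (v m) p - \<phi>' k (f (io p)) * g p) \<le> 2 * l2_sq MB (?a m) + 2 * l2_sq MB (?b m)"
     using l2_sq_add_le[OF a_l2 b_l2] by (intro always_eventually allI) (simp only:)
    show "(\<lambda>m. 2 * l2_sq MB (?a m) + 2 * l2_sq MB (?b m)) \<longlonglongrightarrow> 0"
     using tendsto_add[OF tendsto_mult_left[OF a_lim, of 2] tendsto_mult_left[OF b_lim, of 2]] by simp
   qed simp
  qed (rule \<phi>f)
 qed
 obtain D where D: "\<And>k. \<bar>\<delta> k\<bar> \<le> D"
  using convergent_imp_Bseq[OF convergentI[OF \<psi>(2)]] by (auto simp: Bseq_def)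
 have \<psi>_sq: "(\<phi> k x - \<psi> x)\<^sup>2 \<le> D\<^sup>2" for k x
 proof -
  have "\<bar>\<phi> k x - \<psi> x\<bar> \<le> \<bar>D\<bar>"
   using \<psi>(1)[of k x] D[of k] by linarith
  then show ?thesis by (simp only: abs_le_square_iff)
 qed
 have diff_lim: "(\<lambda>k. l2_sq (\<mu>) (\<lambda>s. \<phi> k (f s) - \<psi> (f s))) \<longlonglongrightarrow> 0"
 proof (rule l2_sq_dominated[where b = "\<lambda>_. D\<^sup>2"])
  show "AE s in \<mu>. (\<lambda>k. \<phi> k (f s) - \<psi> (f s)) \<longlonglongrightarrow> 0"
   by (intro AE_I2 Lim_null[THEN iffD1] \<psi>_lim)
 qed (use \<psi>_sq in \<open>auto intro!: AE_I2\<close>)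
 show ?thesis
 proof (rule W_lim[OF step1 _ _ diff_lim])
  have "(\<lambda>s. \<phi> 0 (f s) - \<psi> (f s)) \<in> l2 (\<mu>)"
  proof (rule l2I)
   show "integrable (\<mu>) (\<lambda>s. (\<phi> 0 (f s) - \<psi> (f s))\<^sup>2)"
    using \<psi>_sq by (intro LM.integrable_const_bound[of _ "D\<^sup>2"]) (auto intro!: AE_I2)
  qed measurable
  from l2_diff[OF \<phi>f[of 0] this] show "(\<lambda>s. \<psi> (f s)) \<in> l2 (\<mu>)" by simp
  show "(\<lambda>p. \<psi>' (f (io p)) * g p) \<in> l2 MB"
   by (rule l2_bounded_mult[OF g, of _ C]) (measurable, use \<psi>'_bound in auto)
  show "(\<lambda>k. l2_sq MB (\<lambda>p. \<phi>' k (f (io p)) * g p - \<psi>' (f (io p)) * g p)) \<longlonglongrightarrow> 0"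
  proof (rule l2_sq_dominated[where b = "\<lambda>p. (2 * C)\<^sup>2 * (g p)\<^sup>2"])
   show "integrable MB (\<lambda>p. (2 * C)\<^sup>2 * (g p)\<^sup>2)"
    using l2D(2)[OF g] by simp
   show "AE p in MB. (\<phi>' k (f (io p)) * g p - \<psi>' (f (io p)) * g p)\<^sup>2 \<le> (2 * C)\<^sup>2 * (g p)\<^sup>2" for k
   proof (rule AE_I2)
    fix p
    have "\<bar>\<phi>' k (f (io p)) - \<psi>' (f (io p))\<bar> \<le> 2 * C"
     using \<phi>(3)[of k "f (io p)"] \<psi>'_bound[of "f (io p)"] by linarith
    from power_mono[OF this, of 2]
    show "(\<phi>' k (f (io p)) * g p - \<psi>' (f (io p)) * g p)\<^sup>2 \<le> (2 * C)\<^sup>2 * (g p)\<^sup>2"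
     unfolding left_diff_distrib[symmetric] power_mult_distrib[of _ "g p"] by (intro mult_right_mono) auto
   qed
   show "AE p in MB. (\<lambda>k. \<phi>' k (f (io p)) * g p - \<psi>' (f (io p)) * g p) \<longlonglongrightarrow> 0"
    by (intro AE_I2 Lim_null[THEN iffD1] tendsto_mult \<psi>(3) tendsto_const)
  qed measurable
 qed
qed

end

section \<open>The form as a Dirichlet form\<close>

lemma l2_polarization:
 assumes "g \<in> l2 M" "k \<in> l2 M"
 shows "l2_sq M (\<lambda>x. g x + k x) - l2_sq M (\<lambda>x. g x - k x) = 4 * l2_inner M g k"
proof -
 have "l2_sq M (\<lambda>x. g x + k x) - l2_sq M (\<lambda>x. g x - k x) = (\<integral>x. (g x + k x)\<^sup>2 - (g x - k x)\<^sup>2 \<partial>M)"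
  unfolding l2_sq_eq using l2D(2)[OF l2_add[OF assms]] l2D(2)[OF l2_diff[OF assms]]
  by (rule Bochner_Integration.integral_diff[symmetric])
 also have "\<dots> = (\<integral>x. 4 * (g x * k x) \<partial>M)"
  by (rule Bochner_Integration.integral_cong) (simp_all add: power2_eq_square algebra_simps)
 finally show ?thesis by (simp add: l2_inner_def)
qed

lemma l2_sq_le_if_abs_le:
 assumes "g \<in> l2 M" "k \<in> l2 M" "\<And>x. \<bar>k x\<bar> \<le> \<bar>g x\<bar>"
 shows "l2_sq M k \<le> l2_sq M g"
 unfolding l2_sq_eq using l2D(2)[OF assms(2)] l2D(2)[OF assms(1)]
proof (rule integral_mono)
 show "(k x)\<^sup>2 \<le> (g x)\<^sup>2" for x
  using assms(3)[of x] by (simp only: abs_le_square_iff)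
qed

lemma l2_inner_commute: "l2_inner M f g = l2_inner M g f" by (simp add: l2_inner_def mult.commute)

lemma l2_inner_add:
 assumes "f \<in> l2 M" "g \<in> l2 M" "h \<in> l2 M"
 shows "l2_inner M (\<lambda>x. f x + g x) h = l2_inner M f h + l2_inner M g h"
 using l2_mult_integrable[OF assms(1,3)] l2_mult_integrable[OF assms(2,3)]
 by (simp add: l2_inner_def distrib_right)

lemma l2_inner_diff:
 assumes "f \<in> l2 M" "g \<in> l2 M" "h \<in> l2 M"
 shows "l2_inner M (\<lambda>x. f x - g x) h = l2_inner M f h - l2_inner M g h"
 using l2_mult_integrable[OF assms(1,3)] l2_mult_integrable[OF assms(2,3)]
 by (simp add: l2_inner_def left_diff_distrib)

lemma l2_inner_scale: "l2_inner M (\<lambda>x. c * f x) h = c * l2_inner M f h"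
 by (simp add: l2_inner_def mult.assoc)

context laakso
begin

interpretation LM: prob_space "\<mu>" by (rule prob_space_laakso)
interpretation BM: prob_space "MB" by (rule prob_space_MB)

lemma grad_energy_dx: "u \<in> mgug_core js \<Longrightarrow> grad_energy js u = l2_sq MB (dx js u)"
 by (simp add: grad_energy_core l2_sq_eq)

lemma grad_energy_diff:
 fixes u v :: "'k::finite laakso_point \<Rightarrow> real"
 assumes "u \<in> mgug_core js" "v \<in> mgug_core js"
 shows "grad_energy js (\<lambda>s. u s - v s) = l2_sq MB (\<lambda>p. dx js u p - dx js v p)"
 unfolding grad_energy_dx[OF core_diff(1)[OF assms]]
 using l2D(1)[OF core_dx_l2[OF core_diff(1)[OF assms]]]
  l2D(1)[OF l2_diff[OF core_dx_l2[OF assms(1)] core_dx_l2[OF assms(2)]]] core_diff(2)[OF assms]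
 by (rule l2_sq_cong_AE)

text \<open>A sequence in \<open>mgug_approx\<close> is only Cauchy in energy; completeness of
  \<open>l2 MB\<close> supplies the function to which its derivatives converge.\<close>

lemma mgug_approx_W:
 fixes f :: "'k::finite laakso_point \<Rightarrow> real"
 assumes f: "f \<in> l2 (\<mu>)" and u: "mgug_approx js f u"
 shows "\<exists>g. W f g \<and> (\<lambda>m. grad_energy js (u m)) \<longlonglongrightarrow> l2_sq MB g"
proof -
 have core: "u m \<in> mgug_core js" for m
  using u by (simp add: mgug_approx_def)
 have lim: "(\<lambda>m. l2_sq (\<mu>) (\<lambda>x. u m x - f x)) \<longlonglongrightarrow> 0"
  using u by (simp add: mgug_approx_def)
 have cauchy: "\<exists>N. \<forall>m\<ge>N. \<forall>l\<ge>N. l2_sq MB (\<lambda>p. dx js (u m) p - dx js (u l) p) < \<epsilon>" if "\<epsilon> > 0" for \<epsilon>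
  using u that unfolding mgug_approx_def by (simp add: grad_energy_diff[OF core core])
 obtain g where g: "g \<in> l2 MB" "(\<lambda>m. l2_sq MB (\<lambda>p. dx js (u m) p - g p)) \<longlonglongrightarrow> 0"
  by (rule BM.l2_complete[OF core_dx_l2[OF core] cauchy])
 have "W f g" by (rule W_lim[OF W_core[OF core] f g(1) lim g(2)])
 moreover have "(\<lambda>m. grad_energy js (u m)) \<longlonglongrightarrow> l2_sq MB g"
  unfolding grad_energy_dx[OF core] by (rule l2_sq_tendsto[OF core_dx_l2[OF core] g])
 ultimately show ?thesis by blast
qed

lemma W_mgug_approx:
 fixes f :: "'k::finite laakso_point \<Rightarrow> real"
 assumes "W f g"
 shows "\<exists>u. mgug_approx js f u"
proof -
 obtain u where u: "\<And>m. u m \<in> mgug_core js" "(\<lambda>m. l2_sq (\<mu>) (\<lambda>s. u m s - f s)) \<longlonglongrightarrow> 0"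
  "(\<lambda>m. l2_sq MB (\<lambda>p. dx js (u m) p - g p)) \<longlonglongrightarrow> 0"
  by (rule W_seq[OF assms]) (rule that; assumption)
 have "\<exists>N. \<forall>m\<ge>N. \<forall>l\<ge>N. grad_energy js (\<lambda>x. u m x - u l x) < \<epsilon>" if \<epsilon>: "\<epsilon> > 0" for \<epsilon>
 proof -
  have "\<forall>\<^sub>F m in sequentially. l2_sq MB (\<lambda>p. dx js (u m) p - g p) < \<epsilon> / 4"
   using u(3) \<epsilon> by (intro order_tendstoD(2)[of _ 0]) auto
  then obtain N where N: "\<forall>m\<ge>N. l2_sq MB (\<lambda>p. dx js (u m) p - g p) < \<epsilon> / 4"
   unfolding eventually_sequentially by blast
  have "grad_energy js (\<lambda>x. u m x - u l x) < \<epsilon>" if "m \<ge> N" "l \<ge> N" for m l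
  proof -
   have "l2_sq MB (\<lambda>p. dx js (u m) p - dx js (u l) p) \<le>
     2 * l2_sq MB (\<lambda>p. dx js (u m) p - g p) + 2 * l2_sq MB (\<lambda>p. g p - dx js (u l) p)"
    by (intro l2_sq_triangle core_dx_l2 u W_l2(2)[OF assms])
   also have "l2_sq MB (\<lambda>p. g p - dx js (u l) p) = l2_sq MB (\<lambda>p. dx js (u l) p - g p)"
    by (rule l2_sq_diff_commute)
   also have "2 * l2_sq MB (\<lambda>p. dx js (u m) p - g p) + 2 * l2_sq MB (\<lambda>p. dx js (u l) p - g p) < \<epsilon>"
    using N[rule_format, OF that(1)] N[rule_format, OF that(2)] by linarith
   finally show ?thesis by (simp add: grad_energy_diff[OF u(1) u(1)])
  qed
  then show ?thesis by blast
 qed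
 then show ?thesis
  using u(1,2) unfolding mgug_approx_def by blast
qed

lemma mgug_dom_iff: "f \<in> mgug_dom js \<longleftrightarrow> (\<exists>g. W (f :: 'k::finite laakso_point \<Rightarrow> real) g)"
proof
 assume "f \<in> mgug_dom js"
 then obtain u where "f \<in> l2 (\<mu>)" "mgug_approx js f u"
  unfolding mgug_dom_def by (elim CollectE conjE exE)
 from mgug_approx_W[OF this] obtain g where "W f g" by (elim exE conjE)
 then show "\<exists>g. W f g" by (rule exI[of _ g])
next
 assume "\<exists>g. W f g"
 then obtain g where g: "W f g" by (elim exE)
 show "f \<in> mgug_dom js"
  unfolding mgug_dom_def by (intro CollectI conjI W_l2(1)[OF g] W_mgug_approx[OF g])
qed

lemma mgug_energy_eq:
 fixes f :: "'k::finite laakso_point \<Rightarrow> real"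
 assumes W: "W f g"
 shows "mgug_energy js f = l2_sq MB g"
 unfolding mgug_energy_def
proof (rule the_equality)
 show conv: "\<forall>u. mgug_approx js f u \<longrightarrow> (\<lambda>m. grad_energy js (u m)) \<longlonglongrightarrow> l2_sq MB g"
 proof (intro allI impI)
  fix u assume "mgug_approx js f u"
  from mgug_approx_W[OF W_l2(1)[OF W] this]
  obtain g' where g': "W f g'" "(\<lambda>m. grad_energy js (u m)) \<longlonglongrightarrow> l2_sq MB g'"
   by (elim exE conjE)
  have "l2_sq MB g' = l2_sq MB g"
   using W_unique[OF g'(1) W] l2D(1)[OF W_l2(2)[OF g'(1)]] l2D(1)[OF W_l2(2)[OF W]] by (intro l2_sq_cong_AE) auto
  then show "(\<lambda>m. grad_energy js (u m)) \<longlonglongrightarrow> l2_sq MB g"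
   using g'(2) by simp
 qed
 \<comment> \<open>Uniqueness of the limit rests on the existence of an approximating sequence;
   without one the condition would hold for every \<open>e\<close>.\<close>
 fix e assume e: "\<forall>u. mgug_approx js f u \<longrightarrow> (\<lambda>m. grad_energy js (u m)) \<longlonglongrightarrow> e"
 from W_mgug_approx[OF W] obtain u where u: "mgug_approx js f u" by (elim exE)
 show "e = l2_sq MB g" by (rule LIMSEQ_unique[OF e[rule_format, OF u] conv[rule_format, OF u]])
qed

lemma mgug_form_eq:
 fixes f h :: "'k::finite laakso_point \<Rightarrow> real"
 assumes "W f g" "W h k"
 shows "mgug_form js f h = l2_inner MB g k"
 unfolding mgug_form_def mgug_energy_eq[OF W_add[OF assms]] mgug_energy_eq[OF W_diff[OF assms]]
 using l2_polarization[OF W_l2(2)[OF assms(1)] W_l2(2)[OF assms(2)]] by simp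

lemma mgug_form_diag: "W f g \<Longrightarrow> mgug_form js f f = l2_sq (MB :: 'k::finite prelaakso measure) g"
 by (simp add: mgug_form_eq l2_sq_def)

lemma mgug_form1_sq_diff:
 fixes f h :: "'k::finite laakso_point \<Rightarrow> real"
 assumes "W f g" "W h k"
 shows "form1_sq (\<mu>) (mgug_form js) (\<lambda>x. f x - h x) =
  l2_sq MB (\<lambda>p. g p - k p) + l2_sq (\<mu>) (\<lambda>x. f x - h x)"
 by (simp add: form1_sq_def mgug_form_diag[OF W_diff[OF assms]])

section \<open>Truncation and vanishing of the derivative on zero sets\<close>

lemma W_const: "W (\<lambda>_ :: 'k::finite laakso_point. c) (\<lambda>_. 0)"
proof -
 have "lift (\<lambda>_ :: 'k prelaakso. c) \<in> mgug_core js"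
  by (rule core_liftI(1)[where F' = "\<lambda>_. 0" and n = 0 and Z = "{}" and C = 0]) auto
 moreover have "lift (\<lambda>_ :: 'k prelaakso. c) = (\<lambda>_. c)" by (simp add: lift_def fun_eq_iff)
 ultimately have core: "(\<lambda>_ :: 'k laakso_point. c) \<in> mgug_core js" by simp
 have "AE p in (MB :: 'k prelaakso measure). dx js (\<lambda>_. c) p = 0" by (rule AE_dxI[of "{}"]) auto
 then show ?thesis by (intro W_core_AE[OF core]) auto
qed

text \<open>Smoothing by \<open>sqrt (x^2 + e_k^2)\<close>, which stays within \<open>e k\<close> of
  \<open>\<bar>x\<bar>\<close>; at \<open>0\<close> all the derivatives vanish, which matches
  \<open>sgn 0 = 0\<close>.\<close>

lemma W_abs:
 fixes f :: "'k::finite laakso_point \<Rightarrow> real"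
 assumes "W f g"
 shows "W (\<lambda>s. \<bar>f s\<bar>) (\<lambda>p. sgn (f (io p)) * g p)"
proof -
 define e where "e k = inverse (real (Suc k))" for k
 have e: "e k > 0" "e \<longlonglongrightarrow> 0" for k
  unfolding e_def using LIMSEQ_inverse_real_of_nat by auto
 have pos: "0 < x\<^sup>2 + (e k)\<^sup>2" for x k
  using e(1)[of k] by (intro add_nonneg_pos) auto
 have ge: "\<bar>x\<bar> \<le> sqrt (x\<^sup>2 + (e k)\<^sup>2)" for x k by (rule real_le_rsqrt) simp
 show ?thesis
 proof (rule W_chain_lim[OF assms, where \<phi> = "\<lambda>k x. sqrt (x\<^sup>2 + (e k)\<^sup>2)" and \<phi>' = "\<lambda>k x. x / sqrt (x\<^sup>2 + (e k)\<^sup>2)" and C = 1 and \<delta> = e])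
  show "((\<lambda>x. sqrt (x\<^sup>2 + (e k)\<^sup>2)) has_real_derivative x / sqrt (x\<^sup>2 + (e k)\<^sup>2)) (at x)" for k x
   using pos[of x k] by (auto intro!: derivative_eq_intros simp: field_simps)
  show "continuous_on UNIV (\<lambda>x. x / sqrt (x\<^sup>2 + (e k)\<^sup>2))" for k
   using pos[of _ k] by (intro continuous_intros) (auto simp: less_imp_neq[symmetric])
  show "\<bar>x / sqrt (x\<^sup>2 + (e k)\<^sup>2)\<bar> \<le> 1" for k x
   using ge[of x k] pos[of x k] by (simp add: abs_divide divide_le_eq)
  show "\<bar>sqrt (x\<^sup>2 + (e k)\<^sup>2) - \<bar>x\<bar>\<bar> \<le> e k" for k x
   using ge[of x k] sqrt_sum_squares_le_sum_abs[of x "e k"] e(1)[of k] by linarith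
  show "e \<longlonglongrightarrow> 0" by (rule e(2))
  show "(\<lambda>k. x / sqrt (x\<^sup>2 + (e k)\<^sup>2)) \<longlonglongrightarrow> sgn x" for x
  proof (cases "x = 0")
   case False
   have "(\<lambda>k. x / sqrt (x\<^sup>2 + (e k)\<^sup>2)) \<longlonglongrightarrow> x / sqrt (x\<^sup>2 + 0\<^sup>2)"
    using False by (intro tendsto_intros e(2)) auto
   moreover have "x / sqrt (x\<^sup>2 + 0\<^sup>2) = sgn x" by (simp add: sgn_if)
   ultimately show ?thesis by simp
  qed simp
 qed
qed

text \<open>Maximum and minimum are expressed by absolute values. Each of the two steps multiplies
  the derivative by \<open>(1 + sgn b) / 2\<close> or \<open>(1 - sgn b) / 2\<close>, a number
  between \<open>0\<close> and \<open>1\<close>.\<close>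

lemma W_truncation:
 fixes f :: "'k::finite laakso_point \<Rightarrow> real"
 assumes W: "W f g"
 shows "\<exists>h. W (\<lambda>s. min (max (f s) 0) 1) h \<and> (\<forall>p. \<bar>h p\<bar> \<le> \<bar>g p\<bar>)"
proof -
 have half: "\<bar>1/2 * (a + sgn b * a)\<bar> \<le> \<bar>a\<bar>" "\<bar>1/2 * (a - sgn b * a)\<bar> \<le> \<bar>a\<bar>" for a b :: real
  by (cases b "0 :: real" rule: linorder_cases; simp)+
 define g1 where "g1 p = 1/2 * (g p + sgn (f (io p)) * g p)" for p
 define h where "h p = 1/2 * (g1 p - sgn (max (f (io p)) 0 - 1) * g1 p)" for p
 have "W (\<lambda>s. 1/2 * (f s + \<bar>f s\<bar>)) g1"
  unfolding g1_def by (intro W_scale W_add W W_abs)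
 moreover have "(\<lambda>s. 1/2 * (f s + \<bar>f s\<bar>)) = (\<lambda>s. max (f s) 0)"
  by (auto simp: fun_eq_iff max_def)
 ultimately have W1: "W (\<lambda>s. max (f s) 0) g1" by simp
 have "W (\<lambda>s. max (f s) 0 - 1) (\<lambda>p. g1 p - 0)" by (rule W_diff[OF W1 W_const])
 from W_abs[OF this] have "W (\<lambda>s. \<bar>max (f s) 0 - 1\<bar>) (\<lambda>p. sgn (max (f (io p)) 0 - 1) * g1 p)"
  by simp
 from W_scale[OF W_diff[OF W_add[OF W1 W_const[of 1]] this], of "1/2"]
 have "W (\<lambda>s. 1/2 * (max (f s) 0 + 1 - \<bar>max (f s) 0 - 1\<bar>)) h" by (simp add: h_def[abs_def])
 moreover have "(\<lambda>s. 1/2 * (max (f s) 0 + 1 - \<bar>max (f s) 0 - 1\<bar>)) = (\<lambda>s. min (max (f s) 0) 1)"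
  by (auto simp: fun_eq_iff min_def abs_if)
 ultimately have "W (\<lambda>s. min (max (f s) 0) 1) h" by simp
 moreover have "\<bar>h p\<bar> \<le> \<bar>g p\<bar>" for p
  unfolding h_def g1_def by (rule order_trans[OF half(2) half(1)])
 ultimately show ?thesis by blast
qed

text \<open>The functions \<open>arctan (n x) / n\<close> tend uniformly to \<open>0\<close>, but
  their derivatives tend to the indicator of \<open>{0}\<close>. So \<open>g\<close> restricted to
  the zero set of \<open>f\<close> is a derivative of the zero function, and closability makes it
  vanish.\<close>

lemma W_zero_set:
 fixes f :: "'k::finite laakso_point \<Rightarrow> real"
 assumes W: "W f g"
 shows "AE p in MB. f (io p) = 0 \<longrightarrow> g p = 0"
proof -
 define n where "n k = real (Suc k)" for k
 have n: "n k > 0" "n k \<ge> 1" for k by (auto simp: n_def)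
 have n_lim: "(\<lambda>k. inverse (n k)) \<longlonglongrightarrow> 0"
  unfolding n_def by (rule LIMSEQ_inverse_real_of_nat)
 have pos: "0 < 1 + (x * n k)\<^sup>2" for x k by (intro add_pos_nonneg) auto
 have "W (\<lambda>s. (\<lambda>_. 0) (f s)) (\<lambda>p. (\<lambda>x. if x = 0 then 1 else 0) (f (io p)) * g p)"
 proof (rule W_chain_lim[OF W, where \<phi> = "\<lambda>k x. inverse (n k) * arctan (x * n k)" and \<phi>' = "\<lambda>k x. inverse (1 + (x * n k)\<^sup>2)"
    and C = 1 and \<delta> = "\<lambda>k. 2 * inverse (n k)"])
  show "((\<lambda>x. inverse (n k) * arctan (x * n k)) has_real_derivative inverse (1 + (x * n k)\<^sup>2)) (at x)" for k x
  proof -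
   have "n k * n k / (n k * n k * (1 + (x * n k)\<^sup>2)) = inverse (1 + (x * n k)\<^sup>2)"
    using n(1)[of k] pos[of x k] by (simp add: divide_simps)
   then have "inverse (n k) * (inverse (1 + (x * n k)\<^sup>2) * n k) = inverse (1 + (x * n k)\<^sup>2)"
    using n(1)[of k] by simp
   moreover have "((\<lambda>x. inverse (n k) * arctan (x * n k)) has_real_derivative inverse (n k) * (inverse (1 + (x * n k)\<^sup>2) * n k)) (at x)"
    by (intro DERIV_cmult DERIV_chain2[OF DERIV_arctan] DERIV_cmult_right[OF DERIV_ident, of "n k", simplified])
   ultimately show ?thesis by presburger
  qed
  show "continuous_on UNIV (\<lambda>x. inverse (1 + (x * n k)\<^sup>2))" for k
   using pos[of _ k] by (intro continuous_intros) (auto simp: less_imp_neq[symmetric])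
  show "\<bar>inverse (1 + (x * n k)\<^sup>2)\<bar> \<le> 1" for k x
   using pos[of x k] by (simp add: inverse_le_1_iff)
  \<comment> \<open>The \<open>2\<close> bounds \<open>pi / 2\<close>, the supremum of
    \<open>arctan\<close>.\<close>
  show "\<bar>inverse (n k) * arctan (x * n k) - 0\<bar> \<le> 2 * inverse (n k)" for k x
  proof -
   have "\<bar>arctan (x * n k)\<bar> \<le> 2"
    using arctan_bounded[of "x * n k"] pi_half_less_two by linarith
   then show ?thesis
    using n(1)[of k] by (simp add: abs_mult mult.commute mult_left_mono)
  qed
  show "(\<lambda>k. 2 * inverse (n k)) \<longlonglongrightarrow> 0"
   using tendsto_mult_left[OF n_lim, of 2] by simp
  show "(\<lambda>k. inverse (1 + (x * n k)\<^sup>2)) \<longlonglongrightarrow> (if x = 0 then 1 else 0)" for x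
  proof (cases "x = 0")
   case False
   have bound: "inverse (1 + (x * n k)\<^sup>2) \<le> inverse (x\<^sup>2) * inverse (n k)" for k
   proof -
    have "n k \<le> (n k)\<^sup>2"
     using n(2)[of k] by (simp add: power2_eq_square)
    then have "x\<^sup>2 * n k \<le> 1 + (x * n k)\<^sup>2"
     using mult_left_mono[of "n k" "(n k)\<^sup>2" "x\<^sup>2"] by (simp add: power_mult_distrib)
    then have "inverse (1 + (x * n k)\<^sup>2) \<le> inverse (x\<^sup>2 * n k)"
     using False n(1)[of k] by (intro le_imp_inverse_le) auto
    then show ?thesis by (simp add: inverse_mult_distrib)
   qed
   have "(\<lambda>k. inverse (1 + (x * n k)\<^sup>2)) \<longlonglongrightarrow> 0"
   proof (rule tendsto_sandwich[OF _ _ tendsto_const])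
    show "(\<lambda>k. inverse (x\<^sup>2) * inverse (n k)) \<longlonglongrightarrow> 0"
     using tendsto_mult_left[OF n_lim, of "inverse (x\<^sup>2)"] by simp
    show "\<forall>\<^sub>F k in sequentially. inverse (1 + (x * n k)\<^sup>2) \<le> inverse (x\<^sup>2) * inverse (n k)"
     by (intro always_eventually allI bound)
    show "\<forall>\<^sub>F k in sequentially. 0 \<le> inverse (1 + (x * n k)\<^sup>2)"
     using pos by (intro always_eventually allI) (simp add: less_imp_le)
   qed
   then show ?thesis
    using False by simp
  qed simp
 qed
 from W_null[OF this] have "AE p in MB. (if f (io p) = 0 then 1 else 0) * g p = 0" by simp
 then show ?thesis by eventually_elim auto
qed

lemma mgug_dirichlet:
 "dirichlet_form (\<mu>) (mgug_form js) (mgug_dom js :: ('k::finite laakso_point \<Rightarrow> real) set)"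
proof -
 let ?M = "\<mu> :: 'k laakso_point measure" and ?E = "mgug_form js :: 'k laakso_point form" and ?F = "mgug_dom js :: ('k laakso_point \<Rightarrow> real) set"
 define D where "D f = (SOME g. W f g)" for f :: "'k laakso_point \<Rightarrow> real"
 have D: "W f (D f)" if "f \<in> ?F" for f
  unfolding D_def using that[unfolded mgug_dom_iff] by (rule someI_ex)
 have WF: "f \<in> ?F" if "W f g" for f g
  using that mgug_dom_iff by blast
 have "?F \<subseteq> l2 ?M"
  using W_l2(1)[OF D] by blast
 moreover have "(\<lambda>x. 0) \<in> ?F" by (rule WF[OF W_const])
 moreover have "\<forall>f\<in>?F. \<forall>g\<in>?F. (\<lambda>x. f x + g x) \<in> ?F"
  using WF[OF W_add[OF D D]] by blast
 moreover have "\<forall>c. \<forall>f\<in>?F. (\<lambda>x. c * f x) \<in> ?F"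
  using WF[OF W_scale[OF D]] by blast
 moreover have "\<forall>f\<in>?F. \<forall>g\<in>borel_measurable ?M. (AE x in ?M. f x = g x) \<longrightarrow> g \<in> ?F \<and> (\<forall>h\<in>?F. ?E f h = ?E g h)"
 proof (intro ballI impI)
  fix f g assume f: "f \<in> ?F" and g: "g \<in> borel_measurable ?M" "AE x in ?M. f x = g x"
  have Wg: "W g (D f)" by (rule W_cong_AE[OF D[OF f] g l2D(1)[OF W_l2(2)[OF D[OF f]]]]) simp
  have "?E f h = ?E g h" if "h \<in> ?F" for h
   using mgug_form_eq[OF D[OF f] D[OF that]] mgug_form_eq[OF Wg D[OF that]] by simp
  then show "g \<in> ?F \<and> (\<forall>h\<in>?F. ?E f h = ?E g h)"
   using WF[OF Wg] by blast
 qed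
 moreover have "\<forall>f\<in>l2 ?M. \<forall>\<epsilon>>0. \<exists>g\<in>?F. l2_sq ?M (\<lambda>x. f x - g x) < \<epsilon>"
 proof (intro ballI allI impI)
  fix f and \<epsilon> :: real assume f: "f \<in> l2 ?M" and "\<epsilon> > 0"
  then obtain u where u: "u \<in> core0" "l2_sq MB (\<lambda>p. u (io p) - f (io p)) < \<epsilon>"
   using core0_closureD[OF core0_dense[OF l2_laakso_imp[OF f]]] by blast
  have "l2_sq ?M (\<lambda>x. f x - u x) = l2_sq ?M (\<lambda>x. u x - f x)" by (rule l2_sq_diff_commute)
  also have "\<dots> = l2_sq MB (\<lambda>p. u (io p) - f (io p))"
   using l2D(1)[OF l2_diff[OF core_l2[OF core0_core[OF u(1)]] f]] by (rule l2_sq_laakso)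
  finally show "\<exists>g\<in>?F. l2_sq ?M (\<lambda>x. f x - g x) < \<epsilon>"
   using u(2) WF[OF W_core[OF core0_core[OF u(1)]]] by force
 qed
 moreover have "\<forall>f\<in>?F. \<forall>g\<in>?F. ?E f g = ?E g f"
  using mgug_form_eq[OF D D] l2_inner_commute by metis
 moreover have "\<forall>f\<in>?F. \<forall>g\<in>?F. \<forall>h\<in>?F. ?E (\<lambda>x. f x + g x) h = ?E f h + ?E g h"
 proof (intro ballI)
  fix f g h assume fgh: "f \<in> ?F" "g \<in> ?F" "h \<in> ?F"
  show "?E (\<lambda>x. f x + g x) h = ?E f h + ?E g h"
   using mgug_form_eq[OF W_add[OF D[OF fgh(1)] D[OF fgh(2)]] D[OF fgh(3)]] mgug_form_eq[OF D[OF fgh(1)] D[OF fgh(3)]]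
    mgug_form_eq[OF D[OF fgh(2)] D[OF fgh(3)]] l2_inner_add[OF W_l2(2)[OF D[OF fgh(1)]] W_l2(2)[OF D[OF fgh(2)]] W_l2(2)[OF D[OF fgh(3)]]]
   by simp
 qed
 moreover have "\<forall>c. \<forall>f\<in>?F. \<forall>h\<in>?F. ?E (\<lambda>x. c * f x) h = c * ?E f h"
 proof (intro allI ballI)
  fix c f h assume fh: "f \<in> ?F" "h \<in> ?F"
  show "?E (\<lambda>x. c * f x) h = c * ?E f h"
   using mgug_form_eq[OF W_scale[OF D[OF fh(1)]] D[OF fh(2)], of c] mgug_form_eq[OF D[OF fh(1)] D[OF fh(2)]]
   by (simp add: l2_inner_scale)
 qed
 moreover have "\<forall>f\<in>?F. 0 \<le> ?E f f"
  using mgug_form_diag[OF D] by (simp add: l2_sq_nonneg)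
 moreover have "\<forall>u :: nat \<Rightarrow> 'k laakso_point \<Rightarrow> real. (\<forall>m. u m \<in> ?F) \<and>
    (\<forall>\<epsilon>>0. \<exists>N. \<forall>m\<ge>N. \<forall>l\<ge>N. form1_sq ?M ?E (\<lambda>x. u m x - u l x) < \<epsilon>) \<longrightarrow>
    (\<exists>f\<in>?F. (\<lambda>m. form1_sq ?M ?E (\<lambda>x. u m x - f x)) \<longlonglongrightarrow> 0)"
 proof (intro allI impI, elim conjE)
  fix u :: "nat \<Rightarrow> 'k laakso_point \<Rightarrow> real"
  assume u: "\<forall>m. u m \<in> ?F" and cauchy: "\<forall>\<epsilon>>0. \<exists>N. \<forall>m\<ge>N. \<forall>l\<ge>N. form1_sq ?M ?E (\<lambda>x. u m x - u l x) < \<epsilon>"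
  have Du: "W (u m) (D (u m))" for m
   using u D by blast
  have form1: "form1_sq ?M ?E (\<lambda>x. u m x - u l x) = l2_sq MB (\<lambda>p. D (u m) p - D (u l) p) + l2_sq ?M (\<lambda>x. u m x - u l x)" for m l
   by (rule mgug_form1_sq_diff[OF Du Du])
  have c1: "\<exists>N. \<forall>m\<ge>N. \<forall>l\<ge>N. l2_sq ?M (\<lambda>x. u m x - u l x) < \<epsilon>" if \<epsilon>: "\<epsilon> > 0" for \<epsilon>
  proof -
   obtain N where N: "\<forall>m\<ge>N. \<forall>l\<ge>N. form1_sq ?M ?E (\<lambda>x. u m x - u l x) < \<epsilon>"
    using cauchy \<epsilon> by blast
   have "l2_sq ?M (\<lambda>x. u m x - u l x) < \<epsilon>" if "m \<ge> N" "l \<ge> N" for m l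
    using N[rule_format, OF that] l2_sq_nonneg[of MB "\<lambda>p. D (u m) p - D (u l) p"] unfolding form1 by linarith
   then show ?thesis by blast
  qed
  have c2: "\<exists>N. \<forall>m\<ge>N. \<forall>l\<ge>N. l2_sq MB (\<lambda>p. D (u m) p - D (u l) p) < \<epsilon>" if \<epsilon>: "\<epsilon> > 0" for \<epsilon>
  proof -
   obtain N where N: "\<forall>m\<ge>N. \<forall>l\<ge>N. form1_sq ?M ?E (\<lambda>x. u m x - u l x) < \<epsilon>"
    using cauchy \<epsilon> by blast
   have "l2_sq MB (\<lambda>p. D (u m) p - D (u l) p) < \<epsilon>" if "m \<ge> N" "l \<ge> N" for m l
    using N[rule_format, OF that] l2_sq_nonneg[of ?M "\<lambda>x. u m x - u l x"] unfolding form1 by linarith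
   then show ?thesis by blast
  qed
  obtain f where f: "f \<in> l2 ?M" "(\<lambda>m. l2_sq ?M (\<lambda>x. u m x - f x)) \<longlonglongrightarrow> 0"
   by (rule LM.l2_complete[OF W_l2(1)[OF Du] c1])
  obtain g where g: "g \<in> l2 MB" "(\<lambda>m. l2_sq MB (\<lambda>p. D (u m) p - g p)) \<longlonglongrightarrow> 0"
   by (rule BM.l2_complete[OF W_l2(2)[OF Du] c2])
  have Wf: "W f g" by (rule W_lim[OF Du f(1) g(1) f(2) g(2)])
  have "(\<lambda>m. form1_sq ?M ?E (\<lambda>x. u m x - f x)) \<longlonglongrightarrow> 0"
   unfolding mgug_form1_sq_diff[OF Du Wf] using tendsto_add[OF g(2) f(2)] by simp
  then show "\<exists>f\<in>?F. (\<lambda>m. form1_sq ?M ?E (\<lambda>x. u m x - f x)) \<longlonglongrightarrow> 0"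
   using WF[OF Wf] by blast
 qed
 moreover have "\<forall>f\<in>?F. (\<lambda>x. min (max (f x) 0) 1) \<in> ?F \<and>
    ?E (\<lambda>x. min (max (f x) 0) 1) (\<lambda>x. min (max (f x) 0) 1) \<le> ?E f f"
 proof
  fix f assume f: "f \<in> ?F"
  obtain h where h: "W (\<lambda>s. min (max (f s) 0) 1) h" "\<forall>p. \<bar>h p\<bar> \<le> \<bar>D f p\<bar>"
   using W_truncation[OF D[OF f]] by blast
  have "l2_sq MB h \<le> l2_sq MB (D f)"
   by (rule l2_sq_le_if_abs_le[OF W_l2(2)[OF D[OF f]] W_l2(2)[OF h(1)] h(2)[rule_format]])
  then show "(\<lambda>x. min (max (f x) 0) 1) \<in> ?F \<and>
    ?E (\<lambda>x. min (max (f x) 0) 1) (\<lambda>x. min (max (f x) 0) 1) \<le> ?E f f"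
   using WF[OF h(1)] by (simp add: mgug_form_diag[OF h(1)] mgug_form_diag[OF D[OF f]])
 qed
 ultimately show ?thesis
  unfolding dirichlet_form_def by blast
qed

lemma mgug_nonzero: "\<exists>f\<in>mgug_dom js. mgug_form js f (f :: 'k::finite laakso_point \<Rightarrow> real) \<noteq> 0"
proof -
 have core: "(xcoord :: 'k laakso_point \<Rightarrow> real) \<in> mgug_core js"
  unfolding xcoord_def
  by (rule core_liftI(1)[where F' = "\<lambda>_. 1" and n = 0 and Z = "{}" and C = 1]) (auto intro!: continuous_intros)
 have "AE p in (MB :: 'k prelaakso measure). dx js xcoord p = 1" by (rule AE_dxI[of "{}"]) auto
 then have W: "W (xcoord :: 'k laakso_point \<Rightarrow> real) (\<lambda>_. 1)"
  by (intro W_core_AE[OF core]) auto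
 have "l2_sq MB (\<lambda>_ :: 'k prelaakso. 1) = 1" by (simp add: l2_sq_eq BM.prob_space[simplified])
 then show ?thesis
  using mgug_form_diag[OF W] mgug_dom_iff[of "xcoord :: 'k laakso_point \<Rightarrow> real"] W by (intro bexI[of _ xcoord]) auto
qed

text \<open>There may be uncountably many open sets on which \<open>u\<close> vanishes almost
  everywhere. Their preimages are unions of members of the countable family \<open>boxes\<close>, so
  the exceptional set of the whole union is still null.\<close>

lemma AE_ess_support:
 fixes u :: "'k::finite laakso_point \<Rightarrow> real"
 shows "AE p in MB. io p \<notin> ess_support (laakso_topology js) (\<mu>) u \<longrightarrow> u (io p) = 0"
proof -
 let ?U = "{U. openin (laakso_topology js) U \<and> (AE x in \<mu>. x \<in> U \<longrightarrow> u x = 0)}"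
 let ?V = "\<lambda>U. {p \<in> laakso_base. io p \<in> U}"
 let ?B = "{R \<in> boxes. \<exists>U\<in>?U. R \<subseteq> ?V U}"
 have "countable ?B" by (rule countable_subset[OF _ countable_boxes]) blast
 moreover have "\<forall>R\<in>?B. AE p in MB. p \<in> R \<longrightarrow> u (io p) = 0"
 proof
  fix R :: "'k prelaakso set" assume "R \<in> ?B"
  then obtain U where U: "AE x in \<mu>. x \<in> U \<longrightarrow> u x = 0" "R \<subseteq> ?V U" by blast
  from AE_laakso_imp[OF U(1)] show "AE p in MB. p \<in> R \<longrightarrow> u (io p) = 0"
   by eventually_elim (use U(2) in blast)
 qed
 ultimately have "AE p in MB. \<forall>R\<in>?B. p \<in> R \<longrightarrow> u (io p) = 0"
  by (simp only: AE_ball_countable)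
 then show ?thesis
 proof (rule AE_mp, intro AE_I2 impI)
  fix p :: "'k prelaakso"
  assume p: "p \<in> space MB" and R: "\<forall>R\<in>?B. p \<in> R \<longrightarrow> u (io p) = 0"
   and "io p \<notin> ess_support (laakso_topology js) (\<mu>) u"
  then have "io p \<in> \<Union>?U"
   using laakso_proj_in_space[of p js] unfolding ess_support_def topspace_laakso_topology by auto
  then obtain U where U: "U \<in> ?U" "io p \<in> U" by blast
  have "openin (top_of_set laakso_base) (?V U)"
   using U(1) by (intro openin_quotient_preimage) blast
  then have "?V U = \<Union>{R \<in> boxes. R \<subseteq> ?V U}" by (rule openin_base_eq_boxes)
  moreover have "p \<in> ?V U"
   using p U(2) by simp
  ultimately obtain R where "R \<in> boxes" "R \<subseteq> ?V U" "p \<in> R" by blast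
  then show "u (io p) = 0"
   using R U(1) by blast
 qed
qed

text \<open>With disjoint supports at least one of the two functions vanishes at almost every point,
  and by \<open>W_zero_set\<close> its derivative vanishes there too; so the product of the
  derivatives is \<open>0\<close>.\<close>

lemma mgug_local:
 "local_form (laakso_topology js) (\<mu>) (mgug_form js) (mgug_dom js :: ('k::finite laakso_point \<Rightarrow> real) set)"
 unfolding local_form_def
proof (intro ballI impI, elim conjE)
 fix u v :: "'k laakso_point \<Rightarrow> real"
 let ?S = "ess_support (laakso_topology js) (\<mu>)"
 assume "u \<in> mgug_dom js" "v \<in> mgug_dom js" and disj: "?S u \<inter> ?S v = {}"
 then obtain g k where W: "W u g" "W v k"
  using mgug_dom_iff by blast
 have "AE p in MB. g p * k p = 0"
  using AE_ess_support[of u] AE_ess_support[of v] W_zero_set[OF W(1)] W_zero_set[OF W(2)]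
 proof eventually_elim
  fix p assume "io p \<notin> ?S u \<longrightarrow> u (io p) = 0" "io p \<notin> ?S v \<longrightarrow> v (io p) = 0"
   "u (io p) = 0 \<longrightarrow> g p = 0" "v (io p) = 0 \<longrightarrow> k p = 0"
  moreover have "io p \<notin> ?S u \<or> io p \<notin> ?S v"
   using disj by blast
  ultimately show "g p * k p = 0" by auto
 qed
 then have "(\<integral>p. g p * k p \<partial>MB) = (\<integral>p. 0 \<partial>(MB :: 'k prelaakso measure))"
  using l2D(1)[OF W_l2(2)[OF W(1)]] l2D(1)[OF W_l2(2)[OF W(2)]] by (intro integral_cong_AE) auto
 then show "mgug_form js u v = 0" by (simp add: mgug_form_eq[OF W] l2_inner_def)
qed

text \<open>For \<open>\<phi> t = (T_t 1, 1)\<close> the semigroup law and symmetry give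
  \<open>\<phi> (s + t) = (T_s 1, T_t 1)\<close>, hence convexity. The energy of \<open>1\<close> is
  minus the right derivative of \<open>\<phi>\<close> at \<open>0\<close> and is \<open>0\<close>,
  so convexity forces \<open>\<phi> \<ge> 1\<close>; contractivity then leaves no room between
  \<open>T_t 1\<close> and \<open>1\<close>.\<close>

lemma semigroup_conservative:
 assumes T: "semigroup_of_form (\<mu>) (mgug_form js) (mgug_dom js :: ('k::finite laakso_point \<Rightarrow> real) set) T"
  and \<tau>: "\<tau> > 0"
 shows "AE x in \<mu>. T \<tau> (\<lambda>x. 1) x = 1"
proof -
 let ?M = "\<mu> :: 'k laakso_point measure" and ?one = "\<lambda>_ :: 'k laakso_point. 1 :: real"
 have one: "?one \<in> l2 ?M" by (rule LM.l2_const)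
 note S = T[unfolded semigroup_of_form_def]
 note T_l2 = conjunct1[OF S, rule_format] and S' = conjunct2[OF conjunct2[OF conjunct2[OF S]]]
 note T_sym = conjunct1[OF S', rule_format] and T_contr = conjunct1[OF conjunct2[OF S'], rule_format]
  and S'' = conjunct2[OF conjunct2[OF S']]
 note T_semi = conjunct1[OF S'', rule_format] and T_lim = conjunct2[OF conjunct2[OF conjunct2[OF S'']], rule_format]
 have one_dom: "?one \<in> mgug_dom js"
  unfolding mgug_dom_iff by (rule exI[of _ "\<lambda>_. 0"]) (rule W_const)
 note lim = T_lim[OF one_dom one_dom]
 have "mgug_form js ?one ?one = 0" by (simp add: mgug_form_diag[OF W_const] l2_sq_zero)
 have norm1: "l2_inner ?M ?one ?one = 1" by (simp add: l2_inner_def LM.prob_space[simplified])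
 define \<phi> where "\<phi> t = l2_inner ?M (T t ?one) ?one" for t
 have \<phi>_add: "\<phi> (s + t) = l2_inner ?M (T s ?one) (T t ?one)" if "s > 0" "t > 0" for s t
 proof -
  have "\<phi> (s + t) = l2_inner ?M (T s (T t ?one)) ?one"
   unfolding \<phi>_def l2_inner_def
   using T_semi[OF that one] l2D(1)[OF T_l2[OF _ one]] l2D(1)[OF T_l2[OF that(1) T_l2[OF that(2) one]]] that
   by (intro integral_cong_AE) auto
  also have "\<dots> = l2_inner ?M (T t ?one) (T s ?one)" by (rule T_sym[OF that(1) T_l2[OF that(2) one] one])
  finally show ?thesis by (simp only: l2_inner_commute)
 qed
 have two: "2 * l2_inner ?M a b \<le> l2_sq ?M a + l2_sq ?M b" if "a \<in> l2 ?M" "b \<in> l2 ?M" for a b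
 proof -
  have "0 \<le> l2_inner ?M (\<lambda>x. a x - b x) (\<lambda>x. a x - b x)"
   using l2_sq_nonneg[of ?M "\<lambda>x. a x - b x"] by (simp add: l2_sq_def)
  also have "\<dots> = l2_sq ?M a + l2_sq ?M b - 2 * l2_inner ?M a b"
   using that l2_diff[OF that] l2_inner_commute[of ?M a "\<lambda>x. a x - b x"] l2_inner_commute[of ?M b "\<lambda>x. a x - b x"] l2_inner_commute[of ?M b a]
   by (simp add: l2_inner_diff l2_sq_def)
  finally show ?thesis by simp
 qed
 have incr: "1 - \<phi> (real (Suc n) * h) \<le> real (Suc n) * (1 - \<phi> h)" if h: "h > 0" for h n
 proof -
  \<comment> \<open>The value at time \<open>0\<close> is set by hand, since the semigroup is
    specified for positive times only.\<close>
  define c where "c k = (if k = 0 then 1 else \<phi> (real k * h))" for k :: nat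
  have convex: "2 * c (Suc k) \<le> c k + c (Suc (Suc k))" for k
  proof (cases k)
   case 0
   have "2 * l2_inner ?M (T h ?one) ?one \<le> l2_sq ?M (T h ?one) + l2_sq ?M ?one"
    by (rule two[OF T_l2[OF h one] one])
   moreover have "l2_sq ?M (T h ?one) = \<phi> (h + h)"
    using \<phi>_add[OF h h] by (simp add: l2_sq_def)
   ultimately show ?thesis
    using norm1 by (simp add: c_def 0 \<phi>_def l2_sq_def)
  next
   case (Suc i)
   \<comment> \<open>Half times: the sums \<open>?s + ?s\<close>, \<open>?s + ?t\<close>,
     \<open>?t + ?t\<close> are three consecutive multiples of \<open>h\<close>.\<close>
   let ?s = "real k * h / 2" and ?t = "real (Suc (Suc k)) * h / 2"
   have st: "?s > 0" "?t > 0"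
    using h by (auto simp: Suc)
   have "2 * l2_inner ?M (T ?s ?one) (T ?t ?one) \<le> l2_sq ?M (T ?s ?one) + l2_sq ?M (T ?t ?one)"
    by (rule two[OF T_l2[OF st(1) one] T_l2[OF st(2) one]])
   then have "2 * \<phi> (?s + ?t) \<le> \<phi> (?s + ?s) + \<phi> (?t + ?t)"
    using \<phi>_add[OF st] \<phi>_add[OF st(1) st(1)] \<phi>_add[OF st(2) st(2)] by (simp only: l2_sq_def)
   moreover have "?s + ?t = real (Suc k) * h" "?s + ?s = real k * h" "?t + ?t = real (Suc (Suc k)) * h"
    by (simp_all add: field_simps)
   ultimately show ?thesis
    using Suc by (simp only: c_def) simp
  qed
  \<comment> \<open>Convexity makes the decrements non-increasing, so each is at most the
    first.\<close>
  have step: "c k - c (Suc k) \<le> c 0 - c 1" for k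
  proof (induction k)
   case (Suc k)
   then show ?case
    using convex[of k] by linarith
  qed simp
  have "c 0 - c k \<le> real k * (c 0 - c 1)" for k
  proof (induction k)
   case (Suc k)
   then show ?case
    using step[of k] by (simp add: distrib_right)
  qed simp
  from this[of "Suc n"] show ?thesis by (simp add: c_def)
 qed
 \<comment> \<open>With \<open>h = \<tau> / (n + 1)\<close> the bound in \<open>incr\<close> is
   \<open>\<tau>\<close> times a difference quotient of \<open>\<phi>\<close> at \<open>0\<close>,
   which tends to \<open>0\<close>.\<close>
 have "filterlim (\<lambda>n. \<tau> / real (Suc n)) (at_right 0) sequentially"
  unfolding filterlim_at using \<tau> LIMSEQ_Suc[OF lim_const_over_n[of \<tau>]] by auto
 from filterlim_compose[OF lim this]
 have "(\<lambda>n. l2_inner ?M (\<lambda>x. ?one x - T (\<tau> / real (Suc n)) ?one x) ?one / (\<tau> / real (Suc n))) \<longlonglongrightarrow> 0"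
  using \<open>mgug_form js ?one ?one = 0\<close> by simp
 moreover have "l2_inner ?M (\<lambda>x. ?one x - T (\<tau> / real (Suc n)) ?one x) ?one = 1 - \<phi> (\<tau> / real (Suc n))" for n
  using l2_inner_diff[OF one T_l2[OF _ one] one, of "\<tau> / real (Suc n)"] \<tau> norm1 by (simp add: \<phi>_def)
 ultimately have "(\<lambda>n. (1 - \<phi> (\<tau> / real (Suc n))) / (\<tau> / real (Suc n))) \<longlonglongrightarrow> 0"
  by (simp only:)
 from tendsto_mult_left[OF this, of \<tau>]
 have "(\<lambda>n. \<tau> * ((1 - \<phi> (\<tau> / real (Suc n))) / (\<tau> / real (Suc n)))) \<longlonglongrightarrow> 0"
  by simp
 moreover have "1 - \<phi> \<tau> \<le> \<tau> * ((1 - \<phi> (\<tau> / real (Suc n))) / (\<tau> / real (Suc n)))" for n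
 proof -
  have "real (Suc n) * (\<tau> / real (Suc n)) = \<tau>" by (simp add: field_simps)
  moreover have "\<tau> * ((1 - \<phi> (\<tau> / real (Suc n))) / (\<tau> / real (Suc n))) = real (Suc n) * (1 - \<phi> (\<tau> / real (Suc n)))"
   using \<tau> by (simp add: field_simps)
  moreover have "\<tau> / real (Suc n) > 0"
   using \<tau> by simp
  ultimately show ?thesis
   using incr[of "\<tau> / real (Suc n)" n] by (simp only:)
 qed
 ultimately have "1 - \<phi> \<tau> \<le> 0" by (intro LIMSEQ_le_const) auto
 then have "l2_sq ?M (\<lambda>x. T \<tau> ?one x - ?one x) \<le> 0"
 proof -
  note Tl = T_l2[OF \<tau> one]
  have "l2_sq ?M (\<lambda>x. T \<tau> ?one x - ?one x) = l2_sq ?M (T \<tau> ?one) - 2 * \<phi> \<tau> + 1"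
   using l2_inner_diff[OF Tl one l2_diff[OF Tl one]] l2_inner_diff[OF Tl one Tl] l2_inner_diff[OF Tl one one]
    l2_inner_commute[of ?M "T \<tau> ?one" "\<lambda>x. T \<tau> ?one x - ?one x"] l2_inner_commute[of ?M ?one "\<lambda>x. T \<tau> ?one x - ?one x"]
    l2_inner_commute[of ?M ?one "T \<tau> ?one"] norm1 by (simp add: l2_sq_def \<phi>_def)
  moreover have "l2_sq ?M (T \<tau> ?one) \<le> 1"
   using T_contr[OF \<tau> one] norm1 by (simp add: l2_sq_def)
  ultimately show ?thesis
   using \<open>1 - \<phi> \<tau> \<le> 0\<close> by linarith
 qed
 then have "(\<integral>x. (T \<tau> ?one x - ?one x)\<^sup>2 \<partial>?M) = 0"
  using l2_sq_nonneg[of ?M "\<lambda>x. T \<tau> ?one x - ?one x"] unfolding l2_sq_eq by linarith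
 then have "AE x in ?M. (T \<tau> ?one x - ?one x)\<^sup>2 = 0"
  using l2D(2)[OF l2_diff[OF T_l2[OF \<tau> one] one]] by (simp add: integral_nonneg_eq_0_iff_AE)
 then show ?thesis by eventually_elim simp
qed

end

section \<open>Regularity\<close>

text \<open>Its integer translates form a partition of unity, so combinations of scaled translates
  interpolate linearly between grid points.\<close>

definition hat :: "real \<Rightarrow> real" where
 "hat y = max 0 (1 - \<bar>y\<bar>)"

lemma hat_nonneg: "0 \<le> hat y" by (simp add: hat_def)

lemma hat_eq_0: "1 \<le> \<bar>y\<bar> \<Longrightarrow> hat y = 0" by (simp add: hat_def)

lemma continuous_on_hat [continuous_intros]: "continuous_on A f \<Longrightarrow> continuous_on A (\<lambda>x. hat (f x))"
 unfolding hat_def by (intro continuous_intros)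

lemma hat_has_derivative:
 assumes "y \<noteq> -1" "y \<noteq> 0" "y \<noteq> 1"
 shows "(hat has_real_derivative (if \<bar>y\<bar> < 1 then - sgn y else 0)) (at y)"
proof -
 consider "y < -1" | "-1 < y" "y < 0" | "0 < y" "y < 1" | "1 < y"
  using assms by linarith
 then show ?thesis
 proof cases
  case 1
  have "(hat has_real_derivative 0) (at y)"
   by (rule has_field_derivative_transform_within_open[of "\<lambda>_. 0" _ _ "{..<-1}"]) (use 1 in \<open>auto simp: hat_def\<close>)
  then show ?thesis
   using 1 by simp
 next
  case 2
  have "(hat has_real_derivative 1) (at y)"
   by (rule has_field_derivative_transform_within_open[of "\<lambda>y. 1 + y" _ _ "{-1<..<0}"])
    (use 2 in \<open>auto simp: hat_def intro!: derivative_eq_intros\<close>)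
  then show ?thesis
   using 2 by simp
 next
  case 3
  have "(hat has_real_derivative -1) (at y)"
   by (rule has_field_derivative_transform_within_open[of "\<lambda>y. 1 - y" _ _ "{0<..<1}"])
    (use 3 in \<open>auto simp: hat_def intro!: derivative_eq_intros\<close>)
  then show ?thesis
   using 3 by simp
 next
  case 4
  have "(hat has_real_derivative 0) (at y)"
   by (rule has_field_derivative_transform_within_open[of "\<lambda>_. 0" _ _ "{1<..}"]) (use 4 in \<open>auto simp: hat_def\<close>)
  then show ?thesis
   using 4 by simp
 qed
qed

lemma hat_sum:
 assumes "0 \<le> y" "y \<le> real N"
 shows "(\<Sum>i\<le>N. hat (y - real i)) = 1"
 using assms
proof (induction N)
 case 0
 then show ?case by (simp add: hat_def)
next
 case (Suc N)
 show ?case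
 proof (cases "y \<le> real N")
  case True
  then have "hat (y - real (Suc N)) = 0" by (intro hat_eq_0) simp
  then show ?thesis
   using Suc True by simp
 next
  case False
  have "(\<Sum>i<N. hat (y - real i)) = 0"
  proof (rule sum.neutral, rule ballI)
   fix i assume "i \<in> {..<N}"
   then have "real i + 1 \<le> real N" by simp
   then show "hat (y - real i) = 0"
    using False by (intro hat_eq_0) simp
  qed
  moreover have "hat (y - real N) = 1 - (y - real N)" "hat (y - real (Suc N)) = 1 - (real (Suc N) - y)"
   using False Suc.prems by (auto simp: hat_def)
  moreover have "(\<Sum>i\<le>Suc N. hat (y - real i)) = (\<Sum>i<N. hat (y - real i)) + hat (y - real N) + hat (y - real (Suc N))"
   by (simp add: lessThan_Suc_atMost[symmetric])
  ultimately show ?thesis by simp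
 qed
qed

context laakso
begin

text \<open>Piecewise linear interpolation in \<open>x\<close>, on a grid containing
  \<open>L n\<close>, of the values of \<open>f\<close> at truncated words. At a point of
  \<open>L n\<close> the interpolant is such a value, which is compatible with the identifications
  by \<open>io_trunc\<close>; elsewhere they do not touch the first \<open>n\<close> digits.\<close>

lemma core_uniformly_dense:
 fixes f :: "'k::finite laakso_point \<Rightarrow> real"
 assumes f: "continuous_map (laakso_topology js) euclideanreal f" and \<epsilon>: "\<epsilon> > 0"
 shows "\<exists>g\<in>mgug_core js. \<forall>s\<in>laakso_space js. \<bar>f s - g s\<bar> < \<epsilon>"
proof -
 obtain C where C: "\<And>s. s \<in> laakso_space js \<Longrightarrow> \<bar>f s\<bar> \<le> C"
  by (rule continuous_bounded[OF f]) (rule that; assumption)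
 have "continuous_on laakso_base (\<lambda>p. f (io p))"
  using f by (simp add: continuous_laakso_iff)
 moreover have "\<epsilon> / 2 > 0"
  using \<epsilon> by simp
 ultimately obtain \<delta> n where \<delta>: "\<delta> > 0" and unif: "\<And>x y w w'. \<lbrakk>\<bar>y - x\<bar> < \<delta>; x \<in> {0..1}; y \<in> {0..1}; agree n w w'\<rbrakk> \<Longrightarrow>
   \<bar>f (io (y, w')) - f (io (x, w))\<bar> < \<epsilon> / 2"
  by (rule uniformly_continuous_base) (rule that; assumption)
 obtain m where m: "1 / \<delta> < real m"
  using reals_Archimedean2 by blast
 \<comment> \<open>\<open>M \<ge> n\<close> puts \<open>L n\<close> among the grid points,
   \<open>M \<ge> m\<close> makes the mesh smaller than \<open>\<delta>\<close>.\<close>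
 define M where "M = max n m"
 define D where "D = real (d M)"
 have "real m < 2 ^ m"
  using of_nat_less_two_power by blast
 also have "(2 :: real) ^ m \<le> 2 ^ M" by (intro power_increasing) (auto simp: M_def)
 also have "(2 :: real) ^ M \<le> D"
  using of_nat_mono[OF d_ge[of M], where 'a = real] by (simp add: D_def)
 finally have D: "1 / \<delta> < D"
  using m by linarith
 then have D0: "D > 0"
  using \<delta> by (simp add: D_def)
 have D1: "1 / D < \<delta>"
  using D D0 \<delta> by (simp add: field_simps)
 have node: "real i / D \<in> {0..1}" if "i \<le> d M" for i
  using that D0 by (simp add: D_def)
 define F where "F = (\<lambda>(x, w). \<Sum>i\<le>d M. f (io (real i / D, trunc n w)) * hat (D * x - real i))"
 define h' where "h' y = (if \<bar>y\<bar> < 1 then - sgn y else 0)" for y :: real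
 define F' where "F' = (\<lambda>(x, w). \<Sum>i\<le>d M. f (io (real i / D, trunc n w)) * (h' (D * x - real i) * D))"
 \<comment> \<open>In the variable \<open>D * x\<close> the kinks of the hats with index up to
   \<open>d M\<close> sit at the integers from \<open>-1\<close> to \<open>d M + 1\<close>; the
   shift by one keeps \<open>j\<close> a natural number.\<close>
 define Z where "Z = (\<lambda>j. (real j - 1) / D) ` {..d M + 2}"
 have F1: "F (x, w) = F (x, trunc n w)" for x w by (simp add: F_def)
 have F2: "F (x, w) = F (x, w')" if g: "glued x w w'" for x w w'
 proof (cases "x \<in> L n")
  case True
  then have "x \<in> L M"
   using L_mono[of n M] by (auto simp: M_def)
  then have x: "0 < x" "x < 1" "x * D \<in> \<int>" by (simp_all add: mem_L D_def)
  from x(3) obtain z where z: "x * D = of_int z" by (elim Ints_cases)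
  have "0 < x * D" "x * D < D"
   using x(1,2) D0 by auto
  then have z': "0 \<le> z" "z < int (d M)"
   unfolding z unfolding D_def by linarith+
  define j where "j = nat z"
  have j: "x * D = real j" "j \<le> d M"
   using z z' by (auto simp: j_def)
  have xj: "x = real j / D"
   using j(1) D0 by (simp add: field_simps)
  \<comment> \<open>At a grid point a single hat is non-zero.\<close>
  have val: "F (x, u) = f (io (x, trunc n u))" for u
  proof -
   have "F (x, u) = (\<Sum>i\<le>d M. f (io (real i / D, trunc n u)) * hat (D * x - real i))"
    by (simp add: F_def)
   also have "\<dots> = (\<Sum>i\<le>d M. if i = j then f (io (x, trunc n u)) else 0)"
   proof (rule sum.cong[OF refl])
    fix i assume "i \<in> {..d M}"
    have Dx: "D * x = real j"
     using j(1) by (simp add: mult.commute)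
    show "f (io (real i / D, trunc n u)) * hat (D * x - real i) = (if i = j then f (io (x, trunc n u)) else 0)"
    proof (cases "i = j")
     case True
     then show ?thesis
      unfolding Dx using xj by (simp add: hat_def)
    next
     case False
     then have "1 \<le> \<bar>real j - real i\<bar>" by linarith
     then show ?thesis
      unfolding Dx using False by (simp add: hat_eq_0)
    qed
   qed
   also have "\<dots> = f (io (x, trunc n u))"
    using j(2) by simp
   finally show ?thesis .
  qed
  have "io (x, w) = io (x, w')"
   using g by (simp add: io_eq_iff)
  from io_trunc[OF this, of n] show ?thesis by (simp only: val)
 next
  case False
  have "io (x, w) = io (x, w')"
   using g by (simp add: io_eq_iff)
  from io_eq_imp_agree[OF this False] have "trunc n w = trunc n w'" by (simp add: trunc_eq_iff)
  then show ?thesis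
   using F1[of x w] F1[of x w'] by simp
 qed
 have F3: "continuous_on {0..1} (\<lambda>x. F (x, v))" for v
  unfolding F_def by (simp, intro continuous_intros)
 have Z: "finite Z" by (simp add: Z_def)
 have F4: "((\<lambda>y. F (y, v)) has_real_derivative F' (x, v)) (at x)" if "x \<notin> Z" for x v
 proof -
  have hd: "((\<lambda>y. hat (D * y - real i)) has_real_derivative h' (D * x - real i) * D) (at x)" if i: "i \<le> d M" for i
  proof -
   have ne: "D * x \<noteq> real k - 1" if "k \<le> d M + 2" for k
   proof
    assume "D * x = real k - 1"
    then have "x = (real k - 1) / D"
     using D0 by (simp add: field_simps)
    then show False
     using \<open>x \<notin> Z\<close> that unfolding Z_def by blast
   qed
   have "(hat has_real_derivative h' (D * x - real i)) (at (D * x - real i))"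
    unfolding h'_def using ne[of i] ne[of "i + 1"] ne[of "i + 2"] i by (intro hat_has_derivative) auto
   moreover have "((\<lambda>y. D * y - real i) has_real_derivative D) (at x)"
    by (auto intro!: derivative_eq_intros)
   ultimately show ?thesis by (rule DERIV_chain2)
  qed
  have "((\<lambda>y. \<Sum>i\<le>d M. f (io (real i / D, trunc n v)) * hat (D * y - real i)) has_real_derivative
    (\<Sum>i\<le>d M. f (io (real i / D, trunc n v)) * (h' (D * x - real i) * D))) (at x)"
   by (intro DERIV_sum DERIV_cmult hd) simp
  then show ?thesis by (simp add: F_def F'_def)
 qed
 have F5: "\<bar>F' (x, v)\<bar> \<le> (\<Sum>i\<le>d M. C * D)" for x v
 proof -
  have "\<bar>F' (x, v)\<bar> \<le> (\<Sum>i\<le>d M. \<bar>f (io (real i / D, trunc n v)) * (h' (D * x - real i) * D)\<bar>)"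
   unfolding F'_def prod.case by (rule sum_abs)
  also have "\<dots> \<le> (\<Sum>i\<le>d M. C * D)"
  proof (rule sum_mono)
   fix i assume i: "i \<in> {..d M}"
   then have fC: "\<bar>f (io (real i / D, trunc n v))\<bar> \<le> C"
    using node[of i] by (intro C laakso_proj_in_space) simp
   have "\<bar>h' (D * x - real i)\<bar> \<le> 1" by (auto simp: h'_def abs_sgn_eq)
   then have "\<bar>h' (D * x - real i) * D\<bar> \<le> 1 * D"
    unfolding abs_mult using D0 by (intro mult_mono) auto
   then show "\<bar>f (io (real i / D, trunc n v)) * (h' (D * x - real i) * D)\<bar> \<le> C * D"
    unfolding abs_mult[of "f _"] using fC by (intro mult_mono) auto
  qed
  finally show ?thesis .
 qed
 have core: "lift F \<in> mgug_core js" and lift: "lift F (io p) = F p" for p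
  using core_liftI[where F = F and F' = F' and n = n and C = "\<Sum>i\<le>d M. C * D", OF F1 F2 F3 Z F4 F5]
  by blast+
 have close: "\<bar>f (io (x, w)) - F (x, w)\<bar> < \<epsilon>" if x: "x \<in> {0..1}" for x w
 proof -
  have s1: "(\<Sum>i\<le>d M. hat (D * x - real i)) = 1"
   using x D0 by (intro hat_sum) (auto simp: D_def mult_le_cancel_left1)
  have eq: "f (io (x, w)) - F (x, w) = (\<Sum>i\<le>d M. (f (io (x, w)) - f (io (real i / D, trunc n w))) * hat (D * x - real i))"
   using s1 by (simp add: F_def sum_subtractf left_diff_distrib sum_distrib_left[symmetric])
  have "\<bar>f (io (x, w)) - F (x, w)\<bar> \<le> (\<Sum>i\<le>d M. \<bar>(f (io (x, w)) - f (io (real i / D, trunc n w))) * hat (D * x - real i)\<bar>)"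
   unfolding eq by (rule sum_abs)
  also have "\<dots> \<le> (\<Sum>i\<le>d M. \<epsilon> / 2 * hat (D * x - real i))"
  proof (rule sum_mono)
   fix i assume i: "i \<in> {..d M}"
   show "\<bar>(f (io (x, w)) - f (io (real i / D, trunc n w))) * hat (D * x - real i)\<bar> \<le> \<epsilon> / 2 * hat (D * x - real i)"
   proof (cases "1 \<le> \<bar>D * x - real i\<bar>")
    case False
    have "x - real i / D = (D * x - real i) / D"
     using D0 by (simp add: field_simps)
    then have "\<bar>x - real i / D\<bar> < 1 / D"
     using False D0 by (simp add: abs_divide divide_strict_right_mono)
    then have "\<bar>x - real i / D\<bar> < \<delta>"
     using D1 by linarith
    then have "\<bar>f (io (x, w)) - f (io (real i / D, trunc n w))\<bar> < \<epsilon> / 2"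
     using i by (intro unif x node) auto
    then show ?thesis
     unfolding abs_mult abs_of_nonneg[OF hat_nonneg] by (intro mult_right_mono hat_nonneg less_imp_le)
   qed (simp add: hat_eq_0)
  qed
  also have "\<dots> = \<epsilon> / 2"
   unfolding sum_distrib_left[symmetric] s1 by simp
  also have "\<dots> < \<epsilon>"
   using \<epsilon> by simp
  finally show ?thesis .
 qed
 show ?thesis
 proof (intro bexI[OF _ core] ballI)
  fix s :: "'k laakso_point" assume "s \<in> laakso_space js"
  then obtain x w where "s = io (x, w)" "x \<in> {0..1}"
   unfolding laakso_space_def laakso_base_def by blast
  then show "\<bar>f s - lift F s\<bar> < \<epsilon>"
   using close by (simp add: lift)
 qed
qed

lemma core_cont_compact_support:
 assumes "u \<in> mgug_core js"
 shows "u \<in> cont_compact_support (laakso_topology js)"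
 unfolding cont_compact_support_def
 using core_continuous[OF assms] closedin_compact_space[OF compact_space_laakso closedin_closure_of]
 by (intro CollectI conjI)

lemma mgug_regular:
 "regular_form (laakso_topology js) (\<mu>) (mgug_form js) (mgug_dom js :: ('k::finite laakso_point \<Rightarrow> real) set)"
 unfolding regular_form_def
proof (intro conjI ballI allI impI)
 fix f :: "'k laakso_point \<Rightarrow> real" and \<epsilon> :: real assume f: "f \<in> mgug_dom js" and \<epsilon>: "\<epsilon> > 0"
 from f obtain g where W: "W f g"
  unfolding mgug_dom_iff by (elim exE)
 obtain u where u: "\<And>m. u m \<in> mgug_core js" "(\<lambda>m. l2_sq (\<mu>) (\<lambda>s. u m s - f s)) \<longlonglongrightarrow> 0"
  "(\<lambda>m. l2_sq MB (\<lambda>p. dx js (u m) p - g p)) \<longlonglongrightarrow> 0"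
  by (rule W_seq[OF W]) (rule that; assumption)
 from tendsto_add[OF u(3) u(2)]
 have "(\<lambda>m. l2_sq MB (\<lambda>p. dx js (u m) p - g p) + l2_sq (\<mu>) (\<lambda>s. u m s - f s)) \<longlonglongrightarrow> 0"
  by simp
 then have "\<forall>\<^sub>F m in sequentially. l2_sq MB (\<lambda>p. dx js (u m) p - g p) + l2_sq (\<mu>) (\<lambda>s. u m s - f s) < \<epsilon>"
  using \<epsilon> by (rule order_tendstoD(2))
 then obtain m where m: "l2_sq MB (\<lambda>p. dx js (u m) p - g p) + l2_sq (\<mu>) (\<lambda>s. u m s - f s) < \<epsilon>"
  unfolding eventually_sequentially by blast
 note Wu = W_core[OF u(1)[of m]]
 have "form1_sq (\<mu>) (mgug_form js) (\<lambda>x. f x - u m x) < \<epsilon>"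
  unfolding mgug_form1_sq_diff[OF W Wu] using m
  by (simp only: l2_sq_diff_commute[of MB g] l2_sq_diff_commute[of "\<mu>" f])
 moreover have "u m \<in> mgug_dom js"
  unfolding mgug_dom_iff by (rule exI[of _ "dx js (u m)"]) (rule Wu)
 ultimately show "\<exists>g\<in>mgug_dom js \<inter> cont_compact_support (laakso_topology js).
   form1_sq (\<mu>) (mgug_form js) (\<lambda>x. f x - g x) < \<epsilon>"
  using core_cont_compact_support[OF u(1)[of m]] by (intro bexI[of _ "u m"] IntI)
next
 fix f :: "'k laakso_point \<Rightarrow> real" and \<epsilon> :: real
 assume f: "f \<in> cont_compact_support (laakso_topology js)" and \<epsilon>: "\<epsilon> > 0"
 then have "continuous_map (laakso_topology js) euclideanreal f" by (simp add: cont_compact_support_def)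
 from core_uniformly_dense[OF this \<epsilon>] obtain u where u: "u \<in> mgug_core js" "\<forall>s\<in>laakso_space js. \<bar>f s - u s\<bar> < \<epsilon>"
  by (elim bexE)
 have "u \<in> mgug_dom js"
  unfolding mgug_dom_iff by (rule exI[of _ "dx js u"]) (rule W_core[OF u(1)])
 then show "\<exists>g\<in>mgug_dom js \<inter> cont_compact_support (laakso_topology js). \<forall>x\<in>topspace (laakso_topology js). \<bar>f x - g x\<bar> < \<epsilon>"
  unfolding topspace_laakso_topology using core_cont_compact_support[OF u(1)] u(2) by (intro bexI[of _ u] IntI)
qed

end

section \<open>Folding maps\<close>

context laakso
begin

interpretation LM: prob_space "\<mu>" by (rule prob_space_laakso)
interpretation BM: prob_space "MB" by (rule prob_space_MB)

definition J :: "nat \<Rightarrow> nat \<Rightarrow> real set" where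
 "J n j = {real j / real (d n)..(real j + 1) / real (d n)}"

definition nodes :: "nat \<Rightarrow> real set" where
 "nodes n = (\<lambda>j. real j / real (d n)) ` {..d n}"

lemma finite_nodes: "finite (nodes n)" by (simp add: nodes_def)

lemma real_d_pos: "0 < real (d n)" by simp

lemma mem_J: "x \<in> J n j \<longleftrightarrow> real j \<le> x * real (d n) \<and> x * real (d n) \<le> real j + 1"
 unfolding J_def atLeastAtMost_iff pos_divide_le_eq[OF real_d_pos] pos_le_divide_eq[OF real_d_pos] by (rule refl)

lemma d_mult:
 "(x + a / real (d n)) * real (d n) = x * real (d n) + a"
 "(a / real (d n) + x) * real (d n) = a + x * real (d n)"
 "(a / real (d n) - x) * real (d n) = a - x * real (d n)" by (simp_all add: distrib_right left_diff_distrib)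

lemma nodesI:
 assumes "x * real (d n) = real b" "b \<le> d n" shows "x \<in> nodes n"
proof -
 have "x = real b / real (d n)"
  using assms(1) real_d_pos[of n] by (simp add: nonzero_eq_divide_eq)
 then show ?thesis
  using assms(2) unfolding nodes_def by blast
qed

lemma J_subset:
 assumes "j < d n" shows "J n j \<subseteq> {0..1}"
proof
 fix x assume "x \<in> J n j"
 moreover have "real j + 1 \<le> real (d n)"
  using assms by linarith
 ultimately have "0 * real (d n) \<le> x * real (d n)" "x * real (d n) \<le> 1 * real (d n)"
  unfolding mem_J by linarith+
 then show "x \<in> {0..1}"
  using mult_right_le_imp_le[OF _ real_d_pos[of n]] by presburger
qed

lemma J_cover:
 assumes "x \<in> {0..1}" shows "\<exists>j<d n. x \<in> J n j"
proof (cases "x = 1")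
 case True
 have "real (d n - 1) = real (d n) - 1"
  using d_pos[of n] by linarith
 then have "x \<in> J n (d n - 1)"
  unfolding mem_J True by simp
 then show ?thesis
  using d_pos[of n] by (intro exI[of _ "d n - 1"] conjI) simp_all
next
 case False
 define k where "k = \<lfloor>x * real (d n)\<rfloor>"
 have "0 \<le> x * real (d n)"
  using assms by simp
 then have k0: "0 \<le> k" by (simp add: k_def)
 have "x * real (d n) < 1 * real (d n)"
  using assms False by (intro mult_strict_right_mono real_d_pos) simp
 moreover have k: "of_int k \<le> x * real (d n)" "x * real (d n) < of_int k + 1"
  unfolding k_def by linarith+
 ultimately have "of_int k < real (d n)" by linarith
 then have "nat k < d n"
  using k0 by linarith
 moreover have "real (nat k) = of_int k"
  using k0 by simp
 ultimately show ?thesis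
  using k by (intro exI[of _ "nat k"] conjI) (simp_all only: mem_J less_imp_le)
qed

lemma J_unique:
 assumes x: "x \<notin> nodes n" and j: "j < d n" "x \<in> J n j" and k: "k < d n" "x \<in> J n k"
 shows "j = k"
proof (rule ccontr)
 have *: False if "a < b" "b < d n" "x \<in> J n a" "x \<in> J n b" for a b
 proof -
  have "real a + 1 \<le> real b"
   using that(1) by linarith
  then have "x * real (d n) = real b"
   using that(3,4) unfolding mem_J by linarith
  then show False
   using nodesI[of x n b] that(2) x by simp
 qed
 assume "j \<noteq> k"
 then consider "j < k" | "k < j" by linarith
 then show False
  using *[of j k] *[of k j] j k by cases blast+
qed

lemma J_interior:
 assumes "x \<notin> nodes n" "j < d n" "x \<in> J n j"
 shows "real j < x * real (d n)" "x * real (d n) < real j + 1"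
 using nodesI[of x n j] nodesI[of x n "Suc j"] assms unfolding mem_J by fastforce+

lemma J_sum:
 assumes "x \<notin> nodes n"
 shows "(\<Sum>j<d n. indicator (J n j) x) = (indicator {0..1} x :: 'a::semiring_1)"
proof (cases "x \<in> {0..1}")
 case True
 then obtain j where j: "j < d n" "x \<in> J n j"
  using J_cover by blast
 have "(\<Sum>k<d n. indicator (J n k) x :: 'a) = (\<Sum>k<d n. if k = j then 1 else 0)"
 proof (rule sum.cong[OF refl])
  fix k assume "k \<in> {..<d n}"
  then have "x \<in> J n k \<longleftrightarrow> k = j"
   using J_unique[OF assms _ _ j] j by blast
  then show "(indicator (J n k) x :: 'a) = (if k = j then 1 else 0)" by (simp add: indicator_def)
 qed
 then show ?thesis
  using True j(1) by simp
next
 case False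
 have "(\<Sum>k<d n. indicator (J n k) x :: 'a) = 0"
 proof (rule sum.neutral, rule ballI)
  fix k assume "k \<in> {..<d n}"
  then have "x \<notin> J n k"
   using J_subset[of k n] False by blast
  then show "(indicator (J n k) x :: 'a) = 0" by simp
 qed
 then show ?thesis
  using False by simp
qed

text \<open>\<open>\<xi>\<close> folds the unit interval onto the interval number \<open>i\<close> of level \<open>n\<close>; the condition on \<open>B\<close> says that
 \<open>B\<close> drops the first \<open>n\<close> digits and maps the remaining ones isometrically onto those of the cylinder of \<open>v\<close>.\<close>

definition folding ::
  "nat \<Rightarrow> nat \<Rightarrow> ('k \<Rightarrow> nat \<Rightarrow> bool) \<Rightarrow> (real \<Rightarrow> real) \<Rightarrow> (('k \<Rightarrow> nat \<Rightarrow> bool) \<Rightarrow> ('k \<Rightarrow> nat \<Rightarrow> bool)) \<Rightarrow> (nat \<Rightarrow> bool) \<Rightarrow> bool" where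
 "folding n i v \<xi> B s \<longleftrightarrow> i < d n \<and>
   (\<forall>j<d n. \<forall>x\<in>J n j. \<xi> x = (if s j then x + (real i - real j) / real (d n) else (real i + real j + 1) / real (d n) - x)) \<and>
   (\<forall>w. B w \<in> cyl n v) \<and>
   (\<forall>m\<ge>n. \<forall>v'\<in>cyl n v. \<exists>u. \<forall>w. B w \<in> cyl m v' \<longleftrightarrow> (\<forall>l. \<forall>i\<in>{n..<m}. w l i = u l i))"

lemma foldingD:
 assumes "folding n i v \<xi> B s"
 shows "i < d n" "\<And>j x. j < d n \<Longrightarrow> x \<in> J n j \<Longrightarrow>
   \<xi> x = (if s j then x + (real i - real j) / real (d n) else (real i + real j + 1) / real (d n) - x)"
  "\<And>w. B w \<in> cyl n v"
  "\<And>m v'. n \<le> m \<Longrightarrow> v' \<in> cyl n v \<Longrightarrow> \<exists>u. \<forall>w. B w \<in> cyl m v' \<longleftrightarrow> (\<forall>l. \<forall>i\<in>{n..<m}. w l i = u l i)"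
 using assms unfolding folding_def by blast+

lemma folding_mult:
 assumes "folding n i v \<xi> B s" "j < d n" "x \<in> J n j"
 shows "\<xi> x * real (d n) = (if s j then x * real (d n) + real i - real j else real i + real j + 1 - x * real (d n))"
 unfolding foldingD(2)[OF assms] by (simp add: d_mult)

lemma folding_J:
 assumes fo: "folding n i v \<xi> B s" and x: "x \<in> {0..1}"
 shows "\<xi> x \<in> J n i"
proof -
 obtain j where j: "j < d n" "x \<in> J n j"
  using J_cover[OF x] by blast
 then show ?thesis
  unfolding mem_J folding_mult[OF fo j] by (simp split: if_split)
qed

lemma folding_unit:
 assumes "folding n i v \<xi> B s" "x \<in> {0..1}"
 shows "\<xi> x \<in> {0..1}"
 using folding_J[OF assms] J_subset[OF foldingD(1)[OF assms(1)]] by blast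

text \<open>Taking \<open>v' = B w\<close> in the last condition of \<open>folding\<close> shows
  that a prefix of the image is determined by a prefix of the argument.\<close>

lemma folding_agree:
 assumes fo: "folding n i v \<xi> B s" and m: "n \<le> m" and ag: "agree m w w'"
 shows "agree m (B w) (B w')"
proof -
 obtain u where u: "\<And>w'. B w' \<in> cyl m (B w) \<longleftrightarrow> (\<forall>l. \<forall>i\<in>{n..<m}. w' l i = u l i)"
  using foldingD(4)[OF fo m foldingD(3)[OF fo, of w]] by blast
 have "B w \<in> cyl m (B w)" by (simp add: mem_cyl)
 then have "\<forall>l. \<forall>i\<in>{n..<m}. w' l i = u l i"
  unfolding u using ag by (simp add: agree_def)
 then show ?thesis
  unfolding u[symmetric] mem_cyl .
qed

text \<open>The affine formulas hold on closed intervals, so they agree at common ends, and finitely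
  many closed pieces can be pasted.\<close>

lemma folding_continuous:
 assumes fo: "folding n i v \<xi> B s"
 shows "continuous_on {0..1} \<xi>"
proof -
 have "continuous_on (\<Union>j\<in>{..<d n}. J n j) \<xi>"
 proof (rule continuous_on_closed_Union)
  show "closed (J n j)" for j by (simp add: J_def)
  show "continuous_on (J n j) \<xi>" if "j \<in> {..<d n}" for j
  proof -
   have "continuous_on (J n j) (\<lambda>x. if s j then x + (real i - real j) / real (d n) else (real i + real j + 1) / real (d n) - x)"
    by (cases "s j") (auto intro!: continuous_intros)
   then show ?thesis
    using foldingD(2)[OF fo] that by (subst continuous_on_cong[OF refl]) auto
  qed
 qed simp
 moreover have "{0..1} \<subseteq> (\<Union>j\<in>{..<d n}. J n j)"
  using J_cover by blast
 ultimately show ?thesis by (rule continuous_on_subset)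
qed

lemma folding_continuous_digits:
 fixes B :: "('k::finite \<Rightarrow> nat \<Rightarrow> bool) \<Rightarrow> _"
 assumes fo: "folding n i v \<xi> B s"
 shows "continuous_on UNIV B"
proof -
 have "open (B -` U)" if U: "open U" for U
 proof (subst open_subopen, rule ballI)
  fix w assume "w \<in> B -` U"
  then have "B w \<in> U" by simp
  with U obtain m where m: "cyl m (B w) \<subseteq> U" by (rule open_contains_cyl)
  show "\<exists>T. open T \<and> w \<in> T \<and> T \<subseteq> B -` U"
  proof (intro exI[of _ "cyl (max n m) w"] conjI open_cyl subsetI)
   fix w' assume "w' \<in> cyl (max n m) w"
   then have "agree (max n m) (B w) (B w')"
    unfolding mem_cyl by (intro folding_agree[OF fo]) simp_all
   then have "B w' \<in> cyl m (B w)"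
    unfolding mem_cyl by (rule agree_mono) simp
   then show "w' \<in> B -` U"
    using m by blast
  qed (simp add: mem_cyl)
 qed
 then show ?thesis by (simp add: continuous_on_open_vimage)
qed

lemma folding_continuous_base:
 fixes B :: "('k::finite \<Rightarrow> nat \<Rightarrow> bool) \<Rightarrow> _"
 assumes fo: "folding n i v \<xi> B s"
 shows "continuous_on laakso_base (\<lambda>p. (\<xi> (fst p), B (snd p)))"
proof (intro continuous_on_Pair)
 show "continuous_on laakso_base (\<lambda>p :: 'k prelaakso. \<xi> (fst p))"
  by (rule continuous_on_compose2[OF folding_continuous[OF fo] continuous_on_fst[OF continuous_on_id]]) (auto simp: laakso_base_def)
 show "continuous_on laakso_base (\<lambda>p :: 'k prelaakso. B (snd p))"
  by (rule continuous_on_compose2[OF folding_continuous_digits[OF fo] continuous_on_snd[OF continuous_on_id]]) simp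
qed

lemma cyl_meet:
 assumes "n \<le> m" "w \<in> cyl n v" "w \<in> cyl m v'"
 shows "v' \<in> cyl n v"
proof -
 have "agree n v' w"
  using assms(3,1) unfolding mem_cyl by (rule agree_mono)
 from agree_trans[OF _ agree_sym[OF this]] show ?thesis
  using assms(2) unfolding mem_cyl .
qed

lemma folding_measurable_interval:
 assumes fo: "folding n i v \<xi> B s"
 shows "\<xi> \<in> MI \<rightarrow>\<^sub>M MI"
proof (rule measurable_restrict_space2)
 show "\<xi> \<in> space MI \<rightarrow> {0..1}"
  using folding_unit[OF fo] by (intro Pi_I) simp
 have "\<xi> \<in> borel_measurable (restrict_space borel {0..1})"
  by (rule borel_measurable_continuous_on_restrict[OF folding_continuous[OF fo]])
 moreover have "sets (restrict_space borel {0..1}) = sets (restrict_space lborel {0..1 :: real})"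
  by (intro sets_restrict_space_cong) simp
 ultimately show "\<xi> \<in> restrict_space lborel {0..1} \<rightarrow>\<^sub>M lborel"
  by (subst measurable_cong_sets[of _ "restrict_space borel {0..1}" _ borel]) simp_all
qed

lemma folding_measurable_digits:
 fixes B :: "('k::finite \<Rightarrow> nat \<Rightarrow> bool) \<Rightarrow> _"
 assumes fo: "folding n i v \<xi> B s"
 shows "B \<in> MK \<rightarrow>\<^sub>M MK"
proof (rule measurable_sigma_sets[OF sets_MK[of n]])
 show "cyls n \<subseteq> Pow UNIV" by simp
 fix A :: "('k \<Rightarrow> nat \<Rightarrow> bool) set" assume "A \<in> cyls n"
 then consider "A = {}" | m v' where "n \<le> m" "A = cyl m v'"
  unfolding cyls_def by blast
 then show "B -` A \<inter> space MK \<in> sets MK"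
 proof cases
  case 2
  show ?thesis
  proof (cases "v' \<in> cyl n v")
   case True
   obtain u where u: "\<And>w. B w \<in> cyl m v' \<longleftrightarrow> (\<forall>l. \<forall>i\<in>{n..<m}. w l i = u l i)"
    using foldingD(4)[OF fo 2(1) True] by blast
   have "B -` A \<inter> space MK = {w \<in> space MK. \<forall>l. \<forall>i\<in>{n..<m}. w l i = u l i}"
    unfolding 2 using u by auto
   also have "\<dots> \<in> sets MK" by measurable
   finally show ?thesis .
  next
   case False
   have "B w \<notin> cyl m v'" for w
    using cyl_meet[OF 2(1) foldingD(3)[OF fo]] False by blast
   then have "B -` A \<inter> space MK = {}"
    unfolding 2 by blast
   then show ?thesis by simp
  qed
 qed simp
qed simp

text \<open>Each of the \<open>d n\<close> affine branches carries its interval isometrically onto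
  \<open>J n i\<close>, so each contributes the integral over \<open>J n i\<close>.\<close>

lemma folding_nn_integral_interval:
 assumes fo: "folding n i v \<xi> B s" and h: "h \<in> borel_measurable MI"
 shows "(\<integral>\<^sup>+x. h (\<xi> x) \<partial>MI) = ennreal (real (d n)) * (\<integral>\<^sup>+x. h x * indicator (J n i) x \<partial>MI)"
proof -
 have Ji: "J n i \<subseteq> {0..1}" by (rule J_subset[OF foldingD(1)[OF fo]])
 define H where "H x = h x * indicator {0..1} x * indicator (J n i) x" for x
 have "(\<lambda>x. h x * indicator {0..1} x) \<in> borel_measurable lborel"
  using h by (subst borel_measurable_restrict_space_iff_ennreal[symmetric]) auto
 moreover have "J n i \<in> sets lborel" by (simp add: J_def)
 ultimately have "H \<in> borel_measurable lborel"
  unfolding H_def by simp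
 then have H: "H \<in> borel_measurable borel" by simp
 have H_eq: "H x = h x * indicator (J n i) x" for x
  using Ji by (auto simp: H_def indicator_def)
 define c where "c j = (if s j then 1 else -1 :: real)" for j
 define t where "t j = (if s j then (real i - real j) / real (d n) else (real i + real j + 1) / real (d n))" for j
 \<comment> \<open>The affine branch maps only \<open>J n j\<close> into \<open>J n i\<close>, and
   \<open>H\<close> vanishes off \<open>J n i\<close>; so the branch may be used on the whole line,
   where the change of variables is available.\<close>
 have shift: "h (\<xi> x) * indicator (J n j) x = H (t j + c j * x)" if j: "j < d n" for x j
 proof (cases "x \<in> J n j")
  case True
  have "\<xi> x = t j + c j * x"
   using foldingD(2)[OF fo j True] by (simp add: c_def t_def split: if_split)
  moreover have "\<xi> x \<in> J n i"
   using J_subset[OF j] True by (intro folding_J[OF fo]) blast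
  ultimately show ?thesis
   using True by (simp add: H_eq)
 next
  case False
  have "(t j + c j * x) * real (d n) = (if s j then x * real (d n) + real i - real j else real i + real j + 1 - x * real (d n))"
   by (simp add: c_def t_def d_mult split: if_split)
  then have "t j + c j * x \<notin> J n i"
   using False unfolding mem_J by (auto split: if_splits)
  then show ?thesis
   using False by (simp add: H_eq)
 qed
 have int: "(\<integral>\<^sup>+x. H (t j + c j * x) \<partial>lborel) = (\<integral>\<^sup>+x. H x \<partial>lborel)" for j
  using nn_integral_real_affine[OF H, of "c j" "t j"] by (simp add: c_def split: if_splits)
 have meas: "(\<lambda>x. H (t j + c j * x)) \<in> borel_measurable lborel" for j
  using measurable_compose[of "\<lambda>x. t j + c j * x" lborel borel H borel] H by simp
 have "(\<integral>\<^sup>+x. h (\<xi> x) \<partial>MI) = (\<integral>\<^sup>+x. h (\<xi> x) * indicator {0..1} x \<partial>lborel)"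
  by (rule nn_integral_restrict_space) simp
 also have "\<dots> = (\<integral>\<^sup>+x. (\<Sum>j<d n. H (t j + c j * x)) \<partial>lborel)"
 proof (rule nn_integral_cong_AE)
  have "AE x in lborel. x \<notin> nodes n" by (intro AE_not_in finite_imp_null_set_lborel finite_nodes)
  then show "AE x in lborel. h (\<xi> x) * indicator {0..1} x = (\<Sum>j<d n. H (t j + c j * x))"
  proof eventually_elim
   fix x assume "x \<notin> nodes n"
   then have "h (\<xi> x) * indicator {0..1} x = (\<Sum>j<d n. h (\<xi> x) * indicator (J n j) x)"
    by (simp only: J_sum[symmetric] sum_distrib_left)
   also have "\<dots> = (\<Sum>j<d n. H (t j + c j * x))" by (intro sum.cong refl shift) simp
   finally show "h (\<xi> x) * indicator {0..1} x = (\<Sum>j<d n. H (t j + c j * x))" .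
  qed
 qed
 also have "\<dots> = (\<Sum>j<d n. \<integral>\<^sup>+x. H (t j + c j * x) \<partial>lborel)"
  using meas by (rule nn_integral_sum)
 also have "\<dots> = ennreal (real (d n)) * (\<integral>\<^sup>+x. H x \<partial>lborel)"
  unfolding int by (simp add: ennreal_of_nat_eq_real_of_nat)
 also have "(\<integral>\<^sup>+x. H x \<partial>lborel) = (\<integral>\<^sup>+x. h x * indicator (J n i) x \<partial>MI)"
  by (subst nn_integral_restrict_space) (simp_all add: H_def[abs_def] mult_ac)
 finally show ?thesis .
qed

text \<open>Two measures are compared on cylinders of depth \<open>m \<ge> n\<close>. Inside
  \<open>cyl n v\<close> the preimage of such a cylinder prescribes \<open>m - n\<close> digits in
  each of the \<open>k\<close> words, so its probability is \<open>2^(n k)\<close> times that of the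
  cylinder; outside, both sides vanish.\<close>

lemma folding_nn_integral_digits:
 fixes B :: "('k::finite \<Rightarrow> nat \<Rightarrow> bool) \<Rightarrow> _"
 assumes fo: "folding n i v \<xi> B s" and G: "G \<in> borel_measurable MK"
 shows "(\<integral>\<^sup>+w. G (B w) \<partial>MK) = ennreal (2 ^ (n * CARD('k))) * (\<integral>\<^sup>+w. G w * indicator (cyl n v) w \<partial>MK)"
proof -
 note B = folding_measurable_digits[OF fo]
 let ?c = "ennreal (2 ^ (n * CARD('k)))"
 have ind: "(\<lambda>w. ?c * indicator (cyl n v) w) \<in> borel_measurable MK"
  by (intro borel_measurable_times_ennreal borel_measurable_const borel_measurable_indicator sets_cyl)
 have "distr MK MK B = density MK (\<lambda>w. ?c * indicator (cyl n v) w)"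
 proof (rule measure_eqI_cyls[of _ _ n])
  show "finite_measure (distr MK MK B)" by (rule MK.finite_measure_distr[OF B])
  fix m and v' :: "'k \<Rightarrow> nat \<Rightarrow> bool" assume m: "n \<le> m"
  have l: "emeasure (distr MK MK B) (cyl m v') = emeasure MK {w. B w \<in> cyl m v'}"
   using emeasure_distr[OF B sets_cyl[of m v']] by (simp add: vimage_def)
  have "emeasure (density MK (\<lambda>w. ?c * indicator (cyl n v) w)) (cyl m v') =
    (\<integral>\<^sup>+w. ?c * indicator (cyl n v) w * indicator (cyl m v') w \<partial>MK)"
   by (rule emeasure_density[OF ind sets_cyl])
  also have "\<dots> = (\<integral>\<^sup>+w. ?c * indicator (cyl n v \<inter> cyl m v') w \<partial>MK)"
   by (intro nn_integral_cong) (simp add: indicator_inter_arith mult.assoc)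
  also have "\<dots> = ?c * emeasure MK (cyl n v \<inter> cyl m v')"
   by (intro nn_integral_cmult_indicator sets.Int sets_cyl)
  finally have r: "emeasure (density MK (\<lambda>w. ?c * indicator (cyl n v) w)) (cyl m v') = ?c * emeasure MK (cyl n v \<inter> cyl m v')" .
  show "emeasure (distr MK MK B) (cyl m v') = emeasure (density MK (\<lambda>w. ?c * indicator (cyl n v) w)) (cyl m v')"
  proof (cases "v' \<in> cyl n v")
   case True
   obtain u where u: "\<And>w. B w \<in> cyl m v' \<longleftrightarrow> (\<forall>l. \<forall>i\<in>{n..<m}. w l i = u l i)"
    using foldingD(4)[OF fo m True] by blast
   have "cyl m v' \<subseteq> cyl n v"
   proof
    fix w assume "w \<in> cyl m v'"
    then have "agree n v' w"
     unfolding mem_cyl using m by (rule agree_mono)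
    then show "w \<in> cyl n v"
     using True unfolding mem_cyl by (rule agree_trans[rotated])
   qed
   then have "cyl n v \<inter> cyl m v' = cyl m v'" by blast
   then have "?c * emeasure MK (cyl n v \<inter> cyl m v') = ennreal (2 ^ (n * CARD('k)) * (1 / 2) ^ (m * CARD('k)))"
    by (simp add: emeasure_cyl ennreal_mult)
   also have "m * CARD('k) = n * CARD('k) + (m - n) * CARD('k)"
    using m by (simp add: distrib_right[symmetric])
   also have "(2 :: real) ^ (n * CARD('k)) * (1 / 2) ^ (n * CARD('k) + (m - n) * CARD('k)) = (1 / 2) ^ ((m - n) * CARD('k))"
    by (simp add: power_add power_divide)
   finally show ?thesis
    unfolding l r u using emeasure_MK_digits[of "{n..<m}" u] by simp
  next
   case False
   have "w \<notin> cyl m v'" if "w \<in> cyl n v" for w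
    using cyl_meet[OF m that] False by blast
   then have "cyl n v \<inter> cyl m v' = {}" "{w. B w \<in> cyl m v'} = {}"
    using foldingD(3)[OF fo] by blast+
   then show ?thesis
    unfolding l r by simp
  qed
 qed simp_all
 then have "(\<integral>\<^sup>+w. G w \<partial>distr MK MK B) = (\<integral>\<^sup>+w. G w \<partial>density MK (\<lambda>w. ?c * indicator (cyl n v) w))"
  by simp
 also have "(\<integral>\<^sup>+w. G w \<partial>distr MK MK B) = (\<integral>\<^sup>+w. G (B w) \<partial>MK)"
  by (rule nn_integral_distr[OF B]) (use G in simp)
 also have "(\<integral>\<^sup>+w. G w \<partial>density MK (\<lambda>w. ?c * indicator (cyl n v) w)) = (\<integral>\<^sup>+w. ?c * (G w * indicator (cyl n v) w) \<partial>MK)"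
  by (subst nn_integral_density[OF ind G]) (simp add: mult_ac)
 also have "\<dots> = ?c * (\<integral>\<^sup>+w. G w * indicator (cyl n v) w \<partial>MK)"
  by (intro nn_integral_cmult borel_measurable_times_ennreal G borel_measurable_indicator sets_cyl)
 finally show ?thesis .
qed

lemma folding_measurable_base:
 fixes B :: "('k::finite \<Rightarrow> nat \<Rightarrow> bool) \<Rightarrow> _"
 assumes fo: "folding n i v \<xi> B s"
 shows "(\<lambda>p. (\<xi> (fst p), B (snd p))) \<in> MB \<rightarrow>\<^sub>M MB"
 unfolding MB_def
 by (intro measurable_Pair measurable_compose[OF measurable_fst folding_measurable_interval[OF fo]]
  measurable_compose[OF measurable_snd folding_measurable_digits[OF fo]])

lemma J_sets:
 assumes "i < d n" shows "J n i \<in> sets MI"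
proof -
 have "J n i \<in> sets lborel" by (simp add: J_def)
 then show ?thesis
  using J_subset[OF assms] by (subst sets_restrict_space_iff) simp_all
qed

lemma J_cyl_sets: "i < d n \<Longrightarrow> J n i \<times> cyl n v \<in> sets (MB :: 'k::finite prelaakso measure)"
 unfolding MB_def by (intro pair_measureI sets_cyl J_sets)

lemma folding_nn_integral:
 fixes B :: "('k::finite \<Rightarrow> nat \<Rightarrow> bool) \<Rightarrow> _"
 assumes fo: "folding n i v \<xi> B s" and h: "h \<in> borel_measurable MB"
 shows "(\<integral>\<^sup>+p. h (\<xi> (fst p), B (snd p)) \<partial>MB) =
  ennreal (real (d n) * 2 ^ (n * CARD('k))) * (\<integral>\<^sup>+p. h p * indicator (J n i \<times> cyl n v) p \<partial>MB)"
proof -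
 note B [measurable] = folding_measurable_digits[OF fo]
 have h' [measurable]: "h \<in> borel_measurable (MI \<Otimes>\<^sub>M MK)"
  using h by (simp add: MB_def)
 from J_sets[OF foldingD(1)[OF fo]] have J [measurable]: "indicator (J n i) \<in> borel_measurable MI"
  by (rule borel_measurable_indicator)
 define G where "G w = (\<integral>\<^sup>+x. h (x, w) * indicator (J n i) x \<partial>MI)" for w
 have G [measurable]: "G \<in> borel_measurable MK"
  unfolding G_def by measurable
 have "(\<integral>\<^sup>+p. h (\<xi> (fst p), B (snd p)) \<partial>MB) = (\<integral>\<^sup>+w. \<integral>\<^sup>+x. h (\<xi> x, B w) \<partial>MI \<partial>MK)"
  using nn_integral_MB[OF measurable_compose[OF folding_measurable_base[OF fo] h]] by simp
 also have "\<dots> = (\<integral>\<^sup>+w. ennreal (real (d n)) * G (B w) \<partial>MK)"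
  unfolding G_def by (intro nn_integral_cong folding_nn_integral_interval[OF fo]) measurable
 also have "\<dots> = ennreal (real (d n)) * (\<integral>\<^sup>+w. G (B w) \<partial>MK)"
  by (intro nn_integral_cmult measurable_compose[OF B G])
 also have "(\<integral>\<^sup>+w. G (B w) \<partial>MK) = ennreal (2 ^ (n * CARD('k))) * (\<integral>\<^sup>+w. G w * indicator (cyl n v) w \<partial>MK)"
  by (rule folding_nn_integral_digits[OF fo G])
 also have "(\<integral>\<^sup>+w. G w * indicator (cyl n v) w \<partial>MK) = (\<integral>\<^sup>+w. \<integral>\<^sup>+x. h (x, w) * indicator (J n i \<times> cyl n v) (x, w) \<partial>MI \<partial>MK)"
  unfolding G_def by (intro nn_integral_cong) (auto simp: indicator_def)
 also have "\<dots> = (\<integral>\<^sup>+p. h p * indicator (J n i \<times> cyl n v) p \<partial>MB)"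
  by (rule nn_integral_MB[symmetric])
   (intro borel_measurable_times_ennreal h borel_measurable_indicator J_cyl_sets foldingD(1)[OF fo])
 finally show ?thesis by (simp add: ennreal_mult mult.assoc)
qed

lemma folding_l2:
 fixes B :: "('k::finite \<Rightarrow> nat \<Rightarrow> bool) \<Rightarrow> _"
 assumes fo: "folding n i v \<xi> B s" and h: "h \<in> l2 MB"
 shows "(\<lambda>p. h (\<xi> (fst p), B (snd p))) \<in> l2 MB"
  "l2_sq MB (\<lambda>p. h (\<xi> (fst p), B (snd p))) =
   real (d n) * 2 ^ (n * CARD('k)) * (\<integral>p. indicator (J n i \<times> cyl n v) p * (h p)\<^sup>2 \<partial>MB)"
proof -
 let ?k = "\<lambda>p. h (\<xi> (fst p), B (snd p))" and ?A = "J n i \<times> cyl n v" and ?c = "real (d n) * 2 ^ (n * CARD('k))"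
 let ?I = "\<integral>p. indicator ?A p * (h p)\<^sup>2 \<partial>MB"
 have k: "?k \<in> borel_measurable MB"
  by (rule measurable_compose[OF folding_measurable_base[OF fo] l2D(1)[OF h]])
 have A: "?A \<in> sets MB" by (rule J_cyl_sets[OF foldingD(1)[OF fo]])
 have int: "integrable MB (\<lambda>p. indicator ?A p * (h p)\<^sup>2)"
  using integrable_mult_indicator[OF A l2D(2)[OF h]] by simp
 have h2: "(\<lambda>p. ennreal ((h p)\<^sup>2)) \<in> borel_measurable MB"
  using l2D(1)[OF h] by measurable
 have "(\<integral>\<^sup>+p. ennreal ((?k p)\<^sup>2) \<partial>MB) = ennreal ?c * (\<integral>\<^sup>+p. ennreal ((h p)\<^sup>2) * indicator ?A p \<partial>MB)"
  by (rule folding_nn_integral[OF fo h2])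
 also have "(\<integral>\<^sup>+p. ennreal ((h p)\<^sup>2) * indicator ?A p \<partial>MB) = (\<integral>\<^sup>+p. ennreal (indicator ?A p * (h p)\<^sup>2) \<partial>MB)"
  by (intro nn_integral_cong) (auto simp: indicator_def)
 also have "\<dots> = ennreal ?I" by (rule nn_integral_eq_integral[OF int]) simp
 also have "ennreal ?c * ennreal ?I = ennreal (?c * ?I)"
  by (rule ennreal_mult[symmetric]) (auto intro!: Bochner_Integration.integral_nonneg)
 finally have "(\<integral>\<^sup>+p. ennreal ((?k p)\<^sup>2) \<partial>MB) = ennreal (?c * ?I)" .
 moreover have "0 \<le> ?c * ?I" by (intro mult_nonneg_nonneg Bochner_Integration.integral_nonneg) auto
 ultimately have "integrable MB (\<lambda>p. (?k p)\<^sup>2) \<and> (\<integral>p. (?k p)\<^sup>2 \<partial>MB) = ?c * ?I"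
  using nn_integral_eq_integrable[of "\<lambda>p. (?k p)\<^sup>2" MB "?c * ?I"] borel_measurable_power[OF k, of 2] by simp
 then show "?k \<in> l2 MB" "l2_sq MB ?k = ?c * ?I"
  using k by (simp_all add: l2_def l2_sq_eq)
qed

lemma folding_measurable_laakso:
 fixes B :: "('k::finite \<Rightarrow> nat \<Rightarrow> bool) \<Rightarrow> _"
 assumes fo: "folding n i v \<xi> B s" and \<Theta>: "\<And>x w. x \<in> {0..1} \<Longrightarrow> \<Theta> (io (x, w)) = io (\<xi> x, B w)"
 shows "\<Theta> \<in> \<mu> \<rightarrow>\<^sub>M \<mu>"
proof (rule measurable_sigma_sets)
 let ?O = "{U :: 'k laakso_point set. openin (laakso_topology js) U}"
 show O: "?O \<subseteq> Pow (laakso_space js)"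
  using openin_subset topspace_laakso_topology by blast
 show "sets (\<mu>) = sigma_sets (laakso_space js) ?O"
  unfolding laakso_measure_def sets_distr using O by (rule sets_measure_of)
 have maps: "\<Theta> s \<in> laakso_space js" if "s \<in> laakso_space js" for s
 proof -
  obtain x w where s: "s = io (x, w)" "x \<in> {0..1}"
   using \<open>s \<in> laakso_space js\<close> unfolding laakso_space_def laakso_base_def by blast
  then show ?thesis
   using folding_unit[OF fo s(2)] by (simp add: \<Theta> laakso_proj_in_space)
 qed
 then show "\<Theta> \<in> space (\<mu>) \<rightarrow> laakso_space js" by (simp add: space_laakso_measure)
 fix U :: "'k laakso_point set" assume "U \<in> ?O"
 then have U: "openin (laakso_topology js) U" by blast
 let ?\<theta> = "\<lambda>p :: 'k prelaakso. (\<xi> (fst p), B (snd p))"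
 have "openin (top_of_set laakso_base) (laakso_base \<inter> ?\<theta> -` {q \<in> laakso_base. io q \<in> U})"
 proof (rule continuous_openin_preimage[OF folding_continuous_base[OF fo]])
  show "openin (top_of_set laakso_base) {q \<in> laakso_base. io q \<in> U}"
   by (rule openin_quotient_preimage[OF U])
  show "?\<theta> \<in> laakso_base \<rightarrow> laakso_base"
  proof
   fix p :: "'k prelaakso" assume "p \<in> laakso_base"
   then show "?\<theta> p \<in> laakso_base"
    using folding_unit[OF fo, of "fst p"] by (cases p) simp
  qed
 qed
 also have "laakso_base \<inter> ?\<theta> -` {q \<in> laakso_base. io q \<in> U} = {p \<in> laakso_base. io p \<in> \<Theta> -` U \<inter> laakso_space js}"
 proof (intro set_eqI)
  fix p :: "'k prelaakso"
  show "p \<in> laakso_base \<inter> ?\<theta> -` {q \<in> laakso_base. io q \<in> U} \<longleftrightarrow> p \<in> {p \<in> laakso_base. io p \<in> \<Theta> -` U \<inter> laakso_space js}"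
   using \<Theta>[of "fst p" "snd p"] folding_unit[OF fo, of "fst p"] laakso_proj_in_space[of p js]
   by (cases p) auto
 qed
 finally have "openin (laakso_topology js) (\<Theta> -` U \<inter> laakso_space js)"
  by (simp add: openin_laakso_topology)
 then show "\<Theta> -` U \<inter> space (\<mu>) \<in> sets (\<mu>)"
  by (simp add: space_laakso_measure openin_sets_laakso)
qed

text \<open>The slope of the folding as an explicit, hence measurable, function of \<open>x\<close>.
  It is compared with the slope only off the nodes, which form a null set.\<close>

definition sg :: "nat \<Rightarrow> (nat \<Rightarrow> bool) \<Rightarrow> real \<Rightarrow> real" where
 "sg n s x = (if s (nat \<lfloor>x * real (d n)\<rfloor>) then 1 else -1)"

lemma sg_sq [simp]: "(sg n s x * y)\<^sup>2 = y\<^sup>2" by (simp add: sg_def power_mult_distrib)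

lemma sg_J:
 assumes "x \<notin> nodes n" "j < d n" "x \<in> J n j"
 shows "sg n s x = (if s j then 1 else -1)"
proof -
 have "\<lfloor>x * real (d n)\<rfloor> = int j"
  using J_interior[OF assms] by (intro floor_unique) simp_all
 then show ?thesis by (simp add: sg_def)
qed

lemma measurable_sg: "(\<lambda>p. sg n s (fst p)) \<in> borel_measurable (MB :: 'k::finite prelaakso measure)"
proof -
 have "(\<lambda>x. \<lfloor>x * real (d n)\<rfloor>) \<in> borel \<rightarrow>\<^sub>M count_space UNIV"
  by measurable
 then have "sg n s \<in> borel_measurable borel"
  unfolding sg_def by (rule measurable_compose[of _ _ _ "\<lambda>k. if s (nat k) then 1 else -1 :: real"]) simp
 then have "sg n s \<in> borel_measurable lborel" by simp
 from measurable_restrict_space1[OF this] show ?thesis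
  unfolding MB_def by (intro measurable_compose[OF measurable_fst])
qed

lemma sg_l2:
 assumes "k \<in> l2 (MB :: 'k::finite prelaakso measure)"
 shows "(\<lambda>p. sg n s (fst p) * k p) \<in> l2 MB"
 using borel_measurable_times[OF measurable_sg[of n s] l2D(1)[OF assms]] l2D(2)[OF assms] by (simp add: l2_def)

text \<open>Along each branch the chain rule multiplies the derivative by \<open>1\<close> or
  \<open>-1\<close>, so the energy stays finite. Compatibility with the identifications is built in,
  since \<open>\<Theta>\<close> is already a map of the quotient.\<close>

lemma folding_core:
 fixes u :: "'k::finite laakso_point \<Rightarrow> real" and B :: "('k \<Rightarrow> nat \<Rightarrow> bool) \<Rightarrow> _"
 assumes fo: "folding n i v \<xi> B s" and \<Theta>: "\<And>x w. x \<in> {0..1} \<Longrightarrow> \<Theta> (io (x, w)) = io (\<xi> x, B w)"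
  and u: "u \<in> mgug_core js"
 shows "W (\<lambda>t. u (\<Theta> t)) (\<lambda>p. sg n s (fst p) * dx js u (\<xi> (fst p), B (snd p)))"
proof -
 obtain N where N: "u \<in> mgug_D js N"
  using u unfolding mem_mgug_core by blast
 obtain Z where Z: "finite Z" and Zd: "\<And>x w. x \<in> {0..1} - Z \<Longrightarrow> ((\<lambda>y. u (io (y, w))) has_real_derivative dx js u (x, w)) (at x)"
  by (rule mgug_D_differentiable[OF N]) (rule that; assumption)
 \<comment> \<open>The fold points, the preimages of \<open>Z\<close> under both kinds of affine
   branch, and the ends.\<close>
 define Z' where "Z' = nodes n \<union> (\<Union>z\<in>Z. \<Union>j\<in>{..<d n}. {z - (real i - real j) / real (d n), (real i + real j + 1) / real (d n) - z}) \<union> {0, 1}"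
 have Z': "finite Z'"
  unfolding Z'_def using Z by (intro finite_UnI finite_nodes finite_UN_I) simp_all
 have deriv: "((\<lambda>y. u (\<Theta> (io (y, w)))) has_real_derivative sg n s x * dx js u (\<xi> x, B w)) (at x)"
  if x: "0 < x" "x < 1" "x \<notin> Z'" for x w
 proof -
  have x01: "x \<in> {0..1}"
   using x by simp
  obtain j where j: "j < d n" "x \<in> J n j"
   using J_cover[OF x01] by blast
  have xn: "x \<notin> nodes n"
   using x(3) by (simp add: Z'_def)
  define b where "b = (if s j then 1 else -1 :: real)"
  define a where "a = (if s j then (real i - real j) / real (d n) else (real i + real j + 1) / real (d n))"
  have \<xi>: "\<xi> y = b * y + a" if "y \<in> J n j" for y
   using foldingD(2)[OF fo j(1) that] by (simp add: a_def b_def split: if_split)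
  have "\<xi> x \<notin> Z"
  proof
   assume "\<xi> x \<in> Z"
   moreover have "x = \<xi> x - (real i - real j) / real (d n) \<or> x = (real i + real j + 1) / real (d n) - \<xi> x"
    using foldingD(2)[OF fo j] by (simp split: if_split)
   ultimately show False
    using x(3) j(1) unfolding Z'_def by blast
  qed
  then have "((\<lambda>y. u (io (y, B w))) has_real_derivative dx js u (\<xi> x, B w)) (at (\<xi> x))"
   using folding_unit[OF fo x01] by (intro Zd) blast
  then have "((\<lambda>y. u (io (y, B w))) has_real_derivative dx js u (\<xi> x, B w)) (at (b * x + a))"
   unfolding \<xi>[OF j(2)] .
  moreover have "((\<lambda>y. b * y + a) has_real_derivative b) (at x)" by (auto intro!: derivative_eq_intros)
  ultimately have "((\<lambda>y. u (io (b * y + a, B w))) has_real_derivative dx js u (\<xi> x, B w) * b) (at x)"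
   by (rule DERIV_chain2)
  moreover have "b = sg n s x"
   unfolding sg_J[OF xn j] b_def ..
  ultimately have D: "((\<lambda>y. u (io (b * y + a, B w))) has_real_derivative sg n s x * dx js u (\<xi> x, B w)) (at x)"
   by (simp add: mult.commute)
  show ?thesis
  proof (rule has_field_derivative_transform_within_open[OF D, of "{real j / real (d n)<..<(real j + 1) / real (d n)}"])
   show "x \<in> {real j / real (d n)<..<(real j + 1) / real (d n)}"
    using J_interior[OF xn j] real_d_pos[of n] by (simp add: pos_divide_less_eq pos_less_divide_eq)
   fix y assume "y \<in> {real j / real (d n)<..<(real j + 1) / real (d n)}"
   then have y: "y \<in> J n j" by (simp add: J_def)
   then have "y \<in> {0..1}"
    using J_subset[OF j(1)] by blast
   then show "u (io (b * y + a, B w)) = u (\<Theta> (io (y, w)))"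
    using \<Theta>[of y w] \<xi>[OF y] by simp
  qed simp
 qed
 have cont: "continuous_on laakso_base (\<lambda>p. u (\<Theta> (io p)))"
 proof -
  have c: "continuous_on laakso_base (\<lambda>p. u (io p))"
   using mgug_D_continuous[OF N] by (simp add: continuous_laakso_iff)
  have sub: "(\<lambda>p :: 'k prelaakso. (\<xi> (fst p), B (snd p))) ` laakso_base \<subseteq> laakso_base"
   using folding_unit[OF fo] by (auto simp: laakso_base_def)
  have "continuous_on laakso_base (\<lambda>p. u (io (\<xi> (fst p), B (snd p))))"
   by (rule continuous_on_compose2[OF c folding_continuous_base[OF fo] sub])
  then show ?thesis
   by (subst continuous_on_cong[OF refl, where g = "\<lambda>p. u (io (\<xi> (fst p), B (snd p)))"]) (auto simp: laakso_base_def \<Theta>)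
 qed
 \<comment> \<open>\<open>folding_agree\<close> speaks of prefixes of length at least
   \<open>n\<close>, whence the maximum.\<close>
 have "(\<lambda>t. u (\<Theta> t)) \<in> mgug_D js (max N n)"
  unfolding mgug_D_def
 proof (intro CollectI conjI allI ballI impI)
  show "continuous_map (laakso_topology js) euclideanreal (\<lambda>t. u (\<Theta> t))"
   using cont by (simp add: continuous_laakso_iff)
  show "(\<lambda>x. u (\<Theta> (io (x, w)))) piecewise_differentiable_on {0..1}" for w
   unfolding piecewise_differentiable_on_def
  proof (intro conjI exI[of _ Z'] ballI Z')
   show "continuous_on {0..1} (\<lambda>x. u (\<Theta> (io (x, w))))"
    by (rule continuous_on_compose2[OF cont, of _ "\<lambda>x. (x, w)"]) (auto intro!: continuous_intros)
   fix x assume x: "x \<in> {0..1} - Z'"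
   then have "0 < x" "x < 1" "x \<notin> Z'" by (auto simp: Z'_def less_le)
   from deriv[OF this, of w] show "(\<lambda>x. u (\<Theta> (io (x, w)))) differentiable (at x within {0..1})"
    using real_differentiable_def differentiable_at_withinI by blast
  qed
  fix x :: real and w w' :: "'k \<Rightarrow> nat \<Rightarrow> bool"
  assume x: "x \<in> {0..1}" and "\<forall>l. \<forall>m<max N n. w l m = w' l m"
  then have "agree (max N n) (B w) (B w')" by (intro folding_agree[OF fo]) (simp_all add: agree_def)
  then have "agree N (B w) (B w')" by (rule agree_mono) simp
  from mgug_D_agree[OF N folding_unit[OF fo x] this] show "u (\<Theta> (io (x, w))) = u (\<Theta> (io (x, w')))"
   unfolding \<Theta>[OF x] .
 qed
 moreover have AE: "AE p in MB. dx js (\<lambda>t. u (\<Theta> t)) p = sg n s (fst p) * dx js u (\<xi> (fst p), B (snd p))"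
  by (rule AE_dxI[OF Z']) (simp add: deriv)
 moreover have l2: "(\<lambda>p. sg n s (fst p) * dx js u (\<xi> (fst p), B (snd p))) \<in> l2 MB"
  by (rule sg_l2[OF folding_l2(1)[OF fo core_dx_l2[OF u]]])
 ultimately have "(\<lambda>t. u (\<Theta> t)) \<in> mgug_core js" by (intro coreI)
 then show ?thesis by (rule W_core_AE[OF _ AE l2D(1)[OF l2]])
qed

text \<open>Composition with a folding is bounded in \<open>L2\<close>, for functions and for
  derivatives, with the factor \<open>?c\<close> on squared norms; so it passes from the core to the
  closure. The signs disappear in the squares.\<close>

lemma folding_W:
 fixes f :: "'k::finite laakso_point \<Rightarrow> real" and B :: "('k \<Rightarrow> nat \<Rightarrow> bool) \<Rightarrow> _"
 assumes fo: "folding n i v \<xi> B s" and \<Theta>: "\<And>x w. x \<in> {0..1} \<Longrightarrow> \<Theta> (io (x, w)) = io (\<xi> x, B w)"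
  and W: "W f g"
 shows "\<exists>h. W (\<lambda>t. f (\<Theta> t)) h \<and>
  l2_sq MB h = real (d n) * 2 ^ (n * CARD('k)) * (\<integral>p. indicator (J n i \<times> cyl n v) p * (g p)\<^sup>2 \<partial>MB)"
proof -
 let ?c = "real (d n) * 2 ^ (n * CARD('k))" and ?A = "J n i \<times> cyl n v"
 let ?\<theta> = "\<lambda>p :: 'k prelaakso. (\<xi> (fst p), B (snd p))"
 have le: "l2_sq MB (\<lambda>p. h (?\<theta> p)) \<le> ?c * l2_sq MB h" if h: "h \<in> l2 MB" for h
 proof -
  have "(\<integral>p. indicator ?A p * (h p)\<^sup>2 \<partial>MB) \<le> (\<integral>p. (h p)\<^sup>2 \<partial>MB)"
   using integrable_mult_indicator[OF J_cyl_sets[OF foldingD(1)[OF fo]] l2D(2)[OF h]] l2D(2)[OF h]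
   by (intro integral_mono) (auto simp: indicator_def)
  then have "?c * (\<integral>p. indicator ?A p * (h p)\<^sup>2 \<partial>MB) \<le> ?c * (\<integral>p. (h p)\<^sup>2 \<partial>MB)"
   by (rule mult_left_mono) simp
  then show ?thesis
   unfolding folding_l2(2)[OF fo h, symmetric] l2_sq_eq .
 qed
 obtain u where u: "\<And>m. u m \<in> mgug_core js" "(\<lambda>m. l2_sq (\<mu>) (\<lambda>s. u m s - f s)) \<longlonglongrightarrow> 0"
  "(\<lambda>m. l2_sq MB (\<lambda>p. dx js (u m) p - g p)) \<longlonglongrightarrow> 0"
  by (rule W_seq[OF W]) (rule that; assumption)
 have \<Theta>': "AE p in MB. k (\<Theta> (io p)) = k (io (?\<theta> p))" for k :: "'k laakso_point \<Rightarrow> real"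
  by (rule AE_I2) (auto simp: laakso_base_def \<Theta>)
 have meas: "(\<lambda>t. k (\<Theta> t)) \<in> borel_measurable (\<mu>)" if "k \<in> borel_measurable (\<mu>)" for k :: "'k laakso_point \<Rightarrow> real"
  by (rule measurable_compose[OF folding_measurable_laakso[OF fo \<Theta>] that])
 have l2_\<Theta>: "(\<lambda>t. k (\<Theta> t)) \<in> l2 (\<mu>)" "l2_sq (\<mu>) (\<lambda>t. k (\<Theta> t)) \<le> ?c * l2_sq (\<mu>) k"
  if k: "k \<in> l2 (\<mu>)" for k :: "'k laakso_point \<Rightarrow> real"
 proof -
  have kb: "(\<lambda>p :: 'k prelaakso. k (io p)) \<in> l2 MB" by (rule l2_laakso_imp[OF k])
  note k\<theta> = folding_l2(1)[OF fo kb]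
  have m: "(\<lambda>p :: 'k prelaakso. k (\<Theta> (io p))) \<in> borel_measurable MB"
   by (rule measurable_compose[OF measurable_proj meas[OF l2D(1)[OF k]]])
  have "integrable MB (\<lambda>p. (k (\<Theta> (io p)))\<^sup>2) \<longleftrightarrow> integrable MB (\<lambda>p. (k (io (?\<theta> p)))\<^sup>2)"
   using m l2D(1)[OF k\<theta>] \<Theta>'[of k] by (intro integrable_cong_AE) auto
  then have "(\<lambda>p :: 'k prelaakso. k (\<Theta> (io p))) \<in> l2 MB"
   using l2D(2)[OF k\<theta>] m by (simp add: l2_def)
  then show "(\<lambda>t. k (\<Theta> t)) \<in> l2 (\<mu>)"
   by (simp add: l2_laakso_iff[OF meas[OF l2D(1)[OF k]]])
  have "l2_sq (\<mu>) (\<lambda>t. k (\<Theta> t)) = l2_sq MB (\<lambda>p. k (\<Theta> (io p)))"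
   by (rule l2_sq_laakso[OF meas[OF l2D(1)[OF k]]])
  also have "\<dots> = l2_sq MB (\<lambda>p. k (io (?\<theta> p)))"
   by (rule l2_sq_cong_AE[OF m l2D(1)[OF k\<theta>] \<Theta>'])
  also have "\<dots> \<le> ?c * l2_sq MB (\<lambda>p. k (io p))" by (rule le[OF kb])
  also have "l2_sq MB (\<lambda>p. k (io p)) = l2_sq (\<mu>) k"
   by (rule l2_sq_laakso[OF l2D(1)[OF k], symmetric])
  finally show "l2_sq (\<mu>) (\<lambda>t. k (\<Theta> t)) \<le> ?c * l2_sq (\<mu>) k" .
 qed
 define h where "h p = sg n s (fst p) * g (?\<theta> p)" for p
 have h: "h \<in> l2 MB"
  unfolding h_def by (rule sg_l2[OF folding_l2(1)[OF fo W_l2(2)[OF W]]])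
 have lim0: "(\<lambda>m. a m) \<longlonglongrightarrow> 0" if "\<And>m. 0 \<le> a m" "\<And>m. a m \<le> ?c * b m" "b \<longlonglongrightarrow> 0" for a b :: "nat \<Rightarrow> real"
 proof (rule tendsto_sandwich[OF _ _ tendsto_const])
  show "\<forall>\<^sub>F m in sequentially. 0 \<le> a m" "\<forall>\<^sub>F m in sequentially. a m \<le> ?c * b m"
   by (intro always_eventually allI that(1,2))+
  show "(\<lambda>m. ?c * b m) \<longlonglongrightarrow> 0"
   using tendsto_mult_left[OF that(3), of ?c] by simp
 qed
 have "W (\<lambda>t. f (\<Theta> t)) h"
 proof (rule W_lim[OF folding_core[OF fo \<Theta> u(1)] l2_\<Theta>(1)[OF W_l2(1)[OF W]] h])
  show "(\<lambda>m. l2_sq (\<mu>) (\<lambda>t. u m (\<Theta> t) - f (\<Theta> t))) \<longlonglongrightarrow> 0"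
   using l2_\<Theta>(2)[OF l2_diff[OF core_l2[OF u(1)] W_l2(1)[OF W]]] by (intro lim0[OF l2_sq_nonneg _ u(2)])
  have "l2_sq MB (\<lambda>p. sg n s (fst p) * dx js (u m) (?\<theta> p) - h p) = l2_sq MB (\<lambda>p. dx js (u m) (?\<theta> p) - g (?\<theta> p))" for m
   unfolding h_def right_diff_distrib[symmetric] l2_sq_eq sg_sq ..
  then have "l2_sq MB (\<lambda>p. sg n s (fst p) * dx js (u m) (?\<theta> p) - h p) \<le> ?c * l2_sq MB (\<lambda>p. dx js (u m) p - g p)" for m
   using le[OF l2_diff[OF core_dx_l2[OF u(1)] W_l2(2)[OF W]]] by simp
  then show "(\<lambda>m. l2_sq MB (\<lambda>p. sg n s (fst p) * dx js (u m) (?\<theta> p) - h p)) \<longlonglongrightarrow> 0"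
   by (intro lim0[OF l2_sq_nonneg _ u(3)])
 qed
 moreover have "l2_sq MB h = l2_sq MB (\<lambda>p. g (?\<theta> p))"
  unfolding h_def l2_sq_eq sg_sq ..
 ultimately show ?thesis
  using folding_l2(2)[OF fo W_l2(2)[OF W]] by (intro exI[of _ h]) simp
qed

end

section \<open>Isometries of cells\<close>

definition cantor :: "(nat \<Rightarrow> bool) \<Rightarrow> real" where
 "cantor u = (\<Sum>i. 2 * of_bool (u i) / 3 ^ (i + 1))"

lemma cantor_tail:
 "summable (\<lambda>i. 2 * of_bool (u (i + m)) / 3 ^ (i + m + 1) :: real)"
 "0 \<le> (\<Sum>i. 2 * of_bool (u (i + m)) / 3 ^ (i + m + 1) :: real)"
 "(\<Sum>i. 2 * of_bool (u (i + m)) / 3 ^ (i + m + 1) :: real) \<le> 1 / 3 ^ m"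
proof -
 let ?f = "\<lambda>i. 2 * of_bool (u (i + m)) / 3 ^ (i + m + 1) :: real"
 let ?g = "\<lambda>i. 2 / 3 ^ (i + m + 1) :: real"
 have "(\<lambda>i. (1 / 3) ^ i :: real) sums (1 / (1 - 1 / 3))" by (rule geometric_sums) simp
 from sums_mult[OF this, of "2 / 3 ^ (m + 1)"]
 have "(\<lambda>i. 2 / 3 ^ (m + 1) * (1 / 3) ^ i :: real) sums (2 / 3 ^ (m + 1) * (1 / (1 - 1 / 3)))" .
 moreover have "2 / 3 ^ (m + 1) * (1 / 3) ^ i = ?g i" for i by (simp add: power_add power_one_over)
 moreover have "2 / 3 ^ (m + 1) * (1 / (1 - 1 / 3)) = (1 / 3 ^ m :: real)" by simp
 ultimately have g: "?g sums (1 / 3 ^ m)" by (simp only:)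
 have f: "0 \<le> ?f i" "?f i \<le> ?g i" for i by (simp_all add: divide_right_mono)
 show sf: "summable ?f" by (rule summable_comparison_test'[OF sums_summable[OF g], of 0]) (use f in simp)
 show "0 \<le> suminf ?f" by (rule suminf_nonneg[OF sf f(1)])
 show "suminf ?f \<le> 1 / 3 ^ m"
  using suminf_le[OF f(2) sf sums_summable[OF g]] sums_unique[OF g] by simp
qed

lemma cantor_split:
 "cantor u = (\<Sum>i. 2 * of_bool (u (i + m)) / 3 ^ (i + m + 1)) + (\<Sum>i<m. 2 * of_bool (u i) / 3 ^ (i + 1))"
 unfolding cantor_def using cantor_tail(1)[of u 0] by (intro suminf_split_initial_segment) simp

text \<open>At the first differing position \<open>i\<close> the digits contribute
  \<open>2 / 3^(i+1)\<close> and the remaining tails differ by at most \<open>1 / 3^(i+1)\<close>;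
  so the distance would be at least \<open>1 / 3^(i+1)\<close>, which is not below
  \<open>1 / 3^m\<close> for \<open>i < m\<close>.\<close>

lemma cantor_sep:
 assumes less: "\<bar>cantor u - cantor u'\<bar> < 1 / 3 ^ m" and "i < m"
 shows "u i = u' i"
 using \<open>i < m\<close>
proof (induction i rule: less_induct)
 case (less i)
 have eq: "(\<Sum>k<i. 2 * of_bool (u k) / 3 ^ (k + 1) :: real) = (\<Sum>k<i. 2 * of_bool (u' k) / 3 ^ (k + 1))"
 proof (rule sum.cong[OF refl])
  fix k assume "k \<in> {..<i}"
  then have "u k = u' k"
   using less by simp
  then show "2 * of_bool (u k) / 3 ^ (k + 1) = (2 * of_bool (u' k) / 3 ^ (k + 1) :: real)" by simp
 qed
 define a where "a = 1 / (3 :: real) ^ Suc i"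
 have c: "\<exists>t. cantor v = t + (\<Sum>k<i. 2 * of_bool (v k) / 3 ^ (k + 1)) + 2 * a * of_bool (v i) \<and> 0 \<le> t \<and> t \<le> a" for v
  using cantor_split[of v "Suc i"] cantor_tail(2,3)[of v "Suc i"] by (intro exI conjI) (simp_all add: a_def)
 obtain t where t: "cantor u = t + (\<Sum>k<i. 2 * of_bool (u k) / 3 ^ (k + 1)) + 2 * a * of_bool (u i)" "0 \<le> t" "t \<le> a"
  using c[of u] by blast
 obtain t' where t': "cantor u' = t' + (\<Sum>k<i. 2 * of_bool (u' k) / 3 ^ (k + 1)) + 2 * a * of_bool (u' i)" "0 \<le> t'" "t' \<le> a"
  using c[of u'] by blast
 have "(3 :: real) ^ Suc i \<le> 3 ^ m"
  using less.prems by (intro power_increasing) simp_all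
 then have "1 / 3 ^ m \<le> a"
  unfolding a_def by (intro divide_left_mono) simp_all
 then have diff: "\<bar>t - t' + 2 * a * (of_bool (u i) - of_bool (u' i))\<bar> < a"
  using assms(1) t(1) t'(1) eq by (simp add: algebra_simps)
 show ?case
 proof (rule ccontr)
  assume "u i \<noteq> u' i"
  then have "of_bool (u i) - of_bool (u' i) = (1 :: real) \<or> of_bool (u i) - of_bool (u' i) = (-1 :: real)"
   by (cases "u i"; cases "u' i") simp_all
  then show False
   using diff t(2,3) t'(2,3) by auto
 qed
qed

lemma cantor_close:
 assumes "\<And>i. i < m \<Longrightarrow> u i = u' i"
 shows "\<bar>cantor u - cantor u'\<bar> \<le> 1 / 3 ^ m"
proof -
 have "(\<Sum>i<m. 2 * of_bool (u i) / 3 ^ (i + 1) :: real) = (\<Sum>i<m. 2 * of_bool (u' i) / 3 ^ (i + 1))"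
  by (rule sum.cong[OF refl]) (simp add: assms)
 then show ?thesis
  using cantor_split[of u m] cantor_split[of u' m] cantor_tail(2,3)[of u m] cantor_tail(2,3)[of u' m] by linarith
qed

lemma cantor_flip:
 assumes "\<And>i. i \<noteq> m \<Longrightarrow> u i = u' i"
 shows "\<bar>cantor u - cantor u'\<bar> \<le> 2 / 3 ^ (m + 1)"
proof -
 have "(\<Sum>i<m. 2 * of_bool (u i) / 3 ^ (i + 1) :: real) = (\<Sum>i<m. 2 * of_bool (u' i) / 3 ^ (i + 1))"
  by (rule sum.cong[OF refl]) (simp add: assms)
 moreover have "(\<lambda>i. u (i + Suc m)) = (\<lambda>i. u' (i + Suc m))" by (rule ext) (simp add: assms)
 then have "(\<Sum>i. 2 * of_bool (u (i + Suc m)) / 3 ^ (i + Suc m + 1) :: real) = (\<Sum>i. 2 * of_bool (u' (i + Suc m)) / 3 ^ (i + Suc m + 1))"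
  by (simp only: fun_eq_iff)
 ultimately have "cantor u - cantor u' = 2 * of_bool (u m) / 3 ^ (m + 1) - 2 * of_bool (u' m) / 3 ^ (m + 1)"
  using cantor_split[of u "Suc m"] cantor_split[of u' "Suc m"] by simp
 then show ?thesis by (cases "u m"; cases "u' m") simp_all
qed

definition cvec :: "('k::finite \<Rightarrow> nat \<Rightarrow> bool) \<Rightarrow> real ^ 'k" where
 "cvec w = (\<chi> l. cantor (w l))"

lemma laakso_emb_eq: "laakso_emb (x, w) = (x, cvec w)" by (simp add: laakso_emb_def cvec_def cantor_def)

lemma cvec_sep:
 assumes "dist (cvec w) (cvec w') < 1 / 3 ^ m"
 shows "agree m w w'"
 unfolding agree_def
proof (intro allI impI)
 fix l i assume i: "i < m"
 have "\<bar>cantor (w l) - cantor (w' l)\<bar> = \<bar>(cvec w - cvec w') $ l\<bar>" by (simp add: cvec_def)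
 also have "\<dots> \<le> dist (cvec w) (cvec w')"
  unfolding dist_norm by (rule component_le_norm_cart)
 finally show "w l i = w' l i"
  using assms i by (intro cantor_sep[of _ _ m]) linarith
qed

lemma cvec_close:
 fixes w w' :: "'k::finite \<Rightarrow> nat \<Rightarrow> bool"
 assumes "agree m w w'"
 shows "dist (cvec w) (cvec w') \<le> real CARD('k) * (1 / 3 ^ m)"
proof -
 have "dist (cvec w) (cvec w') \<le> (\<Sum>l\<in>UNIV. \<bar>(cvec w - cvec w') $ l\<bar>)"
  unfolding dist_norm by (rule norm_le_l1_cart)
 also have "\<dots> \<le> real CARD('k) * (1 / 3 ^ m)"
  using assms by (intro sum_bounded_above) (simp add: cvec_def cantor_close agree_def)
 finally show ?thesis .
qed

lemma cvec_flip:
 fixes w w' :: "'k::finite \<Rightarrow> nat \<Rightarrow> bool"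
 assumes "\<And>l' i'. l' \<noteq> l \<or> i' \<noteq> i \<Longrightarrow> w l' i' = w' l' i'"
 shows "dist (cvec w) (cvec w') \<le> 2 / 3 ^ (i + 1)"
proof -
 have "dist (cvec w) (cvec w') \<le> (\<Sum>l'\<in>UNIV. \<bar>(cvec w - cvec w') $ l'\<bar>)"
  unfolding dist_norm by (rule norm_le_l1_cart)
 also have "\<dots> = (\<Sum>l'\<in>UNIV. if l' = l then \<bar>cantor (w l) - cantor (w' l)\<bar> else 0)"
 proof (rule sum.cong[OF refl])
  fix l' :: 'k
  show "\<bar>(cvec w - cvec w') $ l'\<bar> = (if l' = l then \<bar>cantor (w l) - cantor (w' l)\<bar> else 0)"
  proof (cases "l' = l")
   case False
   then have "w l' = w' l'" by (intro ext assms) simp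
   then show ?thesis
    using False by (simp add: cvec_def)
  qed (simp add: cvec_def)
 qed
 also have "\<dots> = \<bar>cantor (w l) - cantor (w' l)\<bar>" by simp
 also have "\<dots> \<le> 2 / 3 ^ (i + 1)" by (rule cantor_flip) (simp add: assms)
 finally show ?thesis .
qed

lemma cvec_inject: "cvec w = cvec w' \<Longrightarrow> w = w'"
proof (intro ext)
 fix l i assume "cvec w = cvec w'"
 then have "agree (Suc i) w w'" by (intro cvec_sep) simp
 then show "w l i = w' l i" by (simp add: agree_def)
qed

text \<open>Changing a single digit of number larger than \<open>m\<close> moves a point by less than \<open>3\<^sup>-\<^sup>m\<close>, and points at
 such a distance have the same first \<open>m\<close> digits; hence an isometry respects cylinders.\<close>

lemma isometry_agree:
 fixes A :: "('k::finite \<Rightarrow> nat \<Rightarrow> bool) \<Rightarrow> ('k \<Rightarrow> nat \<Rightarrow> bool)"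
 assumes iso: "\<And>w w'. w \<in> cyl n v \<Longrightarrow> w' \<in> cyl n v \<Longrightarrow> dist (cvec (A w)) (cvec (A w')) = dist (cvec w) (cvec w')"
  and w: "w \<in> cyl n v" "w' \<in> cyl n v" and m: "agree m w w'"
 shows "agree m (A w) (A w')"
proof -
 \<comment> \<open>Interpolates between \<open>w\<close> and \<open>w'\<close> by exchanging
   finitely many digits, one at a time.\<close>
 define mix where "mix P = (\<lambda>l i. if (l, i) \<in> P then w' l i else w l i)" for P :: "('k \<times> nat) set"
 have mix_cyl: "mix P \<in> cyl n v" for P
  using w by (simp add: mix_def mem_cyl agree_def)
 have step: "agree m (A w) (A (mix P))" if "finite P" for P
  using that
 proof induction
  case empty
  have "mix {} = w" by (simp add: mix_def)
  then show ?case by simp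
 next
  case (insert p P)
  obtain l i where p: "p = (l, i)" by (cases p)
  show ?case
  proof (cases "i < m")
   case True
   have "mix (insert p P) = mix P"
   proof (intro ext)
    fix l' i'
    show "mix (insert p P) l' i' = mix P l' i'"
    proof (cases "(l', i') = (l, i)")
     case eq: True
     then have "w l' i' = w' l' i'"
      using m True by (simp add: agree_def)
     then show ?thesis by (simp add: mix_def)
    next
     case False
     then have "(l', i') \<in> insert p P \<longleftrightarrow> (l', i') \<in> P"
      by (metis False p mem_simps(1))
     then show ?thesis by (simp only: mix_def)
    qed
   qed
   then show ?thesis
    using insert.IH by simp
  next
   case False
   have "dist (cvec (mix P)) (cvec (mix (insert p P))) \<le> 2 / 3 ^ (i + 1)"
    by (rule cvec_flip[of l]) (auto simp: mix_def p)
   also have "(2 :: real) / 3 ^ (i + 1) < 1 / 3 ^ i" by (simp add: field_simps)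
   also have "(1 :: real) / 3 ^ i \<le> 1 / 3 ^ m"
    using False by (intro divide_left_mono power_increasing) simp_all
   finally have "agree m (A (mix P)) (A (mix (insert p P)))" by (intro cvec_sep) (simp add: iso mix_cyl)
   with insert.IH show ?thesis by (rule agree_trans)
  qed
 qed
 \<comment> \<open>Writing \<open>k\<close> for \<open>CARD('k)\<close>: after exchanging
   \<open>m + k\<close> digits in each coordinate, the remaining distance is at most
   \<open>k / 3^(m + k)\<close>, which is below \<open>1 / 3^m\<close> because
   \<open>k < 3^k\<close>.\<close>
 let ?M = "m + CARD('k)" and ?P = "UNIV \<times> {..<m + CARD('k)}"
 have "agree ?M (mix ?P) w'" by (simp add: mix_def agree_def)
 then have "dist (cvec (mix ?P)) (cvec w') \<le> real CARD('k) * (1 / 3 ^ ?M)" by (rule cvec_close)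
 also have "\<dots> < 1 / 3 ^ m"
 proof -
  have "real CARD('k) < 2 ^ CARD('k)" by (rule of_nat_less_two_power)
  also have "(2 :: real) ^ CARD('k) \<le> 3 ^ CARD('k)" by (intro power_mono) simp_all
  finally show ?thesis by (simp add: power_add field_simps)
 qed
 finally have "agree m (A (mix ?P)) (A w')" by (intro cvec_sep) (simp add: iso mix_cyl w)
 moreover have "agree m (A w) (A (mix ?P))" by (rule step) simp
 ultimately show ?thesis by (rule agree_trans[rotated])
qed

lemma fold0_shift: "fold0 (z + 2 * of_int k) = fold0 z"
proof -
 have "(z + 2 * of_int k + 1) / 2 = (z + 1) / 2 + of_int k" by (simp add: field_simps)
 then have "\<lfloor>(z + 2 * of_int k + 1) / 2\<rfloor> = \<lfloor>(z + 1) / 2\<rfloor> + k" by linarith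
 then show ?thesis by (simp add: fold0_def)
qed

section \<open>Folding maps in coordinates; the structure of isometries between cells\<close>

context laakso
begin

text \<open>Beyond the length of the list the value of \<open>!\<close> is unspecified;
  \<open>word a\<close> serves only to represent its depth-\<open>n\<close> cylinder.\<close>

definition word :: "('k \<Rightarrow> bool list) \<Rightarrow> 'k \<Rightarrow> nat \<Rightarrow> bool" where
 "word a = (\<lambda>l m. a l ! m)"

definition pre :: "nat \<Rightarrow> ('k \<Rightarrow> bool list) \<Rightarrow> ('k \<Rightarrow> nat \<Rightarrow> bool) \<Rightarrow> ('k \<Rightarrow> nat \<Rightarrow> bool)" where
 "pre n a w = (\<lambda>l m. if m < n then a l ! m else w l m)"

definition fld :: "nat \<Rightarrow> nat \<Rightarrow> real \<Rightarrow> real" where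
 "fld n i x = real i / real (d n) + fold0 (real (d n) * (x - real i / real (d n))) / real (d n)"

lemma pre_cyl: "pre n a w \<in> cyl n (word a)" by (simp add: pre_def word_def mem_cyl agree_def)

lemma cell_box_eq:
 assumes "(i, a) \<in> cell_indices js n"
 shows "cell_box js n (i, a) = J n i \<times> cyl n (word a)"
proof -
 have len: "length (a l) = n" for l
  using assms by (simp add: cell_indices_def)
 have "map (w l) [0..<n] = a l \<longleftrightarrow> (\<forall>m<n. word a l m = w l m)" for w l
  unfolding list_eq_iff_nth_eq using len[of l] by (auto simp: word_def)
 then have "{w. \<forall>l. map (w l) [0..<n] = a l} = cyl n (word a)"
  unfolding cyl_def agree_def by simp
 then show ?thesis by (simp add: cell_box_def J_def add.commute)
qed

text \<open>By periodicity \<open>2\<close> the fold is a translation on intervals at even distance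
  from number \<open>i\<close> and a reflection on those at odd distance.\<close>

lemma fld_J:
 assumes "x \<in> J n j"
 shows "fld n i x = (if even (i + j) then x + (real i - real j) / real (d n) else (real i + real j + 1) / real (d n) - x)"
proof -
 let ?D = "real (d n)"
 have x: "real j \<le> x * ?D" "x * ?D \<le> real j + 1"
  using assms unfolding mem_J by simp_all
 have y: "?D * (x - real i / ?D) = x * ?D - real i" by (simp add: right_diff_distrib mult.commute)
 show ?thesis
 proof (cases "even (i + j)")
  case True
  then have "even (int j - int i)" by simp
  then obtain k where "int j - int i = 2 * k" by (elim evenE)
  then have k: "real j - real i = 2 * of_int k"
   by (metis of_int_diff of_int_mult of_int_numeral of_int_of_nat_eq)
  have "fold0 (x * ?D - real i) = fold0 ((x * ?D - real j) + 2 * of_int k)"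
   unfolding k[symmetric] by simp
  also have "\<dots> = x * ?D - real j"
   unfolding fold0_shift using x by (subst fold0_eq_abs) simp_all
  finally have "fld n i x = real i / ?D + (x * ?D - real j) / ?D"
   unfolding fld_def y by simp
  then show ?thesis
   using True by (simp add: diff_divide_distrib)
 next
  case False
  then have "even (int j + 1 - int i)" by simp
  then obtain k where "int j + 1 - int i = 2 * k" by (elim evenE)
  then have k: "real j + 1 - real i = 2 * of_int k"
   by (metis of_int_1 of_int_add of_int_diff of_int_mult of_int_numeral of_int_of_nat_eq)
  have "fold0 (x * ?D - real i) = fold0 ((x * ?D - real j - 1) + 2 * of_int k)"
   unfolding k[symmetric] by simp
  also have "\<dots> = real j + 1 - x * ?D"
   unfolding fold0_shift using x by (subst fold0_eq_abs) simp_all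
  finally have "fld n i x = real i / ?D + (real j + 1 - x * ?D) / ?D"
   unfolding fld_def y by simp
  then show ?thesis
   using False by (simp add: diff_divide_distrib add_divide_distrib)
 qed
qed

lemma fld_mem:
 assumes "x \<in> {0..1}" shows "fld n i x \<in> J n i"
proof -
 obtain j where j: "x \<in> J n j"
  using J_cover[OF assms] by blast
 have "fld n i x * real (d n) = (if even (i + j) then x * real (d n) + real i - real j else real i + real j + 1 - x * real (d n))"
  unfolding fld_J[OF j] by (simp add: d_mult)
 then show ?thesis
  using j unfolding mem_J by (simp split: if_splits)
qed

text \<open>Each branch is a translation or a reflection by a multiple of \<open>1 / d n\<close>,
  and \<open>d n\<close> divides \<open>d q\<close>; so integrality at level
  \<open>q \<ge> n\<close> is preserved in both directions.\<close>

lemma fld_Ints: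
 assumes x: "x \<in> {0..1}" and q: "n \<le> q"
 shows "fld n i x * real (d q) \<in> \<int> \<longleftrightarrow> x * real (d q) \<in> \<int>"
proof -
 obtain j where j: "x \<in> J n j"
  using J_cover[OF x] by blast
 obtain c where c: "d q = d n * c"
  using d_dvd[OF q] by (elim dvdE)
 have c': "a / real (d n) * real (d q) = a * real c" for a by (simp add: c)
 show ?thesis
 proof (cases "even (i + j)")
  case True
  have z: "(real i - real j) * real c \<in> \<int>" by (intro Ints_mult Ints_diff Ints_of_nat)
  have "fld n i x * real (d q) = x * real (d q) + (real i - real j) * real c"
   unfolding fld_J[OF j] using True by (simp only: if_True distrib_right c')
  then show ?thesis
   using Ints_add[OF _ z, of "x * real (d q)"] Ints_diff[OF _ z, of "fld n i x * real (d q)"] by auto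
 next
  case False
  have z: "(real i + real j + 1) * real c \<in> \<int>" by (intro Ints_mult Ints_add Ints_of_nat Ints_1)
  have "fld n i x * real (d q) = (real i + real j + 1) * real c - x * real (d q)"
   unfolding fld_J[OF j] using False by (simp only: if_False left_diff_distrib c')
  then show ?thesis
   using Ints_diff[OF z, of "x * real (d q)"] Ints_diff[OF z, of "fld n i x * real (d q)"] by auto
 qed
qed

text \<open>Well-definedness on the quotient. A free digit of level at most \<open>n\<close> is
  overwritten by the word; a level above \<open>n\<close> is preserved by the fold, and the free
  digit is copied.\<close>

lemma fld_glued:
 assumes x: "x \<in> {0..1}" and i: "i < d n" and g: "glued x w w'"
 shows "glued (fld n i x) (pre n a w) (pre n a w')"
proof (cases "w = w'")
 case True
 then show ?thesis by (simp add: glued_def)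
next
 case False
 then obtain N where N: "hole x N" and eq: "\<forall>l m. m \<noteq> N - 1 \<longrightarrow> w l m = w' l m"
  using g unfolding glued_def by blast
 show ?thesis
 proof (cases "N \<le> n")
  case True
  have "pre n a w = pre n a w'"
  proof (intro ext)
   fix l m
   show "pre n a w l m = pre n a w' l m"
   proof (cases "m < n")
    case False
    then have "m \<noteq> N - 1"
     using True N unfolding hole_def by linarith
    then show ?thesis
     using eq by (simp add: pre_def)
   qed (simp add: pre_def)
  qed
  then show ?thesis by (simp add: glued_def)
 next
  case False
  have x': "x * real (d N) \<in> \<int>" "x * real (d (N - 1)) \<notin> \<int>"
   using N by (auto simp: hole_def mem_L)
  \<comment> \<open>Since \<open>N - 1 \<ge> n\<close>, integrality can be transferred at both
    levels that define a hole of level \<open>N\<close>.\<close>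
  have f: "fld n i x * real (d N) \<in> \<int>" "fld n i x * real (d (N - 1)) \<notin> \<int>"
   using x' False by (simp_all add: fld_Ints[OF x])
  have "fld n i x \<in> {0..1}"
   using fld_mem[OF x, of n i] J_subset[OF i] by blast
  moreover have "fld n i x \<noteq> 0" "fld n i x \<noteq> 1"
   using f(2) by auto
  ultimately have "0 < fld n i x" "fld n i x < 1" by auto
  then have "hole (fld n i x) N"
   using N f unfolding hole_def by (simp add: mem_L)
  moreover have "pre n a w l m = pre n a w' l m" if "m \<noteq> N - 1" for l m
   using eq that by (simp add: pre_def)
  ultimately show ?thesis
   unfolding glued_def by blast
 qed
qed

lemma cell_fold_proj:
 fixes w :: "'k::finite \<Rightarrow> nat \<Rightarrow> bool"
 assumes x: "x \<in> {0..1}" and i: "i < d n"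
 shows "cell_fold js n (i, a) (io (x, w)) = io (fld n i x, pre n a w)"
proof -
 let ?f = "\<lambda>(x, w :: 'k \<Rightarrow> nat \<Rightarrow> bool). io (fld n i x, pre n a w)"
 have "?f q = ?f (x, w)" if "q \<in> io (x, w)" for q
 proof -
  obtain y w' where q: "q = (y, w')" by (cases q)
  have "io (x, w) = io (y, w')"
   using that unfolding q mem_laakso_proj laakso_proj_eq_iff .
  then have e: "x = y \<and> glued x w w'"
   unfolding io_eq_iff .
  have "io (fld n i x, pre n a w) = io (fld n i x, pre n a w')"
   using fld_glued[OF x i conjunct2[OF e], of a] by (simp add: io_eq_iff)
  then show ?thesis
   using conjunct1[OF e] by (simp add: q)
 qed
 moreover have "(x, w) \<in> io (x, w)" by (simp add: mem_laakso_proj)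
 ultimately have "?f ` io (x, w) = {?f (x, w)}" by (intro equalityI image_subsetI) (auto intro: rev_image_eqI)
 then have "the_elem (?f ` io (x, w)) = ?f (x, w)" by simp
 then show ?thesis
  unfolding cell_fold_def Let_def prod.case fld_def pre_def .
qed

text \<open>The two factors are told apart by connectedness: the image digits cannot vary with
  \<open>x\<close> along an interval, and then the Pythagorean identity at two values of
  \<open>x\<close> shows that the image \<open>x\<close> cannot vary with the digits.\<close>

lemma isometry_folding:
 fixes \<Psi> :: "'k::finite laakso_point \<Rightarrow> 'k laakso_point"
 assumes c1: "(i1, a1) \<in> cell_indices js n" and c2: "(i2, a2) \<in> cell_indices js n"
  and iso: "\<And>p q. dist (\<Phi> p) (\<Phi> q) = dist p q" and ind: "induced_cell_map js n (i1, a1) (i2, a2) \<Phi> \<Psi>"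
 obtains \<xi> B s where "folding n i2 (word a2) \<xi> B s"
  "\<And>x w. x \<in> {0..1} \<Longrightarrow> \<Psi> (cell_fold js n (i1, a1) (io (x, w))) = io (\<xi> x, B w)"
proof -
 let ?D = "real (d n)" and ?J1 = "J n i1" and ?J2 = "J n i2" and ?C1 = "cyl n (word a1)" and ?C2 = "cyl n (word a2)"
 have i1: "i1 < d n" and i2: "i2 < d n"
  using c1 c2 by (simp_all add: cell_indices_def)
 have "\<forall>p\<in>?J1 \<times> ?C1. \<exists>q. laakso_emb q = \<Phi> (laakso_emb p) \<and> \<Psi> (io p) = io q"
  using ind unfolding induced_cell_map_def cell_box_eq[OF c1] by blast
 from bchoice[OF this] obtain Q where
  Q: "\<forall>p\<in>?J1 \<times> ?C1. laakso_emb (Q p) = \<Phi> (laakso_emb p) \<and> \<Psi> (io p) = io (Q p)"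
  by blast
 define X where "X x w = fst (Q (x, w))" for x w
 define V where "V x w = snd (Q (x, w))" for x w
 have QXV: "Q (x, w) = (X x w, V x w)" for x w by (simp add: X_def V_def)
 have D: "(X x w - X y w')\<^sup>2 + (dist (cvec (V x w)) (cvec (V y w')))\<^sup>2 = (x - y)\<^sup>2 + (dist (cvec w) (cvec w'))\<^sup>2"
  if xw: "x \<in> ?J1" "w \<in> ?C1" and yw: "y \<in> ?J1" "w' \<in> ?C1" for x w y w'
 proof -
  have "laakso_emb (Q (x, w)) = \<Phi> (laakso_emb (x, w))" "laakso_emb (Q (y, w')) = \<Phi> (laakso_emb (y, w'))"
   using Q xw yw by blast+
  then have "dist (laakso_emb (Q (x, w))) (laakso_emb (Q (y, w'))) = dist (laakso_emb (x, w)) (laakso_emb (y, w'))"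
   by (simp only: iso)
  then show ?thesis
   unfolding QXV laakso_emb_eq dist_Pair_Pair real_sqrt_eq_iff dist_real_def power2_abs .
 qed
 have \<Psi>Q: "\<Psi> (io (x, w)) = io (X x w, V x w)" if "x \<in> ?J1" "w \<in> ?C1" for x w
  using Q that QXV by force
 \<comment> \<open>A displacement in \<open>x\<close> below \<open>1 / 3^(m+1)\<close> moves the
   image digits by no more than that in the Cantor set, which fixes the first \<open>m + 1\<close>
   of them; local constancy becomes constancy on the interval.\<close>
 have Vconst: "V x w = V y w" if x: "x \<in> ?J1" and y: "y \<in> ?J1" and w: "w \<in> ?C1" for x y w
 proof (intro ext)
  fix l m
  show "V x w l m = V y w l m"
  proof (rule connected_local_const[of ?J1 x y "\<lambda>x. V x w l m"])
   show "connected ?J1" by (simp add: J_def)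
   show "\<forall>a\<in>?J1. \<forall>\<^sub>F b in at a within ?J1. V a w l m = V b w l m"
   proof
    fix a assume a: "a \<in> ?J1"
    have "V a w l m = V b w l m" if b: "b \<in> ?J1" "dist b a < 1 / 3 ^ Suc m" for b
    proof -
     have "(dist (cvec (V a w)) (cvec (V b w)))\<^sup>2 \<le> \<bar>a - b\<bar>\<^sup>2"
      using D[OF a w b(1) w] zero_le_power2[of "X a w - X b w"]
      unfolding power2_abs dist_self power_zero_numeral by linarith
     then have "dist (cvec (V a w)) (cvec (V b w)) \<le> \<bar>a - b\<bar>" by (rule power2_le_imp_le) simp
     then have "agree (Suc m) (V a w) (V b w)"
      using b(2) by (intro cvec_sep) (simp add: dist_real_def abs_minus_commute)
     then show ?thesis by (simp add: agree_def)
    qed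
    then show "\<forall>\<^sub>F b in at a within ?J1. V a w l m = V b w l m"
     unfolding eventually_at by (intro exI[of _ "1 / 3 ^ Suc m"] conjI ballI impI) simp_all
   qed
  qed (rule x y)+
 qed
 define lo where "lo = real i1 / ?D"
 define hi where "hi = (real i1 + 1) / ?D"
 have lo_hi: "lo < hi" "hi - lo = 1 / ?D"
  unfolding lo_def hi_def using real_d_pos[of n] by (simp_all add: divide_strict_right_mono diff_divide_distrib[symmetric])
 have J1: "?J1 = {lo..hi}" by (simp add: J_def lo_def hi_def)
 have lo: "lo \<in> ?J1" and hi: "hi \<in> ?J1"
  using lo_hi by (simp_all add: J1)
 define A where "A w = V lo w" for w
 have VA: "V x w = A w" if "x \<in> ?J1" "w \<in> ?C1" for x w
  unfolding A_def by (rule Vconst[OF that(1) lo that(2)])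
 have e1: "(X x w - X y w)\<^sup>2 = (x - y)\<^sup>2" if "x \<in> ?J1" "y \<in> ?J1" "w \<in> ?C1" for x y w
  using D[OF that(1,3) that(2,3)] VA that by simp
 \<comment> \<open>\<open>\<delta>\<close> is the shift caused by changing the digits,
   \<open>t\<close> the shift caused by moving to a second point \<open>y\<close>. Comparing the
   identities with and without the move leaves \<open>2 * \<delta> * t = 0\<close>, and
   \<open>t\<close> is not \<open>0\<close>.\<close>
 have Xconst: "X x w = X x w'" if x: "x \<in> ?J1" and w: "w \<in> ?C1" "w' \<in> ?C1" for x w w'
 proof -
  define y where "y = (if x = lo then hi else lo)"
  have y: "y \<in> ?J1" "y \<noteq> x"
   using lo hi lo_hi(1) by (auto simp: y_def)
  define \<delta> where "\<delta> = X x w - X x w'"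
  define t where "t = X x w' - X y w'"
  have t: "t\<^sup>2 = (x - y)\<^sup>2"
   unfolding t_def by (rule e1[OF x y(1) w(2)])
  have "\<delta>\<^sup>2 + (dist (cvec (A w)) (cvec (A w')))\<^sup>2 = (dist (cvec w) (cvec w'))\<^sup>2"
   using D[OF x w(1) x w(2)] VA x w by (simp add: \<delta>_def)
  moreover have "(\<delta> + t)\<^sup>2 + (dist (cvec (A w)) (cvec (A w')))\<^sup>2 = (x - y)\<^sup>2 + (dist (cvec w) (cvec w'))\<^sup>2"
   using D[OF x w(1) y(1) w(2)] VA x y(1) w by (simp add: \<delta>_def t_def)
  ultimately have "2 * \<delta> * t = 0"
   using t unfolding power2_sum by linarith
  moreover have "t \<noteq> 0"
   using t y(2) by auto
  ultimately show ?thesis by (simp add: \<delta>_def)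
 qed
 have C1: "word a1 \<in> ?C1" by (simp add: mem_cyl)
 define Y where "Y x = X x (word a1)" for x
 have XY: "X x w = Y x" if "x \<in> ?J1" "w \<in> ?C1" for x w
  unfolding Y_def by (rule Xconst[OF that C1])
 have A_iso: "dist (cvec (A w)) (cvec (A w')) = dist (cvec w) (cvec w')" if "w \<in> ?C1" "w' \<in> ?C1" for w w'
 proof -
  have "(dist (cvec (A w)) (cvec (A w')))\<^sup>2 = (dist (cvec w) (cvec w'))\<^sup>2"
   using D[OF lo that(1) lo that(2)] that lo by (simp add: XY VA)
  then show ?thesis by (rule power2_eq_imp_eq) simp_all
 qed
 have \<Psi>: "\<Psi> (io (x, w)) = io (Y x, A w)" if "x \<in> ?J1" "w \<in> ?C1" for x w
  using \<Psi>Q[OF that] that by (simp add: XY VA)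
 have cells: "\<Psi> ` io ` (?J1 \<times> ?C1) = io ` (?J2 \<times> ?C2)"
  using ind unfolding induced_cell_map_def cell_def cell_box_eq[OF c1] cell_box_eq[OF c2] by blast
 have im: "\<exists>y\<in>?J2. \<exists>v\<in>?C2. io (Y x, A w) = io (y, v)" if "x \<in> ?J1" "w \<in> ?C1" for x w
 proof -
  have "\<Psi> (io (x, w)) \<in> io ` (?J2 \<times> ?C2)"
   unfolding cells[symmetric] using that by blast
  then show ?thesis
   unfolding \<Psi>[OF that] by blast
 qed
 have YJ: "Y x \<in> ?J2" if "x \<in> ?J1" for x
  using im[OF that C1] by (auto simp: io_eq_iff)
 have Yabs: "\<bar>Y x - Y y\<bar> = \<bar>x - y\<bar>" if "x \<in> ?J1" "y \<in> ?J1" for x y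
  using e1[OF that C1] unfolding Y_def by (simp add: power2_eq_iff abs_if split: if_splits) (auto simp: algebra_simps)
 \<comment> \<open>\<open>r\<close> records whether the isometry preserves orientation on the
   interval, which shows at its left end.\<close>
 define r where "r \<longleftrightarrow> Y lo = real i2 / ?D"
 have Y: "Y x = (if r then x + (real i2 - real i1) / ?D else (real i2 + real i1 + 1) / ?D - x)" if x: "x \<in> ?J1" for x
 proof -
  define lo2 where "lo2 = real i2 / ?D"
  have J2: "?J2 = {lo2..lo2 + 1 / ?D}" by (simp add: J_def lo2_def add_divide_distrib)
  have b: "lo2 \<le> Y z" "Y z \<le> lo2 + 1 / ?D" if "z \<in> ?J1" for z
   using YJ[OF that] unfolding J2 by simp_all
  have xlo: "\<bar>Y x - Y lo\<bar> = x - lo"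
   using Yabs[OF x lo] x by (simp add: J1)
  show ?thesis
  proof (cases r)
   case True
   then have "Y lo = lo2" by (simp add: r_def lo2_def)
   then have "Y x = lo2 + (x - lo)"
    using xlo b(1)[OF x] by simp
   then show ?thesis
    using True by (simp add: lo_def lo2_def diff_divide_distrib)
  next
   case False
   have "\<bar>Y hi - Y lo\<bar> = 1 / ?D"
    using Yabs[OF hi lo] lo_hi by simp
   then have "Y lo = lo2 + 1 / ?D"
    using b[OF hi] b[OF lo] False unfolding r_def lo2_def[symmetric] by linarith
   then have "Y x = lo2 + 1 / ?D - (x - lo)"
    using xlo b(2)[OF x] by simp
   then show ?thesis
    using False by (simp add: lo_def lo2_def diff_divide_distrib add_divide_distrib)
  qed
 qed
 \<comment> \<open>The image of the cell is known only as a set of points of the quotient. Over an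
   irrational image point these have unique digits, so the range of \<open>A\<close> can be read off
   there.\<close>
 obtain x0 where x0: "x0 \<in> {lo<..<hi}" "x0 \<notin> \<rat>"
  using real_interval_avoid_countable_set[OF lo_hi(1) countable_rat] by blast
 have x0J: "x0 \<in> ?J1"
  using x0(1) by (simp add: J1)
 have Yx0: "Y x0 \<notin> \<rat>"
 proof
  assume Q: "Y x0 \<in> \<rat>"
  have "x0 = (if r then Y x0 - (real i2 - real i1) / ?D else (real i2 + real i1 + 1) / ?D - Y x0)"
   using Y[OF x0J] by simp
  also have "\<dots> \<in> \<rat>"
   using Q by (simp add: Rats_diff Rats_divide Rats_add)
  finally show False
   using x0(2) by simp
 qed
 have A_C2: "A w \<in> ?C2" if w: "w \<in> ?C1" for w
 proof -
  obtain y v where v: "v \<in> ?C2" "io (Y x0, A w) = io (y, v)"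
   using im[OF x0J w] by blast
  moreover from this have "y = Y x0" by (simp add: io_eq_iff)
  ultimately have "A w = v"
   using io_inject[OF _ Yx0] by simp
  then show ?thesis
   using v(1) by simp
 qed
 have A_onto: "\<exists>u\<in>?C1. A u = v" if v: "v \<in> ?C2" for v
 proof -
  have "io (Y x0, v) \<in> io ` (?J2 \<times> ?C2)"
   using YJ[OF x0J] v by blast
  then obtain x u where xu: "x \<in> ?J1" "u \<in> ?C1" "io (Y x0, v) = \<Psi> (io (x, u))"
   unfolding cells[symmetric] by blast
  then have eq: "io (Y x0, v) = io (Y x, A u)" by (simp add: \<Psi>)
  then have "Y x0 = Y x" by (simp add: io_eq_iff)
  then have "v = A u"
   using io_inject[OF _ Yx0] eq by simp
  then show ?thesis
   using xu(2) by blast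
 qed
 have A_agree: "agree m (A u) (A w) \<longleftrightarrow> agree m u w" if uw: "u \<in> ?C1" "w \<in> ?C1" for m u w
 proof
  assume ag: "agree m u w"
  show "agree m (A u) (A w)"
  proof (rule isometry_agree[where n = n and v = "word a1" and A = A])
   show "dist (cvec (A w)) (cvec (A w')) = dist (cvec w) (cvec w')" if "w \<in> ?C1" "w' \<in> ?C1" for w w'
    by (rule A_iso[OF that])
  qed (rule uw ag)+
 next
  assume ag: "agree m (A u) (A w)"
  \<comment> \<open>The converse is the same lemma applied to the inverse of \<open>A\<close>, which
    is again isometric.\<close>
  have inj: "inj_on A ?C1"
  proof (rule inj_onI)
   fix u w assume "u \<in> ?C1" "w \<in> ?C1" "A u = A w"
   then have "dist (cvec u) (cvec w) = 0"
    using A_iso[of u w] by simp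
   then show "u = w" by (intro cvec_inject) simp
  qed
  have im: "A ` ?C1 = ?C2"
   using A_C2 A_onto by blast
  have inv: "inv_into ?C1 A v \<in> ?C1" "A (inv_into ?C1 A v) = v" if "v \<in> ?C2" for v
   using that unfolding im[symmetric] by (rule inv_into_into, rule f_inv_into_f)
  have inv_iso: "dist (cvec (inv_into ?C1 A v)) (cvec (inv_into ?C1 A v')) = dist (cvec v) (cvec v')"
   if "v \<in> ?C2" "v' \<in> ?C2" for v v'
   using A_iso[OF inv(1)[OF that(1)] inv(1)[OF that(2)]] inv(2)[OF that(1)] inv(2)[OF that(2)] by simp
  from isometry_agree[OF inv_iso A_C2[OF uw(1)] A_C2[OF uw(2)] ag]
  show "agree m u w"
   using inv_into_f_f[OF inj uw(1)] inv_into_f_f[OF inj uw(2)] by simp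
 qed
 define B where "B w = A (pre n a1 w)" for w
 define \<xi> where "\<xi> x = Y (fld n i1 x)" for x
 \<comment> \<open>The fold preserves orientation on the interval number \<open>j\<close> iff
   \<open>i1 + j\<close> is even, and the isometry does iff \<open>r\<close>; the composition
   preserves it iff these agree.\<close>
 define s where "s j \<longleftrightarrow> even (i1 + j) = r" for j
 have "folding n i2 (word a2) \<xi> B s"
  unfolding folding_def
 proof (intro conjI allI impI ballI i2)
  fix j x assume j: "j < d n" and x: "x \<in> J n j"
  then have "x \<in> {0..1}"
   using J_subset by blast
  then have f: "fld n i1 x \<in> ?J1" by (rule fld_mem)
  show "\<xi> x = (if s j then x + (real i2 - real j) / ?D else (real i2 + real j + 1) / ?D - x)"
   unfolding \<xi>_def Y[OF f] unfolding fld_J[OF x] s_def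
   by (cases "even (i1 + j)"; cases r) (simp_all add: diff_divide_distrib add_divide_distrib)
 next
  show "B w \<in> ?C2" for w
   unfolding B_def by (rule A_C2[OF pre_cyl])
 next
  fix m v' assume m: "n \<le> m" and "v' \<in> ?C2"
  then obtain u where u: "u \<in> ?C1" "A u = v'"
   using A_onto by blast
  have eq: "B w \<in> cyl m v' \<longleftrightarrow> agree m u (pre n a1 w)" for w
   unfolding mem_cyl B_def u(2)[symmetric] by (rule A_agree[OF u(1) pre_cyl])
  have un: "u l k = a1 l ! k" if "k < n" for l k
   using u(1) that by (simp add: mem_cyl agree_def word_def)
  have "agree m u (pre n a1 w) \<longleftrightarrow> (\<forall>l. \<forall>k\<in>{n..<m}. w l k = u l k)" for w
  proof
   assume ag: "agree m u (pre n a1 w)"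
   show "\<forall>l. \<forall>k\<in>{n..<m}. w l k = u l k"
   proof (intro allI ballI)
    fix l k assume "k \<in> {n..<m}"
    then show "w l k = u l k"
     using ag[unfolded agree_def, rule_format, of k l] by (simp add: pre_def)
   qed
  next
   assume ag: "\<forall>l. \<forall>k\<in>{n..<m}. w l k = u l k"
   show "agree m u (pre n a1 w)"
    unfolding agree_def
   proof (intro allI impI)
    fix l k assume "k < m"
    then show "u l k = pre n a1 w l k"
     using un[of k l] ag[rule_format, of k l] by (cases "k < n") (simp_all add: pre_def)
   qed
  qed
  then show "\<exists>u. \<forall>w. B w \<in> cyl m v' \<longleftrightarrow> (\<forall>l. \<forall>i\<in>{n..<m}. w l i = u l i)"
   unfolding eq by blast
 qed
 moreover have "\<Psi> (cell_fold js n (i1, a1) (io (x, w))) = io (\<xi> x, B w)" if "x \<in> {0..1}" for x w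
  unfolding cell_fold_proj[OF that i1] \<xi>_def B_def by (rule \<Psi>[OF fld_mem[OF that] pre_cyl])
 ultimately show ?thesis by (rule that)
qed

end

section \<open>Invariance\<close>

context laakso
begin

text \<open>\<open>restr_op\<close> and \<open>cell_fold\<close> are uncontrolled outside cells and
  outside the space, so unfolded functions can be compared only on points of the space.\<close>

lemma W_cong_space:
 fixes f :: "'k::finite laakso_point \<Rightarrow> real"
 assumes W: "W f g" and eq: "\<And>s. s \<in> laakso_space js \<Longrightarrow> f s = f' s"
 shows "W f' g"
proof (rule W_cong_AE[OF W])
 show "f' \<in> borel_measurable (\<mu>)"
  using l2D(1)[OF W_l2(1)[OF W]] eq by (subst measurable_cong[of _ f' f]) (simp_all add: space_laakso_measure)
 show "AE s in \<mu>. f s = f' s"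
  using eq by (intro AE_I2) (simp add: space_laakso_measure)
qed (use l2D(1)[OF W_l2(2)[OF W]] in simp_all)

lemma cell_box_subset:
 assumes "c \<in> cell_indices js n" shows "cell_box js n c \<subseteq> laakso_base"
proof -
 obtain i a where c: "c = (i, a)" by (cases c)
 have "J n i \<subseteq> {0..1}"
  using assms by (intro J_subset) (simp add: c cell_indices_def)
 then show ?thesis
  using cell_box_eq[OF assms[unfolded c]] by (auto simp: c laakso_base_def)
qed

lemma cell_box_sets: "c \<in> cell_indices js n \<Longrightarrow> cell_box js n c \<in> sets (MB :: 'k::finite prelaakso measure)"
 by (cases c) (simp add: cell_box_eq J_cyl_sets cell_indices_def)

lemma induced_cell_map_id: "c \<in> cell_indices js n \<Longrightarrow> induced_cell_map js n c c (\<lambda>p. p) (\<lambda>s. s)"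
 using cell_box_subset[of c n] unfolding induced_cell_map_def by auto

lemma cell_fold_in_cell:
 fixes t :: "'k::finite laakso_point"
 assumes c: "c \<in> cell_indices js n" and t: "t \<in> laakso_space js"
 shows "cell_fold js n c t \<in> cell js n c"
proof -
 obtain i a where ia: "c = (i, a)" by (cases c)
 obtain x w where t: "t = io (x, w)" "x \<in> {0..1}"
  using t unfolding laakso_space_def laakso_base_def by blast
 have "i < d n"
  using c by (simp add: ia cell_indices_def)
 then have "cell_fold js n c t = io (fld n i x, pre n a w)"
  unfolding ia t(1) by (rule cell_fold_proj[OF t(2)])
 moreover have "(fld n i x, pre n a w) \<in> cell_box js n c"
  using cell_box_eq[OF c[unfolded ia]] fld_mem[OF t(2)] pre_cyl[of n a w] by (simp add: ia)
 ultimately show ?thesis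
  unfolding cell_def by blast
qed

lemma cell_fold_cell:
 fixes t :: "'k::finite laakso_point"
 assumes c: "c \<in> cell_indices js n" and t: "t \<in> cell js n c"
 shows "cell_fold js n c t = t"
proof -
 obtain i a where ia: "c = (i, a)" by (cases c)
 have i: "i < d n"
  using c by (simp add: ia cell_indices_def)
 obtain x w where t: "t = io (x, w)" "x \<in> J n i" "w \<in> cyl n (word a)"
  using t unfolding cell_def ia cell_box_eq[OF c[unfolded ia]] by blast
 have "x \<in> {0..1}"
  using J_subset[OF i] t(2) by blast
 from cell_fold_proj[OF this i, of a w] have "cell_fold js n c t = io (fld n i x, pre n a w)"
  by (simp add: ia t(1))
 moreover have "fld n i x = x"
  using fld_J[OF t(2), of i] by simp
 moreover have "pre n a w = w"
  using t(3) by (intro ext) (simp add: pre_def word_def mem_cyl agree_def)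
 ultimately show ?thesis by (simp add: t(1))
qed

lemma cell_transfer:
 fixes f :: "'k::finite laakso_point \<Rightarrow> real"
 assumes "c\<^sub>1 \<in> cell_indices js n" "c\<^sub>2 \<in> cell_indices js n"
  and "\<And>p q. dist (\<Phi> p) (\<Phi> q) = dist p q" "induced_cell_map js n c\<^sub>1 c\<^sub>2 \<Phi> \<Psi>" and W: "W f g"
 shows "\<exists>h. W (\<lambda>t. f (\<Psi> (cell_fold js n c\<^sub>1 t))) h \<and>
  l2_sq MB h = real (d n) * 2 ^ (n * CARD('k)) * (\<integral>p. indicator (cell_box js n c\<^sub>2) p * (g p)\<^sup>2 \<partial>MB)"
proof -
 obtain i1 a1 i2 a2 where c: "c\<^sub>1 = (i1, a1)" "c\<^sub>2 = (i2, a2)" by (cases c\<^sub>1, cases c\<^sub>2)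
 obtain \<xi> B s where fo: "folding n i2 (word a2) \<xi> B s"
  and \<Theta>: "\<And>x w. x \<in> {0..1} \<Longrightarrow> \<Psi> (cell_fold js n (i1, a1) (io (x, w))) = io (\<xi> x, B w)"
  by (rule isometry_folding[OF assms(1-4)[unfolded c]]) (rule that; assumption)
 show ?thesis
  unfolding c cell_box_eq[OF assms(2)[unfolded c]] by (rule folding_W[OF fo \<Theta> W])
qed

lemma cell_transfer_id:
 fixes f :: "'k::finite laakso_point \<Rightarrow> real"
 assumes c: "c \<in> cell_indices js n" and W: "W f g"
 shows "\<exists>h. W (unfold_op js n c (restr_op js n c f)) h \<and>
  l2_sq MB h = real (d n) * 2 ^ (n * CARD('k)) * (\<integral>p. indicator (cell_box js n c) p * (g p)\<^sup>2 \<partial>MB)"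
proof -
 from cell_transfer[OF c c refl induced_cell_map_id[OF c] W]
 obtain h where h: "W (\<lambda>t. f (cell_fold js n c t)) h"
  "l2_sq MB h = real (d n) * 2 ^ (n * CARD('k)) * (\<integral>p. indicator (cell_box js n c) p * (g p)\<^sup>2 \<partial>MB)"
  by (elim exE conjE)
 have "W (unfold_op js n c (restr_op js n c f)) h"
  by (rule W_cong_space[OF h(1)]) (simp add: unfold_op_def restr_op_def cell_fold_in_cell[OF c])
 then show ?thesis
  using h(2) by (intro exI[of _ h] conjI)
qed

lemma mem_cell_box:
 assumes x: "x \<notin> nodes n" and j: "j < d n" "x \<in> J n j" and c: "c \<in> cell_indices js n"
 shows "(x, w) \<in> cell_box js n c \<longleftrightarrow> c = (j, \<lambda>l. map (w l) [0..<n])"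
proof -
 obtain i a where ia: "c = (i, a)" by (cases c)
 have i: "i < d n"
  using c by (simp add: ia cell_indices_def)
 have "x \<in> J n i \<longleftrightarrow> i = j"
  using J_unique[OF x i _ j] j by blast
 moreover have "(x, w) \<in> cell_box js n c \<longleftrightarrow> x \<in> J n i \<and> (\<forall>l. map (w l) [0..<n] = a l)"
  by (simp add: cell_box_def ia J_def add.commute)
 ultimately show ?thesis by (auto simp: ia fun_eq_iff)
qed

lemma card_cell_indices:
 "finite (cell_indices js n :: 'k::finite cell_index set)"
 "card (cell_indices js n :: 'k cell_index set) = d n * 2 ^ (n * CARD('k))"
proof -
 let ?S = "{xs :: bool list. length xs = n}"
 have "(cell_indices js n :: 'k cell_index set) = {..<d n} \<times> (UNIV \<rightarrow>\<^sub>E ?S)"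
  by (auto simp: cell_indices_def)
 moreover have fin: "finite ?S" and S: "card ?S = 2 ^ n"
  using finite_lists_length_eq[of "UNIV :: bool set" n] card_lists_length_eq[of "UNIV :: bool set" n] by simp_all
 ultimately show "finite (cell_indices js n :: 'k cell_index set)"
  "card (cell_indices js n :: 'k cell_index set) = d n * 2 ^ (n * CARD('k))"
  by (simp_all add: finite_PiE card_cartesian_product card_PiE power_mult[symmetric])
qed

text \<open>Cells are counted as subsets of the quotient. An irrational \<open>x\<close> in the
  interior of the interval avoids all identifications and all neighbouring intervals, so a cell
  determines its index.\<close>

lemma cell_count_eq: "cell_count js TYPE('k::finite) n = d n * 2 ^ (n * CARD('k))"
proof -
 have "inj_on (cell js n) (cell_indices js n :: 'k cell_index set)"
 proof (rule inj_onI)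
  fix c c' :: "'k cell_index" assume c: "c \<in> cell_indices js n" "c' \<in> cell_indices js n" and eq: "cell js n c = cell js n c'"
  obtain i a where ia: "c = (i, a)" by (cases c)
  have i: "i < d n"
   using c(1) by (simp add: ia cell_indices_def)
  have "real i / real (d n) < (real i + 1) / real (d n)"
   using real_d_pos[of n] by (intro divide_strict_right_mono) simp_all
  from real_interval_avoid_countable_set[OF this countable_rat]
  obtain x where x: "x \<in> {real i / real (d n)<..<(real i + 1) / real (d n)}" "x \<notin> \<rat>" by blast
  have xJ: "x \<in> J n i"
   using x(1) by (simp add: J_def)
  have xn: "x \<notin> nodes n"
  proof
   assume "x \<in> nodes n"
   then have "x \<in> \<rat>"
    unfolding nodes_def by auto
   then show False
    using x(2) by simp
  qed
  have box: "(x, word a) \<in> cell_box js n c"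
   using xJ by (simp add: ia cell_box_eq[OF c(1)[unfolded ia]] mem_cyl)
  then have "io (x, word a) \<in> cell js n c"
   unfolding cell_def by (rule imageI)
  then have "io (x, word a) \<in> cell js n c'"
   unfolding eq .
  then obtain y v where yv: "(y, v) \<in> cell_box js n c'" "io (x, word a) = io (y, v)"
   unfolding cell_def by (elim imageE) (metis surj_pair)
  then have "y = x" by (simp add: io_eq_iff)
  then have "word a = v"
   using io_inject[of x "word a" v] yv(2) x(2) by simp
  then have "(x, word a) \<in> cell_box js n c'"
   using yv(1) \<open>y = x\<close> by simp
  then show "c = c'"
   using box mem_cell_box[OF xn i xJ c(1)] mem_cell_box[OF xn i xJ c(2)] by simp
 qed
 then show ?thesis
  unfolding cell_count_def by (simp add: card_image card_cell_indices(2))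
qed

text \<open>Boxes of a given depth overlap only over the nodes, which form a null set.\<close>

lemma cell_partition:
 fixes g :: "'k::finite prelaakso \<Rightarrow> real"
 assumes g: "g \<in> l2 MB"
 shows "l2_sq MB g = (\<Sum>c\<in>cell_indices js n. \<integral>p. indicator (cell_box js n c) p * (g p)\<^sup>2 \<partial>MB)"
proof -
 let ?I = "cell_indices js n :: 'k cell_index set"
 have int: "integrable MB (\<lambda>p. indicator (cell_box js n c) p * (g p)\<^sup>2)" if "c \<in> ?I" for c
  using integrable_mult_indicator[OF cell_box_sets[OF that] l2D(2)[OF g]] by simp
 have "l2_sq MB g = (\<integral>p. (\<Sum>c\<in>?I. indicator (cell_box js n c) p * (g p)\<^sup>2) \<partial>MB)"
  unfolding l2_sq_eq
 proof (rule integral_cong_AE)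
  show "(\<lambda>p. (g p)\<^sup>2) \<in> borel_measurable MB" "(\<lambda>p. \<Sum>c\<in>?I. indicator (cell_box js n c) p * (g p)\<^sup>2) \<in> borel_measurable MB"
   using l2D(2)[OF g] int by (auto intro!: borel_measurable_sum borel_measurable_integrable)
  show "AE p in MB. (g p)\<^sup>2 = (\<Sum>c\<in>?I. indicator (cell_box js n c) p * (g p)\<^sup>2)"
   using AE_MB_fst_notin[OF finite_nodes[of n]]
  proof (rule AE_mp, intro AE_I2 impI)
   fix p :: "'k prelaakso" assume p: "p \<in> space MB" "fst p \<notin> nodes n"
   obtain x w where xw: "p = (x, w)" by (cases p)
   then obtain j where j: "j < d n" "x \<in> J n j"
    using J_cover[of x n] p(1) by auto
   let ?c = "(j, \<lambda>l. map (w l) [0..<n])"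
   have c: "?c \<in> ?I"
    using j(1) by (simp add: cell_indices_def)
   have "(\<Sum>c\<in>?I. indicator (cell_box js n c) p * (g p)\<^sup>2) = (\<Sum>c\<in>?I. if c = ?c then (g p)\<^sup>2 else 0)"
   proof (rule sum.cong[OF refl])
    fix c assume "c \<in> ?I"
    from mem_cell_box[OF _ j this, of w] p(2)
    show "indicator (cell_box js n c) p * (g p)\<^sup>2 = (if c = ?c then (g p)\<^sup>2 else 0)"
     by (simp add: xw indicator_def)
   qed
   also have "\<dots> = (g p)\<^sup>2"
    using c by (simp add: card_cell_indices(1))
   finally show "(g p)\<^sup>2 = (\<Sum>c\<in>?I. indicator (cell_box js n c) p * (g p)\<^sup>2)" ..
  qed
 qed
 also have "\<dots> = (\<Sum>c\<in>?I. \<integral>p. indicator (cell_box js n c) p * (g p)\<^sup>2 \<partial>MB)"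
  by (rule Bochner_Integration.integral_sum[OF int])
 finally show ?thesis .
qed

text \<open>The factor by which unfolding multiplies the energy over a cell is the number of cells,
  so the cell energy of a restriction is the plain integral of the squared derivative over the
  box.\<close>

lemma mgug_L_invariant: "L_invariant js (mgug_form js) (mgug_dom js :: ('k::finite laakso_point \<Rightarrow> real) set)"
 unfolding L_invariant_def
proof (intro conjI allI ballI impI)
 fix n and c :: "'k cell_index" and f :: "'k laakso_point \<Rightarrow> real" assume c: "c \<in> cell_indices js n" and "f \<in> mgug_dom js"
 then obtain g where "W f g"
  unfolding mgug_dom_iff by (elim exE)
 from cell_transfer_id[OF c this] show "unfold_op js n c (restr_op js n c f) \<in> mgug_dom js"
  unfolding mgug_dom_iff by (elim exE conjE) (rule exI)
next
 fix n and c\<^sub>1 c\<^sub>2 :: "'k cell_index" and \<Phi> \<Psi> and f :: "'k laakso_point \<Rightarrow> real"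
 assume c: "c\<^sub>1 \<in> cell_indices js n" "c\<^sub>2 \<in> cell_indices js n"
  and map: "(\<forall>p q. dist (\<Phi> p) (\<Phi> q) = dist p q) \<and> induced_cell_map js n c\<^sub>1 c\<^sub>2 \<Phi> \<Psi>"
  and f: "f \<in> cell_dom js (mgug_dom js) n c\<^sub>2"
 \<comment> \<open>\<open>f\<close> is given only on the cell, through its unfolding, so
   \<open>?g\<close> is transported in its place; on the cell the two agree.\<close>
 let ?g = "unfold_op js n c\<^sub>2 f"
 have "?g \<in> mgug_dom js"
  using f by (simp add: cell_dom_def)
 then obtain G where W: "W ?g G"
  unfolding mgug_dom_iff by (elim exE)
 have onto: "\<Psi> ` cell js n c\<^sub>1 = cell js n c\<^sub>2"
  using map unfolding induced_cell_map_def by blast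
 from cell_transfer[OF c map[THEN conjunct1, rule_format] map[THEN conjunct2] W]
 obtain h where h: "W (\<lambda>t. ?g (\<Psi> (cell_fold js n c\<^sub>1 t))) h"
  "l2_sq MB h = real (d n) * 2 ^ (n * CARD('k)) * (\<integral>p. indicator (cell_box js n c\<^sub>2) p * (G p)\<^sup>2 \<partial>MB)"
  by (elim exE conjE)
 \<comment> \<open>The transfer by the identity expresses the energy of \<open>?g\<close> itself by
   the same integral over the box of \<open>c\<^sub>2\<close>, so both energies agree.\<close>
 from cell_transfer[OF c(2) c(2) refl induced_cell_map_id[OF c(2)] W]
 obtain h' where h': "W (\<lambda>t. ?g (cell_fold js n c\<^sub>2 t)) h'"
  "l2_sq MB h' = real (d n) * 2 ^ (n * CARD('k)) * (\<integral>p. indicator (cell_box js n c\<^sub>2) p * (G p)\<^sup>2 \<partial>MB)"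
  by (elim exE conjE)
 have W1: "W (unfold_op js n c\<^sub>1 (f \<circ> \<Psi>)) h"
 proof (rule W_cong_space[OF h(1)])
  fix t :: "'k laakso_point" assume "t \<in> laakso_space js"
  then have "\<Psi> (cell_fold js n c\<^sub>1 t) \<in> cell js n c\<^sub>2"
   unfolding onto[symmetric] by (intro imageI cell_fold_in_cell[OF c(1)])
  then show "?g (\<Psi> (cell_fold js n c\<^sub>1 t)) = unfold_op js n c\<^sub>1 (f \<circ> \<Psi>) t"
   by (simp add: unfold_op_def cell_fold_cell[OF c(2)])
 qed
 have W2: "W ?g h'"
  by (rule W_cong_space[OF h'(1)]) (simp add: unfold_op_def cell_fold_cell[OF c(2)] cell_fold_in_cell[OF c(2)])
 show "f \<circ> \<Psi> \<in> cell_dom js (mgug_dom js) n c\<^sub>1"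
  unfolding cell_dom_def mem_Collect_eq mgug_dom_iff by (rule exI[of _ h]) (rule W1)
 show "cell_energy js (mgug_form js) n c\<^sub>1 (f \<circ> \<Psi>) = cell_energy js (mgug_form js) n c\<^sub>2 f"
  unfolding cell_energy_def mgug_form_diag[OF W1] mgug_form_diag[OF W2] h(2) h'(2) ..
next
 fix n and f :: "'k laakso_point \<Rightarrow> real" assume "f \<in> mgug_dom js"
 then obtain g where W: "W f g"
  unfolding mgug_dom_iff by (elim exE)
 have "cell_energy js (mgug_form js) n c (restr_op js n c f) = (\<integral>p. indicator (cell_box js n c) p * (g p)\<^sup>2 \<partial>MB)"
  if c: "c \<in> cell_indices js n" for c
 proof -
  from cell_transfer_id[OF c W] obtain h where h: "W (unfold_op js n c (restr_op js n c f)) h"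
   "l2_sq MB h = real (d n) * 2 ^ (n * CARD('k)) * (\<integral>p. indicator (cell_box js n c) p * (g p)\<^sup>2 \<partial>MB)"
   by (elim exE conjE)
  show ?thesis
   unfolding cell_energy_def mgug_form_diag[OF h(1)] h(2) cell_count_eq by simp
 qed
 then show "mgug_form js f f = (\<Sum>c\<in>cell_indices js n. cell_energy js (mgug_form js) n c (restr_op js n c f))"
  unfolding mgug_form_diag[OF W] cell_partition[OF W_l2(2)[OF W], of n] by simp
qed

lemma mgug_conservative:
 "conservative_form (\<mu>) (mgug_form js) (mgug_dom js :: ('k::finite laakso_point \<Rightarrow> real) set)"
 unfolding conservative_form_def by (intro allI impI semigroup_conservative)

lemma mgug_laakso_forms: "(mgug_form js, mgug_dom js :: ('k::finite laakso_point \<Rightarrow> real) set) \<in> laakso_forms js"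
 unfolding laakso_forms_def mem_Collect_eq prod.case
 by (intro conjI mgug_dirichlet mgug_nonzero mgug_local mgug_regular mgug_conservative mgug_L_invariant)

end

theorem lemma6p1:
 fixes j :: nat and js :: "nat \<Rightarrow> nat"
 assumes "j \<ge> 2" and "\<And>i. i \<ge> 1 \<Longrightarrow> js i \<in> {j, j + 1}"
 shows "(mgug_form js, mgug_dom js :: ('k::finite laakso_point \<Rightarrow> real) set) \<in> laakso_forms js"
proof -
 interpret laakso js
 proof
  fix i :: nat assume "1 \<le> i"
  from assms(2)[OF this] assms(1) show "2 \<le> js i" by auto
 qed
 show ?thesis by (rule mgug_laakso_forms)
qed

end
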